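(* Assume $\mathsf{ZF} + \mathsf{AD}^+ + V = L(\mathscr{P}(\mathbb{R}))$. Let $\kappa$ be an ordinal and let $\langle E_\alpha : \alpha < \kappa\rangle$ be a sequence of equivalence relations on $\mathbb{R}$ such that for every $\alpha<\kappa$, $\mathbb{R}/E_\alpha$ is in bijection with $\mathbb{R}$ and every $E_\alpha$-class is countable. Then there is an injection of $\bigsqcup_{\alpha < \kappa} \mathbb{R}/E_\alpha$ into $\mathbb{R} \times \kappa$.
   Context: $\mathsf{AD}^+$ is the conjunction of: (1) $\mathsf{DC}_{\mathbb{R}}$; (2) every $A \subseteq \mathbb{R}$ has an $\infty$-Borel code, i.e. there are a set of ordinals $S$ and a formula $\varphi$ with $A = \{x \in \mathbb{R} : L[S,x] \models \varphi(S,x)\}$; (3) for every $\lambda < \Theta$ (the least ordinal which is not a surjective image of $\mathbb{R}$), every $A \subseteq \mathbb{R}$ and every continuous $\pi : {}^\omega\lambda \to \mathbb{R}$, the set $\pi^{-1}[A]$ is determined. $\bigsqcup_{\alpha<\kappa} \mathbb{R}/E_\alpha$ denotes the formal disjoint union $\{(\alpha, c) : \alpha < \kappa,\ c \in \mathbb{R}/E_\alpha\}$. *)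

theory Defs
  imports Main
begin

text \<open>
  HOL proves the axiom of choice, so a theorem of ZF + AD$^+$ cannot be stated about HOL's own reals
  and sets. It is stated about an arbitrary first-order structure \<open>(UNIV :: 'a set, \<in>\<^sub>M)\<close> satisfying
  the axioms. Every set-theoretic notion below is interpreted inside that structure: all quantifiers
  over sets, functions, strategies, relations etc. range over elements of \<^typ>\<open>'a\<close>.
\<close>

section \<open>First-order formulas of set theory\<close>

datatype fm =
    Mem nat nat
  | Eq nat nat
  | Neg fm
  | Conj fm fm
  | All nat fm

primrec fv :: "fm \<Rightarrow> nat set" where
  "fv (Mem i j) = {i, j}"
| "fv (Eq i j) = {i, j}"
| "fv (Neg \<phi>) = fv \<phi>"
| "fv (Conj \<phi> \<psi>) = fv \<phi> \<union> fv \<psi>"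
| "fv (All i \<phi>) = fv \<phi> - {i}"

locale set_structure =
  fixes mem :: "'a \<Rightarrow> 'a \<Rightarrow> bool"  (infix "\<in>\<^sub>M" 50)
begin

text \<open>Satisfaction in the substructure with universe \<open>C\<close>.\<close>

primrec sat :: "'a set \<Rightarrow> fm \<Rightarrow> (nat \<Rightarrow> 'a) \<Rightarrow> bool" where
  "sat C (Mem i j) e \<longleftrightarrow> e i \<in>\<^sub>M e j"
| "sat C (Eq i j) e \<longleftrightarrow> e i = e j"
| "sat C (Neg \<phi>) e \<longleftrightarrow> \<not> sat C \<phi> e"
| "sat C (Conj \<phi> \<psi>) e \<longleftrightarrow> sat C \<phi> e \<and> sat C \<psi> e"
| "sat C (All i \<phi>) e \<longleftrightarrow> (\<forall>x\<in>C. sat C \<phi> (e(i := x)))"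

definition ext :: "'a \<Rightarrow> 'a set" where
  "ext a = {x. x \<in>\<^sub>M a}"

end

section \<open>Models of ZF\<close>

text \<open>In the two schemes \<open>e\<close> supplies the parameters.\<close>

locale zf_model = set_structure +
  assumes extensionality: "\<And>a b. (\<forall>x. x \<in>\<^sub>M a \<longleftrightarrow> x \<in>\<^sub>M b) \<Longrightarrow> a = b"
    and foundation: "\<And>a. \<exists>x. x \<in>\<^sub>M a \<Longrightarrow> \<exists>x. x \<in>\<^sub>M a \<and> \<not> (\<exists>y. y \<in>\<^sub>M a \<and> y \<in>\<^sub>M x)"
    and pairing: "\<And>a b. \<exists>c. \<forall>x. x \<in>\<^sub>M c \<longleftrightarrow> x = a \<or> x = b"
    and union: "\<And>a. \<exists>u. \<forall>x. x \<in>\<^sub>M u \<longleftrightarrow> (\<exists>y. y \<in>\<^sub>M a \<and> x \<in>\<^sub>M y)"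
    and power_set: "\<And>a. \<exists>p. \<forall>x. x \<in>\<^sub>M p \<longleftrightarrow> (\<forall>y. y \<in>\<^sub>M x \<longrightarrow> y \<in>\<^sub>M a)"
    and infinity: "\<exists>w. (\<exists>z. z \<in>\<^sub>M w \<and> (\<forall>x. \<not> x \<in>\<^sub>M z)) \<and>
      (\<forall>x. x \<in>\<^sub>M w \<longrightarrow> (\<exists>y. y \<in>\<^sub>M w \<and> (\<forall>z. z \<in>\<^sub>M y \<longleftrightarrow> z \<in>\<^sub>M x \<or> z = x)))"
    and separation: "\<And>\<phi> e a. \<exists>b. \<forall>x. x \<in>\<^sub>M b \<longleftrightarrow> x \<in>\<^sub>M a \<and> sat UNIV \<phi> (e(0 := x))"
    and replacement: "\<And>\<phi> e a. (\<forall>x. x \<in>\<^sub>M a \<longrightarrow> (\<exists>!y. sat UNIV \<phi> (e(0 := x, 1 := y)))) \<Longrightarrow>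
      \<exists>b. \<forall>y. y \<in>\<^sub>M b \<longleftrightarrow> (\<exists>x. x \<in>\<^sub>M a \<and> sat UNIV \<phi> (e(0 := x, 1 := y)))"

context set_structure
begin

section \<open>Basic set theory inside the structure\<close>

text \<open>
  \<open>coll X\<close> is the element of the structure whose members are exactly those of \<open>X\<close>. It is
  meaningful only if there is such an element; in a model of ZF this is so for every use below.
\<close>

definition coll :: "'a set \<Rightarrow> 'a" where
  "coll X = (THE a. ext a = X)"

definition empty :: 'a where
  "empty = coll {}"

definition succ :: "'a \<Rightarrow> 'a" where
  "succ a = coll (insert a (ext a))"

definition pow :: "'a \<Rightarrow> 'a" where
  "pow a = coll {x. ext x \<subseteq> ext a}"

definition opair :: "'a \<Rightarrow> 'a \<Rightarrow> 'a" where
  "opair a b = coll {coll {a}, coll {a, b}}"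

definition cprod :: "'a \<Rightarrow> 'a \<Rightarrow> 'a" where
  "cprod a b = coll {opair x y | x y. x \<in> ext a \<and> y \<in> ext b}"

definition transitive :: "'a \<Rightarrow> bool" where
  "transitive a \<longleftrightarrow> (\<forall>x\<in>ext a. ext x \<subseteq> ext a)"

definition trcl :: "'a \<Rightarrow> 'a" where
  "trcl a = coll {x. \<forall>t. transitive t \<and> ext a \<subseteq> ext t \<longrightarrow> x \<in> ext t}"

definition ordinal :: "'a \<Rightarrow> bool" where
  "ordinal a \<longleftrightarrow> transitive a \<and> (\<forall>x\<in>ext a. transitive x)"

definition limit :: "'a \<Rightarrow> bool" where
  "limit a \<longleftrightarrow> ordinal a \<and> a \<noteq> empty \<and> (\<nexists>b. a = succ b)"

definition omega :: 'a where
  "omega = coll {n. ordinal n \<and> (\<forall>m\<in>ext (succ n). \<not> limit m)}"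

text \<open>Evenness for the elements of \<open>omega\<close>, which may be nonstandard.\<close>

definition even_nat :: "'a \<Rightarrow> bool" where
  "even_nat n \<longleftrightarrow> n \<in> ext omega \<and>
    (\<forall>z. empty \<in> ext z \<and> (\<forall>m\<in>ext z. succ (succ m) \<in> ext z) \<longrightarrow> n \<in> ext z)"

definition odd_nat :: "'a \<Rightarrow> bool" where
  "odd_nat n \<longleftrightarrow> n \<in> ext omega \<and> \<not> even_nat n"

definition func :: "'a \<Rightarrow> 'a \<Rightarrow> 'a \<Rightarrow> bool" where
  "func f a b \<longleftrightarrow> ext f \<subseteq> ext (cprod a b) \<and> (\<forall>x\<in>ext a. \<exists>!y. opair x y \<in> ext f)"

definition funs :: "'a \<Rightarrow> 'a \<Rightarrow> 'a" where
  "funs a b = coll {f. func f a b}"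

definition app :: "'a \<Rightarrow> 'a \<Rightarrow> 'a" where
  "app f x = (THE y. opair x y \<in> ext f)"

definition restr :: "'a \<Rightarrow> 'a \<Rightarrow> 'a" where
  "restr f a = coll {p \<in> ext f. \<exists>x\<in>ext a. \<exists>y. p = opair x y}"

definition injection :: "'a \<Rightarrow> 'a \<Rightarrow> 'a \<Rightarrow> bool" where
  "injection f a b \<longleftrightarrow> func f a b \<and> inj_on (app f) (ext a)"

definition surjection :: "'a \<Rightarrow> 'a \<Rightarrow> 'a \<Rightarrow> bool" where
  "surjection f a b \<longleftrightarrow> func f a b \<and> app f ` ext a = ext b"

definition bijection :: "'a \<Rightarrow> 'a \<Rightarrow> 'a \<Rightarrow> bool" where
  "bijection f a b \<longleftrightarrow> func f a b \<and> bij_betw (app f) (ext a) (ext b)"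

definition countable :: "'a \<Rightarrow> bool" where
  "countable a \<longleftrightarrow> (\<exists>f. injection f a omega)"

text \<open>A real is an element of the Baire space.\<close>

definition reals :: 'a where
  "reals = funs omega omega"

definition equiv_rel :: "'a \<Rightarrow> 'a \<Rightarrow> bool" where
  "equiv_rel a r \<longleftrightarrow> ext r \<subseteq> ext (cprod a a) \<and>
    (\<forall>x\<in>ext a. opair x x \<in> ext r) \<and>
    (\<forall>x y. opair x y \<in> ext r \<longrightarrow> opair y x \<in> ext r) \<and>
    (\<forall>x y z. opair x y \<in> ext r \<and> opair y z \<in> ext r \<longrightarrow> opair x z \<in> ext r)"

definition eq_class :: "'a \<Rightarrow> 'a \<Rightarrow> 'a" where
  "eq_class r x = coll {y. opair x y \<in> ext r}"

definition quot :: "'a \<Rightarrow> 'a \<Rightarrow> 'a" where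
  "quot a r = coll (eq_class r ` ext a)"

text \<open>\<open>seq\<close> is a function with domain \<open>\<kappa>\<close> whose values are relations on \<open>reals\<close>.\<close>

definition disjoint_union_quot :: "'a \<Rightarrow> 'a \<Rightarrow> 'a" where
  "disjoint_union_quot \<kappa> seq =
    coll {opair \<alpha> c | \<alpha> c. \<alpha> \<in> ext \<kappa> \<and> c \<in> ext (quot reals (app seq \<alpha>))}"

section \<open>Relative constructibility\<close>

text \<open>
  \<open>def_closed Ps A F\<close>: the set \<open>F\<close> of pairs \<open>(n, R)\<close> with \<open>R \<subseteq> A\<^sup>n\<close> contains the relations given by
  the atomic formulas of the structure \<open>(A, \<in>, P \<inter> A)\<close>, with \<open>P\<close> ranging over \<open>Ps\<close>, and is closed
  under complement, intersection and projection along the last coordinate. The least such \<open>F\<close>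
  consists of the relations first-order definable without parameters over that structure. Since
  \<open>n\<close> and \<open>F\<close> range over the structure, this is definability by formulas in the sense of the
  structure.
\<close>

definition def_closed :: "'a list \<Rightarrow> 'a \<Rightarrow> 'a \<Rightarrow> bool" where
  "def_closed Ps A F \<longleftrightarrow>
    (\<forall>n\<in>ext omega. \<forall>i\<in>ext n. \<forall>j\<in>ext n.
      opair n (coll {s. func s n A \<and> app s i \<in>\<^sub>M app s j}) \<in> ext F \<and>
      opair n (coll {s. func s n A \<and> app s i = app s j}) \<in> ext F) \<and>
    (\<forall>P\<in>set Ps. \<forall>n\<in>ext omega. \<forall>i\<in>ext n.
      opair n (coll {s. func s n A \<and> app s i \<in>\<^sub>M P}) \<in> ext F) \<and>
    (\<forall>n R. n \<in> ext omega \<and> opair n R \<in> ext F \<longrightarrow>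
      opair n (coll (ext (funs n A) - ext R)) \<in> ext F) \<and>
    (\<forall>n R S. n \<in> ext omega \<and> opair n R \<in> ext F \<and> opair n S \<in> ext F \<longrightarrow>
      opair n (coll (ext R \<inter> ext S)) \<in> ext F) \<and>
    (\<forall>n R. n \<in> ext omega \<and> opair (succ n) R \<in> ext F \<longrightarrow>
      opair n (coll {s. func s n A \<and>
        (\<exists>a\<in>ext A. coll (insert (opair n a) (ext s)) \<in> ext R)}) \<in> ext F)"

definition definable_rel :: "'a list \<Rightarrow> 'a \<Rightarrow> 'a \<Rightarrow> 'a \<Rightarrow> bool" where
  "definable_rel Ps A n R \<longleftrightarrow> n \<in> ext omega \<and> (\<forall>F. def_closed Ps A F \<longrightarrow> opair n R \<in> ext F)"

text \<open>The subsets of \<open>A\<close> definable over \<open>(A, \<in>, P \<inter> A)\<close> from parameters \<open>s \<in> A\<^sup>n\<close>.\<close>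

definition Def :: "'a list \<Rightarrow> 'a \<Rightarrow> 'a" where
  "Def Ps A = coll {X. \<exists>n\<in>ext omega. \<exists>s R. func s n A \<and> definable_rel Ps A (succ n) R \<and>
    X = coll {a \<in> ext A. coll (insert (opair n a) (ext s)) \<in> ext R}}"

text \<open>\<open>f\<close> is the sequence of levels up to and including \<open>\<alpha>\<close>, starting from \<open>T\<close>.\<close>

definition L_levels :: "'a list \<Rightarrow> 'a \<Rightarrow> 'a \<Rightarrow> 'a \<Rightarrow> bool" where
  "L_levels Ps T \<alpha> f \<longleftrightarrow> ordinal \<alpha> \<and> (\<exists>b. func f (succ \<alpha>) b) \<and>
    app f empty = T \<and>
    (\<forall>\<beta>\<in>ext \<alpha>. app f (succ \<beta>) = Def Ps (app f \<beta>)) \<and>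
    (\<forall>\<beta>\<in>ext (succ \<alpha>). limit \<beta> \<longrightarrow> app f \<beta> = coll (\<Union>\<gamma>\<in>ext \<beta>. ext (app f \<gamma>)))"

definition L_class :: "'a list \<Rightarrow> 'a \<Rightarrow> 'a set" where
  "L_class Ps T = {y. \<exists>\<alpha> f. L_levels Ps T \<alpha> f \<and> y \<in> ext (app f \<alpha>)}"

text \<open>\<open>L[S,x]\<close>, where \<open>S\<close> and \<open>x\<close> are used as predicates, and \<open>L(X)\<close>.\<close>

definition L_bracket :: "'a \<Rightarrow> 'a \<Rightarrow> 'a set" where
  "L_bracket S x = L_class [S, x] empty"

definition L_paren :: "'a \<Rightarrow> 'a set" where
  "L_paren X = L_class [] (trcl (coll {X}))"

definition V_eq_L_Pow_reals :: bool where
  "V_eq_L_Pow_reals \<longleftrightarrow> L_paren (pow reals) = UNIV"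

section \<open>AD$^+$\<close>

definition DC_reals :: bool where
  "DC_reals \<longleftrightarrow> (\<forall>r. ext r \<subseteq> ext (cprod reals reals) \<and>
      (\<forall>x\<in>ext reals. \<exists>y\<in>ext reals. opair x y \<in> ext r) \<longrightarrow>
    (\<exists>f. func f omega reals \<and> (\<forall>n\<in>ext omega. opair (app f n) (app f (succ n)) \<in> ext r)))"

text \<open>
  \<open>\<phi>\<close> is an actual formula, as truth in the proper class \<open>L[S,x]\<close> is not definable uniformly in
  codes of formulas. The environment assigns \<open>S\<close> to variable 0 and \<open>x\<close> to variable 1.
\<close>

definition infinity_Borel_code :: "'a \<Rightarrow> fm \<Rightarrow> 'a \<Rightarrow> bool" where
  "infinity_Borel_code S \<phi> A \<longleftrightarrow> (\<forall>\<alpha>\<in>ext S. ordinal \<alpha>) \<and> fv \<phi> \<subseteq> {0, 1} \<and>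
    ext A = {x \<in> ext reals. sat (L_bracket S x) \<phi> ((\<lambda>_. S)(1 := x))}"

text \<open>The ordinal 0 is excluded: it is trivially not a surjective image of the reals.\<close>

definition Theta :: 'a where
  "Theta = (THE \<theta>. ordinal \<theta> \<and> \<theta> \<noteq> empty \<and> (\<nexists>f. surjection f reals \<theta>) \<and>
    (\<forall>\<alpha>\<in>ext \<theta>. \<alpha> \<noteq> empty \<longrightarrow> (\<exists>f. surjection f reals \<alpha>)))"

text \<open>The product topology on \<open>\<^sup>\<omega>\<lambda>\<close>, with \<open>\<lambda>\<close> discrete.\<close>

definition seq_open :: "'a \<Rightarrow> 'a \<Rightarrow> bool" where
  "seq_open l U \<longleftrightarrow> ext U \<subseteq> ext (funs omega l) \<and>
    (\<forall>f\<in>ext U. \<exists>n\<in>ext omega. \<forall>g\<in>ext (funs omega l). restr g n = restr f n \<longrightarrow> g \<in> ext U)"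

definition preimage :: "'a \<Rightarrow> 'a \<Rightarrow> 'a \<Rightarrow> 'a" where
  "preimage p a B = coll {x \<in> ext a. app p x \<in> ext B}"

definition continuous_to_reals :: "'a \<Rightarrow> 'a \<Rightarrow> bool" where
  "continuous_to_reals l p \<longleftrightarrow> func p (funs omega l) reals \<and>
    (\<forall>U. seq_open omega U \<longrightarrow> seq_open l (preimage p (funs omega l) U))"

text \<open>
  The game on \<open>l\<close> with payoff \<open>B\<close>: player I moves at even stages, player II at odd stages, and
  player I wins iff the resulting sequence is in \<open>B\<close>.
\<close>

definition fin_seqs :: "'a \<Rightarrow> 'a" where
  "fin_seqs l = coll {s. \<exists>n\<in>ext omega. func s n l}"

definition determined :: "'a \<Rightarrow> 'a \<Rightarrow> bool" where
  "determined l B \<longleftrightarrow>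
    (\<exists>\<sigma>. func \<sigma> (fin_seqs l) l \<and>
      (\<forall>f. func f omega l \<and> (\<forall>n. even_nat n \<longrightarrow> app f n = app \<sigma> (restr f n)) \<longrightarrow> f \<in> ext B)) \<or>
    (\<exists>\<tau>. func \<tau> (fin_seqs l) l \<and>
      (\<forall>f. func f omega l \<and> (\<forall>n. odd_nat n \<longrightarrow> app f n = app \<tau> (restr f n)) \<longrightarrow> f \<notin> ext B))"

text \<open>In the third clause \<open>l = 0\<close> is excluded, since no moves are possible in a game on 0.\<close>

definition AD_plus :: bool where
  "AD_plus \<longleftrightarrow> DC_reals \<and>
    (\<forall>A. ext A \<subseteq> ext reals \<longrightarrow> (\<exists>S \<phi>. infinity_Borel_code S \<phi> A)) \<and>
    (\<forall>l\<in>ext Theta. l \<noteq> empty \<longrightarrow>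
      (\<forall>A p. ext A \<subseteq> ext reals \<and> continuous_to_reals l p \<longrightarrow>
        determined l (preimage p (funs omega l) A)))"

end

end

theory Submission
  imports Defs
begin

text \<open>
  Let \<open>C\<close> be a class of some \<open>E\<^sub>\<alpha>\<close>. Forcing with finite sequences from the countable set \<open>C\<close>
  adds a real \<open>x\<close> whose columns enumerate \<open>C\<close>; for a set \<open>A\<close> of reals let \<open>F A\<close> be the set of
  conditions that force \<open>x \<in> A\<close>. The set \<open>Y\<close> of reals whose columns are pairwise
  \<open>E\<^sub>\<beta>\<close>-equivalent for some \<open>\<beta>\<close> has an \<open>\<infinity>\<close>-Borel code, and the evaluation of the code meets
  only a well-ordered set \<open>X\<close> of sets of reals, which does not depend on \<open>C\<close>. If some \<open>A\<close> in \<open>X\<close> is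
  such that \<open>F A\<close> is nonempty and decides column 0, then the least such \<open>A\<close> selects an element of
  \<open>C\<close>; if this happens for all \<open>C\<close>, then mapping \<open>(\<alpha>, C)\<close> to the selected element and \<open>\<alpha>\<close> is the
  required injection.

  Otherwise consider the sets \<open>F A\<close>, for \<open>A\<close> in \<open>X\<close>, as conditions themselves. There are only
  countably many of them, because under determinacy well-orderable sets of reals are countable. By
  induction along the code their generic reals lie in \<open>Y\<close>, and as well-ordered unions of meager
  sets are meager, one \<open>\<beta>\<close> works below some condition. Column 0 of the generic real avoids every
  countable set, in particular every \<open>E\<^sub>\<beta>\<close>-class, so the real that a bijection of
  \<open>\<real>/E\<^sub>\<beta>\<close> with \<open>\<real>\<close> assigns to it is not decided, and two conditions force different values
  of one of its digits. Exchanging the first \<open>k\<close> columns with the next \<open>k\<close> moves the second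
  condition away from the first. A generic real below both has \<open>E\<^sub>\<beta>\<close>-equivalent columns 0 and \<open>k\<close> to
  which different reals are assigned, a contradiction.
\<close>

section \<open>Definability with parameters\<close>

primrec rename :: "(nat => nat) => fm => fm" where
  "rename r (Mem i j) = Mem (r i) (r j)"
| "rename r (Eq i j) = Eq (r i) (r j)"
| "rename r (Neg p) = Neg (rename r p)"
| "rename r (Conj p q) = Conj (rename r p) (rename r q)"
| "rename r (All i p) = All (r i) (rename r p)"

definition interleave :: "(nat => 'b) => (nat => 'b) => nat => 'b" where
  "interleave g e n = (if even n then e (n div 2) else g (n div 2))"

named_theorems def_intros

lemma inj_fix_even:
  assumes "odd (c::nat)"
  shows "inj (%n::nat. if even n then n else 4 * (n div 2) + c)"
  by (rule inj_on_inverseI[where g="%m. if even m then m else 2 * ((m - c) div 4) + 1"])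
    (use assms in \<open>auto elim!: oddE\<close>)

lemma inj_rotate_even: "inj (%n::nat. if n = 0 then 1 else if even n then n - 2 else n + 2)"
  by (rule inj_on_inverseI[where g="%m. if m = 1 then 0 else if even m then m + 2 else m - 2"])
    (auto elim!: evenE oddE, presburger)

context set_structure
begin

lemma sat_rename: "inj r ==> sat C (rename r p) e = sat C p (e \<circ> r)"
proof (induction p arbitrary: e)
  case (All i p)
  have "(e(r i := x)) \<circ> r = (e \<circ> r)(i := x)" for x
    using All.prems by (auto simp: fun_eq_iff inj_eq)
  then show ?case using All by (simp del: fun_upd_apply o_apply add: comp_def[symmetric])
qed auto

text \<open>A predicate on environments is definable if it is given by a formula; the odd variables of
  the formula hold the parameters, the even ones the environment.\<close>

definition definable :: "((nat => 'a) => bool) => bool" where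
  "definable P \<longleftrightarrow> (\<exists>p g. \<forall>e. P e = sat UNIV p (interleave g e))"

definition def_term :: "((nat => 'a) => 'a) => bool" where
  "def_term t \<longleftrightarrow> definable (%e. e 0 = t (%n. e (Suc n)))"

lemma definable_neg[def_intros]: assumes "definable P" shows "definable (%e. \<not> P e)"
proof -
  obtain p g where "\<forall>e. P e = sat UNIV p (interleave g e)" using assms unfolding definable_def by blast
  then have "\<forall>e. (\<not> P e) = sat UNIV (Neg p) (interleave g e)" by simp
  then show ?thesis unfolding definable_def by blast
qed

lemma definable_conj[def_intros]: assumes "definable P" "definable Q" shows "definable (%e. P e \<and> Q e)"
proof -
  obtain p g where p: "\<forall>e. P e = sat UNIV p (interleave g e)"
    using assms(1) unfolding definable_def by blast
  obtain q h where q: "\<forall>e. Q e = sat UNIV q (interleave h e)"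
    using assms(2) unfolding definable_def by blast
  define r1 :: "nat => nat" where "r1 = (%n. if even n then n else 4 * (n div 2) + 1)"
  define r2 :: "nat => nat" where "r2 = (%n. if even n then n else 4 * (n div 2) + 3)"
  have inj_r1: "inj r1" unfolding r1_def by (rule inj_fix_even) simp
  have inj_r2: "inj r2" unfolding r2_def by (rule inj_fix_even) simp
  let ?k = "interleave h g"
  have div4: "(4 * m + 1) div 2 = 2 * m" "(4 * m + 3) div 2 = 2 * m + 1" for m :: nat by auto
  have via_r1: "interleave ?k e \<circ> r1 = interleave g e" for e
    by (rule ext) (auto simp: interleave_def r1_def div4 elim!: oddE)
  have via_r2: "interleave ?k e \<circ> r2 = interleave h e" for e
    by (rule ext) (auto simp: interleave_def r2_def div4 elim!: oddE)
  have "\<forall>e. (P e \<and> Q e) = sat UNIV (Conj (rename r1 p) (rename r2 q)) (interleave ?k e)"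
    using p q by (simp add: sat_rename inj_r1 inj_r2 via_r1 via_r2)
  then show ?thesis unfolding definable_def by blast
qed

lemma definable_all[def_intros]:
  assumes "definable (%e. Q (%n. e (Suc n)) (e 0))" shows "definable (%e. \<forall>y. Q e y)"
proof -
  obtain p g where p: "\<And>e. Q (%n. e (Suc n)) (e 0) = sat UNIV p (interleave g e)"
    using assms unfolding definable_def by blast
  define r :: "nat => nat" where "r = (%n. if n = 0 then 1 else if even n then n - 2 else n + 2)"
  have inj_r: "inj r" unfolding r_def by (rule inj_rotate_even)
  define g' where "g' = (%k. g (k - 1))"
  have via_r: "(interleave g' e)(1 := y) \<circ> r = interleave g (case_nat y e)" for e y
  proof (rule ext)
    fix n :: nat
    have "n = 0 \<or> (\<exists>k. n = 2 * k + 2) \<or> (\<exists>k. n = 2 * k + 1)"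
      by (metis Suc_1 Suc_eq_plus1 add_2_eq_Suc' evenE mult_Suc_right mult_0_right not0_implies_Suc
        oddE add.commute)
    then consider "n = 0" | k where "n = 2 * k + 2" | k where "n = 2 * k + 1" by blast
    then show "((interleave g' e)(1 := y) \<circ> r) n = interleave g (case_nat y e) n"
      by cases (auto simp: interleave_def r_def g'_def)
  qed
  have "(\<forall>y. Q e y) = sat UNIV (All 1 (rename r p)) (interleave g' e)" for e
  proof -
    have "Q e y = sat UNIV p (interleave g (case_nat y e))" for y
      using p[of "case_nat y e"] by simp
    then show ?thesis by (simp only: sat.simps sat_rename[OF inj_r] via_r) simp
  qed
  then show ?thesis unfolding definable_def by blast
qed

lemma definable_cong: "definable P ==> (\<And>e. P e = Q e) ==> definable Q"
  by (simp add: definable_def)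

lemma definable_disj[def_intros]: "definable P ==> definable Q ==> definable (%e. P e \<or> Q e)"
  by (rule definable_cong[of "%e. \<not> (\<not> P e \<and> \<not> Q e)"], intro def_intros) auto
lemma definable_imp[def_intros]: "definable P ==> definable Q ==> definable (%e. P e --> Q e)"
  by (rule definable_cong[of "%e. \<not> (P e \<and> \<not> Q e)"], intro def_intros) auto
lemma definable_iff[def_intros]: "definable P ==> definable Q ==> definable (%e. P e \<longleftrightarrow> Q e)"
  by (rule definable_cong[of "%e. (P e --> Q e) \<and> (Q e --> P e)"], intro def_intros) auto
lemma definable_if[def_intros]: "definable P ==> definable Q ==> definable R ==>
    definable (%e. if P e then Q e else R e)"
  by (rule definable_cong[of "%e. (P e --> Q e) \<and> (\<not> P e --> R e)"], intro def_intros) auto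
lemma definable_ex[def_intros]:
  assumes "definable (%e. Q (%n. e (Suc n)) (e 0))" shows "definable (%e. \<exists>y. Q e y)"
  by (rule definable_cong[of "%e. \<not> (\<forall>y. \<not> Q e y)"], rule definable_neg, rule definable_all,
    rule definable_neg, rule assms) auto

lemma definable_rename: assumes "inj r" "definable P" shows "definable (%e. P (%n. e (r n)))"
proof -
  obtain p g where p: "\<And>e. P e = sat UNIV p (interleave g e)" using assms unfolding definable_def by blast
  define r' where "r' = (%n. if even n then 2 * r (n div 2) else n)"
  have inj_r': "inj r'"
    using assms(1) unfolding inj_def r'_def
    by (smt (verit) dvd_triv_left even_two_times_div_two mult_cancel_left zero_neq_numeral)
  have "interleave g e \<circ> r' = interleave g (%n. e (r n))" for e
    by (rule ext) (simp add: interleave_def r'_def)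
  then have "\<forall>e. P (%n. e (r n)) = sat UNIV (rename r' p) (interleave g e)"
    by (simp add: p sat_rename[OF inj_r'])
  then show ?thesis unfolding definable_def by blast
qed

lemma definable_weaken:
  assumes "definable (%e. Q (%n. e (Suc n)) (e 0))" "inj r"
  shows "definable (%e. Q (%n. e (Suc (r n))) (e 0))"
proof -
  have "inj (case_nat 0 (%n. Suc (r n)))"
    by (rule injI) (auto split: nat.splits dest: injD[OF assms(2)])
  from definable_rename[OF this assms(1)] show ?thesis by simp
qed

lemma definable_var_eq: "definable (%e. e i = e j)"
proof -
  have "\<forall>e. (e i = e j) = sat UNIV (Eq (2*i) (2*j)) (interleave g e)" for g by (simp add: interleave_def)
  then show ?thesis unfolding definable_def by blast
qed

lemma definable_var_mem: "definable (%e. e i \<in> ext (e j))"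
proof -
  have "\<forall>e. (e i \<in> ext (e j)) = sat UNIV (Mem (2*i) (2*j)) (interleave g e)" for g
    by (simp add: interleave_def ext_def)
  then show ?thesis unfolding definable_def by blast
qed

lemma def_term_var[def_intros]: "def_term (%e. e k)"
  unfolding def_term_def by (rule definable_var_eq)
lemma def_term_const[def_intros]: "def_term (%e. c)"
proof -
  have "\<forall>e. (e 0 = c) = sat UNIV (Eq 0 1) (interleave (%_. c) e)" by (simp add: interleave_def)
  then show ?thesis unfolding def_term_def definable_def by blast
qed

lemma definable_true: "definable (%e. True)"
  by (rule definable_cong[OF definable_var_eq[of 0 0]]) simp
lemma definable_const[def_intros]: "definable (%e. b)"
proof (cases b)
  case True then show ?thesis using definable_true by simp
next
  case False then show ?thesis using definable_neg[OF definable_true] by simp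
qed

lemma definable_subst:
  assumes "definable (%e. Q (e 0) (%n. e (Suc n)))" "def_term t" shows "definable (%e. Q (t e) e)"
proof -
  have "definable (%e. e 0 = t (%n. e (Suc n)) \<and> Q (e 0) (%n. e (Suc n)))"
    using assms unfolding def_term_def by (intro definable_conj)
  then have "definable (%e. \<exists>y. y = t e \<and> Q y e)" by (rule definable_ex)
  then show ?thesis by (rule definable_cong) simp
qed

lemma def_term_shift: assumes "def_term t" shows "def_term (%e. t (%n. e (Suc n)))"
proof -
  have "inj (case_nat 0 (%n. Suc (Suc n)))" by (auto simp: inj_def split: nat.splits)
  from definable_rename[OF this assms[unfolded def_term_def]] show ?thesis unfolding def_term_def by simp
qed

definition def_pred :: "('a => bool) => bool" where "def_pred P \<longleftrightarrow> definable (%e. P (e 0))"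
definition def_pred2 :: "('a => 'a => bool) => bool" where "def_pred2 P \<longleftrightarrow> definable (%e. P (e 0) (e 1))"
definition def_pred3 :: "('a => 'a => 'a => bool) => bool" where
  "def_pred3 P \<longleftrightarrow> definable (%e. P (e 0) (e 1) (e 2))"
definition def_pred4 :: "('a => 'a => 'a => 'a => bool) => bool" where
  "def_pred4 P \<longleftrightarrow> definable (%e. P (e 0) (e 1) (e 2) (e 3))"
definition def_fun :: "('a => 'a) => bool" where "def_fun F \<longleftrightarrow> def_term (%e. F (e 0))"
definition def_fun2 :: "('a => 'a => 'a) => bool" where "def_fun2 F \<longleftrightarrow> def_term (%e. F (e 0) (e 1))"
definition def_fun3 :: "('a => 'a => 'a => 'a) => bool" where
  "def_fun3 F \<longleftrightarrow> def_term (%e. F (e 0) (e 1) (e 2))"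

lemma def_predD: "def_pred P ==> def_term t ==> definable (%e. P (t e))"
  unfolding def_pred_def using definable_subst[where Q="%y e. P y"] by simp

lemma def_pred2D:
  assumes "def_pred2 P" "def_term t" "def_term u"
  shows "definable (%e. P (t e) (u e))"
proof -
  have "definable (%e. P (e 1) (e 0))"
    using definable_rename[OF _ assms(1)[unfolded def_pred2_def], of "id(0:=1,1:=0)"] by (simp add: inj_def)
  then have "definable (%e. P (e 0) (u (%n. e (Suc n))))"
    using definable_subst[where Q="%y e. P (e 0) y", OF _ def_term_shift[OF assms(3)]] by simp
  then show ?thesis using definable_subst[where Q="%y e. P y (u e)"] assms(2) by simp
qed

lemma def_pred3D:
  assumes "def_pred3 P" "def_term t" "def_term u" "def_term v"
  shows "definable (%e. P (t e) (u e) (v e))"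
proof -
  have "definable (%e. P (e (Suc 0)) (e 0) (e 2))"
    using definable_rename[OF _ assms(1)[unfolded def_pred3_def], of "id(0:=1,1:=0)"] by (simp add: inj_def)
  from definable_rename[OF _ this, of "id(0:=1,1:=2,2:=0)"]
  have "definable (%e. P (e 2) (e 1) (e 0))"  by (simp add: inj_def)
  then have "definable (%e. P (e 1) (e 0) (v (%n. e (Suc (Suc n)))))"
    using definable_subst[where Q="%y e. P (e 1) (e 0) y", OF _ def_term_shift[OF def_term_shift[OF assms(4)]]]
    by (simp add: numeral_2_eq_2)
  then have "definable (%e. P (e 0) (u (%n. e (Suc n))) (v (%n. e (Suc n))))"
    using definable_subst[where Q="%y e. P (e 0) y (v (%n. e (Suc n)))", OF _ def_term_shift[OF assms(3)]]
    by simp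
  then show ?thesis using definable_subst[where Q="%y e. P y (u e) (v e)"] assms(2) by simp
qed

lemma def_pred4D:
  assumes "def_pred4 P" "def_term t" "def_term u" "def_term v" "def_term w"
  shows "definable (%e. P (t e) (u e) (v e) (w e))"
proof -
  have "definable (%e. P (e 3) (e 2) (e 1) (e 0))"
    using definable_rename[OF _ assms(1)[unfolded def_pred4_def], of "id(0:=3,1:=2,2:=1,3:=0)"]
    by (simp add: inj_def)
  then have "definable (%e. P (e 2) (e 1) (e 0) (w (%n. e (Suc (Suc (Suc n))))))"
    using definable_subst[where Q="%y e. P (e 2) (e 1) (e 0) y", OF _ def_term_shift[OF def_term_shift[OF def_term_shift[OF assms(5)]]]]
    by (simp add: numeral_2_eq_2 numeral_3_eq_3)
  then have "definable (%e. P (e 1) (e 0) (v (%n. e (Suc (Suc n)))) (w (%n. e (Suc (Suc n)))))"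
    using definable_subst[where Q="%y e. P (e 1) (e 0) y (w (%n. e (Suc (Suc n))))", OF _ def_term_shift[OF def_term_shift[OF assms(4)]]]
    by (simp add: numeral_2_eq_2)
  then have "definable (%e. P (e 0) (u (%n. e (Suc n))) (v (%n. e (Suc n))) (w (%n. e (Suc n))))"
    using definable_subst[where Q="%y e. P (e 0) y (v (%n. e (Suc n))) (w (%n. e (Suc n)))", OF _ def_term_shift[OF assms(3)]] by simp
  then show ?thesis using definable_subst[where Q="%y e. P y (u e) (v e) (w e)"] assms(2) by simp
qed

lemma def_funD:
  assumes "def_fun F" "def_term t"
  shows "def_term (%e. F (t e))"
proof -
  have "def_pred2 (%y a. y = F a)" using assms(1) by (simp add: def_pred2_def def_fun_def def_term_def)
  then show ?thesis
    unfolding def_term_def by (rule def_pred2D[OF _ def_term_var def_term_shift[OF assms(2)]])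
qed

lemma def_fun2D:
  assumes "def_fun2 F" "def_term t" "def_term u"
  shows "def_term (%e. F (t e) (u e))"
proof -
  have "def_pred3 (%y a b. y = F a b)"
    using assms(1) by (simp add: def_pred3_def def_fun2_def def_term_def numeral_2_eq_2)
  then show ?thesis unfolding def_term_def
    by (rule def_pred3D[OF _ def_term_var def_term_shift[OF assms(2)] def_term_shift[OF assms(3)]])
qed

lemma def_fun3D:
  assumes "def_fun3 F" "def_term t" "def_term u" "def_term v"
  shows "def_term (%e. F (t e) (u e) (v e))"
proof -
  have "def_pred4 (%y a b c. y = F a b c)"
    using assms(1) by (simp add: def_pred4_def def_fun3_def def_term_def numeral_2_eq_2 numeral_3_eq_3)
  then show ?thesis unfolding def_term_def
    by (rule def_pred4D[OF _ def_term_var def_term_shift[OF assms(2)] def_term_shift[OF assms(3)] def_term_shift[OF assms(4)]])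
qed

lemma definable_eq[def_intros]: "def_term t ==> def_term u ==> definable (%e. t e = u e)"
  by (rule def_pred2D[where P="(=)"]) (simp_all add: def_pred2_def definable_var_eq)
lemma definable_mem[def_intros]: "def_term t ==> def_term u ==> definable (%e. t e \<in> ext (u e))"
  by (rule def_pred2D[where P="%a b. a \<in> ext b"]) (simp_all add: def_pred2_def definable_var_mem)
lemma definable_ball[def_intros]: assumes "def_term t" "definable (%e. Q (%n. e (Suc n)) (e 0))"
  shows "definable (%e. \<forall>y\<in>ext (t e). Q e y)"
  unfolding Ball_def
  by (intro definable_all definable_imp definable_mem def_term_shift[OF assms(1)] assms def_intros)
lemma definable_bex[def_intros]: assumes "def_term t" "definable (%e. Q (%n. e (Suc n)) (e 0))"
  shows "definable (%e. \<exists>y\<in>ext (t e). Q e y)"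
  unfolding Bex_def
  by (intro definable_ex definable_conj definable_mem def_term_shift[OF assms(1)] assms def_intros)
lemma definable_subset[def_intros]:
  assumes "def_term t" "def_term u" shows "definable (%e. ext (t e) \<subseteq> ext (u e))"
  unfolding subset_iff
  by (intro definable_all definable_imp definable_mem def_term_shift[OF assms(1)]
    def_term_shift[OF assms(2)] def_intros)
lemma definable_eq_Collect[def_intros]: assumes "def_term t" "definable (%e. Q (%n. e (Suc n)) (e 0))"
  shows "definable (%e. ext (t e) = {y. Q e y})"
  unfolding set_eq_iff mem_Collect_eq
  by (intro definable_all definable_iff definable_mem def_term_shift[OF assms(1)] assms def_intros)
lemma definable_ex1[def_intros]: assumes "definable (%e. Q (%n. e (Suc n)) (e 0))"
  shows "definable (%e. \<exists>!y. Q e y)"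
proof -
  have "definable (%e. Q (%n. e (Suc (Suc n))) (e 0))" using definable_weaken[OF assms inj_Suc] .
  then show ?thesis
    unfolding Ex1_def by (intro definable_ex definable_conj definable_all definable_imp assms def_intros)
qed

lemma def_term_if[def_intros]:
  assumes "definable P" "def_term t" "def_term u" shows "def_term (%e. if P e then t e else u e)"
proof -
  have "definable (%e. P (%n. e (Suc n)))" by (rule definable_rename[OF _ assms(1)]) simp
  then have "definable (%e. if P (%n. e (Suc n)) then e 0 = t (%n. e (Suc n)) else e 0 = u (%n. e (Suc n)))"
    using assms(2,3) unfolding def_term_def by (rule definable_if)
  then show ?thesis unfolding def_term_def by (rule definable_cong) auto
qed

lemma def_predI[def_intros]: "definable (%e. P (e 0)) ==> def_pred P" by (simp add: def_pred_def)
lemma def_pred2I[def_intros]: "definable (%e. P (e 0) (e 1)) ==> def_pred2 P" by (simp add: def_pred2_def)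
lemma def_pred3I[def_intros]: "definable (%e. P (e 0) (e 1) (e 2)) ==> def_pred3 P"
  by (simp add: def_pred3_def)
lemma def_pred4I[def_intros]: "definable (%e. P (e 0) (e 1) (e 2) (e 3)) ==> def_pred4 P"
  by (simp add: def_pred4_def)
lemma def_funI[def_intros]: "def_term (%e. F (e 0)) ==> def_fun F" by (simp add: def_fun_def)
lemma def_fun2I[def_intros]: "def_term (%e. F (e 0) (e 1)) ==> def_fun2 F" by (simp add: def_fun2_def)
lemma def_fun3I[def_intros]: "def_term (%e. F (e 0) (e 1) (e 2)) ==> def_fun3 F" by (simp add: def_fun3_def)

definition is_set :: "'a set => bool" where "is_set X \<longleftrightarrow> (\<exists>a. ext a = X)"

end

context zf_model
begin

lemma ext_inject: "ext a = ext b ==> a = b"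
  using extensionality by (auto simp: ext_def set_eq_iff)

lemma ext_inject_iff[simp]: "ext a = ext b \<longleftrightarrow> a = b"
  using ext_inject by blast

lemma coll_ext[simp]: "coll (ext a) = a"
  unfolding coll_def by (rule the_equality) auto

lemma ext_coll: "is_set X ==> ext (coll X) = X"
  unfolding is_set_def by auto

lemma is_set_ext[simp]: "is_set (ext a)" by (auto simp: is_set_def)

lemma def_term_coll[def_intros]: assumes "definable (%e. Q (%n. e (Suc n)) (e 0))"
  shows "def_term (%e. coll {y. Q e y})"
proof -
  have coll_iff: "(y = coll X) =
      (ext y = X \<or> (\<not> (\<exists>z. ext z = X) \<and> y = (THE a. False)))" for y X
  proof (cases "\<exists>z. ext z = X")
    case True
    then obtain z where "X = ext z" by blast
    then show ?thesis by auto
  next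
    case False
    then have "(%a. ext a = X) = (%a. False)" by auto
    then have "coll X = (THE a. False)" unfolding coll_def by simp
    then show ?thesis using False by auto
  qed
  have is_ext: "definable (%e. ext (e 0) = {y. Q (%n. e (Suc n)) y})"
    by (rule definable_eq_Collect[where Q="%e y. Q (%n. e (Suc n)) y", OF def_term_var definable_weaken[OF assms inj_Suc]])
  have "definable (%e. ext (e 0) = {y. Q (%n. e (Suc (Suc n))) y})"
    by (rule definable_eq_Collect[where Q="%e y. Q (%n. e (Suc (Suc n))) y", OF def_term_var])
      (rule definable_weaken[OF assms], simp add: inj_def)
  then have "definable (%e. \<exists>z. ext z = {y. Q (%n. e (Suc n)) y})"
    by (rule definable_ex[where Q="%e z. ext z = {y. Q (%n. e (Suc n)) y}"])
  with is_ext show ?thesis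
    unfolding def_term_def coll_iff
    by (intro definable_disj definable_conj definable_neg definable_eq def_term_var def_term_const)
qed

lemma is_set_sep: assumes "def_pred P" shows "is_set {x \<in> ext a. P x}"
proof -
  obtain p g where p: "\<And>e. P (e 0) = sat UNIV p (interleave g e)"
    using assms unfolding def_pred_def definable_def by blast
  obtain b where b: "\<forall>x. x \<in>\<^sub>M b \<longleftrightarrow> x \<in>\<^sub>M a \<and> sat UNIV p ((interleave g (%_. a))(0 := x))"
    using separation by blast
  have "(interleave g (%_. a))(0 := x) = interleave g ((%_. a)(0 := x))" for x
    by (rule ext) (auto simp: interleave_def)
  then have "ext b = {x \<in> ext a. P x}" using b p[of "(%_. a)(0 := x)" for x] by (auto simp: ext_def)
  then show ?thesis unfolding is_set_def by blast
qed

lemma is_set_subset: assumes "X \<subseteq> ext a" "def_pred (%x. x \<in> X)" shows "is_set X"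
proof -
  have "X = {x \<in> ext a. x \<in> X}" using assms(1) by auto
  then show ?thesis using is_set_sep[OF assms(2), of a] by simp
qed

lemma is_set_image: assumes "def_fun F" shows "is_set (F ` ext a)"
proof -
  have "definable (%e. e 0 = F (e 1))" using assms by (simp add: def_fun_def def_term_def)
  then obtain p g where p: "\<And>e. (e 0 = F (e 1)) = sat UNIV p (interleave g e)"
    unfolding definable_def by blast
  define r where "r = (%n::nat. if n = 0 then 1 else if n = 2 then 0 else n + 5)"
  define E where "E = (%n. interleave g (%_. a) (n - 5))"
  have "inj r" by (rule injI) (auto simp: r_def split: if_splits)
  moreover have "E(0 := x, 1 := y) \<circ> r = interleave g ((%_. a)(0 := y, 1 := x))" for x y
    by (rule ext) (auto simp: E_def r_def interleave_def elim!: evenE)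
  ultimately have graph: "sat UNIV (rename r p) (E(0 := x, 1 := y)) = (y = F x)" for x y
    by (simp add: sat_rename p[symmetric])
  obtain b where "\<forall>y. y \<in>\<^sub>M b \<longleftrightarrow> (\<exists>x. x \<in>\<^sub>M a \<and> sat UNIV (rename r p) (E(0 := x, 1 := y)))"
    using replacement[of a "rename r p" E] graph by auto
  then have "ext b = F ` ext a" unfolding graph by (auto simp: ext_def)
  then show ?thesis unfolding is_set_def by blast
qed

lemma is_set_empty[simp]: "is_set {}"
proof -
  have "is_set {x \<in> ext undefined. False}" by (rule is_set_sep) (intro def_intros)
  then show ?thesis by simp
qed

lemma is_set_pair[simp]: "is_set {a, b}"
  using pairing[of a b] unfolding is_set_def ext_def by auto
lemma is_set_singleton[simp]: "is_set {a}" using is_set_pair[of a a] by simp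
lemma is_set_Union: "is_set {z. \<exists>y\<in>ext a. z \<in> ext y}"
  using union[of a] unfolding is_set_def ext_def by auto
lemma is_set_Pow: "is_set {x. ext x \<subseteq> ext a}"
proof -
  obtain p where "\<forall>x. x \<in>\<^sub>M p \<longleftrightarrow> (\<forall>y. y \<in>\<^sub>M x --> y \<in>\<^sub>M a)" using power_set by blast
  then have "ext p = {x. ext x \<subseteq> ext a}" by (auto simp: ext_def)
  then show ?thesis unfolding is_set_def by blast
qed

lemma is_set_Un: assumes "is_set X" "is_set Y" shows "is_set (X \<union> Y)"
proof -
  have "X \<union> Y = {z. \<exists>y\<in>ext (coll {coll X, coll Y}). z \<in> ext y}"
    using assms by (auto simp: ext_coll)
  then show ?thesis using is_set_Union[of "coll {coll X, coll Y}"] by simp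
qed

lemma is_set_insert[simp]: "is_set X ==> is_set (insert a X)"
  using is_set_Un[of "{a}" X] by simp

lemma ext_empty[simp]: "ext empty = {}" unfolding empty_def by (simp add: ext_coll)
lemma ext_eq_empty_iff[simp]: "ext a = {} \<longleftrightarrow> a = empty" using ext_inject[of a empty] by auto
lemma ext_succ[simp]: "ext (succ a) = insert a (ext a)" unfolding succ_def by (simp add: ext_coll)
lemma ext_pow[simp]: "ext (pow a) = {x. ext x \<subseteq> ext a}" unfolding pow_def by (simp add: ext_coll is_set_Pow)

definition upair :: "'a => 'a => 'a" where "upair a b = coll {a, b}"
definition bigunion :: "'a => 'a" where "bigunion a = coll {z. \<exists>y\<in>ext a. z \<in> ext y}"
definition sep :: "'a => ('a => bool) => 'a" where "sep a P = coll {x. x \<in> ext a \<and> P x}"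
definition img :: "('a => 'a) => 'a => 'a" where "img F a = coll {y. \<exists>x\<in>ext a. y = F x}"
definition cup :: "'a => 'a => 'a" where "cup a b = coll {x. x \<in> ext a \<or> x \<in> ext b}"

lemma ext_upair[simp]: "ext (upair a b) = {a, b}" unfolding upair_def by (simp add: ext_coll)
lemma ext_bigunion[simp]: "ext (bigunion a) = {z. \<exists>y\<in>ext a. z \<in> ext y}"
  unfolding bigunion_def by (simp add: ext_coll is_set_Union)
lemma ext_cup[simp]: "ext (cup a b) = ext a \<union> ext b"
proof -
  have "{x. x \<in> ext a \<or> x \<in> ext b} = ext a \<union> ext b" by auto
  then show ?thesis unfolding cup_def by (simp add: ext_coll is_set_Un)
qed

lemma ext_sep: "def_pred P ==> ext (sep a P) = {x \<in> ext a. P x}"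
  unfolding sep_def by (simp add: ext_coll is_set_sep)
lemma ext_img: assumes "def_fun F" shows "ext (img F a) = F ` ext a"
proof -
  have "{y. \<exists>x\<in>ext a. y = F x} = F ` ext a" by auto
  then show ?thesis unfolding img_def by (simp add: ext_coll is_set_image[OF assms])
qed

lemma opair_eq_upair: "opair a b = upair (upair a a) (upair a b)" by (simp add: opair_def upair_def)
lemma upair_eq_iff: "upair a b = upair c d \<longleftrightarrow> {a, b} = {c, d}"
  by (metis ext_upair ext_inject)
lemma opair_eq_iff[simp]: "opair a b = opair c d \<longleftrightarrow> a = c \<and> b = d"
  unfolding opair_eq_upair upair_eq_iff by (auto simp: upair_eq_iff doubleton_eq_iff)

lemma def_term_upair[def_intros]: assumes "def_term t" "def_term u" shows "def_term (%e. upair (t e) (u e))"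
proof -
  have "upair a b = coll {y. y = a \<or> y = b}" for a b
    unfolding upair_def by (rule arg_cong[of _ _ coll]) auto
  then have "def_term (%e. upair (e 0) (e 1))" by (simp only:) (intro def_intros)
  from def_fun2D[OF def_fun2I[OF this] assms] show ?thesis .
qed

lemma def_term_opair[def_intros]: "def_term t ==> def_term u ==> def_term (%e. opair (t e) (u e))"
  unfolding opair_eq_upair by (intro def_intros)
lemma def_fun_bigunion[THEN def_funD, def_intros]: "def_fun bigunion"
  by (intro def_funI, unfold bigunion_def, intro def_intros)
lemma def_fun2_cup[THEN def_fun2D, def_intros]: "def_fun2 cup"
  by (intro def_fun2I, unfold cup_def, intro def_intros)
lemma def_term_succ[def_intros]: assumes "def_term t" shows "def_term (%e. succ (t e))"
proof -
  have "succ a = cup a (upair a a)" for a by (rule ext_inject) auto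
  then show ?thesis by (simp only:) (intro def_intros assms)
qed

lemma def_fun_pow[THEN def_funD, def_intros]: "def_fun pow"
  by (intro def_funI, unfold pow_def, intro def_intros)
lemma def_term_sep[def_intros]: assumes "def_term t" "definable (%e. Q (%n. e (Suc n)) (e 0))"
  shows "def_term (%e. sep (t e) (Q e))"
  unfolding sep_def by (rule def_term_coll) (intro def_intros def_term_shift[OF assms(1)] assms)
lemma def_term_img[def_intros]: assumes "def_term t" "def_term (%e. F (%n. e (Suc n)) (e 0))"
  shows "def_term (%e. img (F e) (t e))"
proof -
  have "def_term (%e. F (%n. e (Suc (Suc n))) (e 0))"
    using definable_rename[OF _ assms(2)[unfolded def_term_def], of "case_nat 0 (case_nat 1 (%n. Suc (Suc (Suc n))))"]
    unfolding def_term_def by (simp add: inj_def split: nat.splits)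
  then show ?thesis unfolding img_def
    by (intro def_term_coll definable_bex definable_eq def_term_shift[OF assms(1)] assms def_intros)
qed

lemma ext_cprod[simp]: "ext (cprod a b) = {opair x y | x y. x \<in> ext a \<and> y \<in> ext b}"
proof -
  have "{opair x y | x y. x \<in> ext a \<and> y \<in> ext b} \<subseteq> ext (pow (pow (cup a b)))"
    by (auto simp: opair_eq_upair)
  then have "is_set {opair x y | x y. x \<in> ext a \<and> y \<in> ext b}"
    by (rule is_set_subset) (simp only: mem_Collect_eq, intro def_intros)
  then show ?thesis unfolding cprod_def by (rule ext_coll)
qed

lemma opair_mem_cprod: "opair x y \<in> ext (cprod a b) \<longleftrightarrow> x \<in> ext a \<and> y \<in> ext b"
  by auto
lemma def_fun2_cprod[THEN def_fun2D, def_intros]: "def_fun2 cprod"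
  by (intro def_fun2I, unfold cprod_def, intro def_intros)

section \<open>Functions\<close>

definition ap :: "'a => 'a => 'a" (infixl "$" 100) where
  "f $ x = coll {z. \<exists>y. opair x y \<in> ext f \<and> z \<in> ext y}"

lemma def_fun2_ap[THEN def_fun2D, def_intros]: "def_fun2 ($)"
  by (intro def_fun2I, unfold ap_def, intro def_intros)

lemma ap_equality: assumes "\<And>z. opair x z \<in> ext f \<longleftrightarrow> z = y" shows "f $ x = y"
proof -
  have "{z. \<exists>y. opair x y \<in> ext f \<and> z \<in> ext y} = ext y" using assms by auto
  then show ?thesis by (simp add: ap_def)
qed

lemma app_eq_ap: assumes "\<exists>!y. opair x y \<in> ext f" shows "app f x = f $ x"
proof -
  obtain y where y: "\<And>z. opair x z \<in> ext f \<longleftrightarrow> z = y" using assms by metis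
  then have "app f x = y" unfolding app_def by auto
  then show ?thesis using ap_equality[OF y] by simp
qed

lemma func_app: "func f a b ==> x \<in> ext a ==> app f x = f $ x"
  by (rule app_eq_ap) (auto simp: func_def)

lemma opair_ap_mem: assumes "func f a b" "x \<in> ext a" shows "opair x (f $ x) \<in> ext f"
  using assms unfolding func_def by (metis ap_equality)

lemma func_opair_iff: assumes "func f a b" shows "opair x y \<in> ext f \<longleftrightarrow> x \<in> ext a \<and> y = f $ x"
proof -
  have "opair x y \<in> ext f ==> x \<in> ext a" using assms unfolding func_def by auto
  moreover have "x \<in> ext a ==> opair x y \<in> ext f ==> y = f $ x"
    using assms opair_ap_mem[OF assms] unfolding func_def by metis
  ultimately show ?thesis using opair_ap_mem[OF assms] by metis
qed

lemma ap_in_codomain: assumes "func f a b" "x \<in> ext a" shows "f $ x \<in> ext b"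
  using opair_ap_mem[OF assms] assms(1) unfolding func_def by auto

lemma ext_func: assumes "func f a b" shows "ext f = {opair x (f $ x) | x. x \<in> ext a}"
proof -
  have "p \<in> ext f ==> \<exists>x y. p = opair x y" for p using assms unfolding func_def by auto
  then show ?thesis using func_opair_iff[OF assms] by fastforce
qed

lemma func_ext: assumes "func f a b" "func g a c" "\<And>x. x \<in> ext a ==> f $ x = g $ x" shows "f = g"
proof -
  have "{opair x (f $ x) | x. x \<in> ext a} = {opair x (g $ x) | x. x \<in> ext a}"
    using assms(3) by (auto intro: exI)
  then have "ext f = ext g" using ext_func[OF assms(1)] ext_func[OF assms(2)] by simp
  then show ?thesis by simp
qed

lemma definable_func[THEN def_pred3D, def_intros]: "def_pred3 func"
  by (intro def_pred3I, unfold func_def, intro def_intros)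

lemma ext_funs[simp]: "ext (funs a b) = {f. func f a b}"
proof -
  have "{f. func f a b} \<subseteq> ext (pow (cprod a b))" unfolding func_def by auto
  then have "is_set {f. func f a b}" by (rule is_set_subset) (simp only: mem_Collect_eq, intro def_intros)
  then show ?thesis unfolding funs_def by (rule ext_coll)
qed

lemma def_fun2_funs[THEN def_fun2D, def_intros]: "def_fun2 funs"
  by (intro def_fun2I, unfold funs_def, intro def_intros)

definition lam :: "'a => ('a => 'a) => 'a" where
  "lam a F = img (%x. opair x (F x)) a"

lemma def_term_lam[def_intros]: assumes "def_term t" "def_term (%e. F (%n. e (Suc n)) (e 0))"
  shows "def_term (%e. lam (t e) (F e))"
  unfolding lam_def by (intro def_term_img def_term_opair assms def_intros)

lemma ext_lam: assumes "def_fun F" shows "ext (lam a F) = {opair x (F x) | x. x \<in> ext a}"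
  unfolding lam_def by (subst ext_img) (intro def_intros def_funD[OF assms], auto)

lemma func_lam: assumes "def_fun F" "\<And>x. x \<in> ext a ==> F x \<in> ext b" shows "func (lam a F) a b"
  using assms(2) unfolding func_def ext_lam[OF assms(1)] by auto

lemma func_lam_img: assumes "def_fun F" shows "func (lam a F) a (img F a)"
  by (rule func_lam[OF assms]) (simp add: ext_img[OF assms])

lemma ap_lam: assumes "def_fun F" "x \<in> ext a" shows "lam a F $ x = F x"
  by (rule ap_equality) (use assms(2) in \<open>auto simp: ext_lam[OF assms(1)]\<close>)

lemma func_codomain: assumes "func f a b" "\<And>x. x \<in> ext a ==> f $ x \<in> ext c" shows "func f a c"
  using assms(2) func_opair_iff[OF assms(1)] ext_func[OF assms(1)] unfolding func_def by auto

definition dom :: "'a => 'a" where "dom f = coll {x. \<exists>y. opair x y \<in> ext f}"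
lemma def_fun_dom[THEN def_funD, def_intros]: "def_fun dom"
  by (intro def_funI, unfold dom_def, intro def_intros)
lemma func_dom: assumes "func f a b" shows "dom f = a"
proof -
  have "{x. \<exists>y. opair x y \<in> ext f} = ext a" using func_opair_iff[OF assms] by auto
  then show ?thesis by (simp add: dom_def)
qed

lemma ext_restr: "ext (restr f a) = {p \<in> ext f. \<exists>x\<in>ext a. \<exists>y. p = opair x y}"
  unfolding restr_def by (rule ext_coll, rule is_set_sep) (intro def_intros)
lemma def_term_restr[THEN def_fun2D, def_intros]: "def_fun2 restr"
  by (intro def_fun2I, unfold restr_def Collect_conj_eq[symmetric] mem_Collect_eq, intro def_intros)
lemma func_restr: assumes "func f a b" "ext c \<subseteq> ext a" shows "func (restr f c) c b"
  using assms unfolding func_def ext_restr by (auto simp: subset_iff)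
lemma ap_restr: assumes "x \<in> ext c" shows "restr f c $ x = f $ x"
proof -
  have "{z. \<exists>y. opair x y \<in> ext (restr f c) \<and> z \<in> ext y} = {z. \<exists>y. opair x y \<in> ext f \<and> z \<in> ext y}"
    using assms unfolding ext_restr by auto
  then show ?thesis by (simp add: ap_def)
qed

end
context zf_model
begin

section \<open>Ordinals and recursion\<close>

definition descr :: "('a => bool) => 'a" where "descr P = coll {m. \<exists>n. P n \<and> m \<in> ext n}"

lemma descr_equality: assumes "P n" "\<And>k. P k ==> k = n" shows "descr P = n"
proof -
  have "{m. \<exists>n. P n \<and> m \<in> ext n} = ext n" using assms by blast
  then show ?thesis by (simp add: descr_def)
qed

lemma def_term_descr[def_intros]:
  assumes "definable (%e. Q (%n. e (Suc n)) (e 0))" shows "def_term (%e. descr (Q e))"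
  unfolding descr_def
  by (intro def_term_coll definable_ex definable_conj definable_weaken[OF assms inj_Suc] def_intros)

lemma mem_minimal: assumes "ext a \<noteq> {}" shows "\<exists>x\<in>ext a. ext x \<inter> ext a = {}"
  using foundation[of a] assms by (auto simp: ext_def)

lemma mem_irrefl[simp]: "x \<notin> ext x"
  using mem_minimal[of "upair x x"] by auto
lemma mem_asym: "x \<in> ext y ==> y \<notin> ext x"
  using mem_minimal[of "upair x y"] by auto
lemma definable_transitive[THEN def_predD, def_intros]: "def_pred transitive"
  by (intro def_predI, unfold transitive_def, intro def_intros)
lemma definable_ordinal[THEN def_predD, def_intros]: "def_pred ordinal"
  by (intro def_predI, unfold ordinal_def, intro def_intros)
lemma definable_limit[THEN def_predD, def_intros]: "def_pred limit"
  by (intro def_predI, unfold limit_def, intro def_intros)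

lemma ordinal_mem: "ordinal a ==> x \<in> ext a ==> ordinal x"
  unfolding ordinal_def transitive_def by blast
lemma ordinal_trans: "ordinal a ==> x \<in> ext a ==> y \<in> ext x ==> y \<in> ext a"
  unfolding ordinal_def transitive_def by blast
lemma ordinal_subset: "ordinal a ==> x \<in> ext a ==> ext x \<subseteq> ext a"
  using ordinal_trans by blast

lemma ordinal_least:
  assumes "def_pred P" "ordinal a" "P a"
  obtains b where "ordinal b" "P b" "\<And>c. c \<in> ext b ==> \<not> P c"
proof (cases "\<exists>c\<in>ext a. P c")
  case False
  then show ?thesis using assms that by blast
next
  case True
  have below: "ext (sep a P) = {x \<in> ext a. P x}" by (rule ext_sep) fact
  then have "ext (sep a P) \<noteq> {}" using True by auto
  from mem_minimal[OF this] obtain x where x: "x \<in> ext a" "P x" "ext x \<inter> ext (sep a P) = {}"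
    unfolding below by blast
  then have "\<not> P c" if "c \<in> ext x" for c
    using that below ordinal_trans[OF assms(2)] by auto
  then show ?thesis using that x ordinal_mem[OF assms(2)] by blast
qed

lemma ordinal_induct: assumes "ordinal a" "def_pred P"
    "\<And>b. ordinal b ==> (\<And>c. c \<in> ext b ==> P c) ==> P b" shows "P a"
proof (rule ccontr)
  assume n: "\<not> P a"
  have "def_pred (%x. \<not> P x)" by (intro def_intros def_predD[OF assms(2)])
  from ordinal_least[OF this assms(1) n] obtain b where "ordinal b" "\<not> P b" "\<And>c. c \<in> ext b ==> P c" by metis
  then show False using assms(3) by blast
qed

lemma ordinal_linear:
  assumes "ordinal a" "ordinal b"
  shows "a \<in> ext b \<or> a = b \<or> b \<in> ext a"
proof (rule ccontr)
  assume incomparable: "\<not> ?thesis"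
  let ?C = "%a b. a \<in> ext b \<or> a = b \<or> b \<in> ext a"
  have definable: "def_pred (%a. \<exists>b. ordinal b \<and> \<not> ?C a b)" by (intro def_intros)
  obtain a' where a': "ordinal a'" "\<exists>b. ordinal b \<and> \<not> ?C a' b"
    "\<And>c. c \<in> ext a' ==> \<not> (\<exists>b. ordinal b \<and> \<not> ?C c b)"
    by (rule ordinal_least[OF definable assms(1)]) (use incomparable assms(2) in blast)+
  have "def_pred (%b. \<not> ?C a' b)" by (intro def_intros)
  from ordinal_least[OF this] a'(2)
  obtain b' where b': "ordinal b'" "\<not> ?C a' b'" "\<And>c. c \<in> ext b' ==> ?C a' c" by metis
  have "ext a' = ext b'"
  proof
    show "ext a' \<subseteq> ext b'" using a'(3) b'(1,2) ordinal_trans[OF a'(1)] by blast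
    show "ext b' \<subseteq> ext a'" using b' ordinal_trans[OF b'(1)] by blast
  qed
  then show False using b'(2) by simp
qed

definition least_ord :: "('a => bool) => 'a" where
  "least_ord P = descr (%a. ordinal a \<and> P a \<and> (\<forall>b\<in>ext a. \<not> P b))"
lemma least_ordI:
  assumes "def_pred P" "ordinal a" "P a"
  shows "ordinal (least_ord P)" "P (least_ord P)" "\<And>b. b \<in> ext (least_ord P) ==> \<not> P b"
proof -
  obtain c where c: "ordinal c" "P c" "\<And>b. b \<in> ext c ==> \<not> P b"
    by (rule ordinal_least[OF assms], rule that)
  have "least_ord P = c" unfolding least_ord_def
    by (rule descr_equality) (use c ordinal_linear in blast)+
  then show "ordinal (least_ord P)" "P (least_ord P)" "\<And>b. b \<in> ext (least_ord P) ==> \<not> P b"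
    using c by simp_all
qed

lemma def_term_least_ord[def_intros]:
  assumes "definable (%e. Q (%n. e (Suc n)) (e 0))"
  shows "def_term (%e. least_ord (Q e))"
  unfolding least_ord_def
  by (intro def_term_descr definable_ball definable_conj definable_neg
    definable_weaken[OF assms inj_Suc] assms def_intros)

lemma ordinal_subset_iff: assumes "ordinal a" "ordinal b" shows "ext a \<subseteq> ext b \<longleftrightarrow> a \<in> ext b \<or> a = b"
  using ordinal_linear[OF assms] ordinal_subset[OF assms(2)] mem_irrefl by blast

lemma ordinal_empty[simp]: "ordinal empty" by (simp add: ordinal_def transitive_def)
lemma ordinal_succ[simp]: "ordinal a ==> ordinal (succ a)"
  by (auto simp: ordinal_def transitive_def)
lemma ordinal_bigunion: assumes "\<And>x. x \<in> ext A ==> ordinal x" shows "ordinal (bigunion A)"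
proof -
  have "transitive (bigunion A)"
    unfolding transitive_def ext_bigunion using ordinal_trans[OF assms] by blast
  moreover have "transitive x" if "x \<in> ext (bigunion A)" for x
    using that ordinal_mem[OF assms] unfolding ext_bigunion ordinal_def by blast
  ultimately show ?thesis unfolding ordinal_def by blast
qed

lemma ordinal_bound: assumes "\<And>x. x \<in> ext A ==> ordinal x"
  shows "ordinal (succ (bigunion A)) \<and> (\<forall>x\<in>ext A. x \<in> ext (succ (bigunion A)))"
proof -
  have ordinal_union: "ordinal (bigunion A)" by (rule ordinal_bigunion) fact
  have "x \<in> ext (succ (bigunion A))" if "x \<in> ext A" for x
  proof -
    have "ext x \<subseteq> ext (bigunion A)" using that by auto
    then show ?thesis using ordinal_subset_iff[OF assms[OF that] ordinal_union] by auto
  qed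
  then show ?thesis using ordinal_union by auto
qed

lemma succ_eq_iff[simp]: "succ a = succ b \<longleftrightarrow> a = b"
proof
  assume "succ a = succ b"
  then have "insert a (ext a) = insert b (ext b)" by (metis ext_succ)
  then show "a = b" using mem_asym by (metis insertE insertI1)
qed simp

lemma succ_neq_empty[simp]: "succ a \<noteq> empty" "empty \<noteq> succ a"
  by (metis ext_succ ext_empty insert_not_empty)+
lemma bigunion_succ: "transitive a ==> bigunion (succ a) = a"
  by (rule ext_inject) (auto simp: transitive_def)

lemma inductive_contains_finite_ordinal:
  assumes "empty \<in> ext w" "\<And>x. x \<in> ext w ==> succ x \<in> ext w"
    and "ordinal n" "\<forall>m\<in>ext (succ n). \<not> limit m"
  shows "n \<in> ext w"
proof -
  have "(\<forall>m\<in>ext (succ n). \<not> limit m) --> n \<in> ext w"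
  proof (rule ordinal_induct[OF assms(3)])
    show "def_pred (%n. (\<forall>m\<in>ext (succ n). \<not> limit m) --> n \<in> ext w)" by (intro def_intros)
    fix b assume b: "ordinal b"
      "\<And>c. c \<in> ext b ==> (\<forall>m\<in>ext (succ c). \<not> limit m) --> c \<in> ext w"
    show "(\<forall>m\<in>ext (succ b). \<not> limit m) --> b \<in> ext w"
    proof
      assume no_limit: "\<forall>m\<in>ext (succ b). \<not> limit m"
      then consider "b = empty" | c where "b = succ c" using b(1) unfolding limit_def by auto
      then show "b \<in> ext w"
        by cases (use assms(1,2) b(2) no_limit in auto)
    qed
  qed
  then show ?thesis using assms(4) by blast
qed

lemma is_set_omega: "is_set {n. ordinal n \<and> (\<forall>m\<in>ext (succ n). \<not> limit m)}"
proof -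
  obtain w where w: "\<exists>z. z \<in>\<^sub>M w \<and> (\<forall>x. \<not> x \<in>\<^sub>M z)"
    "\<And>x. x \<in>\<^sub>M w ==> \<exists>y. y \<in>\<^sub>M w \<and> (\<forall>z. z \<in>\<^sub>M y \<longleftrightarrow> z \<in>\<^sub>M x \<or> z = x)"
    using infinity by blast
  obtain z where z: "z \<in> ext w" "ext z = {}" using w(1) unfolding ext_def by blast
  then have "empty \<in> ext w" by simp
  moreover have "succ x \<in> ext w" if x: "x \<in> ext w" for x
  proof -
    obtain y where y: "y \<in> ext w" "\<forall>z. z \<in>\<^sub>M y \<longleftrightarrow> z \<in>\<^sub>M x \<or> z = x"
      using w(2)[of x] x unfolding ext_def by blast
    have "ext y = ext (succ x)" unfolding ext_succ using y(2) unfolding ext_def by blast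
    then have "y = succ x" by (rule ext_inject)
    then show ?thesis using y(1) by simp
  qed
  ultimately have "{n. ordinal n \<and> (\<forall>m\<in>ext (succ n). \<not> limit m)} \<subseteq> ext w"
    using inductive_contains_finite_ordinal by blast
  then show ?thesis by (rule is_set_subset) (simp only: mem_Collect_eq, intro def_intros)
qed

lemma ext_omega: "ext omega = {n. ordinal n \<and> (\<forall>m\<in>ext (succ n). \<not> limit m)}"
  unfolding omega_def by (rule ext_coll[OF is_set_omega])

abbreviation nats where "nats \<equiv> ext omega"
lemma empty_in_omega[simp]: "empty \<in> nats"
  unfolding ext_omega by (auto simp: limit_def)
lemma succ_in_omega[simp]: "n \<in> nats ==> succ n \<in> nats"
  unfolding ext_omega by (auto simp: limit_def)
lemma ordinal_if_in_omega: "n \<in> nats ==> ordinal n" unfolding ext_omega by simp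
lemma omega_trans: "n \<in> nats ==> m \<in> ext n ==> m \<in> nats"
  unfolding ext_omega using ordinal_mem ordinal_trans by auto
lemma ordinal_omega[simp]: "ordinal omega"
  unfolding ordinal_def transitive_def using omega_trans ordinal_if_in_omega ordinal_trans by blast
lemma omega_cases: assumes "n \<in> nats" obtains "n = empty" | m where "m \<in> nats" "n = succ m"
proof -
  have "n = empty \<or> (\<exists>c. n = succ c)" using assms unfolding ext_omega limit_def by auto
  then show ?thesis
  proof
    assume "\<exists>c. n = succ c"
    then obtain c where c: "n = succ c" by blast
    then have "c \<in> nats" using omega_trans[OF assms, of c] by simp
    then show ?thesis using that(2) c by blast
  qed (rule that(1))
qed

lemma omega_induct: assumes "n \<in> nats" "def_pred P" "P empty"
  "\<And>n. n \<in> nats ==> P n ==> P (succ n)" shows "P n"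
proof -
  have definable: "def_pred (%x. x \<in> nats --> P x)" by (intro def_intros def_predD[OF assms(2)])
  have "n \<in> nats --> P n"
  proof (rule ordinal_induct[OF ordinal_if_in_omega[OF assms(1)] definable])
    fix b assume b: "ordinal b" "\<And>c. c \<in> ext b ==> c \<in> nats --> P c"
    show "b \<in> nats --> P b"
    proof
      assume "b \<in> nats"
      then show "P b" by (cases rule: omega_cases) (use assms(3,4) b(2) in auto)
    qed
  qed
  then show ?thesis using assms(1) by blast
qed

definition least_nat :: "('a => bool) => 'a" where
  "least_nat P = least_ord (%n. n \<in> nats \<and> P n)"
lemma least_natI:
  assumes "def_pred P" "n \<in> nats" "P n"
  shows "least_nat P \<in> nats" "P (least_nat P)" "\<And>k. k \<in> ext (least_nat P) ==> \<not> P k"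
proof -
  have "def_pred (%n. n \<in> nats \<and> P n)" by (intro def_intros def_predD[OF assms(1)])
  note least = least_ordI[OF this ordinal_if_in_omega[OF assms(2)], folded least_nat_def]
  show "least_nat P \<in> nats" "P (least_nat P)" "\<And>k. k \<in> ext (least_nat P) ==> \<not> P k"
    using least assms(2,3) omega_trans by blast+
qed

lemma least_nat_in_omega:
  assumes "def_pred P"
  shows "least_nat P \<in> nats"
proof (cases "\<exists>n\<in>nats. P n")
  case True
  then show ?thesis using least_natI(1)[OF assms] by blast
next
  case False
  then have "least_nat P = coll {}"
    unfolding least_nat_def least_ord_def descr_def by (intro arg_cong[of _ _ coll]) blast
  then show ?thesis unfolding empty_def[symmetric] by simp
qed

lemma def_term_least_nat[def_intros]: "definable (%e. Q (%n. e (Suc n)) (e 0)) ==>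
    def_term (%e. least_nat (Q e))"
  unfolding least_nat_def by (intro def_term_least_ord definable_conj def_intros)

lemma omega_linear: assumes "n \<in> nats" "m \<in> nats"
  shows "n \<in> ext m \<or> n = m \<or> m \<in> ext n"
  using ordinal_linear ordinal_if_in_omega assms by blast

definition is_rec_approx :: "('a => 'a) => 'a => 'a => bool" where
  "is_rec_approx H f a \<longleftrightarrow> ordinal a \<and> (\<exists>c. func f a c) \<and> (\<forall>b\<in>ext a. f $ b = H (restr f b))"
definition ord_rec :: "('a => 'a) => 'a => 'a" where
  "ord_rec H a = H (descr (%f. is_rec_approx H f a))"

lemma def_term_app: assumes "def_term (%e. H (%n. e (Suc n)) (e 0))" "inj r" "def_term t"
  shows "def_term (%e. H (%n. e (r n)) (t e))"
proof -
  have "inj (case_nat 1 (case_nat 0 (%n. Suc (Suc (r n)))))"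
    by (rule injI) (auto split: nat.splits dest: injD[OF assms(2)])
  from definable_rename[OF this assms(1)[unfolded def_term_def]]
  have "definable (%e. e 1 = H (%n. e (Suc (Suc (r n)))) (e 0))" by simp
  then show ?thesis unfolding def_term_def
    using definable_subst[where Q="%y e. e 0 = H (%n. e (Suc (r n))) y", OF _ def_term_shift[OF assms(3)]]
    by simp
qed

lemma def_term_app2:
  assumes "def_term (%e. H (%n. e (Suc (Suc n))) (e 1) (e 0))" "inj r" "def_term t" "def_term u"
  shows "def_term (%e. H (%n. e (r n)) (t e) (u e))"
proof -
  let ?H = "%e y. H (%n. e (Suc n)) (e 0) y"
  have lifted: "def_term (%e. ?H (%n. e (Suc n)) (e 0))" using assms(1) by simp
  have "inj (case_nat 0 (%n. Suc (r n)))"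
    by (rule injI) (auto split: nat.splits dest: injD[OF assms(2)])
  from def_term_app[where H="?H", OF lifted this def_term_shift[OF assms(4)]]
  have "def_term (%e. H (%n. e (Suc (r n))) (e 0) (u (%n. e (Suc n))))" by simp
  then show ?thesis
    using def_term_app[where H="%e y. H (%n. e (r n)) y (u e)" and r=id, OF _ inj_on_id assms(3)] by simp
qed

lemma def_term_ord_rec[def_intros]: assumes H: "def_term (%e. H (%n. e (Suc n)) (e 0))" and u: "def_term u"
  shows "def_term (%e. ord_rec (H e) (u e))"
proof -
  have "definable (%e. is_rec_approx (H (%n. e (Suc (Suc n)))) (e 0) (e (Suc 0)))"
    unfolding is_rec_approx_def
    by (intro def_intros def_term_app[OF H, where r="%n. Suc (Suc (Suc n))"]) (auto simp: inj_def)
  then have "def_term (%e. ord_rec (H (%n. e (Suc n))) (e 0))"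
    unfolding ord_rec_def by (intro def_term_app[OF H, where r=Suc] def_term_descr) auto
  from def_term_app[where H="%e. ord_rec (H e)" and r=id, OF this _ u] show ?thesis by simp
qed

lemma is_rec_approx_unique:
  assumes "is_rec_approx H f a" "is_rec_approx H g a'" "ext a \<subseteq> ext a'" "b \<in> ext a"
  shows "f $ b = g $ b"
proof -
  have ord_a: "ordinal a" using assms(1) is_rec_approx_def by blast
  have "b \<in> ext a --> f $ b = g $ b"
  proof (rule ordinal_induct[OF ordinal_mem[OF ord_a assms(4)]])
    show "def_pred (%x. x \<in> ext a --> f $ x = g $ x)" by (intro def_intros)
    fix b assume b: "ordinal b" "\<And>c. c \<in> ext b ==> c \<in> ext a --> f $ c = g $ c"
    show "b \<in> ext a --> f $ b = g $ b"
    proof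
      assume mem: "b \<in> ext a"
      then have sub: "ext b \<subseteq> ext a" "ext b \<subseteq> ext a'" using ordinal_subset[OF ord_a] assms(3) by blast+
      obtain c d where "func f a c" "func g a' d" using assms(1,2) is_rec_approx_def by blast
      from func_restr[OF this(1) sub(1)] func_restr[OF this(2) sub(2)]
      have "restr f b = restr g b"
        by (rule func_ext) (use b(2) sub in \<open>auto simp: ap_restr\<close>)
      then show "f $ b = g $ b" using assms(1,2,3) mem unfolding is_rec_approx_def by auto
    qed
  qed
  then show ?thesis using assms(4) by blast
qed

lemma is_rec_approx_eq: assumes "is_rec_approx H f a" "is_rec_approx H g a" shows "f = g"
proof -
  obtain c d where "func f a c" "func g a d" using assms unfolding is_rec_approx_def by blast
  then show ?thesis by (rule func_ext) (rule is_rec_approx_unique[OF assms], auto)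
qed

lemma is_rec_approx_lam:
  assumes H: "def_fun H" and "ordinal a"
  shows "is_rec_approx H (lam a (ord_rec H)) a"
proof (rule ordinal_induct[OF assms(2)])
  have rec: "def_fun (ord_rec H)" by (intro def_intros def_funD[OF H])
  show "def_pred (%a. is_rec_approx H (lam a (ord_rec H)) a)" unfolding is_rec_approx_def
    by (intro def_intros def_funD[OF H] def_funD[OF rec])
  fix a assume a: "ordinal a" "\<And>b. b \<in> ext a ==> is_rec_approx H (lam b (ord_rec H)) b"
  have f: "func (lam a (ord_rec H)) a (img (ord_rec H) a)" by (rule func_lam_img[OF rec])
  have "lam a (ord_rec H) $ b = H (restr (lam a (ord_rec H)) b)" if b: "b \<in> ext a" for b
  proof -
    have sub: "ext b \<subseteq> ext a" using ordinal_subset a b by blast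
    have "descr (%f. is_rec_approx H f b) = lam b (ord_rec H)"
      by (rule descr_equality) (use a(2)[OF b] is_rec_approx_eq in blast)+
    then have "ord_rec H b = H (lam b (ord_rec H))" by (simp add: ord_rec_def)
    moreover have "restr (lam a (ord_rec H)) b = lam b (ord_rec H)"
      by (rule func_ext[OF func_restr[OF f sub] func_lam_img[OF rec]])
        (use sub in \<open>auto simp: ap_restr ap_lam[OF rec]\<close>)
    ultimately show ?thesis using b by (simp add: ap_lam[OF rec])
  qed
  then show "is_rec_approx H (lam a (ord_rec H)) a" unfolding is_rec_approx_def using a(1) f by blast
qed

lemma ord_rec_unfold:
  assumes "def_fun H" "ordinal a"
  shows "ord_rec H a = H (lam a (ord_rec H))"
proof -
  have "descr (%f. is_rec_approx H f a) = lam a (ord_rec H)"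
    by (rule descr_equality) (use is_rec_approx_lam[OF assms] is_rec_approx_eq in blast)+
  then show ?thesis by (simp add: ord_rec_def)
qed

definition nat_rec :: "'a => ('a => 'a => 'a) => 'a => 'a" where
  "nat_rec a G n = ord_rec (%f. if dom f = empty then a else G (bigunion (dom f)) (f $ bigunion (dom f))) n"

lemma def_term_nat_rec[def_intros]:
  assumes "def_term a" "def_term (%e. G (%n. e (Suc (Suc n))) (e 1) (e 0))" "def_term u"
  shows "def_term (%e. nat_rec (a e) (G e) (u e))"
  unfolding nat_rec_def
  by (intro def_term_ord_rec[where H="%e f. if dom f = empty
      then a e else G e (bigunion (dom f)) (f $ bigunion (dom f))"]
    def_term_if def_term_shift[OF assms(1)] def_term_app2[OF assms(2), where r=Suc] assms(3))
      (intro def_intros | simp)+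

lemma nat_rec_simps:
  assumes G: "def_fun2 G"
  shows nat_rec_empty: "nat_rec a G empty = a"
    and nat_rec_succ: "n \<in> nats ==> nat_rec a G (succ n) = G n (nat_rec a G n)"
proof -
  let ?H = "%f. if dom f = empty then a else G (bigunion (dom f)) (f $ bigunion (dom f))"
  have step: "def_fun ?H" and rec: "def_fun (ord_rec ?H)" by (intro def_intros def_fun2D[OF G])+
  have dom_lam: "dom (lam b (ord_rec ?H)) = b" for b by (rule func_dom[OF func_lam_img[OF rec]])
  show "nat_rec a G empty = a" unfolding nat_rec_def by (subst ord_rec_unfold[OF step]) (auto simp: dom_lam)
  assume n: "n \<in> nats"
  then have "bigunion (succ n) = n" using ordinal_if_in_omega ordinal_def by (intro bigunion_succ) blast
  then show "nat_rec a G (succ n) = G n (nat_rec a G n)" unfolding nat_rec_def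
    using n ordinal_if_in_omega by (subst ord_rec_unfold[OF step]) (auto simp: dom_lam ap_lam[OF rec])
qed

end

context zf_model
begin

section \<open>Natural numbers and countable sets\<close>

definition addn :: "'a => 'a => 'a" where "addn m n = nat_rec m (%_ x. succ x) n"
lemma def_term_addn[def_intros]: assumes "def_term t" "def_term u" shows "def_term (%e. addn (t e) (u e))"
  unfolding addn_def by (intro def_intros assms)
lemma def_fun2_succ: "def_fun2 (%_ x. succ x)" by (intro def_intros)
lemma addn_empty[simp]: "addn m empty = m" unfolding addn_def by (rule nat_rec_empty[OF def_fun2_succ])
lemma addn_succ[simp]: "n \<in> nats ==> addn m (succ n) = succ (addn m n)"
  unfolding addn_def by (rule nat_rec_succ[OF def_fun2_succ])
lemma addn_in_omega[simp]: assumes "m \<in> nats" "n \<in> nats" shows "addn m n \<in> nats"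
  by (rule omega_induct[OF assms(2), where P="%n. addn m n \<in> nats"]) (intro def_intros, use assms in auto)
lemma addn_empty_left[simp]: assumes "n \<in> nats" shows "addn empty n = n"
  by (rule omega_induct[OF assms, where P="%n. addn empty n = n"]) (intro def_intros, auto)
lemma addn_succ_left[simp]: assumes "n \<in> nats" shows "addn (succ m) n = succ (addn m n)"
  by (rule omega_induct[OF assms, where P="%n. addn (succ m) n = succ (addn m n)"]) (intro def_intros, auto)
lemma addn_mono: assumes "j \<in> nats" "i \<in> ext j" shows "addn k i \<in> ext (addn k j)"
proof -
  have "\<forall>i\<in>ext j. addn k i \<in> ext (addn k j)"
    by (rule omega_induct[OF assms(1), where P="%j. \<forall>i\<in>ext j. addn k i \<in> ext (addn k j)"])
      (intro def_intros, auto)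
  then show ?thesis using assms(2) by blast
qed

lemma addn_superset: assumes "i \<in> nats" shows "ext k \<subseteq> ext (addn k i)"
  by (rule omega_induct[OF assms, where P="%i. ext k \<subseteq> ext (addn k i)"]) (intro def_intros, auto)
lemma addn_inj: assumes "i \<in> nats" "j \<in> nats" "addn k i = addn k j" shows "i = j"
  using omega_linear[OF assms(1,2)] addn_mono[OF assms(2), of i k] addn_mono[OF assms(1), of j k] assms(3)
  by auto

definition pfst :: "'a => 'a" where "pfst p = descr (%a. \<exists>b. p = opair a b)"
definition psnd :: "'a => 'a" where "psnd p = descr (%b. \<exists>a. p = opair a b)"
lemma pfst_opair[simp]: "pfst (opair a b) = a" unfolding pfst_def by (rule descr_equality) auto
lemma psnd_opair[simp]: "psnd (opair a b) = b" unfolding psnd_def by (rule descr_equality) auto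
lemma def_term_pfst[THEN def_funD, def_intros]: "def_fun pfst"
  by (intro def_funI, unfold pfst_def, intro def_intros)
lemma def_term_psnd[THEN def_funD, def_intros]: "def_fun psnd"
  by (intro def_funI, unfold psnd_def, intro def_intros)

definition next_pair :: "'a => 'a" where
  "next_pair p = (if psnd p = empty then opair empty (succ (pfst p))
    else opair (succ (pfst p)) (bigunion (psnd p)))"
lemma def_fun_next_pair[THEN def_funD, def_intros]: "def_fun next_pair"
  by (intro def_funI, unfold next_pair_def, intro def_intros)

definition pair_at :: "'a => 'a" where
  "pair_at n = nat_rec (opair empty empty) (%_ p. next_pair p) n"
lemma def_fun_pair_at[THEN def_funD, def_intros]: "def_fun pair_at"
  by (intro def_funI, unfold pair_at_def, intro def_intros)
lemma pair_at_empty: "pair_at empty = opair empty empty"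
  unfolding pair_at_def by (rule nat_rec_empty) (intro def_intros)
lemma pair_at_succ: "n \<in> nats ==> pair_at (succ n) = next_pair (pair_at n)"
  unfolding pair_at_def by (rule nat_rec_succ) (intro def_intros)

lemma omega_bigunion_succ: "n \<in> nats ==> bigunion (succ n) = n"
  using ordinal_if_in_omega ordinal_def by (intro bigunion_succ) blast

lemma pair_at_in:
  assumes "n \<in> nats"
  shows "pair_at n \<in> ext (cprod omega omega)"
proof (rule omega_induct[OF assms])
  show "def_pred (%n. pair_at n \<in> ext (cprod omega omega))" by (intro def_intros)
  show "pair_at empty \<in> ext (cprod omega omega)" by (simp add: pair_at_empty)
  fix n assume n: "n \<in> nats" "pair_at n \<in> ext (cprod omega omega)"
  then obtain a b where ab: "pair_at n = opair a b" "a \<in> nats" "b \<in> nats" by auto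
  from ab(3) show "pair_at (succ n) \<in> ext (cprod omega omega)" unfolding pair_at_succ[OF n(1)] ab(1)
    by (cases rule: omega_cases) (use ab in \<open>auto simp: next_pair_def omega_bigunion_succ\<close>)
qed

definition listed :: "'a => 'a => bool" where
  "listed a b \<longleftrightarrow> (\<exists>n\<in>nats. pair_at n = opair a b)"
lemma def_pred2_listed[THEN def_pred2D, def_intros]: "def_pred2 listed"
  by (intro def_pred2I, unfold listed_def, intro def_intros)
lemma listed_empty: "listed empty empty"
  unfolding listed_def using pair_at_empty empty_in_omega by blast
lemma listed_next:
  "listed a (succ b) ==> b \<in> nats ==> listed (succ a) b"
  "listed a empty ==> listed empty (succ a)"
  unfolding listed_def using pair_at_succ succ_in_omega by (force simp: next_pair_def omega_bigunion_succ)+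

lemma listed_diagonal:
  assumes "k \<in> nats" "a \<in> nats" "listed a k"
  shows "listed (addn a k) empty"
proof -
  have "\<forall>a\<in>nats. listed a k --> listed (addn a k) empty"
  proof (rule omega_induct[OF assms(1)])
    show "def_pred (%k. \<forall>a\<in>nats. listed a k --> listed (addn a k) empty)" by (intro def_intros)
    fix k assume k: "k \<in> nats" "\<forall>a\<in>nats. listed a k --> listed (addn a k) empty"
    then show "\<forall>a\<in>nats. listed a (succ k) --> listed (addn a (succ k)) empty"
      using listed_next(1)[OF _ k(1)] by (metis addn_succ addn_succ_left succ_in_omega)
  qed simp
  then show ?thesis using assms(2,3) by blast
qed

lemma listed_left:
  assumes "m \<in> nats"
  shows "listed m empty"
proof (rule omega_induct[OF assms])
  show "def_pred (%m. listed m empty)" by (intro def_intros)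
  fix m assume m: "m \<in> nats" "listed m empty"
  from listed_diagonal[OF succ_in_omega[OF m(1)] empty_in_omega listed_next(2)[OF m(2)]]
  show "listed (succ m) empty" using m(1) by (simp only: addn_empty_left[OF succ_in_omega])
qed (rule listed_empty)

lemma listed_all:
  assumes "m \<in> nats" "n \<in> nats"
  shows "listed m n"
proof -
  have "\<forall>n\<in>nats. listed m n"
  proof (rule omega_induct[OF assms(1)])
    show "def_pred (%m. \<forall>n\<in>nats. listed m n)" by (intro def_intros)
    show "\<forall>n\<in>nats. listed empty n"
      using omega_cases listed_empty listed_next(2) listed_left by metis
    show "\<And>m. m \<in> nats ==> \<forall>n\<in>nats. listed m n ==> \<forall>n\<in>nats. listed (succ m) n"
      using listed_next(1) succ_in_omega by blast
  qed
  then show ?thesis using assms(2) by blast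
qed

definition nat_fst :: "'a => 'a" where "nat_fst j = pfst (pair_at j)"
definition nat_snd :: "'a => 'a" where "nat_snd j = psnd (pair_at j)"
definition nat_pair :: "'a => 'a => 'a" where "nat_pair i m = least_nat (%j. pair_at j = opair i m)"
lemma def_fun_nat_fst[THEN def_funD, def_intros]: "def_fun nat_fst"
  by (intro def_funI, unfold nat_fst_def, intro def_intros)
lemma def_fun_nat_snd[THEN def_funD, def_intros]: "def_fun nat_snd"
  by (intro def_funI, unfold nat_snd_def, intro def_intros)
lemma def_fun2_nat_pair[THEN def_fun2D, def_intros]: "def_fun2 nat_pair"
  by (intro def_fun2I, unfold nat_pair_def, intro def_intros)
lemma nat_fst_snd_in_omega: "j \<in> nats ==> nat_fst j \<in> nats" "j \<in> nats ==> nat_snd j \<in> nats"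
  using pair_at_in[of j] unfolding nat_fst_def nat_snd_def by auto
lemma nat_pair_props:
  assumes "i \<in> nats" "m \<in> nats"
  shows "nat_pair i m \<in> nats" "nat_fst (nat_pair i m) = i" "nat_snd (nat_pair i m) = m"
proof -
  obtain j where j: "j \<in> nats" "pair_at j = opair i m"
    using listed_all[OF assms] unfolding listed_def by blast
  have "def_pred (%j. pair_at j = opair i m)" by (intro def_intros)
  from least_natI(1,2)[OF this j] show "nat_pair i m \<in> nats" "nat_fst (nat_pair i m) = i"
    "nat_snd (nat_pair i m) = m"
    unfolding nat_pair_def nat_fst_def nat_snd_def by auto
qed

definition enum :: "'a => 'a => bool" where
  "enum e X \<longleftrightarrow> func e omega X \<and> (\<forall>x\<in>ext X. \<exists>n\<in>nats. e $ n = x)"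
definition enumerable :: "'a => bool" where "enumerable X \<longleftrightarrow> (\<exists>e. enum e X)"
lemma def_pred2_enum[THEN def_pred2D, def_intros]: "def_pred2 enum"
  by (intro def_pred2I, unfold enum_def, intro def_intros)
lemma def_pred_enumerable[THEN def_predD, def_intros]: "def_pred enumerable"
  by (intro def_predI, unfold enumerable_def, intro def_intros)

lemma enum_in: "enum e X ==> n \<in> nats ==> e $ n \<in> ext X"
  unfolding enum_def using ap_in_codomain by blast
lemma enum_surj:
  assumes "enum e X" "x \<in> ext X"
  obtains n where "n \<in> nats" "e $ n = x"
  using assms that unfolding enum_def by blast
lemma enum_lam:
  assumes "def_fun F" "\<And>n. n \<in> nats ==> F n \<in> ext X"
    and "\<And>x. x \<in> ext X ==> \<exists>n\<in>nats. F n = x"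
  shows "enum (lam omega F) X"
  unfolding enum_def using func_lam[OF assms(1), of omega X] assms(2,3) ap_lam[OF assms(1)] by metis

lemma enumerableI:
  assumes "def_fun F" "\<And>n. n \<in> nats ==> F n \<in> ext X"
    and "\<And>x. x \<in> ext X ==> \<exists>n\<in>nats. F n = x"
  shows "enumerable X"
  unfolding enumerable_def using enum_lam[OF assms] by blast
lemma enumerableE:
  assumes "enumerable X"
  obtains e where "enum e X"
  using assms unfolding enumerable_def by blast

lemma enumerable_omega: "enumerable omega" by (rule enumerableI[where F="%x. x"]) (intro def_intros, auto)
lemma enumerable_singleton: "enumerable (upair D D)"
  by (rule enumerableI[where F="%_. D"]) (intro def_intros, auto intro: empty_in_omega)
lemma enumerable_nonempty:
  assumes "enumerable X"
  obtains x where "x \<in> ext X"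
  using enumerableE[OF assms] enum_in empty_in_omega by metis

lemma enumerable_img:
  assumes "enumerable X" "def_fun F"
  shows "enumerable (img F X)"
proof -
  obtain e where e: "enum e X" by (rule enumerableE[OF assms(1)])
  show ?thesis
  proof (rule enumerableI[where F="%n. F (e $ n)"])
    show "def_fun (%n. F (e $ n))" by (intro def_intros def_funD[OF assms(2)])
  qed (use enum_in[OF e] enum_surj[OF e] in \<open>auto simp: ext_img[OF assms(2)], metis\<close>)
qed

lemma enumerable_if_surj:
  assumes "enumerable X" "def_fun F" "\<And>x. x \<in> ext X ==> F x \<in> ext Y" "\<And>y. y \<in> ext Y ==> \<exists>x\<in>ext X. F x = y"
  shows "enumerable Y"
proof -
  have "ext (img F X) = ext Y" unfolding ext_img[OF assms(2)] using assms(3,4) by blast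
  then have "img F X = Y" by (rule ext_inject)
  then show ?thesis using enumerable_img[OF assms(1,2)] by simp
qed

lemma enumerable_cprod:
  assumes "enumerable X" "enumerable Y"
  shows "enumerable (cprod X Y)"
proof -
  obtain d e where d: "enum d X" and e: "enum e Y" using enumerableE assms by metis
  show ?thesis
  proof (rule enumerableI[where F="%j. opair (d $ nat_fst j) (e $ nat_snd j)"])
    show "def_fun (%j. opair (d $ nat_fst j) (e $ nat_snd j))" by (intro def_intros)
    show "opair (d $ nat_fst n) (e $ nat_snd n) \<in> ext (cprod X Y)" if "n \<in> nats" for n
      using enum_in[OF d] enum_in[OF e] nat_fst_snd_in_omega[OF that] by simp
    fix x assume "x \<in> ext (cprod X Y)"
    then obtain a b where x: "x = opair a b" "a \<in> ext X" "b \<in> ext Y" by auto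
    obtain n m where "n \<in> nats" "d $ n = a" "m \<in> nats" "e $ m = b"
      using enum_surj[OF d x(2)] enum_surj[OF e x(3)] by metis
    then show "\<exists>n\<in>nats. opair (d $ nat_fst n) (e $ nat_snd n) = x"
      using nat_pair_props[of n m] x by (intro bexI[of _ "nat_pair n m"]) auto
  qed
qed

lemma enumerable_cup: assumes "enumerable X" "enumerable Y" shows "enumerable (cup X Y)"
proof -
  obtain x0 y0 where x0: "x0 \<in> ext X" "y0 \<in> ext Y" using assms enumerable_nonempty by metis
  show ?thesis
  proof (rule enumerable_if_surj[OF enumerable_cprod[OF enumerable_omega enumerable_cprod[OF assms]],
      where F="%p. if pfst p = empty then pfst (psnd p) else psnd (psnd p)"])
    show "def_fun (%p. if pfst p = empty then pfst (psnd p) else psnd (psnd p))" by (intro def_intros)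
    show "(if pfst p = empty then pfst (psnd p) else psnd (psnd p)) \<in> ext (cup X Y)"
      if "p \<in> ext (cprod omega (cprod X Y))" for p
      using that by auto
    fix z assume "z \<in> ext (cup X Y)"
    then consider "z \<in> ext X" | "z \<in> ext Y" by auto
    then show "\<exists>p\<in>ext (cprod omega (cprod X Y)). (if pfst p = empty then pfst (psnd p) else psnd (psnd p)) =
        z"
    proof cases
      case 1 then show ?thesis using x0 by (intro bexI[of _ "opair empty (opair z y0)"]) auto
    next
      case 2 then show ?thesis using x0 by (intro bexI[of _ "opair (succ empty) (opair x0 z)"]) auto
    qed
  qed
qed

lemma enumerable_if_inj:
  assumes "def_fun F" "enumerable Y" "x0 \<in> ext X" "\<And>x. x \<in> ext X ==> F x \<in> ext Y"
    "\<And>x y. x \<in> ext X ==> y \<in> ext X ==> F x = F y ==> x = y"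
  shows "enumerable X"
proof -
  define G where "G = (%y. if \<exists>x\<in>ext X. F x = y then descr (%x. x \<in> ext X \<and> F x = y) else x0)"
  have inverse: "G (F x) = x" if "x \<in> ext X" for x
    using that assms(5) descr_equality[of "%z. z \<in> ext X \<and> F z = F x" x] unfolding G_def by auto
  show ?thesis
  proof (rule enumerable_if_surj[OF assms(2)])
    show "def_fun G" unfolding G_def by (intro def_intros def_funD[OF assms(1)])
    show "G y \<in> ext X" for y
    proof (cases "\<exists>x\<in>ext X. F x = y")
      case True
      then show ?thesis using inverse by auto
    qed (simp add: G_def assms(3))
    show "\<exists>y\<in>ext Y. G y = x" if "x \<in> ext X" for x using assms(4) inverse that by blast
  qed
qed

lemma enumerable_if_countable: assumes "countable X" "x0 \<in> ext X" shows "enumerable X"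
proof -
  obtain f where f: "func f X omega" "inj_on (app f) (ext X)"
    using assms(1) unfolding countable_def injection_def by blast
  show ?thesis
  proof (rule enumerable_if_inj[where F="($) f", OF _ enumerable_omega assms(2)])
    show "def_fun (($) f)" by (intro def_intros)
    show "\<And>x. x \<in> ext X ==> f $ x \<in> nats" by (rule ap_in_codomain[OF f(1)])
    show "\<And>x y. x \<in> ext X ==> y \<in> ext X ==> f $ x = f $ y ==> x = y"
      using f(2) func_app[OF f(1)] unfolding inj_on_def by metis
  qed
qed

subsection \<open>Finite sequences\<close>

definition snoc :: "'a => 'a => 'a" where "snoc s a = cup s (upair (opair (dom s) a) (opair (dom s) a))"
lemma def_term_snoc[def_intros]: assumes "def_term t" "def_term u" shows "def_term (%e. snoc (t e) (u e))"
  unfolding snoc_def by (intro def_intros assms)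

lemma ext_fin_seqs: "ext (fin_seqs l) = {s. \<exists>n\<in>nats. func s n l}"
proof -
  have "{s. \<exists>n\<in>nats. func s n l} \<subseteq> ext (pow (cprod omega l))"
  proof
    fix s assume "s \<in> {s. \<exists>n\<in>nats. func s n l}"
    then obtain n where n: "n \<in> nats" "func s n l" by blast
    have "ext s \<subseteq> ext (cprod n l)" using n(2) unfolding func_def by blast
    also have "\<dots> \<subseteq> ext (cprod omega l)" unfolding ext_cprod using omega_trans[OF n(1)] by blast
    finally show "s \<in> ext (pow (cprod omega l))" by simp
  qed
  then have "is_set {s. \<exists>n\<in>nats. func s n l}"
    by (rule is_set_subset) (simp only: mem_Collect_eq, intro def_intros)
  then show ?thesis unfolding fin_seqs_def by (rule ext_coll)
qed

lemma def_fun_fin_seqs[THEN def_funD, def_intros]: "def_fun fin_seqs"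
  by (intro def_funI, unfold fin_seqs_def, intro def_intros)

lemma snoc_props: assumes "func s n l" "a \<in> ext l"
  shows func_snoc: "func (snoc s a) (succ n) l" and snoc_last: "snoc s a $ n = a"
    and ap_snoc: "i \<in> ext n ==> snoc s a $ i = s $ i" and restr_snoc: "restr (snoc s a) n = s"
    and subset_snoc: "ext s \<subseteq> ext (snoc s a)"
proof -
  have dom_s: "dom s = n" by (rule func_dom[OF assms(1)])
  have mem: "opair i y \<in> ext (snoc s a) \<longleftrightarrow> (i \<in> ext n \<and> y = s $ i) \<or> (i = n \<and> y = a)" for i y
    unfolding snoc_def dom_s using func_opair_iff[OF assms(1)] by auto
  have "ext (snoc s a) \<subseteq> ext (cprod (succ n) l)"
    unfolding snoc_def dom_s using assms unfolding func_def by auto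
  then show f: "func (snoc s a) (succ n) l" unfolding func_def mem by auto
  show "snoc s a $ n = a" by (rule ap_equality) (auto simp: mem)
  show old: "snoc s a $ i = s $ i" if "i \<in> ext n" for i
    using that by (intro ap_equality) (auto simp: mem)
  have "ext n \<subseteq> ext (succ n)" by auto
  from func_restr[OF f this] show "restr (snoc s a) n = s"
    by (rule func_ext[OF _ assms(1)]) (simp add: ap_restr old)
  show "ext s \<subseteq> ext (snoc s a)" unfolding snoc_def by auto
qed

lemma func_succ_snoc:
  assumes "func t (succ n) l" shows "func (restr t n) n l" "t $ n \<in> ext l" "t = snoc (restr t n) (t $ n)"
proof -
  show f: "func (restr t n) n l" by (rule func_restr[OF assms]) auto
  show a: "t $ n \<in> ext l" by (rule ap_in_codomain[OF assms]) auto
  show "t = snoc (restr t n) (t $ n)"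
    by (rule func_ext[OF assms func_snoc[OF f a]]) (auto simp: snoc_last[OF f a] ap_snoc[OF f a] ap_restr)
qed

lemma func_empty[simp]: "func empty empty l" by (simp add: func_def)
lemma func_empty_iff: "func s empty l ==> s = empty" by (rule func_ext[of _ empty]) auto

lemma enum_funs_succ:
  assumes g: "enum g (funs n X)" and d: "enum d X"
  shows "enum (lam omega (%k. snoc (g $ nat_fst k) (d $ nat_snd k))) (funs (succ n) X)"
proof (rule enum_lam)
  show "def_fun (%k. snoc (g $ nat_fst k) (d $ nat_snd k))" by (intro def_intros)
  fix k assume k: "k \<in> nats"
  show "snoc (g $ nat_fst k) (d $ nat_snd k) \<in> ext (funs (succ n) X)"
    using enum_in[OF g] enum_in[OF d] nat_fst_snd_in_omega[OF k] by (simp add: func_snoc)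
next
  fix s assume "s \<in> ext (funs (succ n) X)"
  then have s: "func s (succ n) X" by simp
  note decomp = func_succ_snoc[OF s]
  obtain i where i: "i \<in> nats" "g $ i = restr s n"
    using enum_surj[OF g, of "restr s n"] decomp(1) by auto
  obtain j where j: "j \<in> nats" "d $ j = s $ n" by (rule enum_surj[OF d decomp(2)])
  show "\<exists>k\<in>nats. snoc (g $ nat_fst k) (d $ nat_snd k) = s"
    by (rule bexI[of _ "nat_pair i j"])
      (simp_all add: nat_pair_props[OF i(1) j(1)] i(2) j(2) decomp(3)[symmetric])
qed

lemma enumerable_fin_seqs:
  assumes "enumerable X"
  shows "enumerable (fin_seqs X)"
proof -
  obtain d where d: "enum d X" by (rule enumerableE[OF assms])
  define N where
    "N = nat_rec (lam omega (%_. empty)) (%_ g. lam omega (%k. snoc (g $ nat_fst k) (d $ nat_snd k)))"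
  have step: "def_fun2 (%_ g. lam omega (%k. snoc (g $ nat_fst k) (d $ nat_snd k)))" by (intro def_intros)
  have N: "def_fun N" unfolding N_def by (intro def_intros)
  have enum_N: "enum (N n) (funs n X)" if "n \<in> nats" for n
  proof (rule omega_induct[OF that])
    show "def_pred (%n. enum (N n) (funs n X))" by (intro def_intros def_funD[OF N])
    show "enum (N empty) (funs empty X)" unfolding N_def nat_rec_empty[OF step]
      by (rule enum_lam) (intro def_intros, use func_empty_iff in \<open>auto intro: empty_in_omega\<close>)
    show "enum (N (succ n)) (funs (succ n) X)" if "n \<in> nats" "enum (N n) (funs n X)" for n
      using enum_funs_succ[OF that(2) d] unfolding N_def nat_rec_succ[OF step that(1)] .
  qed
  show ?thesis
  proof (rule enumerableI[where F="%j. N (nat_fst j) $ nat_snd j"])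
    show "def_fun (%j. N (nat_fst j) $ nat_snd j)" by (intro def_intros def_funD[OF N])
    show "N (nat_fst j) $ nat_snd j \<in> ext (fin_seqs X)" if "j \<in> nats" for j
      using enum_in[OF enum_N] nat_fst_snd_in_omega[OF that] by (auto simp: ext_fin_seqs)
    fix s assume "s \<in> ext (fin_seqs X)"
    then obtain n where n: "n \<in> nats" "s \<in> ext (funs n X)" by (auto simp: ext_fin_seqs)
    obtain k where k: "k \<in> nats" "N n $ k = s" by (rule enum_surj[OF enum_N[OF n(1)] n(2)])
    show "\<exists>j\<in>nats. N (nat_fst j) $ nat_snd j = s"
      by (rule bexI[of _ "nat_pair n k"]) (simp_all add: nat_pair_props[OF n(1) k(1)] k(2))
  qed
qed

end
context zf_model
begin

section \<open>Well-orders\<close>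

definition well_orders :: "'a => 'a => bool" where
  "well_orders w X \<longleftrightarrow> (\<forall>Z. ext Z \<subseteq> ext X --> Z \<noteq> empty --> (\<exists>z\<in>ext Z. \<forall>y\<in>ext Z. opair z y \<in> ext w)) \<and>
    (\<forall>a\<in>ext X. \<forall>b\<in>ext X. opair a b \<in> ext w --> opair b a \<in> ext w --> a = b)"
lemma def_pred2_well_orders[THEN def_pred2D, def_intros]: "def_pred2 well_orders"
  by (intro def_pred2I, unfold well_orders_def, intro def_intros)

lemma well_orders_I:
  assumes "\<And>Z x. ext Z \<subseteq> ext X ==> x \<in> ext Z ==> \<exists>z\<in>ext Z. \<forall>y\<in>ext Z. opair z y \<in> ext w"
    and "\<And>a b. a \<in> ext X ==> b \<in> ext X ==> opair a b \<in> ext w ==> opair b a \<in> ext w ==> a = b"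
  shows "well_orders w X"
  unfolding well_orders_def
proof (intro conjI allI impI ballI)
  fix Z assume Z: "ext Z \<subseteq> ext X" "Z \<noteq> empty"
  then obtain x where "x \<in> ext Z" using ext_eq_empty_iff by blast
  then show "\<exists>z\<in>ext Z. \<forall>y\<in>ext Z. opair z y \<in> ext w" using assms(1) Z(1) by blast
qed (use assms(2) in blast)

lemma well_orders_antisym: "well_orders w X ==> a \<in> ext X ==> b \<in> ext X ==> opair a b \<in> ext w ==>
    opair b a \<in> ext w ==> a = b"
  unfolding well_orders_def by blast
lemma well_orders_least:
  assumes "well_orders w X" "ext Z \<subseteq> ext X" "x \<in> ext Z"
  obtains z where "z \<in> ext Z" "\<And>y. y \<in> ext Z ==> opair z y \<in> ext w"
proof -
  have "Z \<noteq> empty" using assms(3) by auto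
  then show ?thesis using assms(1,2) that unfolding well_orders_def by blast
qed

lemma well_orders_subset: "well_orders w X ==> ext Y \<subseteq> ext X ==> well_orders w Y"
  unfolding well_orders_def by blast
lemma well_orders_refl: "well_orders w X ==> a \<in> ext X ==> opair a a \<in> ext w"
  by (rule well_orders_least[of w X "upair a a" a]) auto
lemma well_orders_total: "well_orders w X ==> a \<in> ext X ==> b \<in> ext X ==>
    opair a b \<in> ext w \<or> opair b a \<in> ext w"
  by (rule well_orders_least[of w X "upair a b" a]) auto

lemma well_orders_trans:
  assumes w: "well_orders w X" and X: "a \<in> ext X" "b \<in> ext X" "c \<in> ext X"
    and ab: "opair a b \<in> ext w" and bc: "opair b c \<in> ext w"
  shows "opair a c \<in> ext w"
proof -
  have sub: "ext (cup (upair a b) (upair c c)) \<subseteq> ext X" and "a \<in> ext (cup (upair a b) (upair c c))"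
    using X by auto
  then obtain z where z: "z \<in> ext (cup (upair a b) (upair c c))"
      "\<And>y. y \<in> ext (cup (upair a b) (upair c c)) ==> opair z y \<in> ext w"
    by (rule well_orders_least[OF w]) (rule that)
  have least: "opair z a \<in> ext w" "opair z b \<in> ext w" "opair z c \<in> ext w" using z(2) by auto
  consider "z = a" | "z = b" | "z = c" using z(1) by auto
  then show ?thesis
  proof cases
    case 1
    then show ?thesis using least by simp
  next
    case 2
    then have "a = b" using least(1) ab well_orders_antisym[OF w X(1,2)] by simp
    then show ?thesis using bc by simp
  next
    case 3
    then have "b = c" using least(2) bc well_orders_antisym[OF w X(2,3)] by simp
    then show ?thesis using ab by simp
  qed
qed

definition wo_least :: "'a => 'a => 'a" where
  "wo_least w Z = descr (%z. z \<in> ext Z \<and> (\<forall>y\<in>ext Z. opair z y \<in> ext w))"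
lemma def_fun2_wo_least[THEN def_fun2D, def_intros]: "def_fun2 wo_least"
  by (intro def_fun2I, unfold wo_least_def, intro def_intros)
lemma wo_leastI:
  assumes "well_orders w X" "ext Z \<subseteq> ext X" "x \<in> ext Z"
  shows "wo_least w Z \<in> ext Z" "\<And>y. y \<in> ext Z ==> opair (wo_least w Z) y \<in> ext w"
proof -
  obtain z where z: "z \<in> ext Z" "\<And>y. y \<in> ext Z ==> opair z y \<in> ext w"
    by (rule well_orders_least[OF assms]) (rule that)
  have "wo_least w Z = z" unfolding wo_least_def
  proof (rule descr_equality)
    fix k assume "k \<in> ext Z \<and> (\<forall>y\<in>ext Z. opair k y \<in> ext w)"
    then show "k = z" using z well_orders_antisym[OF assms(1), of k z] assms(2) by blast
  qed (use z in blast)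
  then show "wo_least w Z \<in> ext Z" "\<And>y. y \<in> ext Z ==> opair (wo_least w Z) y \<in> ext w" using z by simp_all
qed

definition pullback_order :: "('a => 'a) => 'a => 'a => 'a" where
  "pullback_order m w Y = sep (cprod Y Y) (%p. opair (m (pfst p)) (m (psnd p)) \<in> ext w)"

lemma well_orders_pullback_order:
  assumes w: "well_orders w X" and m: "def_fun m" "\<And>y. y \<in> ext Y ==> m y \<in> ext X"
    and inj: "\<And>y z. y \<in> ext Y ==> z \<in> ext Y ==> m y = m z ==> y = z"
  shows "well_orders (pullback_order m w Y) Y"
proof (rule well_orders_I)
  have "def_pred (%p. opair (m (pfst p)) (m (psnd p)) \<in> ext w)" by (intro def_intros def_funD[OF m(1)])
  from ext_sep[OF this] have mem_pull:
    "opair a b \<in> ext (pullback_order m w Y) \<longleftrightarrow> a \<in> ext Y \<and> b \<in> ext Y \<and> opair (m a) (m b) \<in> ext w" for a b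
    unfolding pullback_order_def by auto
  note image = ext_img[OF m(1)]
  fix Z x assume Z: "ext Z \<subseteq> ext Y" "x \<in> ext Z"
  have "ext (img m Z) \<subseteq> ext X" "m x \<in> ext (img m Z)" unfolding image using m(2) Z by blast+
  then obtain v where "v \<in> ext (img m Z)" and v: "\<And>y. y \<in> ext (img m Z) ==> opair v y \<in> ext w"
    by (rule well_orders_least[OF w]) (rule that)
  then obtain z where z: "z \<in> ext Z" "v = m z" unfolding image by blast
  have "opair z y \<in> ext (pullback_order m w Y)" if y: "y \<in> ext Z" for y
    unfolding mem_pull using v[unfolded image, OF imageI[OF y]] z Z(1) y by auto
  then show "\<exists>z\<in>ext Z. \<forall>y\<in>ext Z. opair z y \<in> ext (pullback_order m w Y)" using z(1) by blast
next
  fix a b assume "a \<in> ext Y" "b \<in> ext Y" "opair a b \<in> ext (pullback_order m w Y)"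
    "opair b a \<in> ext (pullback_order m w Y)"
  moreover have "def_pred (%p. opair (m (pfst p)) (m (psnd p)) \<in> ext w)"
    by (intro def_intros def_funD[OF m(1)])
  ultimately show "a = b"
    using well_orders_antisym[OF w m(2) m(2)] inj unfolding pullback_order_def by (simp add: ext_sep)
qed

definition image_order :: "('a => 'a) => 'a => 'a => 'a" where
  "image_order F w X = pullback_order (%y. wo_least w (sep X (%x. F x = y))) w (img F X)"
lemma well_orders_img:
  assumes F: "def_fun F" and w: "well_orders w X"
  shows "well_orders (image_order F w X) (img F X)"
  unfolding image_order_def
proof (rule well_orders_pullback_order[OF w])
  let ?m = "%y. wo_least w (sep X (%x. F x = y))"
  show "def_fun ?m" by (intro def_intros def_funD[OF F])
  have fibre: "ext (sep X (%x. F x = y)) = {x \<in> ext X. F x = y}" for y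
    by (rule ext_sep) (intro def_intros def_funD[OF F])
  have "?m y \<in> ext (sep X (%x. F x = y))" if y: "y \<in> ext (img F X)" for y
  proof -
    obtain x where "x \<in> ext X" "F x = y" using y unfolding ext_img[OF F] by blast
    then have "ext (sep X (%x. F x = y)) \<subseteq> ext X" "x \<in> ext (sep X (%x. F x = y))"
      unfolding fibre by simp_all
    then show ?thesis by (rule wo_leastI(1)[OF w])
  qed
  then have m: "?m y \<in> ext X" "F (?m y) = y" if "y \<in> ext (img F X)" for y
    using that by (simp_all add: fibre)
  show "\<And>y. y \<in> ext (img F X) ==> ?m y \<in> ext X" by (rule m(1))
  show "\<And>y z. y \<in> ext (img F X) ==> z \<in> ext (img F X) ==> ?m y = ?m z ==> y = z" by (metis m(2))
qed

definition mem_order :: "'a => 'a" where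
  "mem_order a = sep (cprod a a) (%p. pfst p \<in> ext (psnd p) \<or> pfst p = psnd p)"
lemma def_fun_mem_order[THEN def_funD, def_intros]: "def_fun mem_order"
  by (intro def_funI, unfold mem_order_def, intro def_intros)
lemma opair_mem_order: "opair x y \<in> ext (mem_order a) \<longleftrightarrow> x \<in> ext a \<and> y \<in> ext a \<and> (x \<in> ext y \<or> x = y)"
  unfolding mem_order_def by (subst ext_sep) (intro def_intros, auto)
lemma well_orders_ordinal:
  assumes "ordinal a"
  shows "well_orders (mem_order a) a"
proof (rule well_orders_I)
  fix Z x assume Z: "ext Z \<subseteq> ext a" "x \<in> ext Z"
  then obtain z where z: "z \<in> ext Z" "ext z \<inter> ext Z = {}" using mem_minimal[of Z] ext_eq_empty_iff by blast
  have "opair z y \<in> ext (mem_order a)" if "y \<in> ext Z" for y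
    using ordinal_linear[OF ordinal_mem[OF assms] ordinal_mem[OF assms], of z y] that z Z(1)
    unfolding opair_mem_order by blast
  then show "\<exists>z\<in>ext Z. \<forall>y\<in>ext Z. opair z y \<in> ext (mem_order a)" using z(1) by blast
next
  fix x y assume "opair x y \<in> ext (mem_order a)" "opair y x \<in> ext (mem_order a)"
  then show "x = y" unfolding opair_mem_order using mem_asym by blast
qed

definition prod_order :: "'a => 'a => 'a => 'a => 'a" where
  "prod_order w X v Y = sep (cprod (cprod X Y) (cprod X Y)) (%p.
     (pfst (pfst p) \<noteq> pfst (psnd p) \<and> opair (pfst (pfst p)) (pfst (psnd p)) \<in> ext w) \<or>
     (pfst (pfst p) = pfst (psnd p) \<and> opair (psnd (pfst p)) (psnd (psnd p)) \<in> ext v))"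
lemma opair_prod_order:
  "opair (opair a b) (opair c d) \<in> ext (prod_order w X v Y) \<longleftrightarrow>
    a \<in> ext X \<and> c \<in> ext X \<and> b \<in> ext Y \<and> d \<in> ext Y \<and>
    (a \<noteq> c \<and> opair a c \<in> ext w \<or> a = c \<and> opair b d \<in> ext v)"
  unfolding prod_order_def by (subst ext_sep) (intro def_intros, auto)
lemma well_orders_prod:
  assumes w: "well_orders w X" and v: "well_orders v Y"
  shows "well_orders (prod_order w X v Y) (cprod X Y)"
proof (rule well_orders_I)
  have fst: "def_fun pfst" by (intro def_intros)
  fix Z x assume Z: "ext Z \<subseteq> ext (cprod X Y)" "x \<in> ext Z"
  then have "ext (img pfst Z) \<subseteq> ext X" "pfst x \<in> ext (img pfst Z)" unfolding ext_img[OF fst] by auto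
  then obtain a where "a \<in> ext (img pfst Z)" "\<And>y. y \<in> ext (img pfst Z) ==> opair a y \<in> ext w"
    by (rule well_orders_least[OF w]) (rule that)
  then have a: "a \<in> pfst ` ext Z" "\<And>y. y \<in> pfst ` ext Z ==> opair a y \<in> ext w"
    unfolding ext_img[OF fst] by blast+
  let ?row = "sep Y (%b. opair a b \<in> ext Z)"
  have row: "ext ?row = {b \<in> ext Y. opair a b \<in> ext Z}" by (rule ext_sep) (intro def_intros)
  obtain b0 where "opair a b0 \<in> ext Z" "b0 \<in> ext Y" and a_in_X: "a \<in> ext X" using a(1) Z(1) by force
  then have "ext ?row \<subseteq> ext Y" "b0 \<in> ext ?row" unfolding row by blast+
  then obtain b where b: "b \<in> ext ?row" "\<And>y. y \<in> ext ?row ==> opair b y \<in> ext v"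
    by (rule well_orders_least[OF v]) (rule that)
  have "opair (opair a b) y \<in> ext (prod_order w X v Y)" if y_in_Z: "y \<in> ext Z" for y
  proof -
    obtain c d where y: "y = opair c d" "c \<in> ext X" "d \<in> ext Y" using y_in_Z Z(1) by auto
    then have "opair a c \<in> ext w" using a(2)[of c] y_in_Z by force
    then show ?thesis unfolding y(1) opair_prod_order using b y y_in_Z a_in_X unfolding row by blast
  qed
  then show "\<exists>z\<in>ext Z. \<forall>y\<in>ext Z. opair z y \<in> ext (prod_order w X v Y)" using b(1) unfolding row by blast
next
  fix p q assume pq: "p \<in> ext (cprod X Y)" "q \<in> ext (cprod X Y)"
    "opair p q \<in> ext (prod_order w X v Y)" "opair q p \<in> ext (prod_order w X v Y)"
  then obtain a b c d where pairs: "p = opair a b" "q = opair c d" by auto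
  have "a = c" using pq(3,4) well_orders_antisym[OF w] unfolding pairs opair_prod_order by blast
  moreover from this have "b = d"
    using pq(3,4) well_orders_antisym[OF v] unfolding pairs opair_prod_order by blast
  ultimately show "p = q" using pairs by simp
qed

definition cup_order :: "'a => 'a => 'a => 'a => 'a" where
  "cup_order w X v Y = sep (cprod (cup X Y) (cup X Y)) (%p.
     if pfst p \<in> ext X then psnd p \<in> ext X --> opair (pfst p) (psnd p) \<in> ext w
     else psnd p \<notin> ext X \<and> opair (pfst p) (psnd p) \<in> ext v)"
lemma opair_cup_order:
  "opair x y \<in> ext (cup_order w X v Y) \<longleftrightarrow> x \<in> ext (cup X Y) \<and> y \<in> ext (cup X Y) \<and>
    (if x \<in> ext X then y \<in> ext X --> opair x y \<in> ext w else y \<notin> ext X \<and> opair x y \<in> ext v)"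
  unfolding cup_order_def by (subst ext_sep) (intro def_intros, auto)
lemma well_orders_cup:
  assumes w: "well_orders w X" and v: "well_orders v Y"
  shows "well_orders (cup_order w X v Y) (cup X Y)"
proof (rule well_orders_I)
  fix Z x assume Z: "ext Z \<subseteq> ext (cup X Y)" "x \<in> ext Z"
  show "\<exists>z\<in>ext Z. \<forall>y\<in>ext Z. opair z y \<in> ext (cup_order w X v Y)"
  proof (cases "\<exists>x\<in>ext Z. x \<in> ext X")
    case True
    let ?lower = "sep Z (%b. b \<in> ext X)"
    have lower: "ext ?lower = {b \<in> ext Z. b \<in> ext X}" by (rule ext_sep) (intro def_intros)
    obtain x0 where "ext ?lower \<subseteq> ext X" "x0 \<in> ext ?lower" using True lower by blast
    then obtain z where "z \<in> ext ?lower" "\<And>y. y \<in> ext ?lower ==> opair z y \<in> ext w"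
      by (rule well_orders_least[OF w]) (rule that)
    then show ?thesis using Z(1) unfolding opair_cup_order lower by (intro bexI[of _ z]) auto
  next
    case False
    then have "ext Z \<subseteq> ext Y" using Z(1) by auto
    then obtain z where "z \<in> ext Z" "\<And>y. y \<in> ext Z ==> opair z y \<in> ext v"
      using Z(2) by (rule well_orders_least[OF v]) (rule that)
    then show ?thesis using Z(1) False unfolding opair_cup_order by (intro bexI[of _ z]) auto
  qed
next
  fix a b assume ab: "a \<in> ext (cup X Y)" "b \<in> ext (cup X Y)"
    "opair a b \<in> ext (cup_order w X v Y)" "opair b a \<in> ext (cup_order w X v Y)"
  then show "a = b"
    using well_orders_antisym[OF w, of a b] well_orders_antisym[OF v, of a b]
    unfolding opair_cup_order by (auto split: if_splits)
qed

subsection \<open>Closing off a well-ordered set under definable operations\<close>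

definition ord_bound :: "'a => 'a" where "ord_bound X = succ (bigunion (sep X ordinal))"
lemma def_fun_ord_bound[THEN def_funD, def_intros]: "def_fun ord_bound"
  by (intro def_funI, unfold ord_bound_def, intro def_intros)
lemma ord_bound_props: "ordinal (ord_bound X)" "\<And>a. a \<in> ext X ==> ordinal a ==> a \<in> ext (ord_bound X)"
proof -
  have "ext (sep X ordinal) = {x \<in> ext X. ordinal x}" by (rule ext_sep) (intro def_intros)
  with ordinal_bound[of "sep X ordinal"]
  show "ordinal (ord_bound X)" "\<And>a. a \<in> ext X ==> ordinal a ==> a \<in> ext (ord_bound X)"
    unfolding ord_bound_def by auto
qed

text \<open>One closure step: a tag below 3 says whether to keep an element of \<open>X\<close> or an ordinal below
  one, to form an unordered pair, or to apply \<open>E\<close>.\<close>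

definition step_op :: "('a => 'a) => 'a => 'a" where
  "step_op E t = (if pfst t = empty then pfst (psnd t)
     else if pfst t = succ empty then upair (pfst (psnd t)) (psnd (psnd t))
     else E (pfst (psnd t)))"
definition step_dom :: "'a => 'a" where
  "step_dom X = cprod (succ (succ (succ empty))) (cprod (cup X (ord_bound X)) (cup X (ord_bound X)))"
definition step_dom_order :: "'a => 'a => 'a" where
  "step_dom_order X w = prod_order (mem_order (succ (succ (succ empty)))) (succ (succ (succ empty)))
     (prod_order (cup_order w X (mem_order (ord_bound X)) (ord_bound X)) (cup X (ord_bound X))
       (cup_order w X (mem_order (ord_bound X)) (ord_bound X)) (cup X (ord_bound X)))
     (cprod (cup X (ord_bound X)) (cup X (ord_bound X)))"
definition step_set :: "('a => 'a) => 'a => 'a" where "step_set E X = img (step_op E) (step_dom X)"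
definition step_order :: "('a => 'a) => 'a => 'a => 'a" where
  "step_order E X w = image_order (step_op E) (step_dom_order X w) (step_dom X)"

lemma def_fun_step_op: assumes "def_fun E"
  shows "def_fun (step_op E)" unfolding step_op_def by (intro def_intros def_funD[OF assms])

lemma well_orders_step_order: "def_fun E ==> well_orders w X ==>
    well_orders (step_order E X w) (step_set E X)"
  unfolding step_order_def step_set_def step_dom_order_def step_dom_def
  by (intro well_orders_img def_fun_step_op well_orders_prod well_orders_cup well_orders_ordinal
    ordinal_succ ordinal_empty ord_bound_props)

lemma step_set_props:
  assumes E: "def_fun E"
  shows "ext X \<subseteq> ext (step_set E X)" "a \<in> ext X ==> b \<in> ext X ==> upair a b \<in> ext (step_set E X)"
    "a \<in> ext X ==> E a \<in> ext (step_set E X)" "c \<in> ext X ==> ordinal c ==> ext c \<subseteq> ext (step_set E X)"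
proof -
  have step_set_iff: "ext (step_set E X) = step_op E ` ext (step_dom X)"
    unfolding step_set_def by (rule ext_img[OF def_fun_step_op[OF E]])
  have tagged: "opair t (opair a b) \<in> ext (step_dom X) \<longleftrightarrow>
      t \<in> ext (succ (succ (succ empty))) \<and> a \<in> ext (cup X (ord_bound X)) \<and>
          b \<in> ext (cup X (ord_bound X))" for t a b
    unfolding step_dom_def by (simp only: opair_mem_cprod)
  have keep: "z \<in> ext (step_set E X)" if "z \<in> ext (cup X (ord_bound X))" for z
    unfolding step_set_iff
    by (rule image_eqI[of _ _ "opair empty (opair z z)"]) (use that tagged in \<open>auto simp: step_op_def\<close>)
  show "ext X \<subseteq> ext (step_set E X)" using keep by auto
  show "a \<in> ext X ==> b \<in> ext X ==> upair a b \<in> ext (step_set E X)" for a b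
    unfolding step_set_iff
    by (rule image_eqI[of _ _ "opair (succ empty) (opair a b)"]) (use tagged in \<open>auto simp: step_op_def\<close>)
  show "a \<in> ext X ==> E a \<in> ext (step_set E X)" for a
    unfolding step_set_iff
    by (rule image_eqI[of _ _ "opair (succ (succ empty)) (opair a a)"])
      (use tagged in \<open>auto simp: step_op_def\<close>)
  show "ext c \<subseteq> ext (step_set E X)" if "c \<in> ext X" "ordinal c" for c
    using keep ordinal_subset[OF ord_bound_props(1) ord_bound_props(2)[OF that]] by auto
qed

context
  fixes X W
  assumes X: "def_fun X" and W: "def_fun W" and wo: "\<And>n. n \<in> nats ==> well_orders (W n) (X n)"
begin

definition entry :: "'a => 'a" where "entry z = least_nat (%n. z \<in> ext (X n))"
definition entry_order :: "'a" where
  "entry_order = sep (cprod (bigunion (img X omega)) (bigunion (img X omega))) (%p.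
     entry (pfst p) \<in> ext (entry (psnd p)) \<or>
     entry (pfst p) = entry (psnd p) \<and> p \<in> ext (W (entry (pfst p))))"

lemma def_fun_entry: "def_fun entry" unfolding entry_def by (intro def_intros def_funD[OF X])
lemma entry_props:
  assumes "z \<in> ext (bigunion (img X omega))"
  shows "entry z \<in> nats" "z \<in> ext (X (entry z))"
proof -
  obtain n where n: "n \<in> nats" "z \<in> ext (X n)" using assms unfolding ext_bigunion ext_img[OF X] by blast
  have "def_pred (%n. z \<in> ext (X n))" by (intro def_intros def_funD[OF X])
  from least_natI(1,2)[OF this n] show "entry z \<in> nats" "z \<in> ext (X (entry z))" unfolding entry_def .
qed

lemma opair_entry_order: "opair x y \<in> ext entry_order \<longleftrightarrow>
    x \<in> ext (bigunion (img X omega)) \<and> y \<in> ext (bigunion (img X omega)) \<and>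
    (entry x \<in> ext (entry y) \<or> entry x = entry y \<and> opair x y \<in> ext (W (entry x)))"
  unfolding entry_order_def
  by (subst ext_sep) (intro def_intros def_funD[OF def_fun_entry] def_funD[OF W], auto)

lemma entry_order_least:
  assumes Z: "ext Z \<subseteq> ext (bigunion (img X omega))" "z0 \<in> ext Z"
  obtains z where "z \<in> ext Z" "\<And>y. y \<in> ext Z ==> opair z y \<in> ext entry_order"
proof -
  define n where "n = least_nat (%n. \<exists>z\<in>ext Z. entry z = n)"
  have "def_pred (%n. \<exists>z\<in>ext Z. entry z = n)" by (intro def_intros def_funD[OF def_fun_entry])
  from least_natI[OF this entry_props(1), of z0] Z
  have n: "n \<in> nats" "\<exists>z\<in>ext Z. entry z = n" "\<And>y. y \<in> ext Z ==> entry y \<notin> ext n"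
    unfolding n_def by blast+
  have bottom: "ext (sep Z (%z. entry z = n)) = {z \<in> ext Z. entry z = n}"
    by (rule ext_sep) (intro def_intros def_funD[OF def_fun_entry])
  have sub: "ext (sep Z (%z. entry z = n)) \<subseteq> ext (X n)"
  proof
    fix z assume "z \<in> ext (sep Z (%z. entry z = n))"
    then have z: "z \<in> ext Z" "entry z = n" unfolding bottom by simp_all
    show "z \<in> ext (X n)" using entry_props(2)[OF subsetD[OF Z(1) z(1)]] unfolding z(2) .
  qed
  obtain z1 where z1: "z1 \<in> ext (sep Z (%z. entry z = n))" using n(2) bottom by blast
  obtain z where least: "z \<in> ext (sep Z (%z. entry z = n))"
    "\<And>y. y \<in> ext (sep Z (%z. entry z = n)) ==> opair z y \<in> ext (W n)"
    by (rule well_orders_least[OF wo[OF n(1)] sub z1]) (rule that)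
  then have z: "z \<in> ext Z" "entry z = n" "\<And>y. y \<in> ext Z ==> entry y = n ==> opair z y \<in> ext (W n)"
    unfolding bottom by blast+
  have "opair z y \<in> ext entry_order" if y: "y \<in> ext Z" for y
  proof -
    have in_union: "y \<in> ext (bigunion (img X omega))" "z \<in> ext (bigunion (img X omega))"
      using y z(1) Z(1) by blast+
    have "n \<in> ext (entry y) \<or> entry y = n"
      using omega_linear[OF n(1) entry_props(1)[OF in_union(1)]] n(3)[OF y] by blast
    then show ?thesis unfolding opair_entry_order using in_union z(2) z(3)[OF y] by auto
  qed
  then show thesis by (rule that[OF z(1)])
qed

lemma well_orders_entry_order: "well_orders entry_order (bigunion (img X omega))"
proof (rule well_orders_I)
  show "\<exists>z\<in>ext Z. \<forall>y\<in>ext Z. opair z y \<in> ext entry_order"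
    if "ext Z \<subseteq> ext (bigunion (img X omega))" "z0 \<in> ext Z" for Z z0
    by (rule entry_order_least[OF that]) blast
  fix x y assume xy: "x \<in> ext (bigunion (img X omega))" "y \<in> ext (bigunion (img X omega))"
    "opair x y \<in> ext entry_order" "opair y x \<in> ext entry_order"
  have "entry x = entry y"
    using xy(3,4) mem_asym[of "entry x" "entry y"] unfolding opair_entry_order by auto
  then show "x = y"
    using xy(3,4) well_orders_antisym[OF wo[OF entry_props(1)[OF xy(1)]] entry_props(2)[OF xy(1)]]
      entry_props(2)[OF xy(2)] mem_irrefl[of "entry y"] unfolding opair_entry_order by auto
qed

end

context
  fixes E X0 w0
  assumes E: "def_fun E" and w0: "well_orders w0 X0"
begin

definition stage :: "'a => 'a" where
  "stage n = nat_rec (opair X0 w0) (%_ p. opair (step_set E (pfst p)) (step_order E (pfst p) (psnd p))) n"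
abbreviation stage_set :: "'a => 'a" where "stage_set n \<equiv> pfst (stage n)"

lemma stage_props:
  shows def_fun_stage: "def_fun stage" and stage_empty: "stage empty = opair X0 w0"
    and stage_succ: "n \<in> nats ==>
      stage (succ n) = opair (step_set E (stage_set n)) (step_order E (stage_set n) (psnd (stage n)))"
proof -
  have step: "def_fun2 (%_ p. opair (step_set E (pfst p)) (step_order E (pfst p) (psnd p)))"
    unfolding step_set_def step_order_def image_order_def pullback_order_def step_dom_def
      step_dom_order_def prod_order_def cup_order_def
    by (intro def_intros def_funD[OF def_fun_step_op[OF E]])
  show "def_fun stage"
    by (intro def_funI, unfold stage_def step_set_def step_order_def image_order_def
      pullback_order_def step_dom_def step_dom_order_def prod_order_def cup_order_def)
      (intro def_intros def_funD[OF def_fun_step_op[OF E]])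
  show "stage empty = opair X0 w0" unfolding stage_def by (rule nat_rec_empty[OF step])
  show "n \<in> nats ==>
      stage (succ n) = opair (step_set E (stage_set n)) (step_order E (stage_set n) (psnd (stage n)))"
    unfolding stage_def by (rule nat_rec_succ[OF step])
qed

lemma well_orders_stage:
  assumes "n \<in> nats"
  shows "well_orders (psnd (stage n)) (stage_set n)"
proof (rule omega_induct[OF assms])
  show "def_pred (%n. well_orders (psnd (stage n)) (stage_set n))"
    by (intro def_intros def_funD[OF def_fun_stage])
qed (simp_all add: stage_empty w0 stage_succ well_orders_step_order[OF E])

lemma stage_mono:
  assumes "m \<in> nats" "n \<in> ext m"
  shows "ext (stage_set n) \<subseteq> ext (stage_set m)"
proof -
  have "\<forall>n\<in>ext m. ext (stage_set n) \<subseteq> ext (stage_set m)"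
  proof (rule omega_induct[OF assms(1)])
    show "def_pred (%m. \<forall>n\<in>ext m. ext (stage_set n) \<subseteq> ext (stage_set m))"
      by (intro def_intros def_funD[OF def_fun_stage])
    fix m assume m: "m \<in> nats" "\<forall>n\<in>ext m. ext (stage_set n) \<subseteq> ext (stage_set m)"
    then show "\<forall>n\<in>ext (succ m). ext (stage_set n) \<subseteq> ext (stage_set (succ m))"
      using step_set_props(1)[OF E, of "stage_set m"] by (auto simp: stage_succ[OF m(1)])
  qed simp
  then show ?thesis using assms(2) by blast
qed

definition closure :: 'a where "closure = bigunion (img stage_set omega)"
lemma mem_closure: "z \<in> ext closure \<longleftrightarrow> (\<exists>n\<in>nats. z \<in> ext (stage_set n))"
proof -
  have "def_fun stage_set" by (intro def_intros def_funD[OF def_fun_stage])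
  then show ?thesis unfolding closure_def by (simp add: ext_img)
qed

lemma closure_step:
  assumes "a \<in> ext closure" "b \<in> ext closure"
  obtains n where "a \<in> ext (stage_set n)" "b \<in> ext (stage_set n)"
    "ext (step_set E (stage_set n)) \<subseteq> ext closure"
proof -
  have next_stage: "ext (step_set E (stage_set n)) \<subseteq> ext closure" if "n \<in> nats" for n
  proof
    fix z assume "z \<in> ext (step_set E (stage_set n))"
    then have "z \<in> ext (stage_set (succ n))" by (simp add: stage_succ[OF that])
    then show "z \<in> ext closure" using succ_in_omega[OF that] mem_closure by blast
  qed
  obtain n m where n: "n \<in> nats" "a \<in> ext (stage_set n)"
    and m: "m \<in> nats" "b \<in> ext (stage_set m)"
    using assms unfolding mem_closure by blast
  consider "n \<in> ext m" | "n = m" | "m \<in> ext n" using omega_linear[OF n(1) m(1)] by blast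
  then show thesis
  proof cases
    case 1
    then show thesis using that[OF _ m(2) next_stage[OF m(1)]] stage_mono[OF m(1)] n(2) by blast
  next
    case 2
    then show thesis using that[OF n(2) _ next_stage[OF n(1)]] m(2) by blast
  next
    case 3
    then show thesis using that[OF n(2) _ next_stage[OF n(1)]] stage_mono[OF n(1)] m(2) by blast
  qed
qed

lemma closure_exists:
  obtains X w where "well_orders w X" "ext X0 \<subseteq> ext X"
    "\<And>a b. a \<in> ext X ==> b \<in> ext X ==> upair a b \<in> ext X"
    "\<And>a. a \<in> ext X ==> E a \<in> ext X" "\<And>c. c \<in> ext X ==> ordinal c ==> ext c \<subseteq> ext X"
proof -
  have "def_fun stage_set" "def_fun (%n. psnd (stage n))" by (intro def_intros def_funD[OF def_fun_stage])+
  then have "well_orders (entry_order stage_set (%n. psnd (stage n))) closure"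
    unfolding closure_def by (rule well_orders_entry_order[OF _ _ well_orders_stage])
  then show thesis
  proof (rule that)
    show "ext X0 \<subseteq> ext closure"
    proof
      fix z assume "z \<in> ext X0"
      then have "z \<in> ext (stage_set empty)" by (simp add: stage_empty)
      then show "z \<in> ext closure" using empty_in_omega mem_closure by blast
    qed
    show "upair a b \<in> ext closure" if "a \<in> ext closure" "b \<in> ext closure" for a b
      by (rule closure_step[OF that]) (use step_set_props(2)[OF E] in blast)
    show "E a \<in> ext closure" if "a \<in> ext closure" for a
      by (rule closure_step[OF that that]) (use step_set_props(3)[OF E] in blast)
    show "ext c \<subseteq> ext closure" if "c \<in> ext closure" "ordinal c" for c
      by (rule closure_step[OF that(1,1)]) (use step_set_props(4)[OF E _ that(2)] in blast)
  qed
qed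

end
primrec select_op :: "('a => 'a) list => 'a => 'a" where
  "select_op [] z = z"
| "select_op (F # Fs) z = (if pfst z = empty then F (psnd z) else select_op Fs (psnd z))"

lemma def_fun_select_op: "(\<And>F. F \<in> set Fs ==> def_fun F) ==> def_fun (select_op Fs)"
proof (induction Fs)
  case Nil
  have "select_op [] = (%z. z)" by (simp add: fun_eq_iff)
  moreover have "def_fun (%z. z)" by (intro def_intros)
  ultimately show ?case by simp
next
  case (Cons F Fs)
  then have parts: "def_fun F" "def_fun (select_op Fs)" by auto
  have "select_op (F # Fs) = (%z. if pfst z = empty then F (psnd z) else select_op Fs (psnd z))"
    by (simp add: fun_eq_iff)
  moreover have "def_fun (%z. if pfst z = empty then F (psnd z) else select_op Fs (psnd z))"
    by (intro def_intros def_funD[OF parts(1)] def_funD[OF parts(2)])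
  ultimately show ?case by simp
qed

lemma select_op_closed:
  assumes "\<And>a b. a \<in> ext X ==> b \<in> ext X ==> opair a b \<in> ext X" "empty \<in> ext X"
    "\<And>a. a \<in> ext X ==> select_op Fs a \<in> ext X" "F \<in> set Fs" "a \<in> ext X"
  shows "F a \<in> ext X"
  using assms(3-5)
proof (induction Fs arbitrary: a)
  case (Cons G Fs)
  let ?o = "opair empty empty"
  have pair_in: "?o \<in> ext X" using assms(1,2) by blast
  have "ext ?o \<noteq> {}" unfolding opair_eq_upair by simp
  then have nonempty: "?o \<noteq> empty" by simp
  have G: "G b \<in> ext X" "select_op Fs b \<in> ext X" if b: "b \<in> ext X" for b
  proof -
    have "select_op (G # Fs) (opair empty b) = G b" "select_op (G # Fs) (opair ?o b) = select_op Fs b"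
      using nonempty by simp_all
    then show "G b \<in> ext X" "select_op Fs b \<in> ext X"
      using Cons.prems(1)[OF assms(1)[OF assms(2) b]] Cons.prems(1)[OF assms(1)[OF pair_in b]] by simp_all
  qed
  show ?case
  proof (cases "F = G")
    case True then show ?thesis using G(1)[OF Cons.prems(3)] by simp
  next
    case False
    then have "F \<in> set Fs" using Cons.prems(2) by simp
    then show ?thesis using Cons.IH[of a] G(2) Cons.prems(3) by blast
  qed
qed simp

lemma closure_exists_list:
  assumes Fs: "\<And>F. F \<in> set Fs ==> def_fun F" and w0: "well_orders w0 X0" "empty \<in> ext X0"
  obtains X w where "well_orders w X" "ext X0 \<subseteq> ext X" "\<And>a b. a \<in> ext X ==> b \<in> ext X ==> upair a b \<in> ext X"
    "\<And>a b. a \<in> ext X ==> b \<in> ext X ==> opair a b \<in> ext X"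
    "\<And>F a. F \<in> set Fs ==> a \<in> ext X ==> F a \<in> ext X" "\<And>c. c \<in> ext X ==> ordinal c ==> ext c \<subseteq> ext X"
proof -
  have "def_fun (select_op Fs)" by (rule def_fun_select_op) (rule Fs)
  then obtain X w where X: "well_orders w X" "ext X0 \<subseteq> ext X"
    "\<And>a b. a \<in> ext X ==> b \<in> ext X ==> upair a b \<in> ext X" "\<And>a. a \<in> ext X ==> select_op Fs a \<in> ext X"
    "\<And>c. c \<in> ext X ==> ordinal c ==> ext c \<subseteq> ext X"
    by (rule closure_exists[OF _ w0(1)]) (rule that)
  have opair: "opair a b \<in> ext X" if "a \<in> ext X" "b \<in> ext X" for a b
    unfolding opair_eq_upair using X(3) that by blast
  have "empty \<in> ext X" using X(2) w0(2) by blast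
  with opair have closed: "F a \<in> ext X" if "F \<in> set Fs" "a \<in> ext X" for F a
    using select_op_closed[of X Fs] X(4) that by blast
  show thesis
    by (rule that[OF X(1,2)], erule (1) X(3), erule (1) opair, erule (1) closed, erule (1) X(5))
qed

end

context zf_model
begin

section \<open>Games\<close>

definition parity :: "'a => 'a" where
  "parity n = nat_rec empty (%_ x. if x = empty then succ empty else empty) n"
lemma def_term_parity[def_intros]:
  assumes "def_term t" shows "def_term (%e. parity (t e))" unfolding parity_def by (intro def_intros assms)
lemma parity_empty[simp]: "parity empty = empty"
  unfolding parity_def by (rule nat_rec_empty) (intro def_intros)
lemma parity_succ: "n \<in> nats ==> parity (succ n) = (if parity n = empty then succ empty else empty)"
  unfolding parity_def by (rule nat_rec_succ) (intro def_intros)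
lemma parity_succ_eq_empty: "n \<in> nats ==> parity (succ n) = empty \<longleftrightarrow> parity n \<noteq> empty"
  by (simp add: parity_succ)

lemma even_nat_parity: "even_nat n \<longleftrightarrow> n \<in> nats \<and> parity n = empty"
proof
  assume even: "even_nat n"
  have evens: "ext (sep omega (%n. parity n = empty)) = {n \<in> nats. parity n = empty}"
    by (rule ext_sep) (intro def_intros)
  have "succ (succ m) \<in> ext (sep omega (%n. parity n = empty))"
    if "m \<in> ext (sep omega (%n. parity n = empty))" for m
    using that unfolding evens by (simp add: parity_succ)
  moreover have "empty \<in> ext (sep omega (%n. parity n = empty))" unfolding evens by simp
  ultimately have "n \<in> ext (sep omega (%n. parity n = empty))"
    using even unfolding even_nat_def by blast
  then show "n \<in> nats \<and> parity n = empty" unfolding evens by blast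
next
  assume n: "n \<in> nats \<and> parity n = empty"
  have "n \<in> ext z" if z: "empty \<in> ext z" "\<And>m. m \<in> ext z ==> succ (succ m) \<in> ext z" for z
  proof -
    let ?P = "%n. (parity n = empty --> n \<in> ext z) \<and> (parity n \<noteq> empty --> succ n \<in> ext z)"
    have "?P n"
    proof (rule omega_induct[OF conjunct1[OF n]])
      show "def_pred ?P" by (intro def_intros)
      show "?P n ==> ?P (succ n)" if "n \<in> nats" for n using z(2) parity_succ_eq_empty[OF that] by blast
    qed (use z(1) in simp)
    then show ?thesis using n by blast
  qed
  then show "even_nat n" unfolding even_nat_def using n by blast
qed

lemma ext_reals: "f \<in> ext reals \<longleftrightarrow> func f omega omega" unfolding reals_def by simp

lemma restr_in_fin_seqs:
  assumes "func f omega l" "n \<in> nats"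
  shows "func (restr f n) n l" "restr f n \<in> ext (fin_seqs l)"
proof -
  show "func (restr f n) n l"
    by (rule func_restr[OF assms(1)]) (use omega_trans[OF assms(2)] in blast)
  then show "restr f n \<in> ext (fin_seqs l)" unfolding ext_fin_seqs using assms(2) by blast
qed

lemma restr_succ_eq_snoc:
  assumes f: "func f omega l" and n: "n \<in> nats"
  shows "restr f (succ n) = snoc (restr f n) (f $ n)"
proof (rule func_ext)
  note init = restr_in_fin_seqs(1)[OF f n] and val = ap_in_codomain[OF f n]
  show "func (restr f (succ n)) (succ n) l" by (rule restr_in_fin_seqs(1)[OF f succ_in_omega[OF n]])
  show "func (snoc (restr f n) (f $ n)) (succ n) l" by (rule func_snoc[OF init val])
  fix i assume i: "i \<in> ext (succ n)"
  then consider "i = n" | "i \<in> ext n" by auto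
  then show "restr f (succ n) $ i = snoc (restr f n) (f $ n) $ i" unfolding ap_restr[OF i]
    by cases (simp_all add: snoc_last[OF init val] ap_snoc[OF init val] ap_restr)
qed

lemma course_of_values:
  assumes h: "def_fun h" and X: "\<And>s. s \<in> ext (fin_seqs X) ==> h s \<in> ext X"
  obtains y where "func y omega X" "\<And>n. n \<in> nats ==> y $ n = h (restr y n)"
proof -
  define y where "y = lam omega (ord_rec h)"
  have rec: "def_fun (ord_rec h)" by (intro def_intros def_funD[OF h])
  have step: "ord_rec h n = h (lam n (ord_rec h))" if "n \<in> nats" for n
    by (rule ord_rec_unfold[OF h ordinal_if_in_omega[OF that]])
  have "n \<in> nats --> ord_rec h n \<in> ext X" if "ordinal n" for n
  proof (rule ordinal_induct[OF that]; (intro impI)?)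
    show "def_pred (%n. n \<in> nats --> ord_rec h n \<in> ext X)" by (intro def_intros def_funD[OF rec])
    fix n assume IH: "\<And>m. m \<in> ext n ==> m \<in> nats --> ord_rec h m \<in> ext X"
      and n: "n \<in> nats"
    have "func (lam n (ord_rec h)) n X" by (rule func_lam[OF rec]) (use IH omega_trans[OF n] in blast)
    then show "ord_rec h n \<in> ext X" unfolding step[OF n] by (intro X) (use n in \<open>auto simp: ext_fin_seqs\<close>)
  qed
  then have y: "func y omega X"
    unfolding y_def by (intro func_lam[OF rec]) (use ordinal_if_in_omega in blast)
  have "restr y n = lam n (ord_rec h)" if "n \<in> nats" for n
    by (rule func_ext[OF restr_in_fin_seqs(1)[OF y that] func_lam_img[OF rec]])
      (use omega_trans[OF that] in \<open>simp add: ap_restr ap_lam[OF rec] y_def\<close>)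
  then show thesis using that[OF y] step by (simp add: y_def ap_lam[OF rec])
qed

definition AD :: bool where "AD \<longleftrightarrow> (\<forall>A. ext A \<subseteq> ext reals --> determined omega A)"
definition strategy :: "'a => bool" where "strategy \<sigma> \<longleftrightarrow> func \<sigma> (fin_seqs omega) omega"
definition follows :: "('a => bool) => 'a => 'a => bool" where
  "follows turn \<sigma> y \<longleftrightarrow> (\<forall>n\<in>nats. turn n --> y $ n = \<sigma> $ restr y n)"

lemma strategy_in_omega: "strategy \<sigma> ==> func s n omega ==> n \<in> nats ==> \<sigma> $ s \<in> nats"
  unfolding strategy_def using ap_in_codomain[of \<sigma> "fin_seqs omega" omega s] by (auto simp: ext_fin_seqs)

lemma ap_follows:
  assumes "strategy \<sigma>" "y \<in> ext reals"
  shows "follows (%n. parity n = empty) \<sigma> y \<longleftrightarrow> (\<forall>n. even_nat n --> app y n = app \<sigma> (restr y n))"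
    and "follows (%n. parity n \<noteq> empty) \<sigma> y \<longleftrightarrow> (\<forall>n. odd_nat n --> app y n = app \<sigma> (restr y n))"
proof -
  have y: "func y omega omega" using assms(2) ext_reals by blast
  have "app y n = app \<sigma> (restr y n) \<longleftrightarrow> y $ n = \<sigma> $ restr y n" if "n \<in> nats" for n
    using func_app[OF y that] func_app[OF assms(1)[unfolded strategy_def] restr_in_fin_seqs(2)[OF y that]]
    by simp
  then show "follows (%n. parity n = empty) \<sigma> y \<longleftrightarrow> (\<forall>n. even_nat n --> app y n = app \<sigma> (restr y n))"
    and "follows (%n. parity n \<noteq> empty) \<sigma> y \<longleftrightarrow> (\<forall>n. odd_nat n --> app y n = app \<sigma> (restr y n))"
    unfolding follows_def odd_nat_def even_nat_parity by blast+
qed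

lemma AD_cases:
  assumes AD "ext A \<subseteq> ext reals"
  obtains \<sigma> where "strategy \<sigma>"
    "\<And>y. y \<in> ext reals ==> follows (%n. parity n = empty) \<sigma> y ==> y \<in> ext A"
  | \<sigma> where "strategy \<sigma>"
    "\<And>y. y \<in> ext reals ==> follows (%n. parity n \<noteq> empty) \<sigma> y ==> y \<notin> ext A"
proof -
  have "determined omega A" using assms unfolding AD_def by blast
  then show thesis unfolding determined_def
  proof (elim disjE exE conjE)
    fix \<sigma> assume \<sigma>: "func \<sigma> (fin_seqs omega) omega"
      "\<forall>f. func f omega omega \<and> (\<forall>n. even_nat n --> app f n = app \<sigma> (restr f n)) --> f \<in> ext A"
    then show thesis using that(1)[of \<sigma>] ap_follows(1)[of \<sigma>] unfolding strategy_def ext_reals by blast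
  next
    fix \<sigma> assume \<sigma>: "func \<sigma> (fin_seqs omega) omega"
      "\<forall>f. func f omega omega \<and> (\<forall>n. odd_nat n --> app f n = app \<sigma> (restr f n)) --> f \<notin> ext A"
    then show thesis using that(2)[of \<sigma>] ap_follows(2)[of \<sigma>] unfolding strategy_def ext_reals by blast
  qed
qed

definition play :: "('a => bool) => 'a => 'a => 'a => bool" where
  "play turn \<sigma> z y \<longleftrightarrow> y \<in> ext reals \<and>
    (\<forall>n\<in>nats. y $ n = (if turn n then \<sigma> $ restr y n else z $ n))"

lemma play_follows: "play turn \<sigma> z y ==> follows turn \<sigma> y"
  unfolding play_def follows_def by simp
lemma play_real: "play turn \<sigma> z y ==> func y omega omega"
  unfolding play_def ext_reals by blast
lemma definable_play:
  assumes "def_pred turn" "def_term t" "def_term u" "def_term v"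
  shows "definable (%e. play turn (t e) (u e) (v e))"
proof -
  have "def_pred3 (play turn)"
    by (intro def_pred3I, unfold play_def, intro def_intros def_predD[OF assms(1)])
  then show ?thesis by (rule def_pred3D) fact+
qed

lemma play_exists:
  assumes turn: "def_pred turn" and "strategy \<sigma>" "z \<in> ext reals"
  obtains y where "play turn \<sigma> z y"
proof -
  let ?move = "%s. if turn (dom s) then \<sigma> $ s else z $ dom s"
  have move: "def_fun ?move" by (intro def_intros def_predD[OF turn])
  have legal: "?move s \<in> nats" if s: "s \<in> ext (fin_seqs omega)" for s
  proof -
    obtain n where n: "n \<in> nats" "func s n omega" using s unfolding ext_fin_seqs by blast
    then show ?thesis
      using strategy_in_omega[OF assms(2) n(2,1)] ap_in_codomain[of z omega omega n] assms(3)
        func_dom[OF n(2)]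
      unfolding ext_reals by simp
  qed
  obtain y where y: "func y omega omega" "\<And>n. n \<in> nats ==> y $ n = ?move (restr y n)"
    by (rule course_of_values[OF move legal], assumption) (rule that)
  then have "play turn \<sigma> z y"
    unfolding play_def ext_reals using func_dom[OF restr_in_fin_seqs(1)[OF y(1)]] by simp
  then show thesis by (rule that)
qed

lemma play_agree:
  assumes y: "play turn \<sigma> z y" "play turn \<sigma> z' y'" and m: "m \<in> nats"
    and eq: "\<And>i. i \<in> ext m ==> \<not> turn i ==> (\<And>j. j \<in> ext i ==> y $ j = y' $ j) ==> z $ i = z' $ i"
    and i: "i \<in> ext m"
  shows "y $ i = y' $ i"
proof -
  have "i \<in> ext m --> y $ i = y' $ i"
  proof (rule ordinal_induct[OF ordinal_mem[OF ordinal_if_in_omega[OF m] i]])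
    show "def_pred (%i. i \<in> ext m --> y $ i = y' $ i)" by (intro def_intros)
    fix b assume IH: "\<And>c. c \<in> ext b ==> c \<in> ext m --> y $ c = y' $ c"
    show "b \<in> ext m --> y $ b = y' $ b"
    proof
      assume b: "b \<in> ext m"
      have omega: "b \<in> nats" by (rule omega_trans[OF m b])
      have agree: "y $ j = y' $ j" if "j \<in> ext b" for j
        using IH that ordinal_trans[OF ordinal_if_in_omega[OF m] b] by blast
      then have "restr y b = restr y' b"
        by (intro func_ext[OF restr_in_fin_seqs(1)[OF play_real[OF y(1)] omega]
            restr_in_fin_seqs(1)[OF play_real[OF y(2)] omega]]) (simp add: ap_restr)
      then show "y $ b = y' $ b"
        using y omega eq[OF b _ agree] unfolding play_def by simp
    qed
  qed
  then show ?thesis using i by blast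
qed
section \<open>Category in countable partial orders\<close>

definition descending_seq :: "'a => 'a => 'a => bool" where
  "descending_seq P r f \<longleftrightarrow> func f omega P \<and> (\<forall>n\<in>nats. opair (f $ succ n) (f $ n) \<in> ext r)"
definition dense_set :: "'a => 'a => 'a => bool" where
  "dense_set P r D \<longleftrightarrow> ext D \<subseteq> ext P \<and> (\<forall>p\<in>ext P. \<exists>d\<in>ext D. opair d p \<in> ext r)"
definition seq_meets :: "'a => 'a => 'a => bool" where
  "seq_meets r f D \<longleftrightarrow> (\<exists>n\<in>nats. \<exists>d\<in>ext D. opair (f $ n) d \<in> ext r)"
definition seq_enters :: "'a => 'a => 'a => bool" where
  "seq_enters r f p \<longleftrightarrow> (\<exists>n\<in>nats. opair (f $ n) p \<in> ext r)"
definition countable_dense_family :: "'a => 'a => 'a => bool" where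
  "countable_dense_family P r DD \<longleftrightarrow> enumerable DD \<and> (\<forall>D\<in>ext DD. dense_set P r D)"
definition generic_seq :: "'a => 'a => 'a => 'a => bool" where
  "generic_seq P r DD f \<longleftrightarrow> descending_seq P r f \<and> (\<forall>D\<in>ext DD. seq_meets r f D)"
definition forces_in :: "'a => 'a => 'a => 'a => bool" where
  "forces_in P r p W \<longleftrightarrow> (\<exists>DD. countable_dense_family P r DD \<and> (\<forall>f. generic_seq P r DD f \<and> seq_enters r f p -->
      f \<in> ext W))"
definition seq_equivalent :: "'a => 'a => 'a => bool" where
  "seq_equivalent r f g \<longleftrightarrow> (\<forall>n\<in>nats. \<exists>m\<in>nats. opair (g $ m) (f $ n) \<in> ext r) \<and>
     (\<forall>n\<in>nats. \<exists>m\<in>nats. opair (f $ m) (g $ n) \<in> ext r)"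
definition invariant_set :: "'a => 'a => 'a => bool" where
  "invariant_set P r W \<longleftrightarrow>
      (\<forall>f g. descending_seq P r f \<and> descending_seq P r g \<and> seq_equivalent r f g \<and> f \<in> ext W --> g \<in> ext W)"
definition seq_compl :: "'a => 'a => 'a" where "seq_compl P W = sep (funs omega P) (%f. f \<notin> ext W)"

lemma def_pred3_descending_seq[THEN def_pred3D, def_intros]: "def_pred3 descending_seq"
  by (intro def_pred3I, unfold descending_seq_def, intro def_intros)
lemma def_pred3_dense_set[THEN def_pred3D, def_intros]: "def_pred3 dense_set"
  by (intro def_pred3I, unfold dense_set_def, intro def_intros)
lemma def_pred3_seq_meets[THEN def_pred3D, def_intros]: "def_pred3 seq_meets"
  by (intro def_pred3I, unfold seq_meets_def, intro def_intros)
lemma def_pred3_seq_enters[THEN def_pred3D, def_intros]: "def_pred3 seq_enters"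
  by (intro def_pred3I, unfold seq_enters_def, intro def_intros)
lemma def_pred3_countable_dense_family[THEN def_pred3D, def_intros]: "def_pred3 countable_dense_family"
  by (intro def_pred3I, unfold countable_dense_family_def, intro def_intros)
lemma def_pred4_generic_seq[THEN def_pred4D, def_intros]: "def_pred4 generic_seq"
  by (intro def_pred4I, unfold generic_seq_def, intro def_intros)
lemma def_pred4_forces_in[THEN def_pred4D, def_intros]: "def_pred4 forces_in"
  by (intro def_pred4I, unfold forces_in_def, intro def_intros)
lemma mem_seq_compl: "f \<in> ext (seq_compl P W) \<longleftrightarrow> func f omega P \<and> f \<notin> ext W"
  unfolding seq_compl_def by (subst ext_sep) (intro def_intros, simp)
lemma seq_meets_iff: "seq_meets r f D \<longleftrightarrow> (\<exists>d\<in>ext D. seq_enters r f d)"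
  unfolding seq_meets_def seq_enters_def by blast
lemma seq_equivalent_sym: "seq_equivalent r f g ==> seq_equivalent r g f"
  unfolding seq_equivalent_def by blast

definition prod_le :: "'a => 'a => 'a" where
  "prod_le P r = sep (cprod (cprod P P) (cprod P P)) (%z.
    opair (pfst (pfst z)) (pfst (psnd z)) \<in> ext r \<and> opair (psnd (pfst z)) (psnd (psnd z)) \<in> ext r)"
lemma opair_prod_le:
  "opair (opair a b) (opair c d) \<in> ext (prod_le P r) \<longleftrightarrow>
    a \<in> ext P \<and> b \<in> ext P \<and> c \<in> ext P \<and> d \<in> ext P \<and> opair a c \<in> ext r \<and> opair b d \<in> ext r"
  unfolding prod_le_def by (subst ext_sep) (intro def_intros, auto)

definition pair_seq :: "'a => 'a => 'a" where "pair_seq f h = lam omega (%n. opair (f $ n) (h $ n))"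
definition left_seq :: "'a => 'a" where "left_seq g = lam omega (%n. pfst (g $ n))"
definition right_seq :: "'a => 'a" where "right_seq g = lam omega (%n. psnd (g $ n))"
lemma def_fun2_pair_seq[THEN def_fun2D, def_intros]: "def_fun2 pair_seq"
  by (intro def_fun2I, unfold pair_seq_def, intro def_intros)
lemma def_fun_left_seq[THEN def_funD, def_intros]: "def_fun left_seq"
  by (intro def_funI, unfold left_seq_def, intro def_intros)
lemma def_fun_right_seq[THEN def_funD, def_intros]: "def_fun right_seq"
  by (intro def_funI, unfold right_seq_def, intro def_intros)
lemma ap_pair_seq: "n \<in> nats ==> pair_seq f h $ n = opair (f $ n) (h $ n)"
  unfolding pair_seq_def by (rule ap_lam) (intro def_intros)
lemma ap_left_seq: "n \<in> nats ==> left_seq g $ n = pfst (g $ n)"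
  unfolding left_seq_def by (rule ap_lam) (intro def_intros)
lemma ap_right_seq: "n \<in> nats ==> right_seq g $ n = psnd (g $ n)"
  unfolding right_seq_def by (rule ap_lam) (intro def_intros)

lemma omega_max:
  assumes "n \<in> nats" "m \<in> nats"
  obtains k where "k \<in> nats" "n \<in> ext (succ k)" "m \<in> ext (succ k)"
  using omega_linear[OF assms] that[OF assms(1)] that[OF assms(2)] by auto

end

locale forcing = zf_model +
  fixes P r :: 'a
  assumes refl: "p \<in> ext P ==> opair p p \<in> ext r"
    and trans: "p \<in> ext P ==> q \<in> ext P ==> s \<in> ext P ==>
      opair p q \<in> ext r ==> opair q s \<in> ext r ==> opair p s \<in> ext r"
    and enumerable_conds: "enumerable P"
begin

abbreviation below_eq (infix "\<preceq>" 50) where "p \<preceq> q \<equiv> opair p q \<in> ext r"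
abbreviation descending where "descending \<equiv> descending_seq P r"
abbreviation dense where "dense \<equiv> dense_set P r"
abbreviation meets where "meets \<equiv> seq_meets r"
abbreviation enters where "enters \<equiv> seq_enters r"
abbreviation dense_family where "dense_family \<equiv> countable_dense_family P r"
abbreviation generic where "generic \<equiv> generic_seq P r"
abbreviation forces where "forces \<equiv> forces_in P r"
abbreviation equivalent where "equivalent \<equiv> seq_equivalent r"
abbreviation invariant where "invariant \<equiv> invariant_set P r"

lemma descending_in: "descending f ==> n \<in> nats ==> f $ n \<in> ext P"
  unfolding descending_seq_def using ap_in_codomain by blast
lemma descending_func: "descending f ==> func f omega P"
  unfolding descending_seq_def by blast

lemma descending_antimono:
  assumes f: "descending f" and "n \<in> nats" "m \<in> ext (succ n)"
  shows "f $ n \<preceq> f $ m"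
proof -
  have "\<forall>m\<in>ext (succ n). f $ n \<preceq> f $ m"
  proof (rule omega_induct[OF assms(2)])
    show "def_pred (%n. \<forall>m\<in>ext (succ n). f $ n \<preceq> f $ m)" by (intro def_intros)
    show "\<forall>m\<in>ext (succ empty). f $ empty \<preceq> f $ m"
      using refl[OF descending_in[OF f empty_in_omega]] by simp
    fix n assume n: "n \<in> nats" and IH: "\<forall>m\<in>ext (succ n). f $ n \<preceq> f $ m"
    have step: "f $ succ n \<preceq> f $ n" using f n unfolding descending_seq_def by blast
    note in_P = descending_in[OF f succ_in_omega[OF n]] descending_in[OF f n]
    show "\<forall>m\<in>ext (succ (succ n)). f $ succ n \<preceq> f $ m"
    proof
      fix m assume "m \<in> ext (succ (succ n))"
      then consider "m = succ n" | "m \<in> ext (succ n)" by auto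
      then show "f $ succ n \<preceq> f $ m"
      proof cases
        case 1
        then show ?thesis using refl[OF in_P(1)] by simp
      next
        case 2
        have "f $ m \<in> ext P" by (rule descending_in[OF f omega_trans[OF succ_in_omega[OF n] 2]])
        then show ?thesis using trans[OF in_P _ step] IH 2 by blast
      qed
    qed
  qed
  then show ?thesis using assms(3) by blast
qed

lemma enters_self: "descending f ==> n \<in> nats ==> enters f (f $ n)"
  unfolding seq_enters_def using refl[OF descending_in] by blast

lemma enters_mono:
  assumes "descending f" "p \<in> ext P" "q \<in> ext P" "p \<preceq> q" "enters f p"
  shows "enters f q"
  using assms(5) trans[OF descending_in[OF assms(1)] assms(2,3) _ assms(4)]
  unfolding seq_enters_def by blast

lemma enters_common:
  assumes f: "descending f" and "p \<in> ext P" "q \<in> ext P" "enters f p" "enters f q"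
  obtains k where "k \<in> nats" "f $ k \<preceq> p" "f $ k \<preceq> q"
proof -
  obtain n m where n: "n \<in> nats" "f $ n \<preceq> p" and m: "m \<in> nats" "f $ m \<preceq> q"
    using assms(4,5) unfolding seq_enters_def by blast
  obtain k where k: "k \<in> nats" "n \<in> ext (succ k)" "m \<in> ext (succ k)" by (rule omega_max[OF n(1) m(1)])
  note in_P = descending_in[OF f]
  show thesis
  proof (rule that[OF k(1)])
    show "f $ k \<preceq> p"
      by (rule trans[OF in_P[OF k(1)] in_P[OF n(1)] assms(2) descending_antimono[OF f k(1,2)] n(2)])
    show "f $ k \<preceq> q"
      by (rule trans[OF in_P[OF k(1)] in_P[OF m(1)] assms(3) descending_antimono[OF f k(1,3)] m(2)])
  qed
qed

lemma generic_descending: "generic DD f ==> descending f"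
  unfolding generic_seq_def by blast
lemma generic_meets: "generic DD f ==> D \<in> ext DD ==> meets f D"
  unfolding generic_seq_def by blast
lemma generic_cup: "generic (cup D E) f \<longleftrightarrow> generic D f \<and> generic E f"
  unfolding generic_seq_def by auto
lemma dense_family_cup: "dense_family D ==> dense_family E ==> dense_family (cup D E)"
  unfolding countable_dense_family_def using enumerable_cup by auto
lemma dense_family_sing: "dense D ==> dense_family (upair D D)"
  unfolding countable_dense_family_def using enumerable_singleton by auto
lemma dense_family_img:
  assumes "def_fun F" "enumerable I" "\<And>i. i \<in> ext I ==> dense (F i)"
  shows "dense_family (img F I)"
  unfolding countable_dense_family_def ext_img[OF assms(1)]
  using enumerable_img[OF assms(2,1)] assms(3) by blast
lemma dense_all: "dense P"
  unfolding dense_set_def using refl by blast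

lemma generic_exists:
  assumes DD: "dense_family DD" and p: "p \<in> ext P"
  obtains f where "generic DD f" "f $ empty = p"
proof -
  obtain e where e: "enum e P" by (rule enumerableE[OF enumerable_conds])
  have "enumerable DD" using DD unfolding countable_dense_family_def by blast
  then obtain d where d: "enum d DD" by (rule enumerableE)
  define below where "below = (%n x. e $ least_nat (%k. e $ k \<preceq> x \<and> e $ k \<in> ext (d $ n)))"
  have F_below: "def_fun2 below" unfolding below_def by (intro def_intros)
  have below: "below n x \<in> ext P" "below n x \<preceq> x" "below n x \<in> ext (d $ n)"
    if n: "n \<in> nats" and x: "x \<in> ext P" for n x
  proof -
    have "dense (d $ n)" using DD enum_in[OF d n] unfolding countable_dense_family_def by blast
    then obtain y where y: "y \<in> ext (d $ n)" "y \<preceq> x" "y \<in> ext P" using x unfolding dense_set_def by blast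
    obtain k where k: "k \<in> nats" "e $ k = y" by (rule enum_surj[OF e y(3)])
    have "def_pred (%k. e $ k \<preceq> x \<and> e $ k \<in> ext (d $ n))" by (intro def_intros)
    from least_natI(1,2)[OF this k(1)]
    show "below n x \<in> ext P" "below n x \<preceq> x" "below n x \<in> ext (d $ n)"
      using y k(2) enum_in[OF e] unfolding below_def by simp_all
  qed
  define N where "N = nat_rec p below"
  have N: "def_fun N" unfolding N_def by (intro def_intros def_fun2D[OF F_below])
  have N_0: "N empty = p" unfolding N_def by (rule nat_rec_empty[OF F_below])
  have N_S: "N (succ n) = below n (N n)" if "n \<in> nats" for n
    unfolding N_def by (rule nat_rec_succ[OF F_below that])
  have N_in: "N n \<in> ext P" if "n \<in> nats" for n
    by (rule omega_induct[OF that, where P="%n. N n \<in> ext P"])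
      (intro def_intros def_funD[OF N], use N_0 p N_S below(1) in auto)
  define f where "f = lam omega N"
  have ap_f: "f $ n = N n" if "n \<in> nats" for n unfolding f_def by (rule ap_lam[OF N that])
  have "func f omega P" unfolding f_def by (rule func_lam[OF N N_in])
  then have f: "descending f"
    unfolding descending_seq_def using below(2)[OF _ N_in] by (auto simp: ap_f N_S)
  have "meets f D" if D: "D \<in> ext DD" for D
  proof -
    obtain n where n: "n \<in> nats" "d $ n = D" by (rule enum_surj[OF d D])
    have "f $ succ n \<in> ext D" using below(3)[OF n(1) N_in[OF n(1)]] n by (simp add: ap_f N_S)
    then show ?thesis
      unfolding seq_meets_def using refl[OF descending_in[OF f]] succ_in_omega[OF n(1)] by blast
  qed
  then have "generic DD f" unfolding generic_seq_def using f by blast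
  then show thesis using that ap_f[OF empty_in_omega] N_0 by simp
qed

lemma forcesI:
  "dense_family DD ==> (\<And>f. generic DD f ==> enters f p ==> f \<in> ext W) ==> forces p W"
  unfolding forces_in_def by blast
lemma forcesE:
  assumes "forces p W"
  obtains DD where "dense_family DD" "\<And>f. generic DD f ==> enters f p ==> f \<in> ext W"
  using assms unfolding forces_in_def by blast

lemma forces_mono:
  assumes "p \<in> ext P" "q \<in> ext P" "p \<preceq> q" "forces q W"
  shows "forces p W"
  using assms(4) enters_mono[OF _ assms(1-3)] unfolding forces_in_def generic_seq_def by blast

lemma forces_imp_generic:
  assumes E: "dense_family E" and W: "forces p W"
    and U: "\<And>f. generic E f ==> enters f p ==> f \<in> ext W ==> f \<in> ext U"
  shows "forces p U"
proof -
  obtain D where D: "dense_family D" "\<And>f. generic D f ==> enters f p ==> f \<in> ext W"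
    by (rule forcesE[OF W]) (rule that)
  show ?thesis
    by (rule forcesI[OF dense_family_cup[OF D(1) E]]) (use D(2) U in \<open>simp add: generic_cup\<close>)
qed

lemma forces_imp2:
  assumes "forces p W" "forces p V"
    and "\<And>f. descending f ==> f \<in> ext W ==> f \<in> ext V ==> f \<in> ext U"
  shows "forces p U"
proof -
  obtain D where D: "dense_family D" "\<And>f. generic D f ==> enters f p ==> f \<in> ext W"
    by (rule forcesE[OF assms(1)]) (rule that)
  show ?thesis
    by (rule forces_imp_generic[OF D(1) assms(2)]) (use D(2) assms(3) generic_descending in blast)
qed

lemma forces_imp:
  "forces p W ==> (\<And>f. descending f ==> f \<in> ext W ==> f \<in> ext U) ==> forces p U"
  using forces_imp2[of p W W U] by blast

lemma forces_generic:
  assumes W: "forces p W" and V: "forces q V" and DD: "dense_family DD"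
    and "s \<in> ext P" "s \<preceq> p" "s \<preceq> q"
  obtains f where "generic DD f" "f $ empty = s" "f \<in> ext W" "f \<in> ext V"
proof -
  obtain D where D: "dense_family D" "\<And>f. generic D f ==> enters f p ==> f \<in> ext W"
    by (rule forcesE[OF W]) (rule that)
  obtain E where E: "dense_family E" "\<And>f. generic E f ==> enters f q ==> f \<in> ext V"
    by (rule forcesE[OF V]) (rule that)
  obtain f where f: "generic (cup DD (cup D E)) f" "f $ empty = s"
    by (rule generic_exists[OF dense_family_cup[OF DD dense_family_cup[OF D(1) E(1)]] assms(4)])
  have "enters f p" "enters f q" unfolding seq_enters_def using f(2) assms(5,6) empty_in_omega by metis+
  then show thesis using that[of f] f D(2) E(2) unfolding generic_cup by blast
qed

lemma forces_both:
  assumes "forces p W" "forces p V" "dense_family DD" "p \<in> ext P"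
  obtains f where "generic DD f" "f $ empty = p" "f \<in> ext W" "f \<in> ext V"
  using forces_generic[OF assms refl[OF assms(4)] refl[OF assms(4)]] .

lemma invariant_compl: "invariant W ==> invariant (seq_compl P W)"
  unfolding invariant_set_def mem_seq_compl using seq_equivalent_sym descending_func by meson

lemma not_forces_compl:
  assumes "forces p W" "forces q (seq_compl P W)" "p \<in> ext P" "p \<preceq> q"
  shows False
  by (rule forces_generic[OF assms(1,2) dense_family_sing[OF dense_all] assms(3) refl[OF assms(3)] assms(4)])
    (simp add: mem_seq_compl)
text \<open>The Banach--Mazur game below \<open>p\<close>: a move is the index of a condition, and a move that is not
  below the current condition counts as a pass, so that every sequence of moves is legal.\<close>

context
  fixes e p
  assumes e: "enum e P" and p: "p \<in> ext P"
begin

definition cond_after :: "'a => 'a => 'a" where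
  "cond_after y n = nat_rec p (%n x. if e $ (y $ n) \<preceq> x then e $ (y $ n) else x) n"
lemma def_fun2_cond_after[THEN def_fun2D, def_intros]: "def_fun2 cond_after"
  by (intro def_fun2I, unfold cond_after_def, intro def_intros)

lemma cond_after_empty: "cond_after y empty = p"
  unfolding cond_after_def by (rule nat_rec_empty) (intro def_intros)
lemma cond_after_succ:
  "n \<in> nats ==> cond_after y (succ n) =
    (if e $ (y $ n) \<preceq> cond_after y n then e $ (y $ n) else cond_after y n)"
  unfolding cond_after_def by (rule nat_rec_succ) (intro def_intros)

lemma cond_after_in:
  assumes "n \<in> nats" "\<And>i. i \<in> ext n ==> y $ i \<in> nats"
  shows "cond_after y n \<in> ext P"
proof -
  have "(\<forall>i\<in>ext n. y $ i \<in> nats) --> cond_after y n \<in> ext P"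
  proof (rule omega_induct[OF assms(1)])
    show "def_pred (%n. (\<forall>i\<in>ext n. y $ i \<in> nats) --> cond_after y n \<in> ext P)" by (intro def_intros)
  qed (use enum_in[OF e] in \<open>auto simp: cond_after_empty cond_after_succ p\<close>)
  then show ?thesis using assms(2) by blast
qed

lemma cond_after_cong:
  assumes "n \<in> nats" "\<And>i. i \<in> ext n ==> y $ i = z $ i"
  shows "cond_after y n = cond_after z n"
proof -
  have "(\<forall>i\<in>ext n. y $ i = z $ i) --> cond_after y n = cond_after z n"
  proof (rule omega_induct[OF assms(1)])
    show "def_pred (%n. (\<forall>i\<in>ext n. y $ i = z $ i) --> cond_after y n = cond_after z n)"
      by (intro def_intros)
  qed (auto simp: cond_after_empty cond_after_succ)
  then show ?thesis using assms(2) by blast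
qed

lemma cond_after_descending:
  assumes "y \<in> ext reals"
  shows "descending (lam omega (cond_after y))"
proof -
  have definable: "def_fun (cond_after y)" by (intro def_intros)
  have "func y omega omega" using assms unfolding ext_reals .
  then have moves: "\<And>n i. n \<in> nats ==> i \<in> ext n ==> y $ i \<in> nats"
    using ap_in_codomain omega_trans by blast
  note in_P = cond_after_in[OF _ moves]
  have "func (lam omega (cond_after y)) omega P" by (rule func_lam[OF definable in_P])
  moreover have "cond_after y (succ n) \<preceq> cond_after y n" if "n \<in> nats" for n
    using refl[OF in_P[OF that that]] by (simp add: cond_after_succ[OF that])
  ultimately show ?thesis unfolding descending_seq_def by (simp add: ap_lam[OF definable])
qed

definition last_cond :: "'a => 'a" where "last_cond s = cond_after s (dom s)"
lemma def_fun_last_cond[THEN def_funD, def_intros]: "def_fun last_cond"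
  by (intro def_funI, unfold last_cond_def, intro def_intros)

lemma last_cond_empty: "last_cond empty = p"
  unfolding last_cond_def func_dom[OF func_empty] by (rule cond_after_empty)
lemma last_cond_in: "func s n omega ==> n \<in> nats ==> last_cond s \<in> ext P"
  unfolding last_cond_def using func_dom cond_after_in ap_in_codomain by metis
lemma last_cond_restr:
  "func y omega omega ==> n \<in> nats ==> last_cond (restr y n) = cond_after y n"
  unfolding last_cond_def func_dom[OF restr_in_fin_seqs(1)]
  by (rule cond_after_cong, assumption) (rule ap_restr)

lemma last_cond_snoc:
  assumes s: "func s n omega" and n: "n \<in> nats" and j: "j \<in> nats"
  shows "last_cond (snoc s j) = (if e $ j \<preceq> last_cond s then e $ j else last_cond s)"
    and "last_cond (snoc s j) \<preceq> last_cond s"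
proof -
  have "cond_after (snoc s j) n = cond_after s n"
    by (rule cond_after_cong[OF n]) (rule ap_snoc[OF s j])
  then show eq: "last_cond (snoc s j) = (if e $ j \<preceq> last_cond s then e $ j else last_cond s)"
    unfolding last_cond_def func_dom[OF s] func_dom[OF func_snoc[OF s j]] cond_after_succ[OF n]
    by (simp add: snoc_last[OF s j])
  show "last_cond (snoc s j) \<preceq> last_cond s"
    unfolding eq using refl[OF last_cond_in[OF s n]] by simp
qed

context
  fixes \<sigma> Opp
  assumes \<sigma>: "strategy \<sigma>" and Opp: "def_pred Opp"
    and alternate: "\<And>n. n \<in> nats ==> Opp (succ n) \<longleftrightarrow> \<not> Opp n"
begin

definition reply :: "'a => 'a => 'a" where
  "reply s j = last_cond (snoc (snoc s j) (\<sigma> $ snoc s j))"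
lemma def_fun2_reply[THEN def_fun2D, def_intros]: "def_fun2 reply"
  by (intro def_fun2I, unfold reply_def, intro def_intros)

lemma reply_props:
  assumes s: "func s n omega" and n: "n \<in> nats" and j: "j \<in> nats" "e $ j \<preceq> last_cond s"
  shows "reply s j \<preceq> e $ j" "reply s j \<in> ext P"
proof -
  note moved = func_snoc[OF s j(1)]
  note answer = strategy_in_omega[OF \<sigma> moved succ_in_omega[OF n]]
  have "last_cond (snoc s j) = e $ j" unfolding last_cond_snoc(1)[OF s n j(1)] using j(2) by simp
  then show "reply s j \<preceq> e $ j"
    unfolding reply_def using last_cond_snoc(2)[OF moved succ_in_omega[OF n] answer] by simp
  show "reply s j \<in> ext P"
    unfolding reply_def
    by (rule last_cond_in[OF func_snoc[OF moved answer] succ_in_omega[OF succ_in_omega[OF n]]])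
qed

definition reply_dense :: "'a => 'a => 'a" where
  "reply_dense s t = sep P (%x.
    (\<exists>j\<in>nats. e $ j \<preceq> t \<and> e $ j \<preceq> last_cond s \<and> x \<preceq> reply s j) \<or>
    \<not> (\<exists>z\<in>ext P. z \<preceq> x \<and> z \<preceq> t \<and> z \<preceq> last_cond s))"
lemma def_fun2_reply_dense[THEN def_fun2D, def_intros]: "def_fun2 reply_dense"
  by (intro def_fun2I, unfold reply_dense_def, intro def_intros)
lemma mem_reply_dense:
  "x \<in> ext (reply_dense s t) \<longleftrightarrow> x \<in> ext P \<and>
    ((\<exists>j\<in>nats. e $ j \<preceq> t \<and> e $ j \<preceq> last_cond s \<and> x \<preceq> reply s j) \<or>
    \<not> (\<exists>z\<in>ext P. z \<preceq> x \<and> z \<preceq> t \<and> z \<preceq> last_cond s))"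
  unfolding reply_dense_def by (subst ext_sep) (intro def_intros, simp)

lemma dense_reply_dense:
  assumes s: "func s n omega" "n \<in> nats"
  shows "dense (reply_dense s t)"
  unfolding dense_set_def
proof (intro conjI ballI subsetI)
  show "x \<in> ext P" if "x \<in> ext (reply_dense s t)" for x using that mem_reply_dense by blast
  fix x assume x: "x \<in> ext P"
  show "\<exists>d\<in>ext (reply_dense s t). d \<preceq> x"
  proof (cases "\<exists>z\<in>ext P. z \<preceq> x \<and> z \<preceq> t \<and> z \<preceq> last_cond s")
    case True
    then obtain z where z: "z \<in> ext P" "z \<preceq> x" "z \<preceq> t" "z \<preceq> last_cond s" by blast
    obtain j where j: "j \<in> nats" "e $ j = z" by (rule enum_surj[OF e z(1)])
    have rep: "reply s j \<preceq> z" "reply s j \<in> ext P" using reply_props[OF s j(1)] j(2) z(4) by simp_all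
    have "reply s j \<in> ext (reply_dense s t)"
      unfolding mem_reply_dense using rep(2) j z refl[OF rep(2)] by (intro conjI disjI1 bexI[of _ j]) auto
    then show ?thesis using trans[OF rep(2) z(1) x rep(1) z(2)] by blast
  next
    case False
    then have "x \<in> ext (reply_dense s t)" unfolding mem_reply_dense using x by blast
    then show ?thesis using refl[OF x] by blast
  qed
qed

definition reply_family :: 'a where
  "reply_family = img (%z. reply_dense (pfst z) (psnd z)) (cprod (fin_seqs omega) P)"
lemma reply_family_props:
  shows dense_family_reply: "dense_family reply_family"
    and mem_reply_family:
      "s \<in> ext (fin_seqs omega) ==> t \<in> ext P ==> reply_dense s t \<in> ext reply_family"
proof -
  have definable: "def_fun (%z. reply_dense (pfst z) (psnd z))" by (intro def_intros)
  show "dense_family reply_family" unfolding reply_family_def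
    by (rule dense_family_img[OF definable enumerable_cprod[OF enumerable_fin_seqs[OF enumerable_omega] enumerable_conds]])
      (auto simp: ext_fin_seqs intro: dense_reply_dense)
  show "reply_dense s t \<in> ext reply_family" if "s \<in> ext (fin_seqs omega)" "t \<in> ext P"
    unfolding reply_family_def ext_img[OF definable]
    by (rule image_eqI[of _ _ "opair s t"]) (use that in auto)
qed

context
  fixes f
  assumes f: "generic reply_family f"
begin

definition good_move :: "'a => 'a => bool" where
  "good_move s j \<longleftrightarrow> e $ j \<preceq> f $ dom s \<and> e $ j \<preceq> last_cond s \<and> enters f (reply s j)"
lemma def_pred2_good_move[THEN def_pred2D, def_intros]: "def_pred2 good_move"
  by (intro def_pred2I, unfold good_move_def, intro def_intros)

lemma good_move_exists:
  assumes s: "func s n omega" and n: "n \<in> nats" and entered: "enters f (last_cond s)"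
  obtains j where "j \<in> nats" "good_move s j"
proof -
  note desc = generic_descending[OF f]
  note fn_in = descending_in[OF desc n] and last = last_cond_in[OF s n]
  have "s \<in> ext (fin_seqs omega)" unfolding ext_fin_seqs using s n by blast
  then have "meets f (reply_dense s (f $ n))" by (intro generic_meets[OF f] mem_reply_family fn_in)
  then obtain m d where m: "m \<in> nats" "d \<in> ext (reply_dense s (f $ n))" "f $ m \<preceq> d"
    unfolding seq_meets_def by blast
  have d: "d \<in> ext P" "enters f d" using m mem_reply_dense unfolding seq_enters_def by blast+
  obtain k where k: "k \<in> nats" "f $ k \<preceq> d" "f $ k \<preceq> last_cond s"
    by (rule enters_common[OF desc d(1) last d(2) entered])
  note fk_in = descending_in[OF desc k(1)]
  obtain l where l: "l \<in> nats" "f $ l \<preceq> f $ k" "f $ l \<preceq> f $ n"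
    by (rule enters_common[OF desc fk_in fn_in enters_self[OF desc k(1)] enters_self[OF desc n]])
  note fl_in = descending_in[OF desc l(1)]
  have "f $ l \<preceq> d" "f $ l \<preceq> last_cond s"
    using trans[OF fl_in fk_in d(1) l(2) k(2)] trans[OF fl_in fk_in last l(2) k(3)] by blast+
  then obtain j where j: "j \<in> nats" "e $ j \<preceq> f $ n" "e $ j \<preceq> last_cond s" "d \<preceq> reply s j"
    using m(2) fl_in l(3) unfolding mem_reply_dense by blast
  have "enters f (reply s j)" by (rule enters_mono[OF desc d(1) reply_props(2)[OF s n j(1,3)] j(4) d(2)])
  then show thesis using that[OF j(1)] j(2,3) func_dom[OF s] unfolding good_move_def by simp
qed

lemma shadow_exists:
  obtains y where "y \<in> ext reals" "follows (%n. \<not> Opp n) \<sigma> y"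
    "\<And>n. n \<in> nats ==> Opp n ==> enters f (cond_after y n) ==> good_move (restr y n) (y $ n)"
proof -
  define move where "move = (%s. if Opp (dom s) then least_nat (good_move s) else \<sigma> $ s)"
  have F_move: "def_fun move" unfolding move_def by (intro def_intros def_predD[OF Opp])
  have F_good: "def_pred (good_move s)" for s by (intro def_intros)
  have legal: "move s \<in> nats" if "s \<in> ext (fin_seqs omega)" for s
    using strategy_in_omega[OF \<sigma>] that least_nat_in_omega[OF F_good] unfolding move_def ext_fin_seqs by auto
  then obtain y where y: "func y omega omega" "\<And>n. n \<in> nats ==> y $ n = move (restr y n)"
    using course_of_values[OF F_move, where X=omega] legal by blast
  have move: "y $ n = (if Opp n then least_nat (good_move (restr y n)) else \<sigma> $ restr y n)"
    if "n \<in> nats" for n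
    using y(2)[OF that] func_dom[OF restr_in_fin_seqs(1)[OF y(1) that]] unfolding move_def by simp
  show thesis
  proof (rule that)
    show "y \<in> ext reals" using y(1) ext_reals by blast
    show "follows (%n. \<not> Opp n) \<sigma> y" unfolding follows_def using move by simp
    fix n assume n: "n \<in> nats" "Opp n" "enters f (cond_after y n)"
    obtain j where "j \<in> nats" "good_move (restr y n) j"
      by (rule good_move_exists[OF restr_in_fin_seqs(1)[OF y(1) n(1)] n(1)])
        (simp add: last_cond_restr[OF y(1) n(1)] n(3))
    from least_natI(2)[OF F_good this] show "good_move (restr y n) (y $ n)"
      using move[OF n(1)] n(2) by simp
  qed
qed

context
  fixes y
  assumes y: "y \<in> ext reals" and obeys: "follows (%n. \<not> Opp n) \<sigma> y"
    and good: "\<And>n. n \<in> nats ==> Opp n ==> enters f (cond_after y n) ==> good_move (restr y n) (y $ n)"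
    and start: "enters f (cond_after y (if Opp empty then empty else succ empty))"
begin

lemma shadow_descending: "descending (lam omega (cond_after y))"
  by (rule cond_after_descending[OF y])
lemma ap_shadow: "n \<in> nats ==> lam omega (cond_after y) $ n = cond_after y n"
  by (rule ap_lam) (intro def_intros)
lemma shadow_in: "n \<in> nats ==> cond_after y n \<in> ext P"
  using descending_in[OF shadow_descending] ap_shadow by simp
lemma shadow_enters_prev:
  "n \<in> nats ==> enters f (cond_after y (succ n)) ==> enters f (cond_after y n)"
  using enters_mono[OF generic_descending[OF f] shadow_in[OF succ_in_omega] shadow_in, of n n]
    shadow_descending ap_shadow unfolding descending_seq_def by simp

lemma shadow_move:
  assumes n: "n \<in> nats" and turn: "Opp n" and entered: "enters f (cond_after y n)"
  shows "enters f (cond_after y (succ (succ n)))" "cond_after y (succ n) \<preceq> f $ n"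
proof -
  have y_func: "func y omega omega" using y ext_reals by blast
  note move = good[OF n turn entered, unfolded good_move_def func_dom[OF restr_in_fin_seqs(1)[OF y_func n]]
      last_cond_restr[OF y_func n]]
  show "cond_after y (succ n) \<preceq> f $ n" using move by (simp add: cond_after_succ[OF n])
  have "y $ succ n = \<sigma> $ restr y (succ n)"
    using obeys alternate[OF n] turn succ_in_omega[OF n] unfolding follows_def by blast
  then have "cond_after y (succ (succ n)) = reply (restr y n) (y $ n)"
    using last_cond_restr[OF y_func succ_in_omega[OF succ_in_omega[OF n]]]
      restr_succ_eq_snoc[OF y_func succ_in_omega[OF n]] restr_succ_eq_snoc[OF y_func n]
    unfolding reply_def by simp
  then show "enters f (cond_after y (succ (succ n)))" using move by simp
qed

lemma shadow_enters:
  assumes "n \<in> nats"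
  shows "enters f (cond_after y n)"
proof -
  have "enters f (cond_after y n) \<and> (\<not> Opp n --> enters f (cond_after y (succ n)))"
  proof (rule omega_induct[OF assms])
    show "def_pred (%n. enters f (cond_after y n) \<and> (\<not> Opp n --> enters f (cond_after y (succ n))))"
      by (intro def_intros def_predD[OF Opp])
    show "enters f (cond_after y empty) \<and> (\<not> Opp empty --> enters f (cond_after y (succ empty)))"
      using start shadow_enters_prev[OF empty_in_omega] by (auto split: if_splits)
    fix n assume n: "n \<in> nats"
      "enters f (cond_after y n) \<and> (\<not> Opp n --> enters f (cond_after y (succ n)))"
    then show "enters f (cond_after y (succ n)) \<and>
        (\<not> Opp (succ n) --> enters f (cond_after y (succ (succ n))))"
      using shadow_move(1)[OF n(1)] shadow_enters_prev[OF succ_in_omega[OF n(1)]] alternate[OF n(1)]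
      by blast
  qed
  then show ?thesis by blast
qed

lemma shadow_equivalent: "equivalent (lam omega (cond_after y)) f"
  unfolding seq_equivalent_def
proof (intro conjI ballI)
  fix n assume n: "n \<in> nats"
  show "\<exists>m\<in>nats. f $ m \<preceq> lam omega (cond_after y) $ n"
    using shadow_enters[OF n] unfolding seq_enters_def ap_shadow[OF n] .
  have moved: "cond_after y (succ m) \<preceq> f $ m" if "m \<in> nats" "Opp m" for m
    by (rule shadow_move(2)[OF that shadow_enters[OF that(1)]])
  note desc = generic_descending[OF f]
  have "\<exists>m\<in>nats. cond_after y m \<preceq> f $ n"
  proof (cases "Opp n")
    case True
    then show ?thesis using moved[OF n] succ_in_omega[OF n] by blast
  next
    case False
    note Sn = succ_in_omega[OF n]
    have "cond_after y (succ (succ n)) \<preceq> f $ succ n" using moved[OF Sn] alternate[OF n] False by blast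
    moreover have "f $ succ n \<preceq> f $ n" using desc n unfolding descending_seq_def by blast
    ultimately have "cond_after y (succ (succ n)) \<preceq> f $ n"
      by (rule trans[OF shadow_in[OF succ_in_omega[OF Sn]] descending_in[OF desc Sn] descending_in[OF desc n]])
    then show ?thesis using succ_in_omega[OF Sn] by blast
  qed
  then show "\<exists>m\<in>nats. (lam omega (cond_after y)) $ m \<preceq> f $ n" using ap_shadow by force
qed

end
end

lemma strategy_forces:
  assumes win: "\<And>y. y \<in> ext reals ==> follows (%n. \<not> Opp n) \<sigma> y ==> lam omega (cond_after y) \<in> ext U"
    and inv: "invariant U"
    and q: "q = (if Opp empty then p else last_cond (snoc empty (\<sigma> $ empty)))"
  shows "q \<in> ext P" "q \<preceq> p" "forces q U"
proof -
  note first = strategy_in_omega[OF \<sigma> func_empty empty_in_omega]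
  show "q \<in> ext P" "q \<preceq> p"
    unfolding q
    using p refl[OF p] last_cond_in[OF func_snoc[OF func_empty first] succ_in_omega[OF empty_in_omega]]
      last_cond_snoc(2)[OF func_empty empty_in_omega first] last_cond_empty by simp_all
  show "forces q U"
  proof (rule forcesI[OF dense_family_reply])
    fix f assume f: "generic reply_family f" "enters f q"
    note desc = generic_descending[OF f(1)]
    obtain y where y: "y \<in> ext reals" "follows (%n. \<not> Opp n) \<sigma> y"
      "\<And>n. n \<in> nats ==> Opp n ==> enters f (cond_after y n) ==> good_move f (restr y n) (y $ n)"
      by (rule shadow_exists[OF f(1)]) (rule that)
    have "enters f (cond_after y (if Opp empty then empty else succ empty))"
    proof (cases "Opp empty")
      case True
      then show ?thesis using f(2) by (simp add: q cond_after_empty)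
    next
      case False
      have y_func: "func y omega omega" using y(1) ext_reals by blast
      have init: "restr y empty = empty"
        by (rule func_empty_iff[OF restr_in_fin_seqs(1)[OF y_func empty_in_omega]])
      have "cond_after y (succ empty) = q"
        using last_cond_restr[OF y_func succ_in_omega[OF empty_in_omega]]
          restr_succ_eq_snoc[OF y_func empty_in_omega] y(2) False empty_in_omega
        unfolding q follows_def by (simp add: init)
      then show ?thesis using f(2) False by simp
    qed
    note equiv = shadow_equivalent[OF f(1) y this]
    show "f \<in> ext U"
      using inv win[OF y(1,2)] equiv cond_after_descending[OF y(1)] desc
      unfolding invariant_set_def by blast
  qed
qed

end
end

lemma Baire_dichotomy:
  assumes AD and p: "p \<in> ext P" and W: "invariant W"
  obtains q where "q \<in> ext P" "q \<preceq> p" "forces q W" | "forces p (seq_compl P W)"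
proof -
  obtain e where e: "enum e P" by (rule enumerableE[OF enumerable_conds])
  let ?after = "cond_after e p"
  let ?B = "sep reals (%y. lam omega (?after y) \<in> ext W)"
  have B: "ext ?B = {y \<in> ext reals. lam omega (?after y) \<in> ext W}"
    by (rule ext_sep) (intro def_intros def_fun2_cond_after[OF e p])
  then have "ext ?B \<subseteq> ext reals" by blast
  with \<open>AD\<close> show thesis
  proof (cases rule: AD_cases)
    case (1 \<sigma>)
    have turn: "def_pred (%n. parity n \<noteq> empty)" by (intro def_intros)
    have alternate: "n \<in> nats ==> (parity (succ n) \<noteq> empty) \<longleftrightarrow> \<not> (parity n \<noteq> empty)" for n
      using parity_succ_eq_empty by simp
    have "lam omega (?after y) \<in> ext W" if "y \<in> ext reals" "follows (%n. \<not> parity n \<noteq> empty) \<sigma> y" for y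
      using 1(2)[of y] that B by simp
    from that(1) strategy_forces[OF e p 1(1) turn alternate this W HOL.refl] show thesis by blast
  next
    case (2 \<sigma>)
    have turn: "def_pred (%n. parity n = empty)" by (intro def_intros)
    have win: "lam omega (?after y) \<in> ext (seq_compl P W)"
      if "y \<in> ext reals" "follows (%n. parity n \<noteq> empty) \<sigma> y" for y
      using 2(2)[of y] that B descending_func[OF cond_after_descending[OF e p that(1)]]
      unfolding mem_seq_compl by simp
    have "p = (if parity empty = empty then p else last_cond e p (snoc empty (\<sigma> $ empty)))" by simp
    from strategy_forces(3)[OF e p 2(1) turn parity_succ_eq_empty win invariant_compl[OF W] this]
    show thesis by (rule that(2))
  qed
qed

context
  fixes \<pi> and big
  assumes \<pi>: "def_fun \<pi>" and big: "def_pred big"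
    and big_dense: "\<And>p. p \<in> ext P ==> \<exists>q\<in>ext P. big q \<and> q \<preceq> p"
    and big_below: "\<And>p q. p \<in> ext P ==> q \<in> ext P ==> big p ==> q \<preceq> p ==> big q"
    and \<pi>_in: "\<And>p. p \<in> ext P ==> big p ==> \<pi> p \<in> ext P \<and> big (\<pi> p)"
    and \<pi>_\<pi>: "\<And>p. p \<in> ext P ==> big p ==> \<pi> (\<pi> p) = p"
    and \<pi>_mono: "\<And>p q. p \<in> ext P ==> q \<in> ext P ==> big p ==> q \<preceq> p ==> \<pi> q \<preceq> \<pi> p"
begin

definition pull_back :: "'a => 'a" where "pull_back D = sep P (%u. big u \<and> (\<exists>d\<in>ext D. \<pi> u \<preceq> d))"
lemma def_fun_pull_back: "def_fun pull_back"
  unfolding pull_back_def by (intro def_funI def_intros def_funD[OF \<pi>] def_predD[OF big])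
lemma mem_pull_back: "u \<in> ext (pull_back D) \<longleftrightarrow> u \<in> ext P \<and> big u \<and> (\<exists>d\<in>ext D. \<pi> u \<preceq> d)"
  unfolding pull_back_def
  by (subst ext_sep) (intro def_predI def_intros def_funD[OF \<pi>] def_predD[OF big], simp)

lemma dense_pull_back:
  assumes D: "dense D"
  shows "dense (pull_back D)"
  unfolding dense_set_def
proof (intro conjI ballI subsetI)
  show "u \<in> ext P" if "u \<in> ext (pull_back D)" for u using that mem_pull_back by blast
  fix p assume p: "p \<in> ext P"
  then obtain q where q: "q \<in> ext P" "big q" "q \<preceq> p" using big_dense by blast
  obtain d where d: "d \<in> ext D" "d \<in> ext P" "d \<preceq> \<pi> q"
    using D \<pi>_in[OF q(1,2)] unfolding dense_set_def by blast
  have d_big: "big d" using big_below[OF _ d(2) _ d(3)] \<pi>_in[OF q(1,2)] by blast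
  have "\<pi> d \<preceq> q" using \<pi>_mono[OF _ d(2) _ d(3)] \<pi>_in[OF q(1,2)] \<pi>_\<pi>[OF q(1,2)] by simp
  moreover have "\<pi> d \<in> ext (pull_back D)"
    unfolding mem_pull_back using \<pi>_in[OF d(2) d_big] \<pi>_\<pi>[OF d(2) d_big] refl[OF d(2)] d(1) by auto
  ultimately show "\<exists>u\<in>ext (pull_back D). u \<preceq> p"
    using trans[OF _ q(1) p _ q(3)] \<pi>_in[OF d(2) d_big] by blast
qed

definition image_seq :: "'a => 'a => 'a" where
  "image_seq t f = lam omega (%n. if f $ n \<preceq> t then \<pi> (f $ n) else \<pi> t)"
lemma ap_image_seq:
  "n \<in> nats ==> image_seq t f $ n = (if f $ n \<preceq> t then \<pi> (f $ n) else \<pi> t)"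
  unfolding image_seq_def by (rule ap_lam) (intro def_intros def_funD[OF \<pi>])

lemma image_seq_descending:
  assumes t: "t \<in> ext P" "big t" and f: "descending f"
  shows "descending (image_seq t f)"
proof -
  note big_ft = big_below[OF t(1) descending_in[OF f] t(2)]
  have "def_fun (%n. if f $ n \<preceq> t then \<pi> (f $ n) else \<pi> t)" by (intro def_intros def_funD[OF \<pi>])
  then have "func (image_seq t f) omega P"
    unfolding image_seq_def by (rule func_lam) (use \<pi>_in t big_ft descending_in[OF f] in auto)
  moreover have "image_seq t f $ succ n \<preceq> image_seq t f $ n" if n: "n \<in> nats" for n
  proof -
    note in_P = descending_in[OF f n] descending_in[OF f succ_in_omega[OF n]]
    have step: "f $ succ n \<preceq> f $ n" using f n unfolding descending_seq_def by blast
    have "f $ n \<preceq> t ==> f $ succ n \<preceq> t" by (rule trans[OF in_P(2,1) t(1) step])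
    then show ?thesis
      using \<pi>_mono[OF in_P big_ft[OF n] step] \<pi>_mono[OF t(1) in_P(2) t(2)] refl \<pi>_in[OF t]
      by (simp add: ap_image_seq[OF n] ap_image_seq[OF succ_in_omega[OF n]])
  qed
  ultimately show ?thesis unfolding descending_seq_def by blast
qed

lemma enters_image_seq:
  assumes t: "t \<in> ext P" "big t" and f: "descending f" "enters f t" and q: "q \<in> ext P" "big q"
  shows "enters (image_seq t f) (\<pi> q) \<longleftrightarrow> enters f q"
proof
  assume "enters f q"
  then obtain k where k: "k \<in> nats" "f $ k \<preceq> q" "f $ k \<preceq> t"
    by (rule enters_common[OF f(1) q(1) t(1) _ f(2)])
  from \<pi>_mono[OF q(1) descending_in[OF f(1) k(1)] q(2) k(2)] show "enters (image_seq t f) (\<pi> q)"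
    unfolding seq_enters_def by (intro bexI[of _ k]) (simp_all add: k ap_image_seq)
next
  assume "enters (image_seq t f) (\<pi> q)"
  then obtain n where n: "n \<in> nats" "image_seq t f $ n \<preceq> \<pi> q" unfolding seq_enters_def by blast
  obtain x where x: "x \<in> ext P" "big x" "enters f x" "\<pi> x \<preceq> \<pi> q"
    using n(2) t f(2) big_below[OF t(1) descending_in[OF f(1) n(1)] t(2)]
      descending_in[OF f(1) n(1)] enters_self[OF f(1) n(1)]
    by (auto simp: ap_image_seq[OF n(1)] split: if_splits)
  have "x \<preceq> q" using \<pi>_mono[OF _ _ _ x(4)] \<pi>_in[OF q] \<pi>_in[OF x(1,2)] \<pi>_\<pi>[OF q] \<pi>_\<pi>[OF x(1,2)] by simp
  then show "enters f q" by (rule enters_mono[OF f(1) x(1) q(1) _ x(3)])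
qed

lemma forces_transfer:
  assumes t: "t \<in> ext P" "big t" "forces (\<pi> t) W" and E: "dense_family E"
    and U: "\<And>f h. generic E f ==> generic E h ==>
      (\<And>q. q \<in> ext P ==> big q ==> enters h (\<pi> q) \<longleftrightarrow> enters f q) ==> h \<in> ext W ==> f \<in> ext U"
  shows "forces t U"
proof -
  obtain D where D: "dense_family D" "\<And>h. generic D h ==> enters h (\<pi> t) ==> h \<in> ext W"
    by (rule forcesE[OF t(3)]) (rule that)
  let ?D = "cup D E"
  have dense: "dense_family ?D" by (rule dense_family_cup[OF D(1) E])
  have dense_pull: "dense_family (img pull_back ?D)"
    by (rule dense_family_img[OF def_fun_pull_back])
      (use dense dense_pull_back in \<open>auto simp: countable_dense_family_def\<close>)
  show ?thesis
  proof (rule forcesI[OF dense_family_cup[OF dense_pull E]])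
    fix f assume f: "generic (cup (img pull_back ?D) E) f" "enters f t"
    note desc = generic_descending[OF f(1)]
    let ?h = "image_seq t f"
    note h = image_seq_descending[OF t(1,2) desc] enters_image_seq[OF t(1,2) desc f(2)]
    have "meets ?h B" if B: "B \<in> ext ?D" for B
    proof -
      have "meets f (pull_back B)"
        by (rule generic_meets[OF f(1)])
          (use B in \<open>simp only: ext_cup ext_img[OF def_fun_pull_back]; blast\<close>)
      then obtain u where u: "enters f u" "u \<in> ext (pull_back B)"
        unfolding seq_meets_def seq_enters_def by blast
      then obtain d where d: "d \<in> ext B" "\<pi> u \<preceq> d" "u \<in> ext P" "big u" unfolding mem_pull_back by blast
      have "d \<in> ext P" using d(1) B dense unfolding countable_dense_family_def dense_set_def by blast
      with u(1) h(2)[OF d(3,4)] d show ?thesis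
        using enters_mono[OF h(1) _ _ d(2)] \<pi>_in[OF d(3,4)] unfolding seq_meets_def seq_enters_def by blast
    qed
    then have "generic ?D ?h" unfolding generic_seq_def using h(1) by blast
    then have gen: "generic D ?h" "generic E ?h" unfolding generic_cup by blast+
    have "enters ?h (\<pi> t)" using h(2)[OF t(1,2)] f(2) by blast
    then show "f \<in> ext U" using U[OF _ gen(2) h(2) D(2)[OF gen(1)]] f(1) unfolding generic_cup by blast
  qed
qed

end

interpretation prod: forcing mem "cprod P P" "prod_le P r"
proof
  show "enumerable (cprod P P)" by (rule enumerable_cprod[OF enumerable_conds enumerable_conds])
  show "opair p p \<in> ext (prod_le P r)" if "p \<in> ext (cprod P P)" for p
    using that refl by (auto simp: opair_prod_le)
  fix p q s assume "p \<in> ext (cprod P P)" "q \<in> ext (cprod P P)" "s \<in> ext (cprod P P)"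
    "opair p q \<in> ext (prod_le P r)" "opair q s \<in> ext (prod_le P r)"
  moreover from this obtain a b c d x y where "p = opair a b" "q = opair c d" "s = opair x y" by auto
  ultimately show "opair p s \<in> ext (prod_le P r)"
    using trans[of a c x] trans[of b d y] by (simp add: opair_prod_le)
qed

lemma descending_pair_seq:
  assumes f: "descending f" and h: "descending h"
  shows "prod.descending (pair_seq f h)"
proof -
  note in_P = descending_in[OF f] descending_in[OF h]
  have definable: "def_fun (%n. opair (f $ n) (h $ n))" by (intro def_intros)
  have "func (pair_seq f h) omega (cprod P P)"
    unfolding pair_seq_def by (rule func_lam[OF definable]) (simp add: in_P)
  then show ?thesis using f h unfolding descending_seq_def by (simp add: ap_pair_seq opair_prod_le in_P)
qed

lemma enters_pair_seq:
  assumes f: "descending f" and h: "descending h" and ab: "a \<in> ext P" "b \<in> ext P"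
  shows "prod.enters (pair_seq f h) (opair a b) \<longleftrightarrow> enters f a \<and> enters h b"
proof
  assume "prod.enters (pair_seq f h) (opair a b)"
  then show "enters f a \<and> enters h b" unfolding seq_enters_def by (auto simp: ap_pair_seq opair_prod_le)
next
  note in_P = descending_in[OF f] descending_in[OF h]
  assume "enters f a \<and> enters h b"
  then obtain n m where n: "n \<in> nats" "f $ n \<preceq> a" and m: "m \<in> nats" "h $ m \<preceq> b"
    unfolding seq_enters_def by blast
  obtain k where k: "k \<in> nats" "n \<in> ext (succ k)" "m \<in> ext (succ k)" by (rule omega_max[OF n(1) m(1)])
  have "f $ k \<preceq> a" "h $ k \<preceq> b"
    using trans[OF in_P(1)[OF k(1)] in_P(1)[OF n(1)] ab(1) descending_antimono[OF f k(1,2)] n(2)]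
      trans[OF in_P(2)[OF k(1)] in_P(2)[OF m(1)] ab(2) descending_antimono[OF h k(1,3)] m(2)] .
  then show "prod.enters (pair_seq f h) (opair a b)"
    unfolding seq_enters_def using k(1) in_P ab by (auto simp: ap_pair_seq opair_prod_le)
qed

lemma prod_seq_eq:
  assumes "func g omega (cprod P P)" "n \<in> nats"
  shows "g $ n = opair (left_seq g $ n) (right_seq g $ n)"
  using ap_in_codomain[OF assms] by (auto simp: ap_left_seq[OF assms(2)] ap_right_seq[OF assms(2)])

lemma descending_components:
  assumes g: "prod.descending g"
  shows "descending (left_seq g)" "descending (right_seq g)"
proof -
  note mem_seq_union = prod.descending_func[OF g]
  note split = prod_seq_eq[OF mem_seq_union]
  have in_P: "left_seq g $ n \<in> ext P" "right_seq g $ n \<in> ext P" if "n \<in> nats" for n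
    using ap_in_codomain[OF mem_seq_union that] unfolding split[OF that] by simp_all
  have "left_seq g $ succ n \<preceq> left_seq g $ n \<and> right_seq g $ succ n \<preceq> right_seq g $ n"
    if n: "n \<in> nats" for n
    using g n succ_in_omega[OF n] unfolding descending_seq_def by (simp add: split opair_prod_le)
  moreover have "def_fun (%n. pfst (g $ n))" "def_fun (%n. psnd (g $ n))" by (intro def_intros)+
  then have "func (left_seq g) omega P" "func (right_seq g) omega P"
    unfolding left_seq_def right_seq_def
    using in_P by (auto intro!: func_lam simp: ap_left_seq ap_right_seq)
  ultimately show "descending (left_seq g)" "descending (right_seq g)"
    unfolding descending_seq_def by blast+
qed

lemma equivalent_components:
  assumes g: "prod.descending g" "prod.descending g'" and eq: "prod.equivalent g g'"
  shows "equivalent (left_seq g) (left_seq g')" "equivalent (right_seq g) (right_seq g')"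
proof -
  note split = prod_seq_eq[OF prod.descending_func]
  have "\<exists>m\<in>nats. left_seq x $ m \<preceq> left_seq y $ n \<and> right_seq x $ m \<preceq> right_seq y $ n"
    if "prod.descending x" "prod.descending y" "n \<in> nats"
      "\<exists>m\<in>nats. opair (x $ m) (y $ n) \<in> ext (prod_le P r)" for x y n
    using that(4) by (auto simp: split[OF that(1)] split[OF that(2,3)] opair_prod_le)
  from this[OF g(2,1)] this[OF g]
  show "equivalent (left_seq g) (left_seq g')" "equivalent (right_seq g) (right_seq g')"
    using eq unfolding seq_equivalent_def by blast+
qed

text \<open>Kuratowski--Ulam: a sequence that meets all the tubes of a dense \<open>D\<close> has dense sections.\<close>

definition tube :: "'a => 'a => 'a" where
  "tube D t = sep P (%c. \<exists>d. opair c d \<in> ext D \<and> d \<preceq> t)"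
definition section_at :: "'a => 'a => 'a" where
  "section_at f D = sep P (%d. \<exists>c. opair c d \<in> ext D \<and> enters f c)"
lemma def_fun2_tube[THEN def_fun2D, def_intros]: "def_fun2 tube"
  by (intro def_fun2I, unfold tube_def, intro def_intros)
lemma def_fun2_section_at[THEN def_fun2D, def_intros]: "def_fun2 section_at"
  by (intro def_fun2I, unfold section_at_def, intro def_intros)
lemma mem_tube: "c \<in> ext (tube D t) \<longleftrightarrow> c \<in> ext P \<and> (\<exists>d. opair c d \<in> ext D \<and> d \<preceq> t)"
  unfolding tube_def by (subst ext_sep) (intro def_intros, simp)
lemma mem_section_at: "d \<in> ext (section_at f D) \<longleftrightarrow> d \<in> ext P \<and> (\<exists>c. opair c d \<in> ext D \<and> enters f c)"
  unfolding section_at_def by (subst ext_sep) (intro def_intros, simp)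

lemma dense_tube:
  assumes D: "prod.dense D" and t: "t \<in> ext P"
  shows "dense (tube D t)"
  unfolding dense_set_def
proof (intro conjI ballI subsetI)
  show "c \<in> ext P" if "c \<in> ext (tube D t)" for c using that mem_tube by blast
  fix x assume x: "x \<in> ext P"
  then have "opair x t \<in> ext (cprod P P)" using t by simp
  then obtain z where z: "z \<in> ext D" "opair z (opair x t) \<in> ext (prod_le P r)"
    using D unfolding dense_set_def by blast
  obtain c d where "z = opair c d" using z(1) D unfolding dense_set_def by auto
  then have "c \<in> ext (tube D t)" "c \<preceq> x" using z by (auto simp: mem_tube opair_prod_le)
  then show "\<exists>c\<in>ext (tube D t). c \<preceq> x" by blast
qed

lemma dense_section_at:
  assumes D: "prod.dense D" and f: "descending f" "\<And>t. t \<in> ext P ==> meets f (tube D t)"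
  shows "dense (section_at f D)"
  unfolding dense_set_def
proof (intro conjI ballI subsetI)
  show "d \<in> ext P" if "d \<in> ext (section_at f D)" for d using that mem_section_at by blast
  fix t assume t: "t \<in> ext P"
  obtain c d where c: "enters f c" "opair c d \<in> ext D" "d \<preceq> t"
    using f(2)[OF t] mem_tube unfolding seq_meets_iff by blast
  then have "d \<in> ext P" using D unfolding dense_set_def by auto
  then show "\<exists>d\<in>ext (section_at f D). d \<preceq> t" using c mem_section_at by blast
qed

lemma meets_pair_seq:
  assumes D: "prod.dense D" and f: "descending f" and h: "descending h" "meets h (section_at f D)"
  shows "prod.meets (pair_seq f h) D"
proof -
  obtain c d where c: "enters h d" "opair c d \<in> ext D" "enters f c"
    using h(2) mem_section_at unfolding seq_meets_iff by blast
  then have "c \<in> ext P" "d \<in> ext P" using D unfolding dense_set_def by auto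
  then have "prod.enters (pair_seq f h) (opair c d)" using enters_pair_seq[OF f h(1)] c by blast
  then show ?thesis unfolding seq_meets_iff using c(2) by blast
qed

lemma Kuratowski_Ulam:
  assumes W: "prod.forces (opair a b) W" and ab: "a \<in> ext P" "b \<in> ext P" and E: "dense_family E"
  obtains f E' where "generic E f" "f $ empty = a" "dense_family E'"
    "\<And>h. generic E' h ==> enters h b ==> pair_seq f h \<in> ext W"
proof -
  obtain D where D: "prod.dense_family D"
    "\<And>g. prod.generic D g ==> prod.enters g (opair a b) ==> g \<in> ext W"
    by (rule prod.forcesE[OF W]) (rule that)
  have D_dense: "prod.dense B" if "B \<in> ext D" for B
    using D(1) that unfolding countable_dense_family_def by blast
  have D_enumerable: "enumerable D" using D(1) unfolding countable_dense_family_def by blast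
  have definable_tube: "def_fun (%z. tube (pfst z) (psnd z))" by (intro def_intros)
  let ?tubes = "img (%z. tube (pfst z) (psnd z)) (cprod D P)"
  have tubes: "dense_family ?tubes"
    by (rule dense_family_img[OF definable_tube enumerable_cprod[OF D_enumerable enumerable_conds]])
      (use dense_tube[OF D_dense] in auto)
  obtain f where f: "generic (cup E ?tubes) f" "f $ empty = a"
    by (rule generic_exists[OF dense_family_cup[OF E tubes] ab(1)])
  note desc = generic_descending[OF f(1)]
  have "tube B t \<in> ext ?tubes" if "B \<in> ext D" "t \<in> ext P" for B t
    unfolding ext_img[OF definable_tube] by (rule image_eqI[of _ _ "opair B t"]) (use that in auto)
  then have meets: "meets f (tube B t)" if "B \<in> ext D" "t \<in> ext P" for B t
    using generic_meets[OF f(1)] that by simp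
  have definable_section: "def_fun (section_at f)" by (intro def_intros)
  have sections: "dense_family (img (section_at f) D)"
    by (rule dense_family_img[OF definable_section D_enumerable]) (rule dense_section_at[OF D_dense desc meets])
  show thesis
  proof (rule that[OF _ f(2) sections])
    show "generic E f" using f(1) unfolding generic_cup by blast
    fix h assume h: "generic (img (section_at f) D) h" "enters h b"
    note desc_h = generic_descending[OF h(1)]
    have "prod.meets (pair_seq f h) B" if "B \<in> ext D" for B
      by (rule meets_pair_seq[OF D_dense[OF that] desc desc_h generic_meets[OF h(1)]])
        (use that in \<open>simp add: ext_img[OF definable_section]\<close>)
    then have "prod.generic D (pair_seq f h)"
      unfolding generic_seq_def using descending_pair_seq[OF desc desc_h] by blast
    moreover have "enters f a" using enters_self[OF desc empty_in_omega] f(2) by simp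
    ultimately show "pair_seq f h \<in> ext W" using D(2) enters_pair_seq[OF desc desc_h ab] h(2) by blast
  qed
qed

lemma equivalent_swap:
  assumes g: "prod.descending g" and h: "prod.descending h"
    and enters: "\<And>q. q \<in> ext (cprod P P) ==>
      prod.enters h (opair (psnd q) (pfst q)) \<longleftrightarrow> prod.enters g q"
  shows "prod.equivalent h (pair_seq (right_seq g) (left_seq g))"
  unfolding seq_equivalent_def
proof (intro conjI ballI)
  let ?\<pi> = "%z. opair (psnd z) (pfst z)" and ?g = "pair_seq (right_seq g) (left_seq g)"
  have swap: "?g $ n = ?\<pi> (g $ n)" if "n \<in> nats" for n
    by (simp add: ap_pair_seq[OF that] ap_left_seq[OF that] ap_right_seq[OF that])
  fix n assume n: "n \<in> nats"
  have "prod.enters h (?\<pi> (g $ n))"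
    using enters[OF prod.descending_in[OF g n]] prod.enters_self[OF g n] by blast
  then show "\<exists>m\<in>nats. opair (h $ m) (?g $ n) \<in> ext (prod_le P r)"
    unfolding seq_enters_def swap[OF n] .
  have "prod.enters g (?\<pi> (h $ n))"
    using enters[of "?\<pi> (h $ n)"] prod.descending_in[OF h n] prod.enters_self[OF h n] by auto
  then obtain m where m: "m \<in> nats" "opair (g $ m) (?\<pi> (h $ n)) \<in> ext (prod_le P r)"
    unfolding seq_enters_def by blast
  have "opair (?g $ m) (h $ n) \<in> ext (prod_le P r)"
    using m(2) prod.descending_in[OF g m(1)] prod.descending_in[OF h n]
    by (auto simp: swap[OF m(1)] opair_prod_le)
  then show "\<exists>m\<in>nats. opair (?g $ m) (h $ n) \<in> ext (prod_le P r)" using m(1) by blast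
qed

lemma forces_swap:
  assumes swapped: "prod.forces (opair a b) W" and ab: "a \<in> ext P" "b \<in> ext P" and inv: "prod.invariant W"
    and U: "\<And>g. prod.descending g ==> pair_seq (right_seq g) (left_seq g) \<in> ext W ==> g \<in> ext U"
  shows "prod.forces (opair b a) U"
proof -
  let ?\<pi> = "%z. opair (psnd z) (pfst z)"
  have \<pi>: "def_fun ?\<pi>" and all: "def_pred (%_. True)" by (intro def_intros)+
  show ?thesis
  proof (rule prod.forces_transfer[OF \<pi> all _ _ _ _ _ _ _ _ prod.dense_family_sing[OF prod.dense_all], where W=W])
    show "\<exists>q\<in>ext (cprod P P). True \<and> opair q p \<in> ext (prod_le P r)" if "p \<in> ext (cprod P P)" for p
      using prod.refl[OF that] that by blast
    fix g h assume "prod.generic (upair (cprod P P) (cprod P P)) g"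
      "prod.generic (upair (cprod P P) (cprod P P)) h"
    note desc = this[THEN prod.generic_descending]
    assume "\<And>q. q \<in> ext (cprod P P) ==> True ==> prod.enters h (?\<pi> q) \<longleftrightarrow> prod.enters g q"
    then have "prod.equivalent h (pair_seq (right_seq g) (left_seq g))"
      by (intro equivalent_swap[OF desc]) blast
    moreover assume "h \<in> ext W"
    ultimately show "g \<in> ext U"
      using U[OF desc(1)] inv desc(2) descending_pair_seq[OF descending_components(2,1)[OF desc(1)]]
      unfolding invariant_set_def by blast
  qed (use swapped ab in \<open>auto simp: opair_prod_le\<close>)
qed

text \<open>For an increasing union that is forced while every stage is meager, a generic \<open>f\<close> has a least
  stage containing it; comparing these stages gives a subset of the product whose sections are
  meager in one direction and comeager in the other, against Kuratowski--Ulam.\<close>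

context
  fixes w J Z V q
  assumes AD: AD and wo: "well_orders w J" and Z: "def_fun Z" and inv: "\<And>i. i \<in> ext J ==> invariant (Z i)"
    and mono: "\<And>i j f. i \<in> ext J ==> j \<in> ext J ==> opair j i \<in> ext w ==> f \<in> ext (Z j) ==> f \<in> ext (Z i)"
    and V: "forces q V" "\<And>f. descending f ==> f \<in> ext V ==> \<exists>i\<in>ext J. f \<in> ext (Z i)"
    and q: "q \<in> ext P"
    and meager: "\<And>i. i \<in> ext J ==> forces q (seq_compl P (Z i))"
begin

definition later :: 'a where
  "later = sep (funs omega (cprod P P)) (%g. \<forall>i\<in>ext J. right_seq g \<in> ext (Z i) --> left_seq g \<in> ext (Z i))"
lemma mem_later:
  "g \<in> ext later \<longleftrightarrow> func g omega (cprod P P) \<and>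
    (\<forall>i\<in>ext J. right_seq g \<in> ext (Z i) --> left_seq g \<in> ext (Z i))"
  unfolding later_def by (subst ext_sep) (intro def_predI def_intros def_funD[OF Z], simp)

lemma invariant_later: "prod.invariant later"
  unfolding invariant_set_def
proof (intro allI impI, elim conjE)
  fix g g' assume g: "prod.descending g" "prod.descending g'" "prod.equivalent g g'" "g \<in> ext later"
  note comp = descending_components[OF g(1)] descending_components[OF g(2)] equivalent_components[OF g(1-3)]
  have "left_seq g' \<in> ext (Z i)" if i: "i \<in> ext J" "right_seq g' \<in> ext (Z i)" for i
  proof -
    have "right_seq g \<in> ext (Z i)"
      using inv[OF i(1)] i(2) comp(2,4) seq_equivalent_sym[OF comp(6)] unfolding invariant_set_def by blast
    then have "left_seq g \<in> ext (Z i)" using g(4) i(1) unfolding mem_later by blast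
    then show ?thesis using inv[OF i(1)] comp(1,3,5) unfolding invariant_set_def by blast
  qed
  then show "g' \<in> ext later" unfolding mem_later using prod.descending_func[OF g(2)] by blast
qed

lemma components_pair_seq:
  assumes f: "descending f" and h: "descending h"
  shows "left_seq (pair_seq f h) = f" "right_seq (pair_seq f h) = h"
proof -
  note comp = descending_components[OF descending_pair_seq[OF f h]]
  show "left_seq (pair_seq f h) = f"
    by (rule func_ext[OF descending_func[OF comp(1)] descending_func[OF f]])
      (simp add: ap_left_seq ap_pair_seq)
  show "right_seq (pair_seq f h) = h"
    by (rule func_ext[OF descending_func[OF comp(2)] descending_func[OF h]])
      (simp add: ap_right_seq ap_pair_seq)
qed

lemma generic_stage:
  obtains D where "dense_family D"
    "\<And>f. generic D f ==> enters f q ==> \<exists>i\<in>ext J. f \<in> ext (Z i)"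
proof -
  obtain D where D: "dense_family D" "\<And>f. generic D f ==> enters f q ==> f \<in> ext V"
    by (rule forcesE[OF V(1)]) (rule that)
  then show thesis using that V(2) generic_descending by blast
qed

lemma meager_below:
  assumes "x \<in> ext P" "x \<preceq> q" "i \<in> ext J" "dense_family E"
    and "\<And>f. generic E f ==> enters f x ==> f \<in> ext (Z i)"
  shows False
proof (rule not_forces_compl[OF _ _ assms(1) refl[OF assms(1)]])
  show "forces x (Z i)" using assms(4,5) by (rule forcesI)
  show "forces x (seq_compl P (Z i))" by (rule forces_mono[OF assms(1) q assms(2) meager[OF assms(3)]])
qed

lemma later_not_forced:
  assumes z: "z \<in> ext (cprod P P)" "opair z (opair q q) \<in> ext (prod_le P r)"
  shows "\<not> prod.forces z later"
proof
  assume forced: "prod.forces z later"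
  obtain D where D: "dense_family D" "\<And>f. generic D f ==> enters f q ==> \<exists>i\<in>ext J. f \<in> ext (Z i)"
    by (rule generic_stage) (rule that)
  obtain c d where cd: "z = opair c d" "c \<in> ext P" "d \<in> ext P" "c \<preceq> q" "d \<preceq> q"
    using z by (auto simp: opair_prod_le)
  let ?U = "sep (funs omega (cprod P P)) (%g. pair_seq (right_seq g) (left_seq g) \<in> ext later)"
  have U: "g \<in> ext ?U \<longleftrightarrow> func g omega (cprod P P) \<and> pair_seq (right_seq g) (left_seq g) \<in> ext later" for g
    by (subst ext_sep) (intro def_intros, simp)
  have swapped: "prod.forces (opair d c) ?U"
    by (rule forces_swap[OF forced[unfolded cd(1)] cd(2,3) invariant_later])
      (simp add: U prod.descending_func)
  obtain h E where h: "generic D h" "h $ empty = d" "dense_family E"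
    "\<And>f. generic E f ==> enters f c ==> pair_seq h f \<in> ext ?U"
    by (rule Kuratowski_Ulam[OF swapped cd(3,2) D(1)]) (rule that)
  note desc = generic_descending[OF h(1)]
  have "enters h q"
    using enters_mono[OF desc cd(3) q cd(5)] enters_self[OF desc empty_in_omega] h(2) by simp
  then obtain i where i: "i \<in> ext J" "h \<in> ext (Z i)" using D(2)[OF h(1)] by blast
  show False
  proof (rule meager_below[OF cd(2,4) i(1) h(3)])
    fix f assume f: "generic E f" "enters f c"
    note desc_f = generic_descending[OF f(1)]
    have "pair_seq f h \<in> ext later"
      using h(4)[OF f] unfolding U components_pair_seq[OF desc desc_f] by blast
    then show "f \<in> ext (Z i)" using i unfolding mem_later components_pair_seq[OF desc_f desc] by blast
  qed
qed

lemma later_compl_not_forced: "\<not> prod.forces (opair q q) (seq_compl (cprod P P) later)"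
proof
  assume forced: "prod.forces (opair q q) (seq_compl (cprod P P) later)"
  obtain D where D: "dense_family D" "\<And>f. generic D f ==> enters f q ==> \<exists>i\<in>ext J. f \<in> ext (Z i)"
    by (rule generic_stage) (rule that)
  obtain f E where f: "generic D f" "f $ empty = q" "dense_family E"
    "\<And>h. generic E h ==> enters h q ==> pair_seq f h \<in> ext (seq_compl (cprod P P) later)"
    by (rule Kuratowski_Ulam[OF forced q q D(1)]) (rule that)
  note desc = generic_descending[OF f(1)]
  have "enters f q" using enters_self[OF desc empty_in_omega] f(2) by simp
  then obtain i where i: "i \<in> ext J" "f \<in> ext (Z i)" using D(2)[OF f(1)] by blast
  show False
  proof (rule meager_below[OF q refl[OF q] i(1) f(3)])
    fix h assume h: "generic E h" "enters h q"
    note desc_h = generic_descending[OF h(1)]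
    obtain j where j: "j \<in> ext J" "h \<in> ext (Z j)" "f \<notin> ext (Z j)"
      using f(4)[OF h] unfolding mem_seq_compl mem_later components_pair_seq[OF desc desc_h] by blast
    have "opair i j \<notin> ext w" using mono[OF j(1) i(1) _ i(2)] j(3) by blast
    then show "h \<in> ext (Z i)" using mono[OF i(1) j(1) _ j(2)] well_orders_total[OF wo i(1) j(1)] by blast
  qed
qed

lemma increasing_union_contradiction: False
proof (rule prod.Baire_dichotomy[OF AD _ invariant_later])
  show "opair q q \<in> ext (cprod P P)" using q by simp
qed (use later_not_forced later_compl_not_forced in blast)+

end

context
  fixes w I W
  assumes AD: AD and wo: "well_orders w I" and W: "def_fun W" and inv: "\<And>i. i \<in> ext I ==> invariant (W i)"
begin

definition union_upto :: "'a => 'a" where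
  "union_upto i = sep (funs omega P) (%f. \<exists>j\<in>ext I. opair j i \<in> ext w \<and> f \<in> ext (W j))"
lemma def_fun_union_upto: "def_fun union_upto"
  unfolding union_upto_def by (intro def_funI def_intros def_funD[OF W])
lemma mem_union_upto:
  "f \<in> ext (union_upto i) \<longleftrightarrow> func f omega P \<and> (\<exists>j\<in>ext I. opair j i \<in> ext w \<and> f \<in> ext (W j))"
  unfolding union_upto_def by (subst ext_sep) (intro def_predI def_intros def_funD[OF W], simp)
lemma invariant_union_upto: "invariant (union_upto i)"
  using inv descending_func unfolding invariant_set_def mem_union_upto by blast
lemma union_upto_mono:
  "i \<in> ext I ==> j \<in> ext I ==> opair j i \<in> ext w ==> f \<in> ext (union_upto j) ==> f \<in> ext (union_upto i)"
  using well_orders_trans[OF wo] unfolding mem_union_upto by blast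
lemma union_upto_self: "descending f ==> i \<in> ext I ==> f \<in> ext (W i) ==> f \<in> ext (union_upto i)"
  using descending_func well_orders_refl[OF wo] unfolding mem_union_upto by blast

lemma union_upto_forced:
  assumes p: "p \<in> ext P" and V: "forces p V" and J: "ext J \<subseteq> ext I"
    and cover: "\<And>f. descending f ==> f \<in> ext V ==> \<exists>i\<in>ext J. f \<in> ext (W i)"
  shows "\<exists>i\<in>ext J. \<exists>q\<in>ext P. q \<preceq> p \<and> forces q (union_upto i)"
proof (rule ccontr)
  assume none: "\<not> ?thesis"
  have meager: "forces p (seq_compl P (union_upto i))" if i: "i \<in> ext J" for i
    by (rule Baire_dichotomy[OF AD p invariant_union_upto]) (use none i in fast)+
  have "well_orders w J" by (rule well_orders_subset[OF wo J])
  then show False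
  proof (rule increasing_union_contradiction[OF AD _ def_fun_union_upto invariant_union_upto _ V _ p meager])
    fix i j f assume "i \<in> ext J" "j \<in> ext J" "opair j i \<in> ext w" "f \<in> ext (union_upto j)"
    then show "f \<in> ext (union_upto i)" using J by (intro union_upto_mono[of i j f]) auto
  next
    fix f assume f: "descending f" "f \<in> ext V"
    obtain i where "i \<in> ext J" "f \<in> ext (W i)" using cover[OF f] by blast
    then show "\<exists>i\<in>ext J. f \<in> ext (union_upto i)" using union_upto_self[OF f(1)] J by fast
  qed
qed

lemma well_ordered_additivity:
  assumes p: "p \<in> ext P" and U: "forces p U"
    and cover: "\<And>f. descending f ==> f \<in> ext U ==> \<exists>i\<in>ext I. f \<in> ext (W i)"
  obtains q i where "q \<in> ext P" "i \<in> ext I" "q \<preceq> p" "forces q (W i)"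
proof -
  let ?S = "sep I (%i. \<exists>q\<in>ext P. q \<preceq> p \<and> forces q (union_upto i))"
  have S: "i \<in> ext ?S \<longleftrightarrow> i \<in> ext I \<and> (\<exists>q\<in>ext P. q \<preceq> p \<and> forces q (union_upto i))" for i
    by (subst ext_sep) (intro def_predI def_intros def_funD[OF def_fun_union_upto], simp)
  have "ext ?S \<subseteq> ext I" using S by blast
  moreover obtain i1 where "i1 \<in> ext ?S" using union_upto_forced[OF p U subset_refl cover] S by fast
  ultimately obtain i0 where i0: "i0 \<in> ext ?S" "\<And>i. i \<in> ext ?S ==> opair i0 i \<in> ext w"
    by (rule well_orders_least[OF wo]) (rule that)
  then obtain q where q: "q \<in> ext P" "q \<preceq> p" "forces q (union_upto i0)" and I: "i0 \<in> ext I"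
    unfolding S by blast
  have below_p: "x \<preceq> p" if "x \<in> ext P" "x \<preceq> q" for x by (rule trans[OF that(1) q(1) p that(2) q(2)])
  show thesis
  proof (rule Baire_dichotomy[OF AD q(1) inv[OF I]])
    fix x assume "x \<in> ext P" "x \<preceq> q" "forces x (W i0)"
    then show thesis using that I below_p by blast
  next
    assume not_W: "forces q (seq_compl P (W i0))"
    let ?J = "sep I (%i. opair i i0 \<in> ext w \<and> i \<noteq> i0)" and ?V = "sep (union_upto i0) (%f. f \<notin> ext (W i0))"
    have J: "i \<in> ext ?J \<longleftrightarrow> i \<in> ext I \<and> opair i i0 \<in> ext w \<and> i \<noteq> i0" for i
      by (subst ext_sep) (intro def_intros, simp)
    have V: "f \<in> ext ?V \<longleftrightarrow> f \<in> ext (union_upto i0) \<and> f \<notin> ext (W i0)" for f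
      by (subst ext_sep) (intro def_intros, simp)
    have "forces q ?V" by (rule forces_imp2[OF q(3) not_W]) (simp add: V mem_seq_compl)
    moreover have "ext ?J \<subseteq> ext I" using J by blast
    moreover have "\<exists>i\<in>ext ?J. f \<in> ext (W i)" if "f \<in> ext ?V" for f
      using that J unfolding V mem_union_upto by blast
    ultimately have "\<exists>i\<in>ext ?J. \<exists>x\<in>ext P. x \<preceq> q \<and> forces x (union_upto i)"
      by (rule union_upto_forced[OF q(1)])
    then obtain i where i: "i \<in> ext ?J" "\<exists>x\<in>ext P. x \<preceq> q \<and> forces x (union_upto i)" by (rule bexE)
    then have "i \<in> ext ?S" using J S below_p by blast
    then show thesis using i0(2) well_orders_antisym[OF wo _ I, of i] i J by blast
  qed
qed

end
end

context zf_model
begin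

section \<open>Cohen conditions\<close>

definition extension_order :: "'a => 'a" where
  "extension_order C = sep (cprod (fin_seqs C) (fin_seqs C)) (%z. ext (psnd z) \<subseteq> ext (pfst z))"
lemma def_fun_extension_order[THEN def_funD, def_intros]: "def_fun extension_order"
  by (intro def_funI, unfold extension_order_def, intro def_intros)
lemma opair_extension_order: "opair s t \<in> ext (extension_order C) \<longleftrightarrow>
    s \<in> ext (fin_seqs C) \<and> t \<in> ext (fin_seqs C) \<and> ext t \<subseteq> ext s"
  unfolding extension_order_def by (subst ext_sep) (intro def_intros, auto)

definition seq_union :: "'a => 'a" where "seq_union f = bigunion (img (($) f) omega)"
lemma def_fun_seq_union[THEN def_funD, def_intros]: "def_fun seq_union"
  by (intro def_funI, unfold seq_union_def, intro def_intros)
lemma mem_seq_union: "z \<in> ext (seq_union f) \<longleftrightarrow> (\<exists>n\<in>nats. z \<in> ext (f $ n))"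
proof -
  have "def_fun (($) f)" by (intro def_intros)
  then show ?thesis unfolding seq_union_def by (simp add: ext_img)
qed

definition longer :: "'a => 'a => 'a" where "longer C n = sep (fin_seqs C) (%s. n \<in> ext (dom s))"
lemma def_fun2_longer[THEN def_fun2D, def_intros]: "def_fun2 longer"
  by (intro def_fun2I, unfold longer_def, intro def_intros)
lemma mem_longer: "s \<in> ext (longer C n) \<longleftrightarrow> s \<in> ext (fin_seqs C) \<and> n \<in> ext (dom s)"
  unfolding longer_def by (subst ext_sep) (intro def_intros, simp)
definition length_family :: "'a => 'a" where "length_family C = img (longer C) omega"
lemma ext_length_family: "ext (length_family C) = longer C ` nats"
  unfolding length_family_def by (rule ext_img) (intro def_intros)

lemma fin_seqs_extend:
  assumes c: "c \<in> ext C" and s: "s \<in> ext (fin_seqs C)" and n: "n \<in> nats"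
  shows "\<exists>t\<in>ext (fin_seqs C). ext s \<subseteq> ext t \<and> ext n \<subseteq> ext (dom t)"
proof (rule omega_induct[OF n, where P="%n. \<exists>t\<in>ext (fin_seqs C). ext s \<subseteq> ext t \<and> ext n \<subseteq> ext (dom t)"])
  show "def_pred (%n. \<exists>t\<in>ext (fin_seqs C). ext s \<subseteq> ext t \<and> ext n \<subseteq> ext (dom t))" by (intro def_intros)
  show "\<exists>t\<in>ext (fin_seqs C). ext s \<subseteq> ext t \<and> ext empty \<subseteq> ext (dom t)" using s by auto
  fix n assume n: "n \<in> nats" "\<exists>t\<in>ext (fin_seqs C). ext s \<subseteq> ext t \<and> ext n \<subseteq> ext (dom t)"
  then obtain t m where t: "ext s \<subseteq> ext t" "ext n \<subseteq> ext (dom t)" and m: "m \<in> nats" "func t m C"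
    unfolding ext_fin_seqs by blast
  have dom: "dom t = m" by (rule func_dom[OF m(2)])
  show "\<exists>t\<in>ext (fin_seqs C). ext s \<subseteq> ext t \<and> ext (succ n) \<subseteq> ext (dom t)"
  proof (cases "n \<in> ext m")
    case True
    then have "ext (succ n) \<subseteq> ext (dom t)" using t(2) dom by auto
    then show ?thesis using t(1) m unfolding ext_fin_seqs by blast
  next
    case False
    then have "n = m"
      using ordinal_subset_iff[OF ordinal_if_in_omega[OF n(1)] ordinal_if_in_omega[OF m(1)]] t(2) dom
      by simp
    note f = func_snoc[OF m(2) c]
    have "snoc t c \<in> ext (fin_seqs C)" unfolding ext_fin_seqs using f succ_in_omega[OF m(1)] by blast
    moreover have "ext (succ n) \<subseteq> ext (dom (snoc t c))" using func_dom[OF f] \<open>n = m\<close> by simp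
    moreover have "ext s \<subseteq> ext (snoc t c)" using t(1) subset_snoc[OF m(2) c] by (rule subset_trans)
    ultimately show ?thesis by (intro bexI conjI)
  qed
qed

end

locale cohen = zf_model +
  fixes C :: 'a
  assumes enumerable_C: "enumerable C"
begin

abbreviation Q where "Q \<equiv> fin_seqs C"
abbreviation Q_order where "Q_order \<equiv> extension_order C"

sublocale Q: forcing mem Q Q_order
  by unfold_locales (auto simp: opair_extension_order enumerable_fin_seqs[OF enumerable_C])

lemma fin_seqs_func:
  assumes "s \<in> ext Q"
  shows "dom s \<in> nats" "func s (dom s) C"
  using assms func_dom unfolding ext_fin_seqs by force+

lemma fin_seqs_subsetI:
  assumes "s \<in> ext Q" "t \<in> ext Q" "\<And>i. i \<in> ext (dom s) ==> i \<in> ext (dom t) \<and> s $ i = t $ i"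
  shows "ext s \<subseteq> ext t"
  using ext_func[OF fin_seqs_func(2)[OF assms(1)]] ext_func[OF fin_seqs_func(2)[OF assms(2)]] assms(3)
  by auto

lemma long_extension:
  assumes "s \<in> ext Q" "n \<in> nats"
  obtains t where "t \<in> ext Q" "ext s \<subseteq> ext t" "ext n \<subseteq> ext (dom t)"
proof -
  obtain c where "c \<in> ext C" by (rule enumerable_nonempty[OF enumerable_C])
  from fin_seqs_extend[OF this assms] show thesis using that by blast
qed

lemma dense_family_length_family: "Q.dense_family (length_family C)"
  unfolding length_family_def
proof (rule Q.dense_family_img[OF _ enumerable_omega])
  show "def_fun (longer C)" by (intro def_intros)
  fix n assume n: "n \<in> nats"
  show "Q.dense (longer C n)"
    unfolding dense_set_def
  proof (intro conjI ballI subsetI)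
    show "s \<in> ext Q" if "s \<in> ext (longer C n)" for s using that mem_longer by blast
    fix s assume s: "s \<in> ext Q"
    obtain t where t: "t \<in> ext Q" "ext s \<subseteq> ext t" "ext (succ n) \<subseteq> ext (dom t)"
      by (rule long_extension[OF s succ_in_omega[OF n]])
    then have "t \<in> ext (longer C n)" "opair t s \<in> ext Q_order"
      using s by (auto simp: mem_longer opair_extension_order)
    then show "\<exists>t\<in>ext (longer C n). opair t s \<in> ext Q_order" by blast
  qed
qed

lemma seq_union_unique:
  assumes f: "Q.descending f" and y: "opair i y \<in> ext (seq_union f)" "opair i y' \<in> ext (seq_union f)"
  shows "y = y'"
proof -
  obtain n m where n: "n \<in> nats" "opair i y \<in> ext (f $ n)" and m: "m \<in> nats" "opair i y' \<in> ext (f $ m)"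
    using y unfolding mem_seq_union by blast
  obtain k where k: "k \<in> nats" "n \<in> ext (succ k)" "m \<in> ext (succ k)" by (rule omega_max[OF n(1) m(1)])
  have "opair i y \<in> ext (f $ k)" "opair i y' \<in> ext (f $ k)"
    using Q.descending_antimono[OF f k(1,2)] Q.descending_antimono[OF f k(1,3)] n(2) m(2)
    unfolding opair_extension_order by blast+
  then show ?thesis
    unfolding func_opair_iff[OF fin_seqs_func(2)[OF Q.descending_in[OF f k(1)]]] by simp
qed

lemma entered_subset_seq_union: "Q.enters f s ==> ext s \<subseteq> ext (seq_union f)"
  unfolding seq_enters_def opair_extension_order subset_iff mem_seq_union by blast

lemma long_entered:
  assumes f: "Q.generic (length_family C) f" and n: "n \<in> nats"
  obtains s where "s \<in> ext Q" "ext n \<subseteq> ext (dom s)" "Q.enters f s"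
proof -
  have "Q.meets f (longer C n)"
    by (rule Q.generic_meets[OF f]) (unfold ext_length_family, rule imageI[OF n])
  then obtain s where s: "s \<in> ext Q" "n \<in> ext (dom s)" "Q.enters f s"
    unfolding seq_meets_iff Bex_def mem_longer by blast
  have "ext n \<subseteq> ext (dom s)"
    by (rule ordinal_subset[OF ordinal_if_in_omega[OF fin_seqs_func(1)[OF s(1)]] s(2)])
  then show thesis by (rule that[OF s(1) _ s(3)])
qed

lemma func_seq_union:
  assumes f: "Q.generic (length_family C) f"
  shows "func (seq_union f) omega C"
proof -
  note desc = Q.generic_descending[OF f]
  have "ext (seq_union f) \<subseteq> ext (cprod omega C)"
  proof
    fix z assume "z \<in> ext (seq_union f)"
    then obtain n where n: "n \<in> nats" "z \<in> ext (f $ n)" unfolding mem_seq_union by blast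
    note fin = fin_seqs_func[OF Q.descending_in[OF desc n(1)]]
    have "z \<in> ext (cprod (dom (f $ n)) C)" using n(2) fin(2) unfolding func_def by blast
    then show "z \<in> ext (cprod omega C)" using omega_trans[OF fin(1)] by auto
  qed
  moreover have "\<exists>y. opair i y \<in> ext (seq_union f)" if i: "i \<in> nats" for i
  proof -
    obtain s where s: "s \<in> ext Q" "ext (succ i) \<subseteq> ext (dom s)" "Q.enters f s"
      by (rule long_entered[OF f succ_in_omega[OF i]])
    have "opair i (s $ i) \<in> ext s" by (rule opair_ap_mem[OF fin_seqs_func(2)[OF s(1)]]) (use s(2) in auto)
    then show ?thesis using entered_subset_seq_union[OF s(3)] by blast
  qed
  ultimately show ?thesis unfolding func_def using seq_union_unique[OF desc] by blast
qed

lemma ap_seq_union: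
  assumes f: "Q.generic (length_family C) f" and s: "s \<in> ext Q" "Q.enters f s" and i: "i \<in> ext (dom s)"
  shows "seq_union f $ i = s $ i"
proof -
  have "opair i (s $ i) \<in> ext (seq_union f)"
    using opair_ap_mem[OF fin_seqs_func(2)[OF s(1)] i] entered_subset_seq_union[OF s(2)] by blast
  then show ?thesis unfolding func_opair_iff[OF func_seq_union[OF f]] by simp
qed

lemma seq_union_cong: "Q.equivalent f g ==> seq_union f = seq_union g"
proof (rule ext_inject, rule set_eqI)
  fix z assume "Q.equivalent f g"
  then show "z \<in> ext (seq_union f) \<longleftrightarrow> z \<in> ext (seq_union g)"
    unfolding seq_equivalent_def mem_seq_union opair_extension_order by blast
qed

end

context zf_model
begin

section \<open>Well-orderable sets of reals are countable\<close>

definition double :: "'a => 'a" where "double k = addn k k"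
lemma def_fun_double[THEN def_funD, def_intros]: "def_fun double"
  by (intro def_funI, unfold double_def, intro def_intros)
lemma double_in_omega[simp]: "k \<in> nats ==> double k \<in> nats" unfolding double_def by simp
lemma double_empty[simp]: "double empty = empty" unfolding double_def by simp
lemma double_succ: "k \<in> nats ==> double (succ k) = succ (succ (double k))" unfolding double_def by simp
lemma parity_double: "k \<in> nats ==> parity (double k) = empty"
  by (erule omega_induct[where P="%k. parity (double k) = empty"])
    (intro def_intros, auto simp: double_succ parity_succ)
lemma parity_succ_double: "k \<in> nats ==> parity (succ (double k)) \<noteq> empty"
  by (simp add: parity_succ parity_double)

lemma double_cases:
  assumes "n \<in> nats"
  obtains k where "k \<in> nats" "n = double k" | k where "k \<in> nats" "n = succ (double k)"
proof -
  have "\<exists>k\<in>nats. n = double k \<or> n = succ (double k)"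
  proof (rule omega_induct[OF assms, where P="%n. \<exists>k\<in>nats. n = double k \<or> n = succ (double k)"])
    show "def_pred (%n. \<exists>k\<in>nats. n = double k \<or> n = succ (double k))" by (intro def_intros)
    show "\<exists>k\<in>nats. empty = double k \<or> empty = succ (double k)" by (rule bexI[OF _ empty_in_omega]) simp
    fix n assume "\<exists>k\<in>nats. n = double k \<or> n = succ (double k)"
    then show "\<exists>k\<in>nats. succ n = double k \<or> succ n = succ (double k)"
      using double_succ succ_in_omega by metis
  qed
  then show thesis using that by blast
qed

lemma double_mono:
  assumes "j \<in> nats" "k \<in> ext j"
  shows "double k \<in> ext (double j)"
proof -
  have "\<forall>k\<in>ext j. double k \<in> ext (double j)"
    by (rule omega_induct[OF assms(1), where P="%j. \<forall>k\<in>ext j. double k \<in> ext (double j)"])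
      (intro def_intros, auto simp: double_succ)
  then show ?thesis using assms(2) by blast
qed

lemma double_inj: "k \<in> nats ==> j \<in> nats ==> double k = double j ==> k = j"
  using omega_linear[of k j] double_mono[of j k] double_mono[of k j] by auto
lemma subset_double: "j \<in> nats ==> ext j \<subseteq> ext (double j)"
  unfolding double_def by (rule addn_superset)

definition half :: "'a => 'a" where "half n = least_nat (%k. n = double k \<or> n = succ (double k))"
lemma def_fun_half[THEN def_funD, def_intros]: "def_fun half"
  by (intro def_funI, unfold half_def, intro def_intros)
lemma half_double:
  assumes k: "k \<in> nats"
  shows "half (double k) = k" "half (succ (double k)) = k"
proof -
  have "half n = k" if n: "n = double k \<or> n = succ (double k)" for n
  proof -
    have "def_pred (%k. n = double k \<or> n = succ (double k))" by (intro def_intros)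
    note half = least_natI(1,2)[OF this k n, folded half_def]
    then have "double k = double (half n)" using n k parity_double parity_succ_double by (metis succ_eq_iff)
    then show ?thesis using double_inj[OF k half(1)] by simp
  qed
  then show "half (double k) = k" "half (succ (double k)) = k" by blast+
qed

lemma half_in_omega: "n \<in> nats ==> half n \<in> nats"
  by (erule double_cases) (simp_all add: half_double)

definition even_part :: "'a => 'a" where "even_part y = lam omega (%k. y $ double k)"
lemma def_fun_even_part[THEN def_funD, def_intros]: "def_fun even_part"
  by (intro def_funI, unfold even_part_def, intro def_intros)
lemma ap_even_part: "k \<in> nats ==> even_part y $ k = y $ double k"
  unfolding even_part_def by (rule ap_lam) (intro def_intros)
lemma func_even_part: "func y omega omega ==> func (even_part y) omega omega"
  unfolding even_part_def by (rule func_lam) (intro def_intros, simp add: ap_in_codomain)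

text \<open>Player I produces a real digit by digit and player II tries to guess the next digit; player I
  wins if the real is in \<open>X\<close> and infinitely many guesses were wrong. Against a strategy of player
  II every real in \<open>X\<close> is determined by a finite initial segment. A strategy of player I is refuted
  by additivity: for some real \<open>x\<close> non-meager many guesses of player II would lead to \<open>x\<close>.\<close>

definition guess_game :: "'a => 'a" where
  "guess_game X = sep reals (%y. even_part y \<in> ext X \<and>
    (\<forall>k\<in>nats. \<exists>j\<in>nats. k \<in> ext (succ j) \<and> even_part y $ succ j \<noteq> y $ succ (double j)))"
lemma mem_guess_game:
  "y \<in> ext (guess_game X) \<longleftrightarrow> y \<in> ext reals \<and> even_part y \<in> ext X \<and>
    (\<forall>k\<in>nats. \<exists>j\<in>nats. k \<in> ext (succ j) \<and> even_part y $ succ j \<noteq> y $ succ (double j))"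
  unfolding guess_game_def by (subst ext_sep) (intro def_intros, simp)

abbreviation play_I :: "'a => 'a => 'a => bool" where "play_I \<equiv> play (%n. parity n = empty)"
abbreviation play_II :: "'a => 'a => 'a => bool" where "play_II \<equiv> play (%n. parity n \<noteq> empty)"
lemma def_pred_turns: "def_pred (%n. parity n = empty)" "def_pred (%n. parity n \<noteq> empty)"
  by (intro def_intros)+

context
  fixes X \<sigma>
  assumes X_reals: "ext X \<subseteq> ext reals" and \<sigma>: "strategy \<sigma>"
    and win: "\<And>y. y \<in> ext reals ==> follows (%n. parity n = empty) \<sigma> y ==> y \<in> ext (guess_game X)"
begin

interpretation cohen mem omega by unfold_locales (rule enumerable_omega)

definition outcome :: "'a => 'a" where
  "outcome x = sep (funs omega (fin_seqs omega)) (%f. \<exists>y. play_I \<sigma> (seq_union f) y \<and> even_part y = x)"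
lemma def_fun_outcome: "def_fun outcome"
  unfolding outcome_def by (intro def_intros definable_play[OF def_pred_turns(1)])
lemma mem_outcome:
  "f \<in> ext (outcome x) \<longleftrightarrow> func f omega (fin_seqs omega) \<and> (\<exists>y. play_I \<sigma> (seq_union f) y \<and> even_part y = x)"
  unfolding outcome_def by (subst ext_sep) (intro def_intros definable_play[OF def_pred_turns(1)], simp)

lemma play_I_wins: "play_I \<sigma> z y ==> y \<in> ext (guess_game X)"
  by (rule win[OF _ play_follows]) (simp_all add: play_real[folded ext_reals])

lemma some_outcome_forced:
  assumes AD "well_orders w X"
  obtains s x where "s \<in> ext Q" "x \<in> ext X" "Q.forces s (outcome x)"
proof -
  let ?U = "sep (funs omega Q) (%f. seq_union f \<in> ext reals)"
  have U: "f \<in> ext ?U \<longleftrightarrow> func f omega Q \<and> seq_union f \<in> ext reals" for f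
    by (subst ext_sep) (intro def_intros, simp)
  have start: "empty \<in> ext Q" unfolding ext_fin_seqs using func_empty empty_in_omega by blast
  have inv: "Q.invariant (outcome x)" for x
    unfolding invariant_set_def mem_outcome using seq_union_cong Q.descending_func by metis
  have "Q.forces empty ?U"
    by (rule Q.forcesI[OF dense_family_length_family])
      (use U func_seq_union Q.generic_descending Q.descending_func ext_reals in blast)
  then show thesis
  proof (rule Q.well_ordered_additivity[OF assms(1,2) def_fun_outcome inv start])
    fix f assume f: "Q.descending f" "f \<in> ext ?U"
    obtain y where y: "play_I \<sigma> (seq_union f) y"
      by (rule play_exists[OF def_pred_turns(1) \<sigma>]) (use f(2) U in blast)+
    then have "even_part y \<in> ext X" using play_I_wins mem_guess_game by blast
    then show "\<exists>x\<in>ext X. f \<in> ext (outcome x)"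
      unfolding mem_outcome using y Q.descending_func[OF f(1)] by blast
  qed (rule that)
qed

lemma forced_outcome:
  assumes s: "s \<in> ext Q" "Q.forces s (outcome x)" and x: "x \<in> ext X"
    and z: "z \<in> ext reals" "\<And>i. i \<in> ext (dom s) ==> z $ i = s $ i" and y: "play_I \<sigma> z y"
  shows "even_part y = x"
proof (rule func_ext)
  show "func (even_part y) omega omega" "func x omega omega"
    using func_even_part[OF play_real[OF y]] x X_reals ext_reals by blast+
  have z_func: "func z omega omega" using z(1) ext_reals by blast
  note n = fin_seqs_func[OF s(1)]
  fix k assume k: "k \<in> nats"
  obtain l where l: "l \<in> nats" "dom s \<in> ext (succ l)" "double k \<in> ext (succ l)"
    by (rule omega_max[OF n(1) double_in_omega[OF k]])
  note m = succ_in_omega[OF l(1)]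
  let ?t = "restr z (succ l)"
  have t: "func ?t (succ l) omega" and t_in_Q: "?t \<in> ext Q" using restr_in_fin_seqs[OF z_func m] by blast+
  have "opair i (s $ i) \<in> ext ?t" if "i \<in> ext (dom s)" for i
    using that ordinal_subset[OF ordinal_if_in_omega[OF m] l(2)] z(2)
    unfolding func_opair_iff[OF t] by (auto simp: ap_restr)
  then have "opair ?t s \<in> ext Q_order"
    unfolding opair_extension_order ext_func[OF n(2)] using t_in_Q s(1) by blast
  then have forced: "Q.forces ?t (outcome x)" by (rule Q.forces_mono[OF t_in_Q s(1) _ s(2)])
  obtain f where f: "Q.generic (length_family omega) f" "f $ empty = ?t" "f \<in> ext (outcome x)"
    by (rule Q.forces_both[OF forced forced dense_family_length_family t_in_Q]) (rule that)
  obtain y' where y': "play_I \<sigma> (seq_union f) y'" "even_part y' = x"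
    using f(3) unfolding mem_outcome by blast
  have "Q.enters f ?t" using Q.enters_self[OF Q.generic_descending[OF f(1)] empty_in_omega] f(2) by simp
  then have "seq_union f $ i = z $ i" if "i \<in> ext (succ l)" for i
    using ap_seq_union[OF f(1) t_in_Q] func_dom[OF t] that by (simp add: ap_restr)
  then have "y' $ double k = y $ double k" by (intro play_agree[OF y'(1) y m _ l(3)])
  then show "even_part y $ k = x $ k" using y'(2) ap_even_part[OF k] by metis
qed

lemma no_winning_I:
  assumes AD "well_orders w X"
  shows False
proof -
  obtain s x where s: "s \<in> ext Q" "Q.forces s (outcome x)" and x: "x \<in> ext X"
    by (rule some_outcome_forced[OF assms])
  have x_func: "func x omega omega" using x X_reals ext_reals by blast
  note n = fin_seqs_func[OF s(1)]
  let ?guess = "%i. if i \<in> ext (dom s) then s $ i else x $ succ (half i)"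
  have definable: "def_fun ?guess" by (intro def_intros)
  have "func (lam omega ?guess) omega omega"
    by (rule func_lam[OF definable])
      (use ap_in_codomain[OF n(2)] ap_in_codomain[OF x_func] half_in_omega succ_in_omega in auto)
  then have guess_real: "lam omega ?guess \<in> ext reals" unfolding ext_reals .
  obtain y where y: "play_I \<sigma> (lam omega ?guess) y" by (rule play_exists[OF def_pred_turns(1) \<sigma> guess_real])
  have dig: "even_part y = x"
    by (rule forced_outcome[OF s x guess_real _ y]) (use ap_lam[OF definable] omega_trans[OF n(1)] in auto)
  obtain j where j: "j \<in> nats" "dom s \<in> ext (succ j)" "x $ succ j \<noteq> y $ succ (double j)"
    using play_I_wins[OF y] n(1) dig unfolding mem_guess_game by blast
  have "double j \<notin> ext (dom s)"
    using subset_double[OF j(1)] j(2) mem_irrefl[of "double j"] mem_asym[of "double j"] mem_irrefl by auto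
  then have "succ (double j) \<notin> ext (dom s)" using ordinal_trans[OF ordinal_if_in_omega[OF n(1)]] by auto
  then have "y $ succ (double j) = x $ succ j"
    using y parity_succ_double[OF j(1)] succ_in_omega[OF double_in_omega[OF j(1)]] half_double(2)[OF j(1)]
    unfolding play_def by (simp add: ap_lam[OF definable])
  then show False using j(3) by simp
qed

end

context
  fixes X \<tau>
  assumes X_reals: "ext X \<subseteq> ext reals" and \<tau>: "strategy \<tau>"
    and win: "\<And>y. y \<in> ext reals ==> follows (%n. parity n \<noteq> empty) \<tau> y ==> y \<notin> ext (guess_game X)"
begin

definition stretch :: "'a => 'a" where "stretch x = lam omega (%n. x $ half n)"
lemma def_fun_stretch[THEN def_funD]: "def_fun stretch"
  by (intro def_funI, unfold stretch_def, intro def_intros)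
lemma ap_stretch: "n \<in> nats ==> stretch x $ n = x $ half n"
  unfolding stretch_def by (rule ap_lam) (intro def_intros)

definition guessed_from :: "'a => 'a => bool" where
  "guessed_from x k \<longleftrightarrow> (\<exists>y. play_II \<tau> (stretch x) y \<and>
    (\<forall>j\<in>nats. k \<in> ext (succ j) --> x $ succ j = y $ succ (double j)))"
lemma def_pred2_guessed_from: "def_pred2 guessed_from"
  unfolding guessed_from_def
  by (intro def_pred2I def_intros definable_play[OF def_pred_turns(2)] def_fun_stretch)

lemma play_II_even_part:
  assumes "play_II \<tau> (stretch x) y" "k \<in> nats"
  shows "y $ double k = x $ k"
  using assms parity_double[OF assms(2)] half_double(1)[OF assms(2)]
  unfolding play_def by (simp add: ap_stretch)

lemma guessed_from_exists:
  assumes x: "x \<in> ext X"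
  obtains k where "k \<in> nats" "guessed_from x k"
proof -
  have x_func: "func x omega omega" using x X_reals ext_reals by blast
  have definable: "def_fun (%n. x $ half n)" by (intro def_intros)
  have "func (stretch x) omega omega"
    unfolding stretch_def by (rule func_lam[OF definable]) (rule ap_in_codomain[OF x_func half_in_omega])
  then have "stretch x \<in> ext reals" unfolding ext_reals .
  then obtain y where y: "play_II \<tau> (stretch x) y" by (rule play_exists[OF def_pred_turns(2) \<tau>])
  have "even_part y = x"
    by (rule func_ext[OF func_even_part[OF play_real[OF y]] x_func])
      (simp add: ap_even_part play_II_even_part[OF y])
  moreover have "y \<in> ext reals" "y \<notin> ext (guess_game X)"
    using win[OF _ play_follows[OF y]] play_real[OF y] ext_reals by blast+
  ultimately show thesis using that x y unfolding mem_guess_game guessed_from_def by blast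
qed

lemma eq_if_guessed_from:
  assumes x: "x \<in> ext X" "guessed_from x k" and x': "x' \<in> ext X" "guessed_from x' k"
    and k: "k \<in> nats" and init: "\<And>i. i \<in> ext (succ k) ==> x $ i = x' $ i"
  shows "x = x'"
proof -
  obtain y where y: "play_II \<tau> (stretch x) y"
    "\<And>j. j \<in> nats ==> k \<in> ext (succ j) ==> x $ succ j = y $ succ (double j)"
    using x(2) unfolding guessed_from_def by blast
  obtain y' where y': "play_II \<tau> (stretch x') y'"
    "\<And>j. j \<in> nats ==> k \<in> ext (succ j) ==> x' $ succ j = y' $ succ (double j)"
    using x'(2) unfolding guessed_from_def by blast
  have same_digit: "x $ l = x' $ l"
    if l: "l \<in> nats" and agree: "\<And>i. i \<in> ext (double l) ==> y $ i = y' $ i" for l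
  proof (cases "l \<in> ext (succ k)")
    case False
    then have k_in_l: "k \<in> ext l" using omega_linear[OF l k] by auto
    then have "l \<noteq> empty" by auto
    then obtain j where j: "j \<in> nats" "l = succ j" using omega_cases[OF l] by metis
    have "y $ succ (double j) = y' $ succ (double j)" using agree by (simp add: j double_succ)
    then show ?thesis using y(2)[OF j(1)] y'(2)[OF j(1)] k_in_l unfolding j(2) by simp
  qed (rule init)
  have "x $ l = x' $ l" if l: "l \<in> nats" for l
  proof (rule same_digit[OF l play_agree[OF y(1) y'(1) double_in_omega[OF l]]])
    fix i assume i: "i \<in> ext (double l)" "\<not> parity i \<noteq> empty" "\<And>j. j \<in> ext i ==> y $ j = y' $ j"
    have "i \<in> nats" by (rule omega_trans[OF double_in_omega[OF l] i(1)])
    then obtain h where h: "h \<in> nats" "i = double h"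
      by (rule double_cases) (use i(2) parity_succ_double in auto)
    have "x $ h = x' $ h" by (rule same_digit[OF h(1)]) (use i(3) h(2) in blast)
    then show "stretch x $ i = stretch x' $ i" using h half_double(1) by (simp add: ap_stretch)
  qed
  moreover have "func x omega omega" "func x' omega omega" using x(1) x'(1) X_reals ext_reals by blast+
  ultimately show ?thesis by (blast intro: func_ext)
qed

lemma enumerable_if_winning_II:
  assumes "x0 \<in> ext X"
  shows "enumerable X"
proof -
  let ?k = "%x. least_nat (guessed_from x)"
  have definable: "def_fun ?k" by (intro def_intros def_pred2D[OF def_pred2_guessed_from])
  have k: "?k x \<in> nats" "guessed_from x (?k x)" if x: "x \<in> ext X" for x
  proof -
    obtain k where k: "k \<in> nats" "guessed_from x k" by (rule guessed_from_exists[OF x])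
    have "def_pred (guessed_from x)" by (intro def_intros def_pred2D[OF def_pred2_guessed_from])
    from least_natI(1,2)[OF this k] show "?k x \<in> nats" "guessed_from x (?k x)" .
  qed
  have x_func: "func x omega omega" if "x \<in> ext X" for x using that X_reals ext_reals by blast
  have code: "func (restr x (succ (?k x))) (succ (?k x)) omega" if "x \<in> ext X" for x
    by (rule restr_in_fin_seqs(1)[OF x_func[OF that] succ_in_omega[OF k(1)[OF that]]])
  show ?thesis
  proof (rule enumerable_if_inj[where F="%x. restr x (succ (?k x))", OF _ enumerable_fin_seqs[OF enumerable_omega] assms])
    show "def_fun (%x. restr x (succ (?k x)))" by (intro def_intros def_funD[OF definable])
    show "\<And>x. x \<in> ext X ==> restr x (succ (?k x)) \<in> ext (fin_seqs omega)"
      by (rule restr_in_fin_seqs(2)[OF x_func succ_in_omega[OF k(1)]])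
    fix x x' assume x: "x \<in> ext X" and x': "x' \<in> ext X"
      and same: "restr x (succ (?k x)) = restr x' (succ (?k x'))"
    have "succ (?k x) = succ (?k x')" using func_dom[OF code[OF x]] func_dom[OF code[OF x']] same by simp
    then have eq: "?k x' = ?k x" by simp
    have "x $ i = x' $ i" if "i \<in> ext (succ (?k x))" for i
      using ap_restr[OF that, of x] ap_restr[OF that, of x'] same eq by simp
    then show "x = x'" by (rule eq_if_guessed_from[OF x k(2)[OF x] x' k(2)[OF x', unfolded eq] k(1)[OF x]])
  qed
qed

end

lemma enumerable_if_well_ordered_reals:
  assumes AD and wo: "well_orders w X" and X_reals: "ext X \<subseteq> ext reals" and x0: "x0 \<in> ext X"
  shows "enumerable X"
proof -
  have "ext (guess_game X) \<subseteq> ext reals" using mem_guess_game by blast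
  with \<open>AD\<close> show ?thesis
  proof (cases rule: AD_cases)
    case (1 \<sigma>)
    then show ?thesis using no_winning_I[OF X_reals 1 \<open>AD\<close> wo] by blast
  next
    case (2 \<sigma>)
    then show ?thesis by (rule enumerable_if_winning_II[OF X_reals _ _ x0])
  qed
qed

lemma enumerable_if_well_ordered_subsets:
  assumes AD and wo: "well_orders w P" and Q: "enumerable Q" "\<And>B. B \<in> ext P ==> ext B \<subseteq> ext Q"
    and p: "p \<in> ext P"
  shows "enumerable P"
proof -
  obtain e where e: "enum e Q" by (rule enumerableE[OF Q(1)])
  define char where "char B = lam omega (%n. if e $ n \<in> ext B then succ empty else empty)" for B
  have definable: "def_fun char" unfolding char_def by (intro def_funI def_intros)
  have ap_char: "char B $ n = (if e $ n \<in> ext B then succ empty else empty)" if "n \<in> nats" for B n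
    unfolding char_def by (rule ap_lam[OF _ that]) (intro def_intros)
  have real: "char B \<in> ext reals" for B
    unfolding char_def ext_reals by (rule func_lam) (intro def_intros, simp)
  have inj: "B = B'" if B: "ext B \<subseteq> ext Q" "ext B' \<subseteq> ext Q" "char B = char B'" for B B'
  proof (rule ext_inject, rule set_eqI)
    fix q
    have "q \<in> ext B \<longleftrightarrow> q \<in> ext B'" if q: "q \<in> ext Q"
    proof -
      obtain n where n: "n \<in> nats" "e $ n = q" by (rule enum_surj[OF e q])
      show ?thesis using ap_char[OF n(1), of B] ap_char[OF n(1), of B'] B(3) n(2) by (auto split: if_splits)
    qed
    then show "q \<in> ext B \<longleftrightarrow> q \<in> ext B'" using B(1,2) by blast
  qed
  have image: "ext (img char P) = char ` ext P" by (rule ext_img[OF definable])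
  have "enumerable (img char P)"
    by (rule enumerable_if_well_ordered_reals[OF \<open>AD\<close> well_orders_img[OF definable wo], of "char p"])
      (use image real p in auto)
  then show ?thesis by (rule enumerable_if_inj[OF definable _ p]) (use image inj Q(2) in auto)
qed

section \<open>Determinacy of games on the natural numbers\<close>

lemma surjection_iff_ap: "surjection f a b \<longleftrightarrow> func f a b \<and> (\<forall>y\<in>ext b. \<exists>x\<in>ext a. f $ x = y)"
proof (cases "func f a b")
  case True
  have "app f ` ext a = ($) f ` ext a" by (rule image_cong) (auto simp: func_app[OF True])
  moreover have "($) f ` ext a \<subseteq> ext b" using ap_in_codomain[OF True] by blast
  moreover have "ext b \<subseteq> ($) f ` ext a \<longleftrightarrow> (\<forall>y\<in>ext b. \<exists>x\<in>ext a. f $ x = y)"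
    by (auto simp: subset_iff image_iff eq_commute)
  ultimately have "app f ` ext a = ext b \<longleftrightarrow> (\<forall>y\<in>ext b. \<exists>x\<in>ext a. f $ x = y)" by auto
  then show ?thesis unfolding surjection_def using True by simp
qed (simp add: surjection_def)

lemma def_pred3_surjection[THEN def_pred3D, def_intros]: "def_pred3 surjection"
  by (intro def_pred3I, unfold surjection_iff_ap, intro def_intros)

lemma surjection_image:
  assumes "surjection f a b"
  shows "ext b = ($) f ` ext a"
proof (intro equalityI subsetI)
  have f: "func f a b" "\<forall>y\<in>ext b. \<exists>x\<in>ext a. f $ x = y" using assms unfolding surjection_iff_ap by blast+
  show "y \<in> ($) f ` ext a" if "y \<in> ext b" for y using f(2) that by fast
  show "y \<in> ext b" if "y \<in> ($) f ` ext a" for y using ap_in_codomain[OF f(1)] that by fast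
qed

lemma surjection_below:
  assumes f: "surjection f D a" and a: "ordinal a" and x: "x \<in> ext D"
  shows "ext (f $ x) = ($) f ` {y \<in> ext D. f $ y \<in> ext (f $ x)}"
proof -
  have "ext a = ($) f ` ext D" by (rule surjection_image[OF f])
  then have "ext (f $ x) \<subseteq> ($) f ` ext D" using ordinal_subset[OF a, of "f $ x"] x by simp
  then show ?thesis by auto
qed

lemma surjection_order_unique:
  assumes f: "surjection f D a" and g: "surjection g D b" and a: "ordinal a" and b: "ordinal b"
    and order: "\<And>x y. x \<in> ext D ==> y \<in> ext D ==> f $ x \<in> ext (f $ y) \<longleftrightarrow> g $ x \<in> ext (g $ y)"
  shows "a = b"
proof -
  have eq: "f $ x = g $ x" if x: "x \<in> ext D" for x
  proof -
    have ord: "ordinal (f $ x)" using surjection_image[OF f] x by (intro ordinal_mem[OF a]) simp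
    have definable: "def_pred (%c. \<forall>z\<in>ext D. f $ z = c --> g $ z = c)" by (intro def_intros)
    have "\<forall>z\<in>ext D. f $ z = f $ x --> g $ z = f $ x"
    proof (rule ordinal_induct[OF ord definable], intro ballI impI)
      fix c z assume IH: "\<And>d. d \<in> ext c ==> \<forall>y\<in>ext D. f $ y = d --> g $ y = d"
        and z: "z \<in> ext D" "f $ z = c"
      have "($) g ` {y \<in> ext D. g $ y \<in> ext (g $ z)} = ($) f ` {y \<in> ext D. f $ y \<in> ext (f $ z)}"
        using IH order[OF _ z(1)] z(2) by (intro image_cong) auto
      then show "g $ z = c"
        using surjection_below[OF f a z(1)] surjection_below[OF g b z(1)] z(2) by (intro ext_inject) simp
    qed
    then show ?thesis using x by simp
  qed
  have "($) f ` ext D = ($) g ` ext D" by (rule image_cong) (simp_all add: eq)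
  then show ?thesis unfolding surjection_image[OF f, symmetric] surjection_image[OF g, symmetric]
    by (rule ext_inject)
qed

lemma surjection_bound:
  shows "\<exists>a. ordinal a \<and> a \<noteq> empty \<and> \<not> (\<exists>f. surjection f D a)"
proof (rule ccontr)
  assume "\<not> ?thesis"
  then have surj: "\<exists>f. surjection f D a" if "ordinal a" "a \<noteq> empty" for a using that by blast
  let ?R = "%f. sep (cprod D D) (%p. f $ pfst p \<in> ext (f $ psnd p))"
  have R: "z \<in> ext (?R f) \<longleftrightarrow> z \<in> ext (cprod D D) \<and> f $ pfst z \<in> ext (f $ psnd z)" for z f
    by (subst ext_sep) (intro def_intros, simp)
  let ?F = "%r. descr (%a. ordinal a \<and> (\<exists>f. surjection f D a \<and> r = ?R f))"
  let ?A = "sep (img ?F (pow (cprod D D))) ordinal"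
  have F: "def_fun ?F" by (intro def_intros)
  have A: "a \<in> ext ?A \<longleftrightarrow> a \<in> ?F ` ext (pow (cprod D D)) \<and> ordinal a" for a
    unfolding ext_img[OF F, symmetric] by (subst ext_sep) (intro def_intros, simp)
  have all: "a \<in> ext ?A" if a: "ordinal a" "a \<noteq> empty" for a
  proof -
    obtain f where f: "surjection f D a" using surj[OF a] by blast
    have "?F (?R f) = a"
    proof (rule descr_equality)
      show "ordinal a \<and> (\<exists>g. surjection g D a \<and> ?R f = ?R g)" using f a by blast
      fix b assume "ordinal b \<and> (\<exists>g. surjection g D b \<and> ?R f = ?R g)"
      then obtain g where g: "ordinal b" "surjection g D b" "?R f = ?R g" by blast
      have mem_R: "h $ x \<in> ext (h $ y) \<longleftrightarrow> opair x y \<in> ext (?R h)" if "x \<in> ext D" "y \<in> ext D" for x y h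
        unfolding R using that by simp
      show "b = a"
      proof (rule surjection_order_unique[OF g(2) f g(1) a(1)])
        fix x y assume xy: "x \<in> ext D" "y \<in> ext D"
        show "g $ x \<in> ext (g $ y) \<longleftrightarrow> f $ x \<in> ext (f $ y)" unfolding mem_R[OF xy] g(3) ..
      qed
    qed
    moreover have "?R f \<in> ext (pow (cprod D D))"
      unfolding ext_pow by (intro CollectI subsetI) (unfold R, blast)
    ultimately have "a \<in> ?F ` ext (pow (cprod D D))" by (rule image_eqI[OF sym])
    then show ?thesis unfolding A using a(1) by blast
  qed
  have bound: "ordinal (succ (bigunion ?A))" "x \<in> ext ?A ==> x \<in> ext (succ (bigunion ?A))" for x
    using ordinal_bound[of ?A] A by blast+
  have "succ (bigunion ?A) \<in> ext ?A" by (rule all[OF bound(1)]) simp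
  then show False using bound(2) mem_irrefl by blast
qed

lemma Theta_props: "ordinal Theta" "Theta \<noteq> empty" "\<not> (\<exists>f. surjection f reals Theta)"
proof -
  let ?P = "%a. ordinal a \<and> a \<noteq> empty \<and> \<not> (\<exists>f. surjection f reals a)"
  obtain a where a: "?P a" using surjection_bound by blast
  have "def_pred ?P" by (intro def_intros)
  then obtain b where b: "ordinal b" "?P b" "\<And>c. c \<in> ext b ==> \<not> ?P c"
    by (rule ordinal_least[where a=a]) (use a in blast)+
  let ?Q = "%\<theta>. ordinal \<theta> \<and> \<theta> \<noteq> empty \<and> (\<nexists>f. surjection f reals \<theta>) \<and>
    (\<forall>\<alpha>\<in>ext \<theta>. \<alpha> \<noteq> empty --> (\<exists>f. surjection f reals \<alpha>))"
  have Q: "?Q b" using b ordinal_mem by blast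
  have "?Q c ==> c = b" for c using Q ordinal_linear[of c b] by blast
  then have "Theta = b" unfolding Theta_def using Q by (intro the_equality) blast+
  then show "ordinal Theta" "Theta \<noteq> empty" "\<not> (\<exists>f. surjection f reals Theta)" using b(2) by blast+
qed

lemma reals_onto_countable_ordinal:
  assumes n: "n \<in> ext (succ omega)" "n \<noteq> empty"
  shows "\<exists>f. surjection f reals n"
proof -
  let ?F = "%x. if x $ empty \<in> ext n then x $ empty else empty"
  have F: "def_fun ?F" by (intro def_intros)
  have "ordinal n" using n(1) ordinal_mem[OF ordinal_succ[OF ordinal_omega]] by blast
  then have zero: "empty \<in> ext n" using ordinal_linear[OF _ ordinal_empty] n(2) by auto
  have n_sub: "ext n \<subseteq> nats" using n(1) ordinal_subset[OF ordinal_omega] by auto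
  have "func (lam reals ?F) reals n" by (rule func_lam[OF F]) (use zero in simp)
  moreover have "\<exists>x\<in>ext reals. (lam reals ?F) $ x = m" if m: "m \<in> ext n" for m
  proof
    have const: "def_fun (%_. m)" by (intro def_intros)
    show real: "lam omega (%_. m) \<in> ext reals"
      unfolding ext_reals by (rule func_lam[OF const]) (use m n_sub in blast)
    show "lam reals ?F $ lam omega (%_. m) = m"
      using ap_lam[OF F real] ap_lam[OF const empty_in_omega] m by simp
  qed
  ultimately show ?thesis unfolding surjection_iff_ap by blast
qed

lemma omega_in_Theta: "omega \<in> ext Theta"
proof -
  have "Theta \<notin> ext (succ omega)" using Theta_props reals_onto_countable_ordinal by blast
  then show ?thesis using ordinal_linear[OF Theta_props(1) ordinal_omega] by simp
qed

lemma AD_if_AD_plus: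
  assumes AD_plus
  shows AD
  unfolding AD_def
proof (intro allI impI)
  fix A assume A: "ext A \<subseteq> ext reals"
  let ?id = "lam reals (%x. x)"
  have definable: "def_fun (%x. x)" by (intro def_intros)
  have id: "func ?id reals reals" by (rule func_lam[OF definable])
  have pre: "preimage ?id (funs omega omega) U = U" if U: "ext U \<subseteq> ext reals" for U
  proof -
    have "{x \<in> ext reals. app ?id x \<in> ext U} = ext U" using func_app[OF id] ap_lam[OF definable] U by auto
    then show ?thesis unfolding preimage_def reals_def[symmetric] by simp
  qed
  have "continuous_to_reals omega ?id"
    unfolding continuous_to_reals_def using id pre unfolding seq_open_def reals_def by auto
  moreover have "omega \<noteq> empty" using empty_in_omega ext_eq_empty_iff by blast
  ultimately have "determined omega (preimage ?id (funs omega omega) A)"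
    using assms A omega_in_Theta unfolding AD_plus_def by blast
  then show "determined omega A" unfolding pre[OF A] .
qed

end
context zf_model
begin

section \<open>The levels of \<open>L[S,x]\<close>\<close>

definition extend :: "'a => 'a => 'a => 'a" where "extend n s a = cup s (upair (opair n a) (opair n a))"
lemma def_term_extend[THEN def_fun3D, def_intros]: "def_fun3 extend"
  by (intro def_fun3I, unfold extend_def, intro def_intros)
lemma coll_insert_opair: "coll (insert (opair n a) (ext s)) = extend n s a"
proof -
  have "insert (opair n a) (ext s) = ext (extend n s a)" unfolding extend_def by auto
  then show ?thesis by simp
qed

lemma extend_eq_snoc: "func s n A ==> extend n s a = snoc s a"
  unfolding extend_def snoc_def by (simp add: func_dom)

definition rel_mem :: "'a => 'a => 'a => 'a => 'a" where
  "rel_mem A n i j = sep (funs n A) (%s. s $ i \<in> ext (s $ j))"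
definition rel_eq :: "'a => 'a => 'a => 'a => 'a" where
  "rel_eq A n i j = sep (funs n A) (%s. s $ i = s $ j)"
definition rel_pred :: "'a => 'a => 'a => 'a => 'a" where
  "rel_pred P A n i = sep (funs n A) (%s. s $ i \<in> ext P)"
definition rel_compl :: "'a => 'a => 'a => 'a" where "rel_compl A n R = sep (funs n A) (%s. s \<notin> ext R)"
definition rel_inter :: "'a => 'a => 'a" where "rel_inter R R' = sep R (%s. s \<in> ext R')"
definition rel_proj :: "'a => 'a => 'a => 'a" where
  "rel_proj A n R = sep (funs n A) (%s. \<exists>a\<in>ext A. extend n s a \<in> ext R)"

lemma ext_rel_mem: "ext (rel_mem A n i j) = {s. func s n A \<and> s $ i \<in> ext (s $ j)}"
  unfolding rel_mem_def by (subst ext_sep) (intro def_intros, simp)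
lemma ext_rel_eq: "ext (rel_eq A n i j) = {s. func s n A \<and> s $ i = s $ j}"
  unfolding rel_eq_def by (subst ext_sep) (intro def_intros, simp)
lemma ext_rel_pred: "ext (rel_pred P A n i) = {s. func s n A \<and> s $ i \<in> ext P}"
  unfolding rel_pred_def by (subst ext_sep) (intro def_intros, simp)
lemma ext_rel_compl: "ext (rel_compl A n R) = {s. func s n A \<and> s \<notin> ext R}"
  unfolding rel_compl_def by (subst ext_sep) (intro def_intros, simp)
lemma ext_rel_inter: "ext (rel_inter R R') = ext R \<inter> ext R'"
  unfolding rel_inter_def by (subst ext_sep) (intro def_intros, auto)
lemma ext_rel_proj: "ext (rel_proj A n R) = {s. func s n A \<and> (\<exists>a\<in>ext A. extend n s a \<in> ext R)}"
  unfolding rel_proj_def by (subst ext_sep) (intro def_intros, simp)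

lemma def_term_rel_compl[THEN def_fun3D, def_intros]: "def_fun3 rel_compl"
  by (intro def_fun3I, unfold rel_compl_def, intro def_intros)
lemma def_fun2_rel_inter[THEN def_fun2D, def_intros]: "def_fun2 rel_inter"
  by (intro def_fun2I, unfold rel_inter_def, intro def_intros)
lemma def_term_rel_proj[THEN def_fun3D, def_intros]: "def_fun3 rel_proj"
  by (intro def_fun3I, unfold rel_proj_def, intro def_intros)

definition closed_rels :: "'a => 'a => 'a => 'a => bool" where
  "closed_rels S x A F \<longleftrightarrow>
      (\<forall>n\<in>nats. \<forall>i\<in>ext n. \<forall>j\<in>ext n. opair n (rel_mem A n i j) \<in> ext F \<and> opair n (rel_eq A n i j) \<in> ext F) \<and>
    (\<forall>n\<in>nats. \<forall>i\<in>ext n. opair n (rel_pred S A n i) \<in> ext F \<and> opair n (rel_pred x A n i) \<in> ext F) \<and>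
    (\<forall>n R. n \<in> nats \<and> opair n R \<in> ext F --> opair n (rel_compl A n R) \<in> ext F) \<and>
    (\<forall>n R R'. n \<in> nats \<and> opair n R \<in> ext F \<and> opair n R' \<in> ext F --> opair n (rel_inter R R') \<in> ext F) \<and>
    (\<forall>n R. n \<in> nats \<and> opair (succ n) R \<in> ext F --> opair n (rel_proj A n R) \<in> ext F)"

lemma definable_closed_rels[THEN def_pred3D, def_intros]: "def_pred3 (closed_rels S)"
  by (intro def_pred3I, unfold closed_rels_def rel_mem_def rel_eq_def rel_pred_def, intro def_intros)

lemma coll_eqI: "X = ext a ==> coll X = a" by simp

lemma def_closed_iff: "def_closed [S, x] A F \<longleftrightarrow> closed_rels S x A F"
proof -
  have mem: "a \<in>\<^sub>M b \<longleftrightarrow> a \<in> ext b" for a b by (simp add: ext_def)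
  have rels: "coll {s. func s n A \<and> app s i \<in>\<^sub>M app s j} = rel_mem A n i j"
    "coll {s. func s n A \<and> app s i = app s j} = rel_eq A n i j"
    "coll {s. func s n A \<and> app s i \<in>\<^sub>M P} = rel_pred P A n i" if "i \<in> ext n" "j \<in> ext n" for n i j P
    by (rule coll_eqI, auto simp: ext_rel_mem ext_rel_eq ext_rel_pred mem func_app[OF _ that(1)]
      func_app[OF _ that(2)])+
  have compl: "coll (ext (funs n A) - ext R) = rel_compl A n R" for n R
    by (rule coll_eqI) (auto simp: ext_rel_compl)
  have inter: "coll (ext R \<inter> ext R') = rel_inter R R'" for R R' by (rule coll_eqI) (simp add: ext_rel_inter)
  have proj: "coll {s. func s n A \<and> (\<exists>a\<in>ext A. coll (insert (opair n a) (ext s)) \<in> ext R)} =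
      rel_proj A n R" for n R
    by (rule coll_eqI) (simp add: ext_rel_proj coll_insert_opair)
  show ?thesis unfolding def_closed_def closed_rels_def compl inter proj
    by (simp add: rels ball_conj_distrib cong: ball_cong)
qed

definition def_rel :: "'a => 'a => 'a => 'a => 'a => bool" where
  "def_rel S x A n R \<longleftrightarrow> n \<in> nats \<and> (\<forall>F. closed_rels S x A F --> opair n R \<in> ext F)"
lemma definable_def_rel[THEN def_pred4D, def_intros]: "def_pred4 (def_rel S)"
  by (intro def_pred4I, unfold def_rel_def, intro def_intros)
lemma definable_rel_iff: "definable_rel [S, x] A n R \<longleftrightarrow> def_rel S x A n R"
  unfolding definable_rel_def def_rel_def def_closed_iff ..

lemma closed_rels_def_rel:
  assumes n: "n \<in> nats"
  shows "i \<in> ext n ==> j \<in> ext n ==> def_rel S x A n (rel_mem A n i j)"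
    "i \<in> ext n ==> j \<in> ext n ==> def_rel S x A n (rel_eq A n i j)"
    "i \<in> ext n ==> def_rel S x A n (rel_pred S A n i)" "i \<in> ext n ==> def_rel S x A n (rel_pred x A n i)"
    "def_rel S x A n R ==> def_rel S x A n (rel_compl A n R)"
      "def_rel S x A n R ==> def_rel S x A n R' ==> def_rel S x A n (rel_inter R R')"
    "def_rel S x A (succ n) R ==> def_rel S x A n (rel_proj A n R)"
proof -
  have def_relI: "def_rel S x A n R" if "\<And>F. closed_rels S x A F ==> opair n R \<in> ext F" for R
    using that n unfolding def_rel_def by blast
  have mem: "opair m R \<in> ext F" if "def_rel S x A m R" "closed_rels S x A F" for m R F
    using that unfolding def_rel_def by blast
  show "i \<in> ext n ==> j \<in> ext n ==> def_rel S x A n (rel_mem A n i j)"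
    "i \<in> ext n ==> j \<in> ext n ==> def_rel S x A n (rel_eq A n i j)"
    "i \<in> ext n ==> def_rel S x A n (rel_pred S A n i)" "i \<in> ext n ==> def_rel S x A n (rel_pred x A n i)"
    by (rule def_relI, use n in \<open>simp add: closed_rels_def\<close>)+
  have closed: "opair m R \<in> ext F ==> opair m (rel_compl A m R) \<in> ext F"
    "opair m R \<in> ext F ==> opair m R' \<in> ext F ==> opair m (rel_inter R R') \<in> ext F"
    "opair (succ m) R \<in> ext F ==> opair m (rel_proj A m R) \<in> ext F"
    if "closed_rels S x A F" "m \<in> nats" for F m R R'
    using that unfolding closed_rels_def by blast+
  show "def_rel S x A n R ==> def_rel S x A n (rel_compl A n R)"
    "def_rel S x A n R ==> def_rel S x A n R' ==> def_rel S x A n (rel_inter R R')"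
    "def_rel S x A (succ n) R ==> def_rel S x A n (rel_proj A n R)"
    by (rule def_relI, rule closed[OF _ n], assumption, erule (1) mem, (erule (1) mem)?)+
qed

definition rel_section :: "'a => 'a => 'a => 'a => 'a" where
  "rel_section A n s R = sep A (%a. extend n s a \<in> ext R)"
lemma ext_rel_section: "ext (rel_section A n s R) = {a \<in> ext A. extend n s a \<in> ext R}"
  unfolding rel_section_def by (rule ext_sep) (intro def_intros)

definition def_pow :: "'a => 'a => 'a => 'a" where
  "def_pow S x A = sep (pow A) (%X. \<exists>n\<in>nats. \<exists>s R.
     func s n A \<and> def_rel S x A (succ n) R \<and> X = rel_section A n s R)"
lemma def_term_def_pow[THEN def_fun2D, def_intros]: "def_fun2 (def_pow S)"
  by (intro def_fun2I, unfold def_pow_def rel_section_def, intro def_intros)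
lemma ext_def_pow: "X \<in> ext (def_pow S x A) \<longleftrightarrow>
    (\<exists>n\<in>nats. \<exists>s R. func s n A \<and> def_rel S x A (succ n) R \<and> X = rel_section A n s R)"
proof -
  have "def_pred (%X. \<exists>n\<in>nats. \<exists>s R. func s n A \<and> def_rel S x A (succ n) R \<and> X = rel_section A n s R)"
    unfolding rel_section_def by (intro def_intros)
  from ext_sep[OF this] show ?thesis unfolding def_pow_def using ext_rel_section by auto
qed

lemma Def_eq_def_pow: "Def [S, x] A = def_pow S x A"
proof -
  have "coll {a \<in> ext A. coll (insert (opair n a) (ext s)) \<in> ext R} = rel_section A n s R" for n s R
    by (rule coll_eqI) (simp add: ext_rel_section coll_insert_opair)
  note E = this
  show ?thesis unfolding Def_def definable_rel_iff E by (rule coll_eqI) (simp add: set_eq_iff ext_def_pow)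
qed

definition level_step :: "'a => 'a => 'a => 'a" where
  "level_step S x f = (if limit (dom f) then bigunion (img (($) f) (dom f))
    else bigunion (img (%b. def_pow S x (f $ b)) (sep (dom f) (%b. dom f = succ b))))"
definition level :: "'a => 'a => 'a => 'a" where "level S x c = ord_rec (level_step S x) c"

lemma def_term_level_step[THEN def_fun2D, def_intros]: "def_fun2 (level_step S)"
  by (intro def_fun2I, unfold level_step_def, intro def_intros)
lemma def_term_level[THEN def_fun2D, def_intros]: "def_fun2 (level S)"
  by (intro def_fun2I, unfold level_def, intro def_intros)

lemma level_unfold:
  assumes "ordinal c"
  shows "a \<in> ext (level S x c) \<longleftrightarrow>
    (limit c \<and> (\<exists>b\<in>ext c. a \<in> ext (level S x b))) \<or> (\<exists>b. c = succ b \<and> a \<in> ext (def_pow S x (level S x b)))"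
proof -
  have rec: "def_fun (ord_rec (level_step S x))" by (intro def_intros)
  let ?f = "lam c (ord_rec (level_step S x))"
  have dom: "dom ?f = c" by (rule func_dom[OF func_lam_img[OF rec]])
  have ap_f: "?f $ b = level S x b" if "b \<in> ext c" for b unfolding level_def by (rule ap_lam[OF rec that])
  have definable: "def_fun (($) ?f)" "def_fun (%b. def_pow S x (?f $ b))"
    and successor: "def_pred (%b. c = succ b)" by (intro def_intros)+
  have step: "level S x c = level_step S x ?f"
    unfolding level_def by (rule ord_rec_unfold[OF _ assms]) (intro def_intros)
  show ?thesis
  proof (cases "limit c")
    case True
    then have "c \<noteq> succ b" for b unfolding limit_def by blast
    moreover have "level_step S x ?f = bigunion (img (($) ?f) c)"
      unfolding level_step_def[of S x ?f] dom using True by simp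
    then have "ext (level S x c) = {z. \<exists>b\<in>ext c. z \<in> ext (?f $ b)}"
      unfolding step by (simp add: ext_img[OF definable(1)])
    ultimately show ?thesis using True ap_f by auto
  next
    case False
    then have "level_step S x ?f = bigunion (img (%b. def_pow S x (?f $ b)) (sep c (%b. c = succ b)))"
      unfolding level_step_def[of S x ?f] dom by simp
    then have "ext (level S x c) = {z. \<exists>b\<in>ext c. c = succ b \<and> z \<in> ext (def_pow S x (?f $ b))}"
      unfolding step by (auto simp: ext_img[OF definable(2)] ext_sep[OF successor])
    moreover have "c = succ b ==> b \<in> ext c \<and> ?f $ b = level S x b" for b using ap_f[of b] by auto
    ultimately show ?thesis using False by auto
  qed
qed

lemma level_empty: "level S x empty = empty"
  by (rule ext_inject, rule set_eqI, subst level_unfold) (simp_all add: limit_def)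
lemma level_succ: "ordinal b ==> level S x (succ b) = def_pow S x (level S x b)"
  by (rule ext_inject, rule set_eqI, subst level_unfold) (simp_all add: limit_def)
lemma level_limit: "limit b ==> ext (level S x b) = (\<Union>c\<in>ext b. ext (level S x c))"
  using level_unfold[of b] unfolding limit_def by auto

lemma L_levels_eq_level:
  assumes f: "L_levels [S, x] empty c f" and "b \<in> ext (succ c)"
  shows "app f b = level S x b"
proof -
  have c: "ordinal c" and zero: "app f empty = empty"
    and S: "\<And>b. b \<in> ext c ==> app f (succ b) = def_pow S x (app f b)"
    and lim: "\<And>b. b \<in> ext (succ c) ==> limit b ==> app f b = coll (\<Union>d\<in>ext b. ext (app f d))"
    using f unfolding L_levels_def Def_eq_def_pow by blast+
  obtain B where "func f (succ c) B" using f unfolding L_levels_def by blast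
  note app_ap = func_app[OF this]
  have "b \<in> ext (succ c) --> f $ b = level S x b" if b: "ordinal b" for b
  proof (rule ordinal_induct[OF b], goal_cases)
    case 1
    show "def_pred (%b. b \<in> ext (succ c) --> f $ b = level S x b)" by (intro def_intros)
  next
    case (2 b)
    have below: "app f d = level S x d" if "b \<in> ext (succ c)" "d \<in> ext b" for d
    proof -
      have d: "d \<in> ext (succ c)" by (rule ordinal_trans[OF ordinal_succ[OF c] that])
      show ?thesis using 2(2)[OF that(2), THEN mp, OF d] app_ap[OF d] by simp
    qed
    show "b \<in> ext (succ c) --> f $ b = level S x b"
    proof
      assume b: "b \<in> ext (succ c)"
      consider "b = empty" | d where "b = succ d" | "limit b" using 2(1) unfolding limit_def by blast
      then have "app f b = level S x b"
      proof cases
        case 1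
        then show ?thesis using zero level_empty by simp
      next
        case (2 d)
        then have "d \<in> ext c" using b ordinal_trans[OF c] by auto
        then show ?thesis
          using S[of d] below[OF b, of d] level_succ[OF ordinal_mem[OF c]] unfolding 2 by simp
      next
        case 3
        then show ?thesis using lim[OF b 3] below[OF b] level_limit[OF 3, of S x, symmetric] by simp
      qed
      then show "f $ b = level S x b" using app_ap[OF b] by simp
    qed
  qed
  from this[OF ordinal_mem[OF ordinal_succ[OF c] assms(2)], THEN mp, OF assms(2)]
  show ?thesis using app_ap[OF assms(2)] by metis
qed

lemma L_levels_lam_level:
  assumes c: "ordinal c"
  shows "L_levels [S, x] empty c (lam (succ c) (level S x))"
proof -
  let ?f = "lam (succ c) (level S x)"
  have definable: "def_fun (level S x)" by (intro def_intros)
  have f: "func ?f (succ c) (img (level S x) (succ c))" by (rule func_lam_img[OF definable])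
  have app_f: "app ?f b = level S x b" if "b \<in> ext (succ c)" for b
    using func_app[OF f that] ap_lam[OF definable that] by simp
  have zero: "app ?f empty = empty"
    using app_f[of empty] ordinal_linear[OF c ordinal_empty] level_empty by auto
  have step: "app ?f (succ b) = Def [S, x] (app ?f b)" if b: "b \<in> ext c" for b
  proof -
    have "succ b \<in> ext (succ c)"
      using ordinal_subset_iff[OF ordinal_succ[OF ordinal_mem[OF c b]] c] ordinal_subset[OF c b] b by auto
    then show ?thesis using app_f b level_succ[OF ordinal_mem[OF c b]] unfolding Def_eq_def_pow by simp
  qed
  have "app ?f b = coll (\<Union>d\<in>ext b. ext (app ?f d))" if b: "b \<in> ext (succ c)" "limit b" for b
  proof -
    have "(\<Union>d\<in>ext b. ext (app ?f d)) = ext (level S x b)"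
      unfolding level_limit[OF b(2)] using app_f ordinal_trans[OF ordinal_succ[OF c] b(1)] by simp
    then show ?thesis using app_f[OF b(1)] by simp
  qed
  then show ?thesis unfolding L_levels_def using c f zero step by blast
qed

lemma L_bracket_eq_levels: "L_bracket S x = {y. \<exists>c. ordinal c \<and> y \<in> ext (level S x c)}"
proof (intro equalityI subsetI)
  fix y assume "y \<in> L_bracket S x"
  then obtain c f where f: "L_levels [S, x] empty c f" "y \<in> ext (app f c)"
    unfolding L_bracket_def L_class_def by blast
  then have "ordinal c" unfolding L_levels_def by blast
  then show "y \<in> {y. \<exists>c. ordinal c \<and> y \<in> ext (level S x c)}"
    using f(2) L_levels_eq_level[OF f(1), of c] by auto
next
  fix y assume "y \<in> {y. \<exists>c. ordinal c \<and> y \<in> ext (level S x c)}"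
  then obtain c where c: "ordinal c" "y \<in> ext (level S x c)" by blast
  note levels = L_levels_lam_level[OF c(1), of S x]
  have "y \<in> ext (app (lam (succ c) (level S x)) c)" using L_levels_eq_level[OF levels, of c] c(2) by simp
  then show "y \<in> L_bracket S x" unfolding L_bracket_def L_class_def using levels by blast
qed

end

section \<open>Names for the elements of \<open>L[S,x]\<close>\<close>

primrec subformulas :: "fm => fm list" where
  "subformulas (Mem i j) = [Mem i j]"
| "subformulas (Eq i j) = [Eq i j]"
| "subformulas (Neg p) = Neg p # subformulas p"
| "subformulas (Conj p q) = Conj p q # subformulas p @ subformulas q"
| "subformulas (All i p) = All i p # subformulas p"

lemma subformulas_refl: "p \<in> set (subformulas p)" by (cases p) auto
lemma subformulas_trans: "q \<in> set (subformulas p) ==> set (subformulas q) \<subseteq> set (subformulas p)"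
  by (induction p) auto
lemma finite_fv: "finite (fv p)" by (induction p) auto
lemma fv_subformulas_bound: "\<exists>k. \<forall>q\<in>set (subformulas p). fv q \<subseteq> {..<k}"
proof -
  have "finite (\<Union>q\<in>set (subformulas p). fv q)" using finite_fv by simp
  then obtain k where "\<forall>i\<in>(\<Union>q\<in>set (subformulas p). fv q). i < k" using finite_nat_set_iff_bounded by blast
  then show ?thesis by blast
qed

context zf_model
begin

lemma sat_cong: "(\<And>i. i \<in> fv p ==> e i = e' i) ==> sat C p e = sat C p e'"
proof (induction p arbitrary: e e')
  case (All i p)
  have "sat C p (e(i := x)) = sat C p (e'(i := x))" for x by (rule All.IH) (use All.prems in auto)
  then show ?case by simp
next
  case (Conj p q)
  have "sat C p e = sat C p e'" by (rule Conj.IH(1)) (use Conj.prems in auto)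
  moreover have "sat C q e = sat C q e'" by (rule Conj.IH(2)) (use Conj.prems in auto)
  ultimately show ?case by simp
next
  case (Neg p)
  have "sat C p e = sat C p e'" by (rule Neg.IH) (use Neg.prems in auto)
  then show ?case by simp
qed auto

lemma definable_sat_L_bracket:
  assumes "\<And>i. def_term (t i)" "def_term u" shows "definable (%e. sat (L_bracket S (u e)) p (%i. t i e))"
  using assms
proof (induction p arbitrary: t u)
  case (Mem i j)
  have "definable (%e. t i e \<in> ext (t j e))" by (rule definable_mem[OF Mem(1) Mem(1)])
  then show ?case by (simp add: ext_def)
next
  case (Eq i j)
  have "definable (%e. t i e = t j e)" by (rule definable_eq[OF Eq(1) Eq(1)])
  then show ?case by simp
next
  case (Neg p)
  from definable_neg[OF Neg.IH[OF Neg.prems]] show ?case by simp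
next
  case (Conj p q)
  from definable_conj[OF Conj.IH(1)[OF Conj.prems] Conj.IH(2)[OF Conj.prems]] show ?case by simp
next
  case (All i p)
  let ?t = "%j. if j = i then (%e. e 0) else (%e. t j (%n. e (Suc n)))"
  have t: "def_term (?t j)" for j using def_term_shift[OF All.prems(1)] def_term_var by simp
  have u: "def_term (%e. u (%n. e (Suc n)))" by (rule def_term_shift[OF All.prems(2)])
  have sat_definable: "definable (%e. sat (L_bracket S (u (%n. e (Suc n)))) p (%j. ?t j e))"
    by (rule All.IH[OF t u])
  have level_definable: "definable (%e. \<exists>c. ordinal c \<and> e 0 \<in> ext (level S (u (%n. e (Suc n))) c))"
    by (intro definable_ex definable_conj definable_ordinal definable_mem def_term_level def_term_var
      def_term_shift[OF u])
  have "definable (%e. (\<exists>c. ordinal c \<and> e 0 \<in> ext (level S (u (%n. e (Suc n))) c)) -->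
    sat (L_bracket S (u (%n. e (Suc n)))) p (%j. if j = i then e 0 else t j (%n. e (Suc n))))"
    by (rule definable_imp[OF level_definable definable_cong[OF sat_definable]])
      (rule arg_cong[where f="sat _ p"], auto)
  from definable_all[where Q="%e y. (\<exists>c. ordinal c \<and> y \<in> ext (level S (u e) c)) -->
    sat (L_bracket S (u e)) p (%j. if j = i then y else t j e)", OF this]
  show ?case
  proof (rule definable_cong)
    fix e
    have "(%j. t j e)(i := y) = (%j. if j = i then y else t j e)" for y by auto
    then show "(\<forall>y. (\<exists>c. ordinal c \<and> y \<in> ext (level S (u e) c)) -->
        sat (L_bracket S (u e)) p (%j. if j = i then y else t j e))
      = sat (L_bracket S (u e)) (All i p) (%i. t i e)"
      by (simp add: L_bracket_eq_levels[of S "u e"] Ball_def)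
  qed
qed

definition const_name :: "'a => 'a" where "const_name a = lam reals (%_. a)"
definition id_name :: 'a where "id_name = lam reals (%x. x)"
definition val_mem :: "'a => 'a => 'a" where "val_mem f g = sep reals (%x. f $ x \<in> ext (g $ x))"
definition val_eq :: "'a => 'a => 'a" where "val_eq f g = sep reals (%x. f $ x = g $ x)"
definition rcompl :: "'a => 'a" where "rcompl A = sep reals (%x. x \<notin> ext A)"
definition rinter :: "'a => 'a => 'a" where "rinter A B = sep reals (%x. x \<in> ext A \<and> x \<in> ext B)"
definition basic :: "'a => 'a" where "basic p = sep reals (%x. p \<in> ext x)"
definition eval_seq :: "'a => 'a" where "eval_seq s = lam reals (%x. lam (dom s) (%i. (s $ i) $ x))"
definition val_sat :: "'a => fm => (nat => 'a) => 'a" where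
  "val_sat S p e = sep reals (%x. sat (L_bracket S x) p (%i. e i $ x))"

lemma def_fun2_val_mem[THEN def_fun2D, def_intros]: "def_fun2 val_mem"
  by (intro def_fun2I, unfold val_mem_def, intro def_intros)
lemma def_fun2_val_eq[THEN def_fun2D, def_intros]: "def_fun2 val_eq"
  by (intro def_fun2I, unfold val_eq_def, intro def_intros)
lemma def_fun2_rinter[THEN def_fun2D, def_intros]: "def_fun2 rinter"
  by (intro def_fun2I, unfold rinter_def, intro def_intros)
lemma def_fun_rcompl[THEN def_funD, def_intros]: "def_fun rcompl"
  by (intro def_funI, unfold rcompl_def, intro def_intros)
lemma def_fun_basic[THEN def_funD, def_intros]: "def_fun basic"
  by (intro def_funI, unfold basic_def, intro def_intros)
lemma def_fun_const_name[THEN def_funD, def_intros]: "def_fun const_name"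
  by (intro def_funI, unfold const_name_def, intro def_intros)
lemma def_fun_eval_seq[THEN def_funD, def_intros]: "def_fun eval_seq"
  by (intro def_funI, unfold eval_seq_def, intro def_intros)

lemma mem_val_mem: "x \<in> ext (val_mem f g) \<longleftrightarrow> x \<in> ext reals \<and> f $ x \<in> ext (g $ x)"
  unfolding val_mem_def by (subst ext_sep) (intro def_intros, simp)
lemma mem_val_eq: "x \<in> ext (val_eq f g) \<longleftrightarrow> x \<in> ext reals \<and> f $ x = g $ x"
  unfolding val_eq_def by (subst ext_sep) (intro def_intros, simp)
lemma mem_rcompl: "x \<in> ext (rcompl A) \<longleftrightarrow> x \<in> ext reals \<and> x \<notin> ext A"
  unfolding rcompl_def by (subst ext_sep) (intro def_intros, simp)
lemma mem_rinter: "x \<in> ext (rinter A B) \<longleftrightarrow> x \<in> ext reals \<and> x \<in> ext A \<and> x \<in> ext B"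
  unfolding rinter_def by (subst ext_sep) (intro def_intros, simp)
lemma mem_basic: "x \<in> ext (basic p) \<longleftrightarrow> x \<in> ext reals \<and> p \<in> ext x"
  unfolding basic_def by (subst ext_sep) (intro def_intros, simp)
lemma mem_val_sat: "x \<in> ext (val_sat S p e) \<longleftrightarrow> x \<in> ext reals \<and> sat (L_bracket S x) p (%i. e i $ x)"
proof -
  have "def_pred (%x. sat (L_bracket S x) p (%i. e i $ x))"
    by (rule def_predI, rule definable_sat_L_bracket) (intro def_intros)+
  from ext_sep[OF this] show ?thesis unfolding val_sat_def by simp
qed

lemma val_sat_eqI:
  "(\<And>x. x \<in> ext A \<longleftrightarrow> x \<in> ext reals \<and> sat (L_bracket S x) p (%i. e i $ x)) ==> val_sat S p e = A"
  by (rule ext_inject, rule set_eqI) (simp add: mem_val_sat)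
lemma ap_const_name: "x \<in> ext reals ==> const_name a $ x = a"
  unfolding const_name_def by (rule ap_lam) (intro def_intros)
lemma ap_id_name: "x \<in> ext reals ==> id_name $ x = x"
  unfolding id_name_def by (rule ap_lam) (intro def_intros)

lemma ap_ap_eval_seq:
  assumes "x \<in> ext reals" "func s n Z" "i \<in> ext n"
  shows "eval_seq s $ x $ i = s $ i $ x"
proof -
  have "eval_seq s $ x = lam (dom s) (%i. (s $ i) $ x)"
    unfolding eval_seq_def by (rule ap_lam[OF _ assms(1)]) (intro def_intros)
  then show ?thesis unfolding func_dom[OF assms(2)] by (simp add: ap_lam[OF _ assms(3)] def_intros)
qed

lemma func_eval_seq:
  assumes "x \<in> ext reals" "func s n Z" "\<And>t. t \<in> ext Z ==> t $ x \<in> ext B"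
  shows "func (eval_seq s $ x) n B"
proof -
  have "eval_seq s $ x = lam n (%i. (s $ i) $ x)"
    unfolding eval_seq_def func_dom[OF assms(2)] by (rule ap_lam[OF _ assms(1)]) (intro def_intros)
  moreover have "def_fun (%i. (s $ i) $ x)" by (intro def_intros)
  ultimately show ?thesis using func_lam[of _ n B] assms(3) ap_in_codomain[OF assms(2)] by simp
qed

lemma eval_seq_snoc:
  assumes x: "x \<in> ext reals" and s: "func s n Z" and t: "t \<in> ext Z"
    and Z: "\<And>t. t \<in> ext Z ==> t $ x \<in> ext B"
  shows "eval_seq (snoc s t) $ x = extend n (eval_seq s $ x) (t $ x)"
proof -
  have Ev_s: "func (eval_seq s $ x) n B" by (rule func_eval_seq[OF x s Z])
  have "eval_seq (snoc s t) $ x = snoc (eval_seq s $ x) (t $ x)"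
  proof (rule func_ext[OF func_eval_seq[OF x func_snoc[OF s t] Z] func_snoc[OF Ev_s Z[OF t]]])
    fix i assume i: "i \<in> ext (succ n)"
    note at_i = ap_ap_eval_seq[OF x func_snoc[OF s t] i]
    show "eval_seq (snoc s t) $ x $ i = snoc (eval_seq s $ x) (t $ x) $ i"
    proof (cases "i = n")
      case True
      then show ?thesis unfolding at_i using snoc_last[OF s t] snoc_last[OF Ev_s Z[OF t]] by simp
    next
      case False
      then have i: "i \<in> ext n" using i by simp
      show ?thesis unfolding at_i ap_snoc[OF s t i] ap_snoc[OF Ev_s Z[OF t] i] ap_ap_eval_seq[OF x s i] ..
    qed
  qed
  then show ?thesis using extend_eq_snoc[OF Ev_s] by simp
qed

lemma code_eq_val_sat:
  assumes "infinity_Borel_code S \<phi> Y"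
  shows "Y = val_sat S \<phi> ((%_. const_name S)(1 := id_name))"
proof (rule val_sat_eqI[symmetric])
  fix x
  have env: "(%i. (((%_. const_name S)(1 := id_name)) i) $ x) = (%_. S)(1 := x)" if "x \<in> ext reals"
    using ap_const_name[OF that] ap_id_name[OF that] by auto
  show "x \<in> ext Y \<longleftrightarrow> x \<in> ext reals \<and> sat (L_bracket S x) \<phi> (%i. (((%_. const_name S)(1 := id_name)) i) $ x)"
    using assms unfolding infinity_Borel_code_def
    by (cases "x \<in> ext reals") (simp_all only: env mem_Collect_eq simp_thms)
qed

primrec encode :: "nat => (nat => 'a) => 'a" where
  "encode 0 e = empty"
| "encode (Suc k) e = opair (e k) (encode k e)"
primrec decode :: "nat => nat => 'a => 'a" where
  "decode 0 i d = empty"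
| "decode (Suc k) i d = (if i = k then pfst d else decode k i (psnd d))"
lemma decode_encode: "i < k ==> decode k i (encode k e) = e i" by (induction k) auto
lemma def_term_decode[def_intros]: "def_term t ==> def_term (%e. decode k i (t e))"
proof (induction k arbitrary: t)
  case (Suc k)
  have "def_term (%e. decode k i (psnd (t e)))" by (rule Suc.IH[OF def_term_psnd[OF Suc.prems]])
  then show ?case using def_term_pfst[OF Suc.prems] by (cases "i = k") auto
qed (simp add: def_term_const)

definition coded_sat :: "'a => nat => fm => 'a => 'a" where
  "coded_sat S k p d = val_sat S p (%j. decode k j d)"
lemma def_fun_coded_sat: "def_fun (coded_sat S k p)"
proof (rule def_funI)
  show "def_term (%f. coded_sat S k p (f 0))"
    unfolding coded_sat_def val_sat_def
  proof (rule def_term_sep[where Q="%f x. sat (L_bracket S x) p (%j. (decode k j (f 0)) $ x)"])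
    show "def_term (%f. reals)" by (rule def_term_const)
    show "definable (%f. sat (L_bracket S (f 0)) p (%j. (decode k j (f (Suc 0))) $ (f 0)))"
      by (rule definable_sat_L_bracket) (intro def_intros)+
  qed
qed

lemma coded_sat_encode:
  assumes "fv p \<subseteq> {..<k}"
  shows "coded_sat S k p (encode k e) = val_sat S p e"
  unfolding coded_sat_def
proof (rule val_sat_eqI)
  fix x
  have "sat (L_bracket S x) p (%i. (decode k i (encode k e)) $ x) = sat (L_bracket S x) p (%i. e i $ x)"
    by (rule sat_cong) (use assms in \<open>auto simp: decode_encode\<close>)
  then show "x \<in> ext (val_sat S p e) \<longleftrightarrow>
      x \<in> ext reals \<and> sat (L_bracket S x) p (%i. (decode k i (encode k e)) $ x)"
    unfolding mem_val_sat by simp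
qed

definition refutes :: "'a => nat => nat => fm => 'a => 'a => 'a => bool" where
  "refutes S k i p d x a \<longleftrightarrow> \<not> sat (L_bracket S x) p (%j. if j = i then a else (decode k j d) $ x)"
lemma definable_refutes[def_intros]:
  assumes "def_term t" "def_term u" "def_term v" shows "definable (%e. refutes S k i p (t e) (u e) (v e))"
  unfolding refutes_def by (rule definable_neg, rule definable_sat_L_bracket) (intro def_intros assms)+
lemma refutes_encode:
  assumes "fv p \<subseteq> {..<k}"
  shows "refutes S k i p (encode k e) x a \<longleftrightarrow> \<not> sat (L_bracket S x) p ((%j. e j $ x)(i := a))"
  unfolding refutes_def
  by (subst sat_cong[where e'="(%j. e j $ x)(i := a)"]) (use assms in \<open>auto simp: decode_encode\<close>)
definition refuted_at :: "'a => nat => nat => fm => 'a => 'a => 'a => bool" where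
  "refuted_at S k i p d x c \<longleftrightarrow> ordinal c \<and> (\<exists>a\<in>ext (level S x c). refutes S k i p d x a)"
lemma definable_refuted_at[def_intros]: assumes "def_term t" "def_term u" "def_term v"
  shows "definable (%e. refuted_at S k i p (t e) (u e) (v e))"
  unfolding refuted_at_def by (intro def_intros assms def_term_shift)
definition refutation_bound :: "'a => nat => nat => fm => 'a => 'a" where
  "refutation_bound S k i p d = ord_bound (img (%x. least_ord (refuted_at S k i p d x)) reals)"
lemma def_fun_refutation_bound: "def_fun (refutation_bound S k i p)"
  unfolding refutation_bound_def by (intro def_intros)

lemma refutation_bound_props:
  assumes x: "x \<in> ext reals" and a: "a \<in> L_bracket S x" "refutes S k i p d x a"
  shows "\<exists>b\<in>ext (refutation_bound S k i p d). \<exists>a\<in>ext (level S x b). refutes S k i p d x a"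
proof -
  obtain c where c: "ordinal c" "refuted_at S k i p d x c"
    using a unfolding L_bracket_eq_levels refuted_at_def by blast
  have "def_pred (refuted_at S k i p d x)" by (intro def_intros)
  note least = least_ordI(1,2)[OF this c]
  have "def_fun (%x. least_ord (refuted_at S k i p d x))" by (intro def_intros)
  then have "least_ord (refuted_at S k i p d x) \<in> ext (img (%x. least_ord (refuted_at S k i p d x)) reals)"
    using x by (simp add: ext_img)
  then have "least_ord (refuted_at S k i p d x) \<in> ext (refutation_bound S k i p d)"
    unfolding refutation_bound_def by (rule ord_bound_props(2)) (rule least(1))
  then show ?thesis using least(2) unfolding refuted_at_def by blast
qed

definition mem_name :: "'a => 'a => 'a => 'a => 'a => 'a" where
  "mem_name S c n i j = lam reals (%x. rel_mem (level S x c) n i j)"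
definition eq_name :: "'a => 'a => 'a => 'a => 'a => 'a" where
  "eq_name S c n i j = lam reals (%x. rel_eq (level S x c) n i j)"
definition pred_name :: "'a => 'a => 'a => 'a => 'a => 'a" where
  "pred_name S u c n i = lam reals (%x. rel_pred (u $ x) (level S x c) n i)"
definition compl_name :: "'a => 'a => 'a => 'a => 'a" where
  "compl_name S c n r = lam reals (%x. rel_compl (level S x c) n (r $ x))"
definition inter_name :: "'a => 'a => 'a" where
  "inter_name r r' = lam reals (%x. rel_inter (r $ x) (r' $ x))"
definition proj_name :: "'a => 'a => 'a => 'a => 'a" where
  "proj_name S c n r = lam reals (%x. rel_proj (level S x c) n (r $ x))"
definition section_name :: "'a => 'a => 'a => 'a => 'a => 'a" where
  "section_name S c n r s = lam reals (%x. rel_section (level S x c) n (eval_seq s $ x) (r $ x))"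

lemma
  assumes x: "x \<in> ext reals"
  shows ap_mem_name: "mem_name S c n i j $ x = rel_mem (level S x c) n i j"
    and ap_eq_name: "eq_name S c n i j $ x = rel_eq (level S x c) n i j"
    and ap_pred_name: "pred_name S u c n i $ x = rel_pred (u $ x) (level S x c) n i"
    and ap_compl_name: "compl_name S c n r $ x = rel_compl (level S x c) n (r $ x)"
    and ap_inter_name: "inter_name r r' $ x = rel_inter (r $ x) (r' $ x)"
    and ap_proj_name: "proj_name S c n r $ x = rel_proj (level S x c) n (r $ x)"
    and ap_section_name: "section_name S c n r s $ x = rel_section (level S x c) n (eval_seq s $ x) (r $ x)"
  unfolding mem_name_def eq_name_def pred_name_def compl_name_def inter_name_def proj_name_def
    section_name_def rel_mem_def rel_eq_def rel_pred_def rel_section_def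
  by (rule ap_lam[OF _ x], intro def_intros)+

definition uncurry2 :: "('a => 'a => 'a) => 'a => 'a" where "uncurry2 F d = F (pfst d) (psnd d)"
definition uncurry3 :: "('a => 'a => 'a => 'a) => 'a => 'a" where
  "uncurry3 F d = uncurry2 (F (pfst d)) (psnd d)"
definition uncurry4 :: "('a => 'a => 'a => 'a => 'a) => 'a => 'a" where
  "uncurry4 F d = uncurry3 (F (pfst d)) (psnd d)"
abbreviation base_name_ops :: "'a => ('a => 'a) list" where
  "base_name_ops S \<equiv> [const_name, %_. id_name, %_. S, uncurry2 val_mem, uncurry2 val_eq, rcompl, uncurry2 rinter,
    uncurry3 extend, eval_seq, uncurry4 (mem_name S), uncurry4 (eq_name S), uncurry4 (pred_name S),
    uncurry3 (compl_name S), uncurry2 inter_name, uncurry3 (proj_name S), uncurry4 (section_name S)]"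
definition name_ops :: "'a => fm => nat => ('a => 'a) list" where
  "name_ops S \<phi> k = base_name_ops S @ map (coded_sat S k) (subformulas \<phi>) @
    [refutation_bound S k i p. All i p \<leftarrow> subformulas \<phi>]"

lemma def_fun_name_ops: "F \<in> set (name_ops S \<phi> k) ==> def_fun F"
proof -
  have "list_all def_fun (base_name_ops S)"
    unfolding list.pred_inject uncurry2_def[abs_def] uncurry3_def[abs_def] uncurry4_def[abs_def]
      mem_name_def eq_name_def pred_name_def compl_name_def inter_name_def proj_name_def section_name_def
      rel_mem_def rel_eq_def rel_pred_def rel_section_def
    by (intro conjI list.pred_inject(1); intro def_intros)
  moreover have "list_all def_fun
      (map (coded_sat S k) (subformulas \<phi>) @ [refutation_bound S k i p. All i p \<leftarrow> subformulas \<phi>])"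
    by (auto simp: list_all_iff def_fun_coded_sat def_fun_refutation_bound split: fm.splits)
  moreover assume "F \<in> set (name_ops S \<phi> k)"
  ultimately show "def_fun F" unfolding name_ops_def list_all_iff by fastforce
qed

definition borel_closed :: "'a => 'a => bool" where
  "borel_closed X L \<longleftrightarrow> ext L \<subseteq> {A. ext A \<subseteq> ext reals} \<and> (\<forall>i\<in>nats. \<forall>j\<in>nats. basic (opair i j) \<in> ext L) \<and>
    (\<forall>A\<in>ext L. rcompl A \<in> ext L) \<and> (\<forall>A\<in>ext L. \<forall>B\<in>ext L. rinter A B \<in> ext L) \<and>
    (\<forall>A\<in>ext X. \<forall>Z. ext Z \<subseteq> ext L --> ext A = {x \<in> ext reals. \<forall>B\<in>ext Z. x \<in> ext B} --> A \<in> ext L)"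

definition covers :: "'a => 'a => bool" where
  "covers D t \<longleftrightarrow> (\<forall>x\<in>ext reals. \<forall>y\<in>ext (t $ x). \<exists>s\<in>ext D. s $ x = y)"
lemma def_pred2_covers[THEN def_pred2D, def_intros]: "def_pred2 covers"
  by (intro def_pred2I, unfold covers_def, intro def_intros)
lemma coversD: "covers D t ==> x \<in> ext reals ==> y \<in> ext (t $ x) ==> \<exists>s\<in>ext D. s $ x = y"
  unfolding covers_def by blast

lemma ap_eq_if_covers:
  assumes "covers D t" "covers D t'" and x: "x \<in> ext reals"
    and same: "\<And>s. s \<in> ext D ==> s $ x \<in> ext (t $ x) \<longleftrightarrow> s $ x \<in> ext (t' $ x)"
  shows "t $ x = t' $ x"
proof (rule ext_inject, rule set_eqI)
  fix y
  show "y \<in> ext (t $ x) \<longleftrightarrow> y \<in> ext (t' $ x)"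
    using coversD[OF assms(1) x, of y] coversD[OF assms(2) x, of y] same by metis
qed

end

text \<open>The set \<open>X\<close> is closed under everything that is needed to evaluate the code \<open>\<phi>\<close>, so each set of
  reals met during the evaluation, and in particular each infinitary intersection, belongs to \<open>X\<close>.\<close>

locale name_universe = zf_model +
  fixes S X w :: 'a and \<phi> :: fm and k :: nat
  assumes wo: "well_orders w X" and S_ord: "\<And>a. a \<in> ext S ==> ordinal a \<and> a \<in> ext X"
    and omega_in_X: "omega \<in> ext X"
    and ord_X: "\<And>c. c \<in> ext X ==> ordinal c ==> ext c \<subseteq> ext X"
    and upair_in_X: "\<And>a b. a \<in> ext X ==> b \<in> ext X ==> upair a b \<in> ext X"
    and name_op_in_X: "\<And>F a. F \<in> set (name_ops S \<phi> k) ==> a \<in> ext X ==> F a \<in> ext X"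
    and fv_k: "\<And>q. q \<in> set (subformulas \<phi>) ==> fv q \<subseteq> {..<k}"
begin

lemma omega_subset_X: "n \<in> nats ==> n \<in> ext X" using ord_X[OF omega_in_X ordinal_omega] by blast
lemma empty_in_X: "empty \<in> ext X" by (rule omega_subset_X[OF empty_in_omega])
lemma opair_in_X: "a \<in> ext X ==> b \<in> ext X ==> opair a b \<in> ext X"
  unfolding opair_eq_upair by (intro upair_in_X)

lemma uncurry2_in_X: "uncurry2 F \<in> set (name_ops S \<phi> k) ==> a \<in> ext X ==> b \<in> ext X ==> F a b \<in> ext X"
  using name_op_in_X[of "uncurry2 F" "opair a b"] opair_in_X by (simp add: uncurry2_def)
lemma uncurry3_in_X:
  "uncurry3 F \<in> set (name_ops S \<phi> k) ==> a \<in> ext X ==> b \<in> ext X ==> c \<in> ext X ==> F a b c \<in> ext X"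
  using name_op_in_X[of "uncurry3 F" "opair a (opair b c)"] opair_in_X
  by (simp add: uncurry3_def uncurry2_def)
lemma uncurry4_in_X:
  "uncurry4 F \<in> set (name_ops S \<phi> k) ==> a \<in> ext X ==> b \<in> ext X ==> c \<in> ext X ==> d \<in> ext X ==>
    F a b c d \<in> ext X"
  using name_op_in_X[of "uncurry4 F" "opair a (opair b (opair c d))"] opair_in_X
  by (simp add: uncurry4_def uncurry3_def uncurry2_def)

lemma const_name_X: "a \<in> ext X ==> const_name a \<in> ext X" by (rule name_op_in_X) (simp add: name_ops_def)
lemma id_name_X: "id_name \<in> ext X"
  using name_op_in_X[of "%_. id_name", OF _ empty_in_X] by (simp add: name_ops_def)
lemma S_X: "S \<in> ext X" using name_op_in_X[of "%_. S", OF _ empty_in_X] by (simp add: name_ops_def)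
lemma rcompl_X: "a \<in> ext X ==> rcompl a \<in> ext X" by (rule name_op_in_X) (simp add: name_ops_def)
lemma eval_seq_X: "s \<in> ext X ==> eval_seq s \<in> ext X" by (rule name_op_in_X) (simp add: name_ops_def)
lemma val_mem_X: "a \<in> ext X ==> b \<in> ext X ==> val_mem a b \<in> ext X"
  by (rule uncurry2_in_X) (simp add: name_ops_def)
lemma val_eq_X: "a \<in> ext X ==> b \<in> ext X ==> val_eq a b \<in> ext X"
  by (rule uncurry2_in_X) (simp add: name_ops_def)
lemma rinter_X: "a \<in> ext X ==> b \<in> ext X ==> rinter a b \<in> ext X"
  by (rule uncurry2_in_X) (simp add: name_ops_def)
lemma extend_X: "n \<in> ext X ==> s \<in> ext X ==> a \<in> ext X ==> extend n s a \<in> ext X"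
  by (rule uncurry3_in_X) (simp add: name_ops_def)
lemma mem_name_X: "c \<in> ext X ==> n \<in> ext X ==> i \<in> ext X ==> j \<in> ext X ==> mem_name S c n i j \<in> ext X"
  by (rule uncurry4_in_X) (simp add: name_ops_def)
lemma eq_name_X: "c \<in> ext X ==> n \<in> ext X ==> i \<in> ext X ==> j \<in> ext X ==> eq_name S c n i j \<in> ext X"
  by (rule uncurry4_in_X) (simp add: name_ops_def)
lemma pred_name_X: "u \<in> ext X ==> c \<in> ext X ==> n \<in> ext X ==> i \<in> ext X ==> pred_name S u c n i \<in> ext X"
  by (rule uncurry4_in_X) (simp add: name_ops_def)
lemma compl_name_X: "c \<in> ext X ==> n \<in> ext X ==> r \<in> ext X ==> compl_name S c n r \<in> ext X"
  by (rule uncurry3_in_X) (simp add: name_ops_def)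
lemma inter_name_X: "r \<in> ext X ==> r' \<in> ext X ==> inter_name r r' \<in> ext X"
  by (rule uncurry2_in_X) (simp add: name_ops_def)
lemma proj_name_X: "c \<in> ext X ==> n \<in> ext X ==> r \<in> ext X ==> proj_name S c n r \<in> ext X"
  by (rule uncurry3_in_X) (simp add: name_ops_def)
lemma section_name_X: "c \<in> ext X ==> n \<in> ext X ==> r \<in> ext X ==> s \<in> ext X ==>
    section_name S c n r s \<in> ext X"
  by (rule uncurry4_in_X) (simp add: name_ops_def)

lemma encode_X: "(\<And>i. e i \<in> ext X) ==> encode m e \<in> ext X"
  by (induction m) (simp_all add: empty_in_X opair_in_X)

lemma val_sat_X:
  assumes p: "p \<in> set (subformulas \<phi>)" and e: "\<And>i. e i \<in> ext X"
  shows "val_sat S p e \<in> ext X"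
proof -
  have "coded_sat S k p (encode k e) \<in> ext X"
    by (rule name_op_in_X[OF _ encode_X[OF e]]) (use p in \<open>simp add: name_ops_def\<close>)
  then show ?thesis unfolding coded_sat_encode[OF fv_k[OF p]] .
qed

lemma refutation_bound_in_X:
  assumes p: "All i p \<in> set (subformulas \<phi>)" and e: "\<And>i. e i \<in> ext X"
  obtains c where "c \<in> ext X" "ordinal c"
    "\<And>x a. x \<in> ext reals ==> a \<in> L_bracket S x ==> \<not> sat (L_bracket S x) p ((%j. e j $ x)(i := a)) ==>
      \<exists>b\<in>ext c. \<exists>a\<in>ext (level S x b). \<not> sat (L_bracket S x) p ((%j. e j $ x)(i := a))"
proof -
  let ?c = "refutation_bound S k i p (encode k e)"
  have "p \<in> set (subformulas \<phi>)" using subformulas_trans[OF p] subformulas_refl by auto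
  note nsat = refutes_encode[OF fv_k[OF this]]
  show thesis
  proof (rule that[of ?c])
    show "?c \<in> ext X" by (rule name_op_in_X[OF _ encode_X[OF e]]) (use p in \<open>force simp: name_ops_def\<close>)
    show "ordinal ?c" unfolding refutation_bound_def by (rule ord_bound_props(1))
    fix x a assume "x \<in> ext reals" "a \<in> L_bracket S x" "\<not> sat (L_bracket S x) p ((%j. e j $ x)(i := a))"
    then show "\<exists>b\<in>ext ?c. \<exists>a\<in>ext (level S x b). \<not> sat (L_bracket S x) p ((%j. e j $ x)(i := a))"
      using refutation_bound_props[of x a S k i p "encode k e"] unfolding nsat by blast
  qed
qed

lemma basic_X:
  assumes "i \<in> nats" "j \<in> nats"
  shows "basic (opair i j) \<in> ext X"
proof -
  have "basic (opair i j) = val_mem (const_name (opair i j)) id_name"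
    by (rule ext_inject, rule set_eqI, unfold mem_val_mem mem_basic) (auto simp: ap_const_name ap_id_name)
  then show ?thesis using assms by (simp add: val_mem_X const_name_X id_name_X opair_in_X omega_subset_X)
qed

lemma finite_seq_in_X:
  assumes n: "n \<in> nats" and Z: "ext Z \<subseteq> ext X" and s: "func s n Z"
  shows "s \<in> ext X"
proof -
  have "\<forall>s. func s n Z --> s \<in> ext X"
  proof (rule omega_induct[OF n]; (intro allI impI)?)
    show "def_pred (%n. \<forall>s. func s n Z --> s \<in> ext X)" by (intro def_intros)
    show "s \<in> ext X" if "func s empty Z" for s using func_empty_iff[OF that] empty_in_X by simp
    fix n s assume n: "n \<in> nats" "\<forall>s. func s n Z --> s \<in> ext X" and s: "func s (succ n) Z"
    note decomp = func_succ_snoc[OF s]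
    have "extend n (restr s n) (s $ n) \<in> ext X"
      using n decomp(1,2) Z omega_subset_X by (intro extend_X) blast+
    then show "s \<in> ext X" using decomp(3) unfolding extend_eq_snoc[OF decomp(1)] by simp
  qed
  then show ?thesis using s by blast
qed

end

locale borel_family = name_universe +
  fixes L :: 'a
  assumes bclosed: "borel_closed X L"
begin

lemma L_subset_reals: "A \<in> ext L ==> ext A \<subseteq> ext reals"
  and L_basic: "i \<in> nats ==> j \<in> nats ==> basic (opair i j) \<in> ext L"
  and L_rcompl: "A \<in> ext L ==> rcompl A \<in> ext L"
    and L_rinter: "A \<in> ext L ==> B \<in> ext L ==> rinter A B \<in> ext L"
  and L_Inter: "ext Z \<subseteq> ext L ==> A \<in> ext X ==> ext A = {x \<in> ext reals. \<forall>B\<in>ext Z. x \<in> ext B} ==> A \<in> ext L"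
  using bclosed unfolding borel_closed_def by blast+

lemma L_INTER:
  assumes F: "def_fun F" "\<And>i. i \<in> ext I ==> F i \<in> ext L" and A: "A \<in> ext X"
    "\<And>x. x \<in> ext A \<longleftrightarrow> x \<in> ext reals \<and> (\<forall>i\<in>ext I. x \<in> ext (F i))"
  shows "A \<in> ext L"
proof (rule L_Inter[of "img F I"])
  show "ext (img F I) \<subseteq> ext L" unfolding ext_img[OF F(1)] using F(2) by blast
  show "ext A = {x \<in> ext reals. \<forall>B\<in>ext (img F I). x \<in> ext B}" unfolding ext_img[OF F(1)] using A(2) by auto
qed fact

lemma L_UNION:
  assumes F: "def_fun F" "\<And>i. i \<in> ext I ==> F i \<in> ext L" and A: "A \<in> ext X"
    "\<And>x. x \<in> ext A \<longleftrightarrow> x \<in> ext reals \<and> (\<exists>i\<in>ext I. x \<in> ext (F i))"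
  shows "A \<in> ext L"
proof -
  have "rcompl A \<in> ext L"
  proof (rule L_INTER[where F="%i. rcompl (F i)" and I=I])
    show "def_fun (%i. rcompl (F i))" by (intro def_intros def_funD[OF F(1)])
    show "\<And>i. i \<in> ext I ==> rcompl (F i) \<in> ext L" using L_rcompl F(2) by blast
    show "rcompl A \<in> ext X" by (rule rcompl_X[OF A(1)])
    show "\<And>x. x \<in> ext (rcompl A) \<longleftrightarrow> x \<in> ext reals \<and> (\<forall>i\<in>ext I. x \<in> ext (rcompl (F i)))"
      unfolding mem_rcompl A(2) by blast
  qed
  from L_rcompl[OF this] have "rcompl (rcompl A) \<in> ext L" .
  moreover have "rcompl (rcompl A) = A"
    by (rule ext_inject, rule set_eqI, unfold mem_rcompl) (use A(2) in blast)
  ultimately show ?thesis by simp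
qed

text \<open>A name is a function on the reals, and \<open>name_family D\<close> says that \<open>D\<close> is a transitive family of names
  between which membership and equality have truth values in \<open>L\<close>. By extensionality it suffices to
  know this for membership of names already present, which is how \<open>add_names\<close> adds new ones.\<close>

definition name_family :: "'a => bool" where
  "name_family D \<longleftrightarrow> ext D \<subseteq> ext X \<and> (\<forall>t\<in>ext D. covers D t) \<and>
    (\<forall>s\<in>ext D. \<forall>t\<in>ext D. val_eq s t \<in> ext L \<and> val_mem s t \<in> ext L)"
definition add_names :: "'a => 'a" where
  "add_names D = sep X (%t. covers D t \<and> (\<forall>s\<in>ext D. val_mem s t \<in> ext L))"

lemma definable_name_family[THEN def_predD, def_intros]: "def_pred name_family"
  by (intro def_predI, unfold name_family_def, intro def_intros)
lemma def_fun_add_names[THEN def_funD, def_intros]: "def_fun add_names"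
  by (intro def_funI, unfold add_names_def, intro def_intros)
lemma mem_add_names: "t \<in> ext (add_names D) \<longleftrightarrow> t \<in> ext X \<and> covers D t \<and> (\<forall>s\<in>ext D. val_mem s t \<in> ext L)"
  unfolding add_names_def by (subst ext_sep) (intro def_intros, simp)
lemma add_namesD:
  assumes "t \<in> ext (add_names D)"
  shows "t \<in> ext X" "covers D t" "\<And>s. s \<in> ext D ==> val_mem s t \<in> ext L"
  using assms unfolding mem_add_names by blast+
lemma subset_add_names: "name_family D ==> ext D \<subseteq> ext (add_names D)"
  unfolding name_family_def mem_add_names subset_iff by blast

lemma val_eq_add_names:
  assumes t: "t \<in> ext (add_names D)" and t': "t' \<in> ext (add_names D)"
  shows "val_eq t t' \<in> ext L"
proof -
  let ?implies = "%s t t'. rcompl (rinter (val_mem s t) (rcompl (val_mem s t')))"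
  show ?thesis
  proof (rule L_INTER[where I=D and F="%s. rinter (?implies s t t') (?implies s t' t)"])
    show "def_fun (%s. rinter (?implies s t t') (?implies s t' t))" by (intro def_intros)
    show "rinter (?implies s t t') (?implies s t' t) \<in> ext L" if "s \<in> ext D" for s
      using add_namesD(3)[OF t that] add_namesD(3)[OF t' that] by (intro L_rinter L_rcompl)
    show "val_eq t t' \<in> ext X" by (intro val_eq_X add_namesD(1)[OF t] add_namesD(1)[OF t'])
    fix x
    have "t $ x = t' $ x \<longleftrightarrow> (\<forall>s\<in>ext D. s $ x \<in> ext (t $ x) \<longleftrightarrow> s $ x \<in> ext (t' $ x))" if "x \<in> ext reals"
      using ap_eq_if_covers[OF add_namesD(2)[OF t] add_namesD(2)[OF t'] that] by auto
    then show "x \<in> ext (val_eq t t') \<longleftrightarrow>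
        x \<in> ext reals \<and> (\<forall>s\<in>ext D. x \<in> ext (rinter (?implies s t t') (?implies s t' t)))"
      unfolding mem_rinter mem_rcompl mem_val_mem mem_val_eq by blast
  qed
qed

lemma val_mem_add_names:
  assumes D: "name_family D" and t: "t \<in> ext (add_names D)" and t': "t' \<in> ext (add_names D)"
  shows "val_mem t t' \<in> ext L"
proof (rule L_UNION[where I=D and F="%s. rinter (val_eq s t) (val_mem s t')"])
  show "def_fun (%s. rinter (val_eq s t) (val_mem s t'))" by (intro def_intros)
  show "rinter (val_eq s t) (val_mem s t') \<in> ext L" if "s \<in> ext D" for s
    using that subset_add_names[OF D]
    by (intro L_rinter val_eq_add_names[OF _ t] add_namesD(3)[OF t']) blast+
  show "val_mem t t' \<in> ext X" by (intro val_mem_X add_namesD(1)[OF t] add_namesD(1)[OF t'])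
  fix x
  have "\<exists>s\<in>ext D. s $ x = t $ x" if "x \<in> ext reals" "t $ x \<in> ext (t' $ x)"
    by (rule coversD[OF add_namesD(2)[OF t'] that])
  then show "x \<in> ext (val_mem t t') \<longleftrightarrow>
      x \<in> ext reals \<and> (\<exists>s\<in>ext D. x \<in> ext (rinter (val_eq s t) (val_mem s t')))"
    unfolding mem_rinter mem_val_eq mem_val_mem by force
qed

lemma name_family_add_names: "name_family D ==> name_family (add_names D)"
  unfolding name_family_def[of "add_names D"]
  using val_eq_add_names val_mem_add_names add_namesD subset_add_names
  unfolding covers_def by (simp add: subset_iff) blast

definition name_stage :: "'a => 'a" where
  "name_stage c = ord_rec (%f. bigunion (img (%b. add_names (f $ b)) (dom f))) c"
lemma def_fun_name_stage[THEN def_funD, def_intros]: "def_fun name_stage"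
  by (intro def_funI, unfold name_stage_def, intro def_intros)

lemma mem_name_stage:
  assumes "ordinal c"
  shows "t \<in> ext (name_stage c) \<longleftrightarrow> (\<exists>b\<in>ext c. t \<in> ext (add_names (name_stage b)))"
proof -
  let ?H = "%f. bigunion (img (%b. add_names (f $ b)) (dom f))" and ?f = "lam c name_stage"
  have definable: "def_fun name_stage" "def_fun (%b. add_names (?f $ b))" by (intro def_intros)+
  have "name_stage c = ?H ?f"
    unfolding name_stage_def[abs_def] by (rule ord_rec_unfold[OF _ assms]) (intro def_intros)
  moreover have "dom ?f = c" by (rule func_dom[OF func_lam_img[OF definable(1)]])
  ultimately have "ext (name_stage c) = {t. \<exists>b\<in>ext c. t \<in> ext (add_names (?f $ b))}"
    by (simp add: ext_img[OF definable(2)])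
  then show ?thesis using ap_lam[OF definable(1)] by auto
qed

lemma name_stage_mono:
  assumes "ordinal c" "b \<in> ext c"
  shows "ext (name_stage b) \<subseteq> ext (name_stage c)"
  unfolding subset_iff mem_name_stage[OF assms(1)] mem_name_stage[OF ordinal_mem[OF assms]]
  using ordinal_trans[OF assms] by blast

lemma name_family_directed:
  assumes c: "ordinal c" and D: "\<And>b. b \<in> ext c ==> name_family (D b)"
    and mono: "\<And>a b. b \<in> ext c ==> a \<in> ext b ==> ext (D a) \<subseteq> ext (D b)"
    and union: "\<And>t. t \<in> ext U \<longleftrightarrow> (\<exists>b\<in>ext c. t \<in> ext (D b))"
  shows "name_family U"
  unfolding name_family_def
proof (intro conjI ballI subsetI)
  fix s assume s: "s \<in> ext U"
  then obtain a where a: "a \<in> ext c" "s \<in> ext (D a)" unfolding union by blast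
  then show "s \<in> ext X" using D unfolding name_family_def by blast
  show "covers U s" using D[OF a(1)] a union unfolding name_family_def covers_def by meson
  fix t assume "t \<in> ext U"
  then obtain b where b: "b \<in> ext c" "t \<in> ext (D b)" unfolding union by blast
  obtain d where "d \<in> ext c" "s \<in> ext (D d)" "t \<in> ext (D d)"
    using ordinal_linear[OF ordinal_mem[OF c a(1)] ordinal_mem[OF c b(1)]] mono a b by blast
  then show "val_eq s t \<in> ext L" "val_mem s t \<in> ext L" using D unfolding name_family_def by blast+
qed

lemma name_family_name_stage:
  assumes "ordinal c"
  shows "name_family (name_stage c)"
proof (rule ordinal_induct[OF assms])
  show "def_pred (%c. name_family (name_stage c))" by (intro def_intros)
  fix c assume c: "ordinal c" and IH: "\<And>b. b \<in> ext c ==> name_family (name_stage b)"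
  show "name_family (name_stage c)"
  proof (rule name_family_directed[OF c name_family_add_names[OF IH] _ mem_name_stage[OF c]])
    show "ext (add_names (name_stage a)) \<subseteq> ext (add_names (name_stage b))"
      if "b \<in> ext c" "a \<in> ext b" for a b
      using mem_name_stage[OF ordinal_mem[OF c that(1)]] that(2) subset_add_names[OF IH[OF that(1)]]
      by blast
  qed
qed

lemma closed_name_family_exists:
  obtains N where "name_family N" "ext (add_names N) \<subseteq> ext N"
proof -
  let ?P = "%t c. t \<in> ext (name_stage c)"
  let ?U = "sep X (%t. \<exists>c. ordinal c \<and> ?P t c)"
  have U: "t \<in> ext ?U \<longleftrightarrow> t \<in> ext X \<and> (\<exists>c. ordinal c \<and> ?P t c)" for t
    by (subst ext_sep) (intro def_intros, simp)
  let ?rank = "%t. least_ord (?P t)"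
  have definable: "def_fun ?rank" by (intro def_intros)
  have definable_exists: "def_pred (?P t)" for t by (intro def_intros)
  have rank: "ordinal (?rank t)" "?P t (?rank t)" if t: "t \<in> ext ?U" for t
  proof -
    obtain c where "ordinal c" "?P t c" using t unfolding U by blast
    then show "ordinal (?rank t)" "?P t (?rank t)" by (rule least_ordI(1,2)[OF definable_exists])+
  qed
  define c where "c = succ (bigunion (img ?rank ?U))"
  have c: "ordinal c" "\<And>t. t \<in> ext ?U ==> ?rank t \<in> ext c"
    using ordinal_bound[of "img ?rank ?U"] rank(1) unfolding ext_img[OF definable] c_def by blast+
  have "t \<in> ext ?U" if t: "t \<in> ext (add_names (name_stage c))" for t
  proof -
    have "t \<in> ext (name_stage (succ c))" using mem_name_stage[OF ordinal_succ[OF c(1)]] t by auto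
    then show ?thesis unfolding U using add_namesD(1)[OF t] ordinal_succ[OF c(1)] by blast
  qed
  moreover have "t \<in> ext (name_stage c)" if "t \<in> ext ?U" for t
    using name_stage_mono[OF c(1) c(2)[OF that]] rank(2)[OF that] by (rule subsetD)
  ultimately show thesis using that[OF name_family_name_stage[OF c(1)]] by (simp add: subset_iff)
qed

end

locale names = borel_family +
  fixes N :: 'a
  assumes name_family_N: "name_family N" and add_names_N: "ext (add_names N) \<subseteq> ext N"
begin

lemma in_X_if_in_N: "t \<in> ext N ==> t \<in> ext X"
  and val_eq_in_L: "s \<in> ext N ==> t \<in> ext N ==> val_eq s t \<in> ext L"
  and val_mem_in_L: "s \<in> ext N ==> t \<in> ext N ==> val_mem s t \<in> ext L"
  using name_family_N unfolding name_family_def by blast+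
lemma in_N_I:
  assumes "t \<in> ext X" "\<And>x y. x \<in> ext reals ==> y \<in> ext (t $ x) ==> \<exists>s\<in>ext N. s $ x = y"
    "\<And>s. s \<in> ext N ==> val_mem s t \<in> ext L"
  shows "t \<in> ext N"
proof -
  have "t \<in> ext (add_names N)" unfolding mem_add_names covers_def using assms by blast
  then show ?thesis using add_names_N by blast
qed

lemma const_name_in_N:
  assumes a: "a \<in> ext X" and b: "\<And>b. b \<in> ext a ==> const_name b \<in> ext N"
  shows "const_name a \<in> ext N"
proof (rule in_N_I[OF const_name_X[OF a]])
  fix x y assume "x \<in> ext reals" "y \<in> ext (const_name a $ x)"
  then show "\<exists>s\<in>ext N. s $ x = y" using b by (intro bexI[of _ "const_name y"]) (simp_all add: ap_const_name)
next
  fix s assume s: "s \<in> ext N"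
  show "val_mem s (const_name a) \<in> ext L"
  proof (rule L_UNION[where I=a and F="%b. val_eq s (const_name b)"])
    show "def_fun (%b. val_eq s (const_name b))" by (intro def_intros)
    show "\<And>b'. b' \<in> ext a ==> val_eq s (const_name b') \<in> ext L" using val_eq_in_L[OF s] b by blast
    show "val_mem s (const_name a) \<in> ext X" by (rule val_mem_X[OF in_X_if_in_N[OF s] const_name_X[OF a]])
    show "\<And>x. x \<in> ext (val_mem s (const_name a)) \<longleftrightarrow>
        x \<in> ext reals \<and> (\<exists>i\<in>ext a. x \<in> ext (val_eq s (const_name i)))"
      unfolding mem_val_mem mem_val_eq by (auto simp: ap_const_name)
  qed
qed

lemma const_name_ordinal:
  assumes "ordinal a" "a \<in> ext X"
  shows "const_name a \<in> ext N"
proof -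
  have "a \<in> ext X --> const_name a \<in> ext N"
  proof (rule ordinal_induct[OF assms(1)], rule_tac [2] impI)
    show "def_pred (%a. a \<in> ext X --> const_name a \<in> ext N)" by (intro def_intros)
    fix b assume b: "ordinal b" "\<And>c. c \<in> ext b ==> c \<in> ext X --> const_name c \<in> ext N" "b \<in> ext X"
    show "const_name b \<in> ext N" by (rule const_name_in_N[OF b(3)]) (use b(2) ord_X[OF b(3,1)] in blast)
  qed
  then show ?thesis using assms(2) by blast
qed

lemma const_name_S: "const_name S \<in> ext N"
  by (rule const_name_in_N[OF S_X]) (use S_ord const_name_ordinal in blast)
lemma const_name_opair:
  assumes ij: "i \<in> nats" "j \<in> nats"
  shows "const_name (opair i j) \<in> ext N"
proof -
  have nat: "const_name n \<in> ext N" if "n \<in> nats" for n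
    by (rule const_name_ordinal[OF ordinal_if_in_omega omega_subset_X]) (rule that)+
  have "const_name (upair a b) \<in> ext N"
    if "a \<in> ext X" "b \<in> ext X" "const_name a \<in> ext N" "const_name b \<in> ext N" for a b
    by (rule const_name_in_N[OF upair_in_X]) (use that in auto)
  then show ?thesis unfolding opair_eq_upair using ij by (simp add: upair_in_X omega_subset_X nat)
qed

lemma id_name_in_N: "id_name \<in> ext N"
proof (rule in_N_I[OF id_name_X])
  fix x y assume x: "x \<in> ext reals" and y: "y \<in> ext (id_name $ x)"
  have "ext x \<subseteq> ext (cprod omega omega)" using x unfolding ext_reals func_def by blast
  then obtain i j where "y = opair i j" "i \<in> nats" "j \<in> nats" using y unfolding ap_id_name[OF x] by auto
  then show "\<exists>s\<in>ext N. s $ x = y" using ap_const_name[OF x] const_name_opair by blast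
next
  fix s assume s: "s \<in> ext N"
  show "val_mem s id_name \<in> ext L"
  proof (rule L_UNION[where I="cprod omega omega" and F="%p. rinter (val_eq s (const_name p)) (basic p)"])
    show "def_fun (%p. rinter (val_eq s (const_name p)) (basic p))" by (intro def_intros)
    show "rinter (val_eq s (const_name p)) (basic p) \<in> ext L" if p: "p \<in> ext (cprod omega omega)" for p
    proof -
      obtain i j where "p = opair i j" "i \<in> nats" "j \<in> nats" using p by auto
      then show ?thesis using L_rinter[OF val_eq_in_L[OF s const_name_opair] L_basic] by blast
    qed
    show "val_mem s id_name \<in> ext X" by (rule val_mem_X[OF in_X_if_in_N[OF s] id_name_X])
    fix x
    have "ext x \<subseteq> ext (cprod omega omega)" if "x \<in> ext reals"
      using that unfolding ext_reals func_def by blast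
    then show "x \<in> ext (val_mem s id_name) \<longleftrightarrow>
        x \<in> ext reals \<and> (\<exists>p\<in>ext (cprod omega omega). x \<in> ext (rinter (val_eq s (const_name p)) (basic p)))"
      unfolding mem_rinter mem_basic mem_val_eq mem_val_mem using ap_id_name ap_const_name by auto
  qed
qed

definition level_names :: "'a => 'a" where
  "level_names c = sep N (%t. \<forall>x\<in>ext reals. t $ x \<in> ext (level S x c))"
lemma def_fun_level_names[THEN def_funD, def_intros]: "def_fun level_names"
  by (intro def_funI, unfold level_names_def, intro def_intros)
lemma mem_level_names: "t \<in> ext (level_names c) \<longleftrightarrow> t \<in> ext N \<and> (\<forall>x\<in>ext reals. t $ x \<in> ext (level S x c))"
  unfolding level_names_def by (subst ext_sep) (intro def_intros, simp)
definition covered :: "'a => bool" where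
  "covered c \<longleftrightarrow> (\<forall>x\<in>ext reals. \<forall>a\<in>ext (level S x c). \<exists>t\<in>ext (level_names c). t $ x = a)"
lemma definable_covered[THEN def_predD, def_intros]: "def_pred covered"
  by (intro def_predI, unfold covered_def, intro def_intros)

definition rel_name :: "'a => 'a => 'a => bool" where
  "rel_name c n r \<longleftrightarrow> n \<in> nats \<and> r \<in> ext X \<and> (\<forall>x\<in>ext reals. def_rel S x (level S x c) n (r $ x)) \<and>
    (\<forall>s. func s n (level_names c) --> val_mem (eval_seq s) r \<in> ext L)"
lemma def_pred3_rel_name[THEN def_pred3D, def_intros]: "def_pred3 rel_name"
  by (intro def_pred3I, unfold rel_name_def, intro def_intros)
lemma rel_nameD:
  assumes "rel_name c n r"
  shows "n \<in> nats" "r \<in> ext X" "\<And>x. x \<in> ext reals ==> def_rel S x (level S x c) n (r $ x)"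
    "\<And>s. func s n (level_names c) ==> val_mem (eval_seq s) r \<in> ext L"
  using assms unfolding rel_name_def by blast+

lemma level_names_value: "t \<in> ext (level_names c) ==> x \<in> ext reals ==> t $ x \<in> ext (level S x c)"
  unfolding mem_level_names by blast
lemma level_names_in_N: "t \<in> ext (level_names c) ==> t \<in> ext N" unfolding mem_level_names by blast
lemma level_names_in_X: "ext (level_names c) \<subseteq> ext X" using level_names_in_N in_X_if_in_N by blast
lemma func_eval_seq_level: "func s n (level_names c) ==> x \<in> ext reals ==>
    func (eval_seq s $ x) n (level S x c)"
  by (rule func_eval_seq) (auto intro: level_names_value)
lemma eval_seq_snoc_level:
  "x \<in> ext reals ==> func s n (level_names c) ==> t \<in> ext (level_names c) ==>
      eval_seq (snoc s t) $ x = extend n (eval_seq s $ x) (t $ x)"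
  by (rule eval_seq_snoc) (auto intro: level_names_value)

lemma rel_nameI:
  assumes "n \<in> nats" "r \<in> ext X" "\<And>x. x \<in> ext reals ==> def_rel S x (level S x c) n (r $ x)"
    and A: "\<And>s. func s n (level_names c) ==> A s \<in> ext L"
      "\<And>s x. func s n (level_names c) ==> x \<in> ext reals ==> x \<in> ext (A s) \<longleftrightarrow> eval_seq s $ x \<in> ext (r $ x)"
  shows "rel_name c n r"
proof -
  have "val_mem (eval_seq s) r \<in> ext L" if s: "func s n (level_names c)" for s
  proof -
    have "A s = val_mem (eval_seq s) r"
      by (rule ext_inject, rule set_eqI)
        (use L_subset_reals[OF A(1)[OF s]] A(2)[OF s] in \<open>auto simp: mem_val_mem\<close>)
    then show ?thesis using A(1)[OF s] by simp
  qed
  then show ?thesis unfolding rel_name_def using assms(1-3) by simp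
qed

context
  fixes c
  assumes c: "c \<in> ext X" "ordinal c" and covered_c: "covered c"
begin

lemma covered_value: "x \<in> ext reals ==> a \<in> ext (level S x c) ==> \<exists>t\<in>ext (level_names c). t $ x = a"
  using covered_c unfolding covered_def by blast

lemma rel_name_mem_name:
  assumes n: "n \<in> nats" "i \<in> ext n" "j \<in> ext n"
  shows "rel_name c n (mem_name S c n i j)"
proof (rule rel_nameI[where A="%s. val_mem (s $ i) (s $ j)"])
  show "mem_name S c n i j \<in> ext X" by (intro mem_name_X c omega_subset_X n(1) omega_trans[OF n(1)] n(2,3))
  show "val_mem (s $ i) (s $ j) \<in> ext L" if "func s n (level_names c)" for s
    using ap_in_codomain[OF that] n level_names_in_N by (blast intro: val_mem_in_L)
qed (use n in \<open>simp_all add: ap_mem_name closed_rels_def_rel mem_val_mem ext_rel_mem ap_ap_eval_seq func_eval_seq_level\<close>)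

lemma rel_name_eq_name:
  assumes n: "n \<in> nats" "i \<in> ext n" "j \<in> ext n"
  shows "rel_name c n (eq_name S c n i j)"
proof (rule rel_nameI[where A="%s. val_eq (s $ i) (s $ j)"])
  show "eq_name S c n i j \<in> ext X" by (intro eq_name_X c omega_subset_X n(1) omega_trans[OF n(1)] n(2,3))
  show "val_eq (s $ i) (s $ j) \<in> ext L" if "func s n (level_names c)" for s
    using ap_in_codomain[OF that] n level_names_in_N by (blast intro: val_eq_in_L)
qed (use n in \<open>simp_all add: ap_eq_name closed_rels_def_rel mem_val_eq ext_rel_eq ap_ap_eval_seq func_eval_seq_level\<close>)

lemma rel_name_pred_name:
  assumes n: "n \<in> nats" "i \<in> ext n" and u: "u = const_name S \<or> u = id_name"
  shows "rel_name c n (pred_name S u c n i)"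
proof (rule rel_nameI[where A="%s. val_mem (s $ i) u"])
  have u_in_N: "u \<in> ext N" using u const_name_S id_name_in_N by blast
  show "pred_name S u c n i \<in> ext X"
    by (intro pred_name_X c omega_subset_X n(1) omega_trans[OF n] in_X_if_in_N[OF u_in_N])
  show "def_rel S x (level S x c) n (pred_name S u c n i $ x)" if "x \<in> ext reals" for x
    using u closed_rels_def_rel(3,4)[OF n(1,2)] that by (auto simp: ap_pred_name ap_const_name ap_id_name)
  show "val_mem (s $ i) u \<in> ext L" if "func s n (level_names c)" for s
    using ap_in_codomain[OF that n(2)] level_names_in_N by (blast intro: val_mem_in_L[OF _ u_in_N])
qed (use n in \<open>simp_all add: ap_pred_name mem_val_mem ext_rel_pred ap_ap_eval_seq func_eval_seq_level\<close>)

lemma rel_name_compl_name: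
  assumes r: "rel_name c n r"
  shows "rel_name c n (compl_name S c n r)"
proof (rule rel_nameI[OF rel_nameD(1)[OF r], where A="%s. rcompl (val_mem (eval_seq s) r)"])
  show "compl_name S c n r \<in> ext X" by (intro compl_name_X c omega_subset_X rel_nameD[OF r])
qed (use rel_nameD[OF r] in \<open>simp_all add: ap_compl_name closed_rels_def_rel L_rcompl mem_rcompl mem_val_mem ext_rel_compl func_eval_seq_level\<close>)

lemma rel_name_inter_name:
  assumes r: "rel_name c n r" and r': "rel_name c n r'"
  shows "rel_name c n (inter_name r r')"
proof (rule rel_nameI[OF rel_nameD(1)[OF r], where A="%s. rinter (val_mem (eval_seq s) r) (val_mem (eval_seq s) r')"])
  show "inter_name r r' \<in> ext X" by (intro inter_name_X rel_nameD[OF r] rel_nameD[OF r'])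
qed (use rel_nameD[OF r] rel_nameD[OF r']
  in \<open>simp_all add: ap_inter_name closed_rels_def_rel L_rinter mem_rinter mem_val_mem ext_rel_inter\<close>)

lemma ex_level_iff:
  assumes "x \<in> ext reals"
  shows "(\<exists>a\<in>ext (level S x c). Q a) \<longleftrightarrow> (\<exists>t\<in>ext (level_names c). Q (t $ x))"
  using covered_value[OF assms] level_names_value[OF _ assms] by metis

lemma rel_name_proj_name:
  assumes r: "rel_name c (succ n) r" and n: "n \<in> nats"
  shows "rel_name c n (proj_name S c n r)"
proof (rule rel_nameI[OF n, where A="%s. val_mem (eval_seq s) (proj_name S c n r)"])
  show X: "proj_name S c n r \<in> ext X" by (intro proj_name_X c omega_subset_X n rel_nameD[OF r])
  show "def_rel S x (level S x c) n (proj_name S c n r $ x)" if "x \<in> ext reals" for x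
    using closed_rels_def_rel(7)[OF n rel_nameD(3)[OF r that]] that by (simp add: ap_proj_name)
  fix s assume s: "func s n (level_names c)"
  show "val_mem (eval_seq s) (proj_name S c n r) \<in> ext L"
  proof (rule L_UNION[where I="level_names c" and F="%t. val_mem (eval_seq (snoc s t)) r"])
    show "def_fun (%t. val_mem (eval_seq (snoc s t)) r)" by (intro def_intros)
    show "\<And>t. t \<in> ext (level_names c) ==> val_mem (eval_seq (snoc s t)) r \<in> ext L"
      by (rule rel_nameD(4)[OF r func_snoc[OF s]])
    show "val_mem (eval_seq s) (proj_name S c n r) \<in> ext X"
      by (intro val_mem_X eval_seq_X finite_seq_in_X[OF n level_names_in_X s] X)
    show "x \<in> ext (val_mem (eval_seq s) (proj_name S c n r)) \<longleftrightarrow>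
        x \<in> ext reals \<and> (\<exists>t\<in>ext (level_names c). x \<in> ext (val_mem (eval_seq (snoc s t)) r))" for x
      using func_eval_seq_level[OF s]
      by (auto simp: mem_val_mem ap_proj_name ext_rel_proj eval_seq_snoc_level[OF _ s] ex_level_iff)
  qed
qed (simp add: mem_val_mem)

definition named_rels :: "'a => 'a" where
  "named_rels x =
      img (%p. opair (pfst p) (psnd p $ x)) (sep (cprod omega X) (%p. rel_name c (pfst p) (psnd p)))"
lemma mem_named_rels: "opair n R \<in> ext (named_rels x) \<longleftrightarrow> (\<exists>r. rel_name c n r \<and> r $ x = R)"
proof -
  have definable: "def_fun (%p. opair (pfst p) (psnd p $ x))" by (intro def_intros)
  have codes: "ext (sep (cprod omega X) (%p. rel_name c (pfst p) (psnd p))) =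
      {p \<in> ext (cprod omega X). rel_name c (pfst p) (psnd p)}"
    by (rule ext_sep) (intro def_intros)
  show ?thesis
    unfolding named_rels_def ext_img[OF definable] codes using rel_nameD(1,2) by (fastforce simp: image_iff)
qed

lemma closed_rels_named_rels:
  assumes x: "x \<in> ext reals"
  shows "closed_rels S x (level S x c) (named_rels x)"
  unfolding closed_rels_def mem_named_rels
proof (intro conjI ballI allI impI; (elim conjE exE)?)
  fix n i j assume n: "n \<in> nats" "i \<in> ext n" "j \<in> ext n"
  show "\<exists>r. rel_name c n r \<and> r $ x = rel_mem (level S x c) n i j"
    using rel_name_mem_name[OF n] ap_mem_name[OF x] by blast
  show "\<exists>r. rel_name c n r \<and> r $ x = rel_eq (level S x c) n i j"
    using rel_name_eq_name[OF n] ap_eq_name[OF x] by blast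
next
  fix n i assume n: "n \<in> nats" "i \<in> ext n"
  show "\<exists>r. rel_name c n r \<and> r $ x = rel_pred S (level S x c) n i"
    using rel_name_pred_name[OF n, of "const_name S"] ap_pred_name[OF x, of S "const_name S"]
      ap_const_name[OF x] by metis
  show "\<exists>r. rel_name c n r \<and> r $ x = rel_pred x (level S x c) n i"
    using rel_name_pred_name[OF n, of id_name] ap_pred_name[OF x, of S id_name] ap_id_name[OF x] by metis
next
  show "\<exists>r. rel_name c n r \<and> r $ x = rel_compl (level S x c) n R" if "rel_name c n r" "r $ x = R" for n r R
    using rel_name_compl_name[OF that(1)] ap_compl_name[OF x] that(2) by blast
  show "\<exists>r. rel_name c n r \<and> r $ x = rel_inter R R'"
    if "rel_name c n r" "r $ x = R" "rel_name c n r'" "r' $ x = R'" for n r r' R R'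
    using rel_name_inter_name[OF that(1,3)] ap_inter_name[OF x] that(2,4) by blast
  show "\<exists>r. rel_name c n r \<and> r $ x = rel_proj (level S x c) n R"
    if "n \<in> nats" "rel_name c (succ n) r" "r $ x = R" for n r R
    using rel_name_proj_name[OF that(2,1)] ap_proj_name[OF x] that(3) by blast
qed

lemma rel_name_exists: "x \<in> ext reals ==> def_rel S x (level S x c) n R ==> \<exists>r. rel_name c n r \<and> r $ x = R"
  using closed_rels_named_rels unfolding def_rel_def mem_named_rels[symmetric] by blast

lemma name_params:
  assumes x: "x \<in> ext reals" and s: "func s n (level S x c)"
  obtains t where "func t n (level_names c)" "eval_seq t $ x = s"
proof -
  let ?G = "%i. wo_least w (sep (level_names c) (%t. t $ x = s $ i))"
  have G: "def_fun ?G" by (intro def_intros)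
  have fibre: "ext (sep (level_names c) (%t. t $ x = s $ i)) = {t \<in> ext (level_names c).
      t $ x = s $ i}" for i
    by (rule ext_sep) (intro def_intros)
  have choice: "?G i \<in> ext (level_names c)" "?G i $ x = s $ i" if i: "i \<in> ext n" for i
  proof -
    obtain t where "t \<in> ext (level_names c)" "t $ x = s $ i"
      using covered_value[OF x ap_in_codomain[OF s i]] by blast
    then have "?G i \<in> ext (sep (level_names c) (%t. t $ x = s $ i))"
      by (intro wo_leastI(1)[OF wo, where x=t]) (use level_names_in_X in \<open>auto simp: fibre\<close>)
    then show "?G i \<in> ext (level_names c)" "?G i $ x = s $ i" unfolding fibre by blast+
  qed
  have t: "func (lam n ?G) n (level_names c)" by (rule func_lam[OF G choice(1)])
  have "eval_seq (lam n ?G) $ x = s"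
    by (rule func_ext[OF func_eval_seq_level[OF t x] s])
      (simp add: ap_ap_eval_seq[OF x t] ap_lam[OF G] choice(2))
  then show thesis by (rule that[OF t])
qed

lemma section_name_in_level_names:
  assumes r: "rel_name c (succ n) r" and n: "n \<in> nats" and s: "func s n (level_names c)"
  shows "section_name S c n r s \<in> ext (level_names (succ c))"
  unfolding mem_level_names
proof (intro conjI ballI)
  let ?t = "section_name S c n r s"
  have t_in_X: "?t \<in> ext X"
    by (intro section_name_X c omega_subset_X n rel_nameD[OF r] finite_seq_in_X[OF n level_names_in_X s])
  show "?t \<in> ext N"
  proof (rule in_N_I[OF t_in_X])
    fix x y assume "x \<in> ext reals" "y \<in> ext (?t $ x)"
    then show "\<exists>s\<in>ext N. s $ x = y"
      using covered_value[of x y] level_names_in_N by (auto simp: ap_section_name ext_rel_section)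
  next
    fix u assume u: "u \<in> ext N"
    show "val_mem u ?t \<in> ext L"
    proof (rule L_UNION[where I="level_names c"
      and F="%v. rinter (val_eq u v) (val_mem (eval_seq (snoc s v)) r)"])
      show "def_fun (%v. rinter (val_eq u v) (val_mem (eval_seq (snoc s v)) r))" by (intro def_intros)
      show "\<And>v. v \<in> ext (level_names c) ==> rinter (val_eq u v) (val_mem (eval_seq (snoc s v)) r) \<in> ext L"
        using L_rinter[OF val_eq_in_L[OF u level_names_in_N] rel_nameD(4)[OF r func_snoc[OF s]]] .
      show "val_mem u ?t \<in> ext X" by (rule val_mem_X[OF in_X_if_in_N[OF u] t_in_X])
      fix x
      have "u $ x \<in> ext (?t $ x) \<longleftrightarrow>
          (\<exists>v\<in>ext (level_names c). u $ x = v $ x \<and> extend n (eval_seq s $ x) (v $ x) \<in> ext (r $ x))"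
        if x: "x \<in> ext reals"
        unfolding ap_section_name[OF x] ext_rel_section
          ex_level_iff[OF x, of "%a. u $ x = a \<and> extend n (eval_seq s $ x) a \<in> ext (r $ x)", symmetric]
            by auto
      then show "x \<in> ext (val_mem u ?t) \<longleftrightarrow>
          x \<in> ext reals \<and>
          (\<exists>v\<in>ext (level_names c). x \<in> ext (rinter (val_eq u v) (val_mem (eval_seq (snoc s v)) r)))"
        by (auto simp: mem_rinter mem_val_eq mem_val_mem eval_seq_snoc_level[OF _ s])
    qed
  qed
  fix x assume x: "x \<in> ext reals"
  then show "?t $ x \<in> ext (level S x (succ c))"
    unfolding level_succ[OF c(2)] ext_def_pow ap_section_name[OF x]
    using n func_eval_seq_level[OF s x] rel_nameD(3)[OF r x] by blast
qed

lemma covered_succ: "covered (succ c)"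
  unfolding covered_def
proof (intro ballI)
  fix x a assume x: "x \<in> ext reals" and "a \<in> ext (level S x (succ c))"
  then obtain n s R where n: "n \<in> nats" and s: "func s n (level S x c)"
    and R: "def_rel S x (level S x c) (succ n) R"
    and a: "a = rel_section (level S x c) n s R" unfolding level_succ[OF c(2)] ext_def_pow by blast
  obtain r where r: "rel_name c (succ n) r" "r $ x = R" using rel_name_exists[OF x R] by blast
  obtain t where t: "func t n (level_names c)" "eval_seq t $ x = s" by (rule name_params[OF x s])
  show "\<exists>t\<in>ext (level_names (succ c)). t $ x = a"
    using section_name_in_level_names[OF r(1) n t(1)]
    unfolding a by (intro bexI[of _ "section_name S c n r t"]) (simp_all add: ap_section_name x t(2) r(2))
qed

end

lemma covered_limit:
  assumes b: "limit b" and IH: "\<And>d. d \<in> ext b ==> covered d"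
  shows "covered b"
  unfolding covered_def
proof (intro ballI)
  fix x a assume x: "x \<in> ext reals" and "a \<in> ext (level S x b)"
  then obtain d where d: "d \<in> ext b" "a \<in> ext (level S x d)" unfolding level_limit[OF b] by blast
  then obtain t where t: "t \<in> ext (level_names d)" "t $ x = a" using IH x unfolding covered_def by blast
  then have "t \<in> ext (level_names b)" using d(1) unfolding mem_level_names level_limit[OF b] by blast
  then show "\<exists>t\<in>ext (level_names b). t $ x = a" using t(2) by blast
qed

lemma all_covered:
  assumes "ordinal c" "c \<in> ext X"
  shows "covered c"
proof -
  have "c \<in> ext X --> covered c"
  proof (rule ordinal_induct[OF assms(1)], rule_tac [2] impI)
    show "def_pred (%c. c \<in> ext X --> covered c)" by (intro def_intros)
    fix b assume b: "ordinal b" "\<And>d. d \<in> ext b ==> d \<in> ext X --> covered d" "b \<in> ext X"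
    have IH: "d \<in> ext X" "ordinal d" "covered d" if "d \<in> ext b" for d
      using b(2)[OF that] ord_X[OF b(3,1)] that ordinal_mem[OF b(1) that] by blast+
    consider "b = empty" | d where "b = succ d" | "limit b" using b(1) unfolding limit_def by blast
    then show "covered b"
    proof cases
      case 1
      then show ?thesis unfolding covered_def by (simp add: level_empty)
    next
      case (2 d)
      then show ?thesis using covered_succ[of d] IH[of d] by simp
    next
      case 3
      then show ?thesis using IH(3) by (rule covered_limit)
    qed
  qed
  then show ?thesis using assms(2) by blast
qed

definition named_points :: 'a where
  "named_points = sep N (%t. \<forall>x\<in>ext reals. \<exists>c. ordinal c \<and> t $ x \<in> ext (level S x c))"
lemma mem_named_points: "t \<in> ext named_points \<longleftrightarrow> t \<in> ext N \<and> (\<forall>x\<in>ext reals. t $ x \<in> L_bracket S x)"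
  unfolding named_points_def L_bracket_eq_levels by (subst ext_sep) (intro def_intros, simp)

lemma def_fun_val_sat_upd: "def_fun (%t. val_sat S p (e(i := t)))"
proof -
  have "def_term (%f. val_sat S p (%j. if j = i then f 0 else e j))" unfolding val_sat_def
  proof (rule def_term_sep[where Q="%f x. sat (L_bracket S x) p (%j. (if j = i then f 0 else e j) $ x)"])
    show "def_term (%f. reals)" by (rule def_term_const)
    show "definable (%f. sat (L_bracket S (f 0)) p (%j. (if j = i then f (Suc 0) else e j) $ (f 0)))"
      by (rule definable_sat_L_bracket) (auto intro!: def_intros)
  qed
  moreover have "e(i := t) = (%j. if j = i then t else e j)" for t by auto
  ultimately show ?thesis unfolding def_fun_def by simp
qed

lemma val_sat_All:
  assumes p: "All i p \<in> set (subformulas \<phi>)" and e: "\<And>i. e i \<in> ext N"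
  shows "x \<in> ext (val_sat S (All i p) e) \<longleftrightarrow>
      x \<in> ext reals \<and> (\<forall>t\<in>ext named_points. x \<in> ext (val_sat S p (e(i := t))))"
proof (cases "x \<in> ext reals")
  case x: True
  let ?fails = "%a. \<not> sat (L_bracket S x) p ((%j. e j $ x)(i := a))"
  have upd: "(%j. ((e(i := t)) j) $ x) = (%j. e j $ x)(i := t $ x)" for t by auto
  have "(\<exists>a\<in>L_bracket S x. ?fails a) \<longleftrightarrow> (\<exists>t\<in>ext named_points. ?fails (t $ x))"
  proof
    assume "\<exists>a\<in>L_bracket S x. ?fails a"
    moreover obtain c where c: "c \<in> ext X" "ordinal c"
      "\<And>x a. x \<in> ext reals ==> a \<in> L_bracket S x ==> \<not> sat (L_bracket S x) p ((%j. e j $ x)(i := a)) ==>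
        \<exists>b\<in>ext c. \<exists>a\<in>ext (level S x b). \<not> sat (L_bracket S x) p ((%j. e j $ x)(i := a))"
      by (rule refutation_bound_in_X[OF p in_X_if_in_N[OF e]]) (rule that)
    ultimately obtain b a where b: "b \<in> ext c" "a \<in> ext (level S x b)" "?fails a" using x by blast
    have ord: "ordinal b" "b \<in> ext X" using ordinal_mem[OF c(2) b(1)] ord_X[OF c(1,2)] b(1) by blast+
    obtain t where t: "t \<in> ext (level_names b)" "t $ x = a"
      using all_covered[OF ord] x b(2) unfolding covered_def by blast
    then have "t \<in> ext named_points"
      unfolding mem_named_points L_bracket_eq_levels using ord(1) unfolding mem_level_names by blast
    then show "\<exists>t\<in>ext named_points. ?fails (t $ x)" using t(2) b(3) by blast
  qed (use x in \<open>auto simp: mem_named_points\<close>)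
  then show ?thesis using x unfolding mem_val_sat upd by auto
qed (simp add: mem_val_sat)

lemma val_sat_in_L: "p \<in> set (subformulas \<phi>) ==> (\<And>i. e i \<in> ext N) ==> val_sat S p e \<in> ext L"
proof (induction p arbitrary: e)
  case (Mem i j)
  have "val_sat S (Mem i j) e = val_mem (e i) (e j)"
    by (rule val_sat_eqI, unfold mem_val_mem) (simp add: ext_def)
  then show ?case using val_mem_in_L[OF Mem(2) Mem(2)] by simp
next
  case (Eq i j)
  have "val_sat S (Eq i j) e = val_eq (e i) (e j)" by (rule val_sat_eqI) (simp add: mem_val_eq)
  then show ?case using val_eq_in_L[OF Eq(2) Eq(2)] by simp
next
  case (Neg p)
  have "p \<in> set (subformulas \<phi>)" using subformulas_trans[OF Neg.prems(1)] subformulas_refl by auto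
  moreover have "val_sat S (Neg p) e = rcompl (val_sat S p e)"
    by (rule val_sat_eqI) (auto simp: mem_rcompl mem_val_sat)
  ultimately show ?case using L_rcompl[OF Neg.IH[OF _ Neg.prems(2)]] by simp
next
  case (Conj p q)
  have "p \<in> set (subformulas \<phi>)" "q \<in> set (subformulas \<phi>)"
    using subformulas_trans[OF Conj.prems(1)] subformulas_refl by auto
  moreover have "val_sat S (Conj p q) e = rinter (val_sat S p e) (val_sat S q e)"
    by (rule val_sat_eqI) (auto simp: mem_rinter mem_val_sat)
  ultimately show ?case
    using L_rinter[OF Conj.IH(1)[OF _ Conj.prems(2)] Conj.IH(2)[OF _ Conj.prems(2)]] by simp
next
  case (All i p)
  have p: "p \<in> set (subformulas \<phi>)" using subformulas_trans[OF All.prems(1)] subformulas_refl by auto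
  show ?case
  proof (rule L_INTER[where I=named_points, OF def_fun_val_sat_upd _ _ val_sat_All[OF All.prems]])
    show "val_sat S p (e(i := t)) \<in> ext L" if "t \<in> ext named_points" for t
      by (rule All.IH[OF p]) (use that All.prems(2) in \<open>simp add: mem_named_points\<close>)
    show "val_sat S (All i p) e \<in> ext X" by (rule val_sat_X[OF All.prems(1) in_X_if_in_N[OF All.prems(2)]])
  qed
qed

end

context zf_model
begin

lemma borel_closure:
  assumes Y: "infinity_Borel_code S \<phi> Y" and Gs: "\<And>G. G \<in> set Gs ==> def_fun G"
  obtains X w where "well_orders w X" "omega \<in> ext X" "\<And>c. c \<in> ext X ==> ordinal c ==> ext c \<subseteq> ext X"
    "\<And>a b. a \<in> ext X ==> b \<in> ext X ==> opair a b \<in> ext X"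
    "\<And>G a. G \<in> set Gs ==> a \<in> ext X ==> G a \<in> ext X"
    "\<And>a. a \<in> ext X ==> rcompl a \<in> ext X" "\<And>a b. a \<in> ext X ==> b \<in> ext X ==> rinter a b \<in> ext X"
    "\<And>i j. i \<in> nats ==> j \<in> nats ==> basic (opair i j) \<in> ext X" "Y \<in> ext X"
    "\<And>L. borel_closed X L ==> Y \<in> ext L"
proof -
  obtain k where k: "\<And>q. q \<in> set (subformulas \<phi>) ==> fv q \<subseteq> {..<k}" using fv_subformulas_bound by blast
  have S: "\<And>a. a \<in> ext S ==> ordinal a" using Y unfolding infinity_Borel_code_def by blast
  let ?O = "cup S (upair omega omega)"
  define \<gamma> where "\<gamma> = succ (bigunion ?O)"
  have O: "ext ?O = insert omega (ext S)" by auto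
  have "ordinal a" if "a \<in> ext ?O" for a using that S ordinal_omega unfolding O by blast
  from ordinal_bound[of ?O, OF this] have \<gamma>: "ordinal \<gamma>" "ext S \<subseteq> ext \<gamma>" "omega \<in> ext \<gamma>"
    unfolding \<gamma>_def O by blast+
  have ops: "def_fun F" if "F \<in> set (name_ops S \<phi> k @ Gs)" for F using that def_fun_name_ops Gs by auto
  obtain X w where X: "well_orders w X" "ext \<gamma> \<subseteq> ext X"
    "\<And>a b. a \<in> ext X ==> b \<in> ext X ==> upair a b \<in> ext X"
    "\<And>a b. a \<in> ext X ==> b \<in> ext X ==> opair a b \<in> ext X"
    "\<And>F a. F \<in> set (name_ops S \<phi> k @ Gs) ==> a \<in> ext X ==> F a \<in> ext X"
    "\<And>c. c \<in> ext X ==> ordinal c ==> ext c \<subseteq> ext X"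
    by (rule closure_exists_list[OF ops well_orders_ordinal[OF \<gamma>(1)] ordinal_trans[OF \<gamma>(1,3) empty_in_omega]])
      (assumption, rule that)
  interpret name_universe mem S X w \<phi> k
    by unfold_locales (use X \<gamma> S k in auto)
  let ?e = "(%_. const_name S)(1 := id_name) :: nat => 'a"
  have Y_TS: "Y = val_sat S \<phi> ?e" by (rule code_eq_val_sat[OF Y])
  have "Y \<in> ext L" if L: "borel_closed X L" for L
  proof -
    interpret borel_family mem S X w \<phi> k L by unfold_locales (rule L)
    obtain N where N: "name_family N" "ext (add_names N) \<subseteq> ext N" by (rule closed_name_family_exists)
    interpret names mem S X w \<phi> k L N by unfold_locales (rule N)+
    show ?thesis
      unfolding Y_TS by (rule val_sat_in_L[OF subformulas_refl]) (use const_name_S id_name_in_N in simp)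
  qed
  moreover have "Y \<in> ext X"
    unfolding Y_TS by (rule val_sat_X[OF subformulas_refl]) (use const_name_X[OF S_X] id_name_X in simp)
  ultimately show thesis
    using that[OF wo omega_in_X ord_X opair_in_X _ rcompl_X rinter_X basic_X] X(5) by auto
qed

end

context zf_model
begin

section \<open>Exchanging columns\<close>

definition swap :: "'a => 'a => 'a" where
  "swap k i = (if i \<in> ext k then addn k i
     else if \<exists>j\<in>ext k. i = addn k j then least_nat (%j. j \<in> ext k \<and> i = addn k j) else i)"
lemma def_fun2_swap[THEN def_fun2D, def_intros]: "def_fun2 swap"
  by (intro def_fun2I, unfold swap_def, intro def_intros)

lemma swap_low: "i \<in> ext k ==> swap k i = addn k i" unfolding swap_def by simp
lemma swap_high:
  assumes k: "k \<in> nats" and j: "j \<in> ext k"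
  shows "swap k (addn k j) = j"
proof -
  have omega: "j \<in> nats" by (rule omega_trans[OF k j])
  have "addn k j \<notin> ext k" using addn_superset[OF omega, of k] mem_irrefl[of "addn k j"] by blast
  then have tsw: "swap k (addn k j) = least_nat (%i. i \<in> ext k \<and> addn k j = addn k i)"
    unfolding swap_def using j by auto
  have "def_pred (%i. i \<in> ext k \<and> addn k j = addn k i)" by (intro def_intros)
  note least = least_natI(1,2)[OF this omega conjI[OF j HOL.refl]]
  show ?thesis unfolding tsw by (rule addn_inj[OF least(1) omega, where k=k]) (use least(2) in simp)
qed

lemma swap_cases: assumes "k \<in> nats"
  obtains "i \<in> ext k" "swap k i = addn k i" | j where "j \<in> ext k" "i = addn k j"
    "swap k i = j" | "swap k i = i"
proof -
  consider "i \<in> ext k" | j where "j \<in> ext k" "i = addn k j" | "i \<notin> ext k" "\<not> (\<exists>j\<in>ext k. i = addn k j)"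
    by blast
  then show thesis
  proof cases
    case 1
    then show thesis using that(1) swap_low by blast
  next
    case 2
    then show thesis using that(2)[OF 2] swap_high[OF assms 2(1)] by simp
  next
    case 3
    then show thesis using that(3) unfolding swap_def by simp
  qed
qed

lemma swap_swap: assumes k: "k \<in> nats" shows "swap k (swap k i) = i"
  by (rule swap_cases[OF k, of i]) (simp_all add: swap_high[OF k] swap_low)
lemma swap_in:
  assumes k: "k \<in> nats" and N: "ordinal N" "ext (addn k k) \<subseteq> ext N" and i: "i \<in> ext N"
  shows "swap k i \<in> ext N"
  by (rule swap_cases[OF k, of i]) (use addn_mono[OF k, of i k] addn_superset[OF k, of k] N(2) i in auto)
lemma swap_in_omega: "k \<in> nats ==> i \<in> nats ==> swap k i \<in> nats"
  by (rule swap_in[OF _ ordinal_omega]) (use omega_trans[OF addn_in_omega] in blast)+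

definition swap_real :: "'a => 'a => 'a" where
  "swap_real k x = lam omega (%j. x $ nat_pair (swap k (nat_fst j)) (nat_snd j))"
lemma def_fun2_swap_real[THEN def_fun2D, def_intros]: "def_fun2 swap_real"
  by (intro def_fun2I, unfold swap_real_def, intro def_intros)
lemma ap_swap_real: "j \<in> nats ==> swap_real k x $ j = x $ nat_pair (swap k (nat_fst j)) (nat_snd j)"
  unfolding swap_real_def by (rule ap_lam) (intro def_intros)
lemma nat_pair_swap_in_omega: "k \<in> nats ==> j \<in> nats ==> nat_pair (swap k (nat_fst j)) (nat_snd j) \<in> nats"
  by (intro nat_pair_props swap_in_omega nat_fst_snd_in_omega)
lemma swap_real_in:
  assumes k: "k \<in> nats" and x: "x \<in> ext reals"
  shows "swap_real k x \<in> ext reals"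
  unfolding ext_reals swap_real_def
  by (rule func_lam)
    (intro def_intros, use x ap_in_codomain nat_pair_swap_in_omega[OF k] in \<open>unfold ext_reals, blast\<close>)
definition swap_set :: "'a => 'a => 'a" where "swap_set k A = sep reals (%x. swap_real k x \<in> ext A)"
lemma def_fun2_swap_set[THEN def_fun2D, def_intros]: "def_fun2 swap_set"
  by (intro def_fun2I, unfold swap_set_def, intro def_intros)
lemma mem_swap_set: "x \<in> ext (swap_set k A) \<longleftrightarrow> x \<in> ext reals \<and> swap_real k x \<in> ext A"
  unfolding swap_set_def by (subst ext_sep) (intro def_intros, simp)
lemma swap_set_basic: assumes k: "k \<in> nats" and j: "j \<in> nats"
  shows "swap_set k (basic (opair j m)) = basic (opair (nat_pair (swap k (nat_fst j)) (nat_snd j)) m)"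
proof (rule ext_inject, rule set_eqI, unfold mem_swap_set mem_basic)
  fix x
  have "opair j m \<in> ext (swap_real k x) \<longleftrightarrow> opair (nat_pair (swap k (nat_fst j)) (nat_snd j)) m \<in> ext x"
    if x: "x \<in> ext reals"
  proof -
    have f: "func x omega omega" "func (swap_real k x) omega omega"
      using x swap_real_in[OF k x] unfolding ext_reals by blast+
    show ?thesis unfolding func_opair_iff[OF f(1)] func_opair_iff[OF f(2)] ap_swap_real[OF j]
      using j nat_pair_swap_in_omega[OF k j] by blast
  qed
  then show "(x \<in> ext reals \<and> swap_real k x \<in> ext reals \<and> opair j m \<in> ext (swap_real k x)) = (x \<in> ext reals \<and>
      opair (nat_pair (swap k (nat_fst j)) (nat_snd j)) m \<in> ext x)"
    using swap_real_in[OF k] by blast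
qed

definition column :: "'a => 'a => 'a" where "column x i = lam omega (%m. x $ nat_pair i m)"
lemma def_fun2_column[THEN def_fun2D, def_intros]: "def_fun2 column"
  by (intro def_fun2I, unfold column_def, intro def_intros)
lemma ap_column: "m \<in> nats ==> column x i $ m = x $ nat_pair i m"
  unfolding column_def by (rule ap_lam) (intro def_intros)
lemma column_in_reals: assumes "x \<in> ext reals" "i \<in> nats" shows "column x i \<in> ext reals"
  unfolding ext_reals column_def
  by (rule func_lam)
    (intro def_intros, use assms ap_in_codomain nat_pair_props(1) in \<open>unfold ext_reals, blast\<close>)
lemma column_swap_real: assumes k: "k \<in> nats" "empty \<in> ext k" and x: "x \<in> ext reals"
  shows "column (swap_real k x) empty = column x k"
proof (rule func_ext)
  show "func (column (swap_real k x) empty) omega omega" "func (column x k) omega omega"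
    using column_in_reals[OF swap_real_in[OF k(1) x] empty_in_omega] column_in_reals[OF x k(1)]
    unfolding ext_reals by blast+
  fix m assume m: "m \<in> nats"
  show "column (swap_real k x) empty $ m = column x k $ m"
    unfolding ap_column[OF m] ap_swap_real[OF nat_pair_props(1)[OF empty_in_omega m]]
      nat_pair_props(2,3)[OF empty_in_omega m] swap_low[OF k(2)] by simp
qed

definition join_columns :: "'a => 'a" where "join_columns g = lam omega (%j. (g $ nat_fst j) $ nat_snd j)"
lemma def_fun_join_columns[THEN def_funD, def_intros]: "def_fun join_columns"
  by (intro def_funI, unfold join_columns_def, intro def_intros)
lemma ap_join_columns: "j \<in> nats ==> join_columns g $ j = g $ nat_fst j $ nat_snd j"
  unfolding join_columns_def by (rule ap_lam) (intro def_intros)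

section \<open>Forcing with finite sequences from a countable set of reals\<close>

definition joined_in :: "'a => 'a => 'a" where
  "joined_in C A = sep (funs omega (fin_seqs C)) (%f. join_columns (seq_union f) \<in> ext A)"
lemma def_fun2_joined_in[THEN def_fun2D, def_intros]: "def_fun2 joined_in"
  by (intro def_fun2I, unfold joined_in_def, intro def_intros)
lemma mem_joined_in: "f \<in> ext (joined_in C A) \<longleftrightarrow>
    func f omega (fin_seqs C) \<and> join_columns (seq_union f) \<in> ext A"
  unfolding joined_in_def by (subst ext_sep) (intro def_intros, simp)
definition forcing_set :: "'a => 'a => 'a" where
  "forcing_set C A = sep (fin_seqs C) (%s. forces_in (fin_seqs C) (extension_order C) s (joined_in C A))"
lemma def_fun2_forcing_set[THEN def_fun2D, def_intros]: "def_fun2 forcing_set"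
  by (intro def_fun2I, unfold forcing_set_def, intro def_intros)
lemma mem_forcing_set: "s \<in> ext (forcing_set C A) \<longleftrightarrow>
    s \<in> ext (fin_seqs C) \<and> forces_in (fin_seqs C) (extension_order C) s (joined_in C A)"
  unfolding forcing_set_def by (subst ext_sep) (intro def_intros, simp)

definition swap_seq :: "'a => 'a => 'a" where "swap_seq k t = lam (dom t) (%i. t $ swap k i)"
lemma def_fun2_swap_seq[THEN def_fun2D, def_intros]: "def_fun2 swap_seq"
  by (intro def_fun2I, unfold swap_seq_def, intro def_intros)
abbreviation wide :: "'a => 'a => bool" where "wide k t \<equiv> ext (addn k k) \<subseteq> ext (dom t)"

end

locale column_forcing = cohen +
  assumes determinacy: AD and C_reals: "ext C \<subseteq> ext reals"
begin

abbreviation F where "F \<equiv> forcing_set C"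

lemma join_columns_real:
  assumes "func g omega C"
  shows "join_columns g \<in> ext reals"
  unfolding ext_reals join_columns_def
proof (rule func_lam)
  show "def_fun (%j. (g $ nat_fst j) $ nat_snd j)" by (intro def_intros)
  fix j assume j: "j \<in> nats"
  have "g $ nat_fst j \<in> ext reals"
    using ap_in_codomain[OF assms nat_fst_snd_in_omega(1)[OF j]] C_reals by blast
  then show "g $ nat_fst j $ nat_snd j \<in> nats"
    unfolding ext_reals by (rule ap_in_codomain[OF _ nat_fst_snd_in_omega(2)[OF j]])
qed

lemma func_join_columns: "func g omega C ==> func (join_columns g) omega omega"
  using join_columns_real ext_reals by blast
lemma column_join_columns:
  assumes "func g omega C" "i \<in> nats"
  shows "column (join_columns g) i = g $ i"
proof (rule func_ext)
  show "func (column (join_columns g) i) omega omega"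
    using column_in_reals[OF join_columns_real[OF assms(1)] assms(2)] unfolding ext_reals .
  show "func (g $ i) omega omega"
    using ap_in_codomain[OF assms] C_reals unfolding ext_reals[symmetric] by blast
  fix m assume m: "m \<in> nats"
  show "column (join_columns g) i $ m = g $ i $ m"
    unfolding ap_column[OF m] ap_join_columns[OF nat_pair_props(1)[OF assms(2) m]]
      nat_pair_props(2,3)[OF assms(2) m] ..
qed

lemma invariant_joined_in: "Q.invariant (joined_in C A)"
  unfolding invariant_set_def mem_joined_in using seq_union_cong Q.descending_func by metis

lemma F_I:
  assumes "s \<in> ext Q"
    "\<And>f. Q.generic (length_family C) f ==> Q.enters f s ==> join_columns (seq_union f) \<in> ext A"
  shows "s \<in> ext (F A)"
  unfolding mem_forcing_set using assms(1)
  by (intro conjI Q.forcesI[OF dense_family_length_family])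
    (auto simp: mem_joined_in intro: assms(2) Q.descending_func Q.generic_descending)
lemma F_imp2:
  assumes "s \<in> ext (F A)" "s \<in> ext (F B)"
    and imp: "\<And>g. func g omega C ==> join_columns g \<in> ext A ==> join_columns g \<in> ext B ==>
        join_columns g \<in> ext D"
  shows "s \<in> ext (F D)"
proof -
  have s: "s \<in> ext Q" "Q.forces s (joined_in C A)" "Q.forces s (joined_in C B)"
    using assms(1,2) unfolding mem_forcing_set by blast+
  obtain E where E: "Q.dense_family E" "\<And>f. Q.generic E f ==> Q.enters f s ==> f \<in> ext (joined_in C B)"
    by (rule Q.forcesE[OF s(3)]) (rule that)
  have "Q.forces s (joined_in C D)"
    by (rule Q.forces_imp_generic[OF Q.dense_family_cup[OF E(1) dense_family_length_family] s(2)])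
      (use E(2) imp func_seq_union in \<open>simp add: Q.generic_cup mem_joined_in\<close>)
  then show ?thesis unfolding mem_forcing_set using s(1) by blast
qed

lemma F_imp: "s \<in> ext (F A) ==> (\<And>g. func g omega C ==> join_columns g \<in> ext A ==> join_columns g \<in> ext B) ==>
    s \<in> ext (F B)"
  by (rule F_imp2[of s A A]) auto

lemma F_subset_Q: "ext (F A) \<subseteq> ext Q" using mem_forcing_set by blast
lemma F_upward:
  assumes "s \<in> ext (F A)" "t \<in> ext Q" "ext s \<subseteq> ext t"
  shows "t \<in> ext (F A)"
  using assms Q.forces_mono[of t s] unfolding mem_forcing_set opair_extension_order by blast
lemma F_mono: "s \<in> ext (F A) ==> ext A \<subseteq> ext B ==> s \<in> ext (F B)" by (rule F_imp) blast+
lemma F_rinter: "s \<in> ext (F (rinter A B)) \<longleftrightarrow> s \<in> ext (F A) \<and> s \<in> ext (F B)"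
proof
  assume s: "s \<in> ext (F (rinter A B))"
  show "s \<in> ext (F A) \<and> s \<in> ext (F B)" by (intro conjI F_imp[OF s]) (simp_all add: mem_rinter)
next
  assume "s \<in> ext (F A) \<and> s \<in> ext (F B)"
  then show "s \<in> ext (F (rinter A B))"
    by (elim conjE) (rule F_imp2, assumption+, simp add: mem_rinter join_columns_real)
qed

lemma F_rcompl_disjoint:
  assumes "s \<in> ext (F A)" "s \<in> ext (F (rcompl A))"
  shows False
proof -
  have s: "s \<in> ext Q" "Q.forces s (joined_in C A)" "Q.forces s (joined_in C (rcompl A))"
    using assms unfolding mem_forcing_set by blast+
  show False
    by (rule Q.forces_both[OF s(2,3) dense_family_length_family s(1)]) (simp add: mem_joined_in mem_rcompl)
qed

lemma F_dense:
  assumes s: "s \<in> ext Q" "s \<notin> ext (F A)"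
  obtains t where "t \<in> ext (F (rcompl A))" "ext s \<subseteq> ext t"
proof (rule Q.Baire_dichotomy[OF determinacy s(1) invariant_joined_in[of "rcompl A"]])
  fix q assume "q \<in> ext Q" "opair q s \<in> ext Q_order" "Q.forces q (joined_in C (rcompl A))"
  then show thesis using that[of q] unfolding mem_forcing_set opair_extension_order by blast
next
  assume "Q.forces s (seq_compl Q (joined_in C (rcompl A)))"
  then have "Q.forces s (joined_in C A)"
    by (rule Q.forces_imp_generic[OF dense_family_length_family])
      (use func_seq_union join_columns_real in \<open>simp add: mem_seq_compl mem_joined_in mem_rcompl\<close>)
  then show thesis using s unfolding mem_forcing_set by blast
qed

lemma F_eq_Q:
  assumes "\<And>g. func g omega C ==> join_columns g \<in> ext A"
  shows "ext (F A) = ext Q"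
proof
  show "ext Q \<subseteq> ext (F A)" by (rule subsetI, erule F_I) (rule assms[OF func_seq_union])
qed (rule F_subset_Q)

lemma F_Inter:
  assumes wo: "well_orders w X" and Z: "ext Z \<subseteq> ext X" and A: "ext A = {x \<in> ext reals. \<forall>B\<in>ext Z. x \<in> ext B}"
    and s: "s \<in> ext Q" "\<And>B. B \<in> ext Z ==> s \<in> ext (F B)"
  shows "s \<in> ext (F A)"
proof (rule ccontr)
  assume "s \<notin> ext (F A)"
  then obtain t where t: "t \<in> ext (F (rcompl A))" "ext s \<subseteq> ext t" by (rule F_dense[OF s(1)])
  have t_in_Q: "t \<in> ext Q" and forced: "Q.forces t (joined_in C (rcompl A))"
    using t(1) unfolding mem_forcing_set by blast+
  have definable: "def_fun (%B. joined_in C (rcompl B))" by (intro def_intros)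
  have cover: "\<exists>B\<in>ext Z. f \<in> ext (joined_in C (rcompl B))"
    if "Q.descending f" "f \<in> ext (joined_in C (rcompl A))" for f
    using that(2) unfolding mem_joined_in mem_rcompl A by blast
  obtain q B where q: "q \<in> ext Q" "B \<in> ext Z" "opair q t \<in> ext Q_order"
    "Q.forces q (joined_in C (rcompl B))"
    by (rule Q.well_ordered_additivity[OF determinacy well_orders_subset[OF wo Z] definable invariant_joined_in t_in_Q forced cover], assumption+)
  have "q \<in> ext (F B)"
    by (rule F_upward[OF s(2)[OF q(2)] q(1)]) (use q(3) t(2) in \<open>unfold opair_extension_order, blast\<close>)
  moreover have "q \<in> ext (F (rcompl B))" unfolding mem_forcing_set using q by blast
  ultimately show False by (rule F_rcompl_disjoint)
qed

lemma F_basicI: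
  assumes t: "t \<in> ext Q" "nat_fst j \<in> ext (dom t)" and j: "j \<in> nats"
  shows "t \<in> ext (F (basic (opair j (t $ nat_fst j $ nat_snd j))))"
proof (rule F_I[OF t(1)])
  fix f assume f: "Q.generic (length_family C) f" "Q.enters f t"
  note g = func_seq_union[OF f(1)]
  show "join_columns (seq_union f) \<in> ext (basic (opair j (t $ nat_fst j $ nat_snd j)))"
    unfolding mem_basic func_opair_iff[OF func_join_columns[OF g]] ap_join_columns[OF j]
      ap_seq_union[OF f(1) t(1) f(2) t(2)] using join_columns_real[OF g] j by blast
qed

lemma F_basic_dense:
  assumes s: "s \<in> ext Q" and j: "j \<in> nats"
  obtains t m where "t \<in> ext Q" "m \<in> nats" "ext s \<subseteq> ext t" "t \<in> ext (F (basic (opair j m)))"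
proof -
  note half = nat_fst_snd_in_omega[OF j]
  obtain t where t: "t \<in> ext Q" "ext s \<subseteq> ext t" "ext (succ (nat_fst j)) \<subseteq> ext (dom t)"
    by (rule long_extension[OF s succ_in_omega[OF half(1)]])
  have dom: "nat_fst j \<in> ext (dom t)" using t(3) by auto
  then have "t $ nat_fst j \<in> ext C" by (rule ap_in_codomain[OF fin_seqs_func(2)[OF t(1)]])
  then have "func (t $ nat_fst j) omega omega" using C_reals unfolding ext_reals[symmetric] by blast
  then have "t $ nat_fst j $ nat_snd j \<in> nats" by (rule ap_in_codomain[OF _ half(2)])
  then show thesis using that t(1,2) F_basicI[OF t(1) dom j] by blast
qed

lemma F_basic_disjoint:
  assumes "m \<noteq> m'" "s \<in> ext (F (basic (opair j m)))" "s \<in> ext (F (basic (opair j m')))"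
  shows False
proof (rule F_rcompl_disjoint[OF assms(3)])
  show "s \<in> ext (F (rcompl (basic (opair j m'))))"
    by (rule F_imp[OF assms(2)])
      (use assms(1) in \<open>auto simp: mem_rcompl mem_basic func_opair_iff[OF func_join_columns]\<close>)
qed

lemma swap_seq_props:
  assumes k: "k \<in> nats" and t: "t \<in> ext Q" "wide k t"
  shows swap_seq_in: "swap_seq k t \<in> ext Q" and dom_swap_seq: "dom (swap_seq k t) = dom t"
    and ap_swap_seq: "i \<in> ext (dom t) ==> swap_seq k t $ i = t $ swap k i"
      and swap_seq_swap_seq: "swap_seq k (swap_seq k t) = t"
proof -
  note fin = fin_seqs_func[OF t(1)]
  have tsw: "swap k i \<in> ext (dom t)" if "i \<in> ext (dom t)" for i
    by (rule swap_in[OF k ordinal_if_in_omega[OF fin(1)] t(2) that])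
  have definable: "def_fun (%i. t $ swap k i)" "def_fun (%i. swap_seq k t $ swap k i)"
    by (intro def_intros)+
  have f: "func (swap_seq k t) (dom t) C"
    unfolding swap_seq_def by (rule func_lam[OF definable(1) ap_in_codomain[OF fin(2) tsw]])
  show "swap_seq k t \<in> ext Q" unfolding ext_fin_seqs using f fin(1) by blast
  show dom: "dom (swap_seq k t) = dom t" by (rule func_dom[OF f])
  show ap_swap_seq: "swap_seq k t $ i = t $ swap k i" if "i \<in> ext (dom t)" for i
    unfolding swap_seq_def by (rule ap_lam[OF definable(1) that])
  have "swap_seq k (swap_seq k t) = lam (dom t) (%i. swap_seq k t $ swap k i)"
    unfolding swap_seq_def[of k "swap_seq k t"] dom ..
  then show "swap_seq k (swap_seq k t) = t"
    using func_ext[OF func_lam[OF definable(2) ap_in_codomain[OF f tsw]] fin(2)]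
    by (simp add: ap_lam[OF definable(2)] ap_swap_seq[OF tsw] swap_swap[OF k])
qed

lemma swap_seq_mono:
  assumes k: "k \<in> nats" and t: "t \<in> ext Q" "wide k t" and u: "u \<in> ext Q" "ext t \<subseteq> ext u"
  shows "wide k u" "ext (swap_seq k t) \<subseteq> ext (swap_seq k u)"
proof -
  have extends: "i \<in> ext (dom u)" "t $ i = u $ i" if "i \<in> ext (dom t)" for i
  proof -
    have "opair i (t $ i) \<in> ext u" using opair_ap_mem[OF fin_seqs_func(2)[OF t(1)] that] u(2) by blast
    then show "i \<in> ext (dom u)" "t $ i = u $ i"
      unfolding func_opair_iff[OF fin_seqs_func(2)[OF u(1)]] by blast+
  qed
  show wide_u: "wide k u" using t(2) extends(1) by blast
  note tw_t = swap_seq_props[OF k t] and tw_u = swap_seq_props[OF k u(1) wide_u]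
  have "swap_seq k t $ i = swap_seq k u $ i" if i: "i \<in> ext (dom t)" for i
    using tw_t(3)[OF i] tw_u(3)[OF extends(1)[OF i]]
      extends(2)[OF swap_in[OF k ordinal_if_in_omega[OF fin_seqs_func(1)[OF t(1)]] t(2) i]] by simp
  then show "ext (swap_seq k t) \<subseteq> ext (swap_seq k u)"
    by (intro fin_seqs_subsetI[OF tw_t(1) tw_u(1)]) (simp add: tw_t(2) tw_u(2) extends(1))
qed

lemma wide_extension:
  assumes "k \<in> nats" "s \<in> ext Q"
  obtains t where "t \<in> ext Q" "ext s \<subseteq> ext t" "wide k t"
  using long_extension[OF assms(2) addn_in_omega[OF assms(1) assms(1)]] .

lemma swap_real_join_columns:
  assumes k: "k \<in> nats" and g: "func g omega C" "func g' omega C"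
    and swap: "\<And>i. i \<in> nats ==> g' $ i = g $ swap k i"
  shows "swap_real k (join_columns g) = join_columns g'"
proof (rule func_ext)
  show "func (swap_real k (join_columns g)) omega omega"
    using swap_real_in[OF k join_columns_real[OF g(1)]] unfolding ext_reals .
  show "func (join_columns g') omega omega" by (rule func_join_columns[OF g(2)])
  fix j assume j: "j \<in> nats"
  show "swap_real k (join_columns g) $ j = join_columns g' $ j"
    unfolding ap_swap_real[OF j] ap_join_columns[OF j]
      ap_join_columns[OF nat_pair_swap_in_omega[OF k j]] swap[OF nat_fst_snd_in_omega(1)[OF j]]
      nat_pair_props(2,3)[OF swap_in_omega[OF k nat_fst_snd_in_omega(1)[OF j]] nat_fst_snd_in_omega(2)[OF j]] ..
qed

lemma F_swap_set_if:
  assumes k: "k \<in> nats" and t: "t \<in> ext Q" "wide k t" and forced: "swap_seq k t \<in> ext (F A)"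
  shows "t \<in> ext (F (swap_set k A))"
proof -
  have "Q.forces t (joined_in C (swap_set k A))"
  proof (rule Q.forces_transfer[where \<pi>="swap_seq k" and big="wide k" and W="joined_in C A"
    and E="length_family C"])
    show "def_fun (swap_seq k)" "def_pred (wide k)" by (intro def_intros)+
    show "t \<in> ext Q" "wide k t" "Q.forces (swap_seq k t) (joined_in C A)" "Q.dense_family (length_family C)"
      using t forced dense_family_length_family unfolding mem_forcing_set by blast+
    fix p assume p: "p \<in> ext Q"
    show "\<exists>q\<in>ext Q. wide k q \<and> opair q p \<in> ext Q_order"
      by (rule wide_extension[OF k p]) (use p in \<open>auto simp: opair_extension_order\<close>)
    show "wide k p ==> swap_seq k p \<in> ext Q \<and> wide k (swap_seq k p)"
      "wide k p ==> swap_seq k (swap_seq k p) = p" using swap_seq_props[OF k p] by auto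
    fix q assume "q \<in> ext Q" "wide k p" "opair q p \<in> ext Q_order"
    then show "wide k q" "opair (swap_seq k q) (swap_seq k p) \<in> ext Q_order"
      using swap_seq_mono[OF k p] swap_seq_in[OF k] p unfolding opair_extension_order by blast+
  next
    fix f h assume f: "Q.generic (length_family C) f" and h: "Q.generic (length_family C) h"
      and h_in: "h \<in> ext (joined_in C A)"
      and swap: "\<And>q. q \<in> ext Q ==> wide k q ==> Q.enters h (swap_seq k q) \<longleftrightarrow> Q.enters f q"
    have "seq_union h $ i = seq_union f $ swap k i" if i: "i \<in> nats" for i
    proof -
      obtain m where m: "m \<in> nats" "i \<in> ext (succ m)" "addn k k \<in> ext (succ m)"
        by (rule omega_max[OF i addn_in_omega[OF k k]])
      obtain s where s: "s \<in> ext Q" "ext (succ m) \<subseteq> ext (dom s)" "Q.enters f s"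
        by (rule long_entered[OF f succ_in_omega[OF m(1)]])
      have wide: "wide k s" and dom: "i \<in> ext (dom s)"
        using m(2) s(2) ordinal_subset[OF ordinal_if_in_omega[OF succ_in_omega[OF m(1)]] m(3)] by blast+
      note twist = swap_seq_props[OF k s(1) wide]
      have "seq_union h $ i = swap_seq k s $ i"
        using ap_seq_union[OF h twist(1)] swap[OF s(1) wide] s(3) twist(2) dom by simp
      also have "\<dots> = seq_union f $ swap k i"
        using ap_seq_union[OF f s(1,3) swap_in[OF k ordinal_if_in_omega[OF fin_seqs_func(1)[OF s(1)]] wide dom]] twist(3)[OF dom] by simp
      finally show ?thesis .
    qed
    then have "swap_real k (join_columns (seq_union f)) = join_columns (seq_union h)"
      by (rule swap_real_join_columns[OF k func_seq_union[OF f] func_seq_union[OF h]])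
    then show "f \<in> ext (joined_in C (swap_set k A))"
      using h_in join_columns_real[OF func_seq_union[OF f]] Q.descending_func[OF Q.generic_descending[OF f]]
      unfolding mem_joined_in mem_swap_set by simp
  qed
  then show ?thesis unfolding mem_forcing_set using t(1) by blast
qed

lemma F_swap_swap:
  assumes k: "k \<in> nats"
  shows "F (swap_set k (swap_set k A)) = F A"
proof -
  have "swap_real k (swap_real k (join_columns g)) = join_columns g" if g: "func g omega C" for g
  proof -
    have definable: "def_fun (%i. g $ swap k i)" by (intro def_intros)
    let ?g = "lam omega (%i. g $ swap k i)"
    have swapped_func: "func ?g omega C"
      by (rule func_lam[OF definable ap_in_codomain[OF g swap_in_omega[OF k]]])
    have "swap_real k (join_columns g) = join_columns ?g"
      by (rule swap_real_join_columns[OF k g swapped_func]) (rule ap_lam[OF definable])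
    moreover have "swap_real k (join_columns ?g) = join_columns g"
      by (rule swap_real_join_columns[OF k swapped_func g])
        (simp add: ap_lam[OF definable swap_in_omega[OF k]] swap_swap[OF k])
    ultimately show ?thesis by simp
  qed
  then have "join_columns g \<in> ext (swap_set k (swap_set k A)) \<longleftrightarrow> join_columns g \<in> ext A"
    if g: "func g omega C" for g
    unfolding mem_swap_set using that join_columns_real[OF g] swap_real_in[OF k] by simp
  then show ?thesis by (intro ext_inject set_eqI) (use F_imp in blast)
qed

definition swap_cond :: "'a => 'a => 'a" where
  "swap_cond k B = sep Q (%s. \<forall>t\<in>ext Q. ext s \<subseteq> ext t --> wide k t --> swap_seq k t \<in> ext B)"
lemma def_fun2_swap_cond[THEN def_fun2D, def_intros]: "def_fun2 swap_cond"
  by (intro def_fun2I, unfold swap_cond_def, intro def_intros)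
lemma mem_swap_cond: "s \<in> ext (swap_cond k B) \<longleftrightarrow> s \<in> ext Q \<and> (\<forall>t\<in>ext Q. ext s \<subseteq> ext t --> wide k t -->
    swap_seq k t \<in> ext B)"
  unfolding swap_cond_def by (subst ext_sep) (intro def_intros, simp)
lemma swap_cond_mono: "ext B \<subseteq> ext B' ==> ext (swap_cond k B) \<subseteq> ext (swap_cond k B')"
  unfolding subset_iff mem_swap_cond by blast

lemma F_swap_set:
  assumes k: "k \<in> nats"
  shows "F (swap_set k A) = swap_cond k (F A)"
proof (rule ext_inject, rule set_eqI, rule iffI)
  fix s assume s: "s \<in> ext (F (swap_set k A))"
  have "swap_seq k t \<in> ext (F A)" if t: "t \<in> ext Q" "ext s \<subseteq> ext t" "wide k t" for t
  proof -
    have "swap_seq k (swap_seq k t) \<in> ext (F (swap_set k A))"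
      unfolding swap_seq_swap_seq[OF k t(1,3)] by (rule F_upward[OF s t(1,2)])
    from F_swap_set_if[OF k swap_seq_in[OF k t(1,3)] _ this] show ?thesis
      unfolding dom_swap_seq[OF k t(1,3)] F_swap_swap[OF k] using t(3) by blast
  qed
  then show "s \<in> ext (swap_cond k (F A))" unfolding mem_swap_cond using s F_subset_Q by blast
next
  fix s assume s: "s \<in> ext (swap_cond k (F A))"
  then have s_in_Q: "s \<in> ext Q" unfolding mem_swap_cond by blast
  show "s \<in> ext (F (swap_set k A))"
  proof (rule ccontr)
    assume "s \<notin> ext (F (swap_set k A))"
    then obtain u where u: "u \<in> ext (F (rcompl (swap_set k A)))" "ext s \<subseteq> ext u"
      by (rule F_dense[OF s_in_Q])
    have "u \<in> ext Q" using u(1) F_subset_Q by blast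
    then obtain t where t: "t \<in> ext Q" "ext u \<subseteq> ext t" "wide k t" by (rule wide_extension[OF k])
    have "swap_seq k t \<in> ext (F A)" using s t u(2) unfolding mem_swap_cond by blast
    then have "t \<in> ext (F (swap_set k A))" by (rule F_swap_set_if[OF k t(1,3)])
    then show False by (rule F_rcompl_disjoint[OF _ F_upward[OF u(1) t(1,2)]])
  qed
qed

lemma common_swap_extension:
  assumes s: "s1 \<in> ext Q" "s2 \<in> ext Q"
  obtains k t where "k \<in> nats" "empty \<in> ext k" "t \<in> ext Q" "wide k t"
    "ext s1 \<subseteq> ext t" "ext s2 \<subseteq> ext (swap_seq k t)"
proof -
  obtain c where c: "c \<in> ext C" by (rule enumerable_nonempty[OF enumerable_C])
  note fin1 = fin_seqs_func[OF s(1)] and fin2 = fin_seqs_func[OF s(2)]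
  obtain l where l: "l \<in> nats" "dom s1 \<in> ext (succ l)" "dom s2 \<in> ext (succ l)"
    by (rule omega_max[OF fin1(1) fin2(1)])
  define k where "k = succ l"
  have k: "k \<in> nats" unfolding k_def by (rule succ_in_omega[OF l(1)])
  have dom_k: "ext (dom s1) \<subseteq> ext k" "ext (dom s2) \<subseteq> ext k"
    using ordinal_subset[OF ordinal_if_in_omega[OF k]] l(2,3) unfolding k_def by blast+
  have zero: "empty \<in> ext k"
    unfolding k_def using ordinal_linear[OF ordinal_empty ordinal_if_in_omega[OF l(1)]] by auto
  let ?entry = "%i. if i \<in> ext (dom s1) then s1 $ i else if swap k i \<in> ext (dom s2) then s2 $ swap k i else c"
  define t where "t = lam (addn k k) ?entry"
  have definable: "def_fun ?entry" by (intro def_intros)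
  have "func t (addn k k) C"
    unfolding t_def
    by (rule func_lam[OF definable]) (use ap_in_codomain[OF fin1(2)] ap_in_codomain[OF fin2(2)] c in auto)
  then have t: "t \<in> ext Q" "dom t = addn k k"
    using addn_in_omega[OF k k] func_dom unfolding ext_fin_seqs by blast+
  then have wide: "wide k t" by simp
  have ap_t: "t $ i = ?entry i" if "i \<in> ext (addn k k)" for i
    unfolding t_def by (rule ap_lam[OF definable that])
  have low: "i \<in> ext (addn k k)" if "i \<in> ext k" for i using addn_superset[OF k, of k] that by blast
  note swapped = swap_seq_props[OF k t(1) wide]
  have "ext s1 \<subseteq> ext t"
    by (rule fin_seqs_subsetI[OF s(1) t(1)]) (use ap_t low dom_k(1) t(2) in auto)
  moreover have "ext s2 \<subseteq> ext (swap_seq k t)"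
  proof (rule fin_seqs_subsetI[OF s(2) swapped(1)], unfold swapped(2) t(2))
    fix i assume i: "i \<in> ext (dom s2)"
    then have i_in_k: "i \<in> ext k" using dom_k(2) by blast
    have "addn k i \<notin> ext k"
      using addn_superset[OF omega_trans[OF k i_in_k], of k] mem_irrefl[of "addn k i"] by blast
    then have "addn k i \<notin> ext (dom s1)" using dom_k(1) by blast
    then have "t $ addn k i = s2 $ i" using ap_t[OF addn_mono[OF k i_in_k]] swap_high[OF k i_in_k] i by simp
    then show "i \<in> ext (addn k k) \<and> s2 $ i = swap_seq k t $ i"
      using swapped(3)[of i] t(2) low[OF i_in_k] swap_low[OF i_in_k] by simp
  qed
  ultimately show thesis using that[OF k zero t(1) wide] by blast
qed

end

section \<open>Forcing with the sets \<open>F A\<close>\<close>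

locale F_forcing = column_forcing +
  fixes X w Y :: 'a
  assumes wo: "well_orders w X" and X_rcompl: "\<And>A. A \<in> ext X ==> rcompl A \<in> ext X"
    and X_rinter: "\<And>A B. A \<in> ext X ==> B \<in> ext X ==> rinter A B \<in> ext X"
    and X_basic: "\<And>i j. i \<in> nats ==> j \<in> nats ==> basic (opair i j) \<in> ext X"
    and X_swap_set: "\<And>k A. k \<in> nats ==> A \<in> ext X ==> swap_set k A \<in> ext X"
    and Y_X: "Y \<in> ext X" and Y_reals: "ext Y \<subseteq> ext reals" and F_Y: "ext (F Y) = ext Q"
    and Y_L: "\<And>L. borel_closed X L ==> Y \<in> ext L"
    and undecided: "\<And>A a. A \<in> ext X ==> ext A \<subseteq> ext reals ==> F A \<noteq> empty ==> a \<in> ext C ==>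
      \<exists>s\<in>ext (F A). dom s \<noteq> empty \<and> s $ empty \<noteq> a"
begin

definition P :: 'a where "P = sep (img F (sep X (%A. ext A \<subseteq> ext reals))) (%B. B \<noteq> empty)"
definition P_order :: 'a where "P_order = sep (cprod P P) (%p. ext (pfst p) \<subseteq> ext (psnd p))"

lemma ext_P: "ext P = {B \<in> F ` {A \<in> ext X. ext A \<subseteq> ext reals}. B \<noteq> empty}"
proof -
  have "def_pred (%A. ext A \<subseteq> ext reals)" "def_pred (%B. B \<noteq> empty)" "def_fun F" by (intro def_intros)+
  then show ?thesis unfolding P_def by (simp add: ext_sep ext_img)
qed

lemma mem_P: "B \<in> ext P \<longleftrightarrow> (\<exists>A\<in>ext X. ext A \<subseteq> ext reals \<and> B = F A) \<and> B \<noteq> empty"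
  unfolding ext_P by blast
lemma opair_P_order: "opair B B' \<in> ext P_order \<longleftrightarrow> B \<in> ext P \<and> B' \<in> ext P \<and> ext B \<subseteq> ext B'"
  unfolding P_order_def by (subst ext_sep) (intro def_intros, auto)
lemma P_subset_Q: "B \<in> ext P ==> ext B \<subseteq> ext Q" unfolding mem_P using F_subset_Q by blast
lemma P_nonempty: "B \<in> ext P ==> \<exists>s. s \<in> ext B" unfolding mem_P using ext_eq_empty_iff by blast
lemma P_upward: "B \<in> ext P ==> s \<in> ext B ==> t \<in> ext Q ==> ext s \<subseteq> ext t ==> t \<in> ext B"
  unfolding mem_P using F_upward by blast
lemma F_in_P: "A \<in> ext X ==> ext A \<subseteq> ext reals ==> s \<in> ext (F A) ==> F A \<in> ext P"
  unfolding mem_P by (metis ext_eq_empty_iff emptyE)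
lemma rcompl_reals: "ext (rcompl A) \<subseteq> ext reals" and rinter_reals: "ext (rinter A B) \<subseteq> ext reals"
  and basic_reals: "ext (basic p) \<subseteq> ext reals"
  and swap_set_reals: "ext (swap_set k A) \<subseteq> ext reals"
    using mem_rcompl mem_rinter mem_basic mem_swap_set by blast+
lemma P_meet:
  assumes "B \<in> ext P" "A \<in> ext X" "s \<in> ext B" "s \<in> ext (F A)"
  obtains B' where "B' \<in> ext P" "ext B' \<subseteq> ext B" "ext B' \<subseteq> ext (F A)"
proof -
  obtain A' where A': "A' \<in> ext X" "B = F A'" using assms(1) unfolding mem_P by blast
  have "s \<in> ext (F (rinter A' A))" using assms(3,4) A'(2) F_rinter by blast
  then have "F (rinter A' A) \<in> ext P" by (rule F_in_P[OF X_rinter[OF A'(1) assms(2)] rinter_reals])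
  then show thesis using that[of "F (rinter A' A)"] A'(2) F_rinter by blast
qed

lemma P_inhabited: obtains p where "p \<in> ext P"
proof -
  obtain q where "q \<in> ext Q" by (rule enumerable_nonempty[OF Q.enumerable_conds])
  then show thesis using that F_in_P[OF Y_X Y_reals] F_Y by blast
qed

lemma enumerable_P: "enumerable P"
proof -
  let ?sets = "sep X (%A. ext A \<subseteq> ext reals)"
  have F: "def_fun F" and definable: "def_pred (%A. ext A \<subseteq> ext reals)" "def_pred (%B. B \<noteq> empty)"
    by (intro def_intros)+
  have "well_orders w ?sets" by (rule well_orders_subset[OF wo]) (use ext_sep[OF definable(1)] in blast)
  then have wo_P: "well_orders (image_order F w ?sets) P"
    by (rule well_orders_subset[OF well_orders_img[OF F]]) (auto simp: P_def ext_sep[OF definable(2)])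
  obtain p where p: "p \<in> ext P" by (rule P_inhabited)
  show ?thesis
    by (rule enumerable_if_well_ordered_subsets[OF determinacy wo_P Q.enumerable_conds _ p])
    (rule P_subset_Q)
qed

sublocale P: forcing mem P P_order
  by unfold_locales (auto simp: opair_P_order enumerable_P)

definition ends_in :: "'a => 'a => bool" where "ends_in f B \<longleftrightarrow> (\<exists>k\<in>nats. ext (f $ k) \<subseteq> ext B)"
lemma def_pred2_ends_in[THEN def_pred2D, def_intros]: "def_pred2 ends_in"
  by (intro def_pred2I, unfold ends_in_def, intro def_intros)

lemma ends_in_common:
  assumes f: "P.descending f" and B: "ends_in f B" "ends_in f B'"
  obtains k where "k \<in> nats" "ext (f $ k) \<subseteq> ext B" "ext (f $ k) \<subseteq> ext B'"
proof -
  obtain n m where n: "n \<in> nats" "ext (f $ n) \<subseteq> ext B" "m \<in> nats" "ext (f $ m) \<subseteq> ext B'"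
    using B unfolding ends_in_def by blast
  obtain k where k: "k \<in> nats" "n \<in> ext (succ k)" "m \<in> ext (succ k)" by (rule omega_max[OF n(1,3)])
  have "ext (f $ k) \<subseteq> ext (f $ n)" "ext (f $ k) \<subseteq> ext (f $ m)"
    using P.descending_antimono[OF f k(1,2)] P.descending_antimono[OF f k(1,3)]
    unfolding opair_P_order by blast+
  then show thesis using that[OF k(1)] n(2,4) by blast
qed

lemma ends_in_compatible:
  assumes "P.descending f" "ends_in f B" "ends_in f B'"
  obtains s where "s \<in> ext B" "s \<in> ext B'"
proof -
  obtain k where k: "k \<in> nats" "ext (f $ k) \<subseteq> ext B" "ext (f $ k) \<subseteq> ext B'"
    by (rule ends_in_common[OF assms])
  then show ?thesis using that P_nonempty[OF P.descending_in[OF assms(1) k(1)]] by blast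
qed

lemma not_ends_in_rcompl: "P.descending f ==> ends_in f (F A) ==> ends_in f (F (rcompl A)) ==> False"
  by (rule ends_in_compatible[of f "F A" "F (rcompl A)"]) (assumption+, rule F_rcompl_disjoint)
lemma ends_in_rinter:
  assumes f: "P.descending f"
  shows "ends_in f (F (rinter A B)) \<longleftrightarrow> ends_in f (F A) \<and> ends_in f (F B)"
proof
  show "ends_in f (F A) \<and> ends_in f (F B)" if "ends_in f (F (rinter A B))"
    using that unfolding ends_in_def subset_iff F_rinter by blast
  assume "ends_in f (F A) \<and> ends_in f (F B)"
  then obtain k where "k \<in> nats" "ext (f $ k) \<subseteq> ext (F A)" "ext (f $ k) \<subseteq> ext (F B)"
    using ends_in_common[OF f] by metis
  then show "ends_in f (F (rinter A B))" unfolding ends_in_def subset_iff F_rinter by blast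
qed

lemma ends_in_if_enters: "P.enters f B ==> ext B \<subseteq> ext B' ==> ends_in f B'"
  unfolding seq_enters_def ends_in_def opair_P_order by blast
lemma ends_in_iff_enters:
  assumes f: "P.descending f" and A: "A \<in> ext X" "ext A \<subseteq> ext reals"
  shows "ends_in f (F A) \<longleftrightarrow> F A \<in> ext P \<and> P.enters f (F A)"
proof
  assume "ends_in f (F A)"
  then obtain k where k: "k \<in> nats" "ext (f $ k) \<subseteq> ext (F A)" unfolding ends_in_def by blast
  note fk = P.descending_in[OF f k(1)]
  have "F A \<in> ext P" using P_nonempty[OF fk] k(2) F_in_P[OF A] by blast
  then show "F A \<in> ext P \<and> P.enters f (F A)" unfolding seq_enters_def opair_P_order using k fk by blast
qed (use ends_in_if_enters in blast)

lemma ends_in_cong: "P.equivalent f g ==> ends_in f B \<longleftrightarrow> ends_in g B"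
  unfolding seq_equivalent_def ends_in_def opair_P_order by (meson subset_trans)

definition generic_real :: "'a => 'a" where
  "generic_real f = lam omega (%j. least_nat (%m. ends_in f (F (basic (opair j m)))))"
lemma def_fun_generic_real[THEN def_funD, def_intros]: "def_fun generic_real"
  by (intro def_funI, unfold generic_real_def, intro def_intros)
lemma ap_generic_real: "j \<in> nats ==> generic_real f $ j = least_nat (%m. ends_in f (F (basic (opair j m))))"
  unfolding generic_real_def by (rule ap_lam) (intro def_intros)
lemma generic_real_in_reals: "generic_real f \<in> ext reals"
  unfolding ext_reals generic_real_def
  by (rule func_lam) (intro def_intros, rule least_nat_in_omega, intro def_intros)
lemma generic_real_cong: "P.equivalent f g ==> generic_real f = generic_real g"
  unfolding generic_real_def by (simp add: ends_in_cong)

definition digit_at :: "'a => 'a" where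
  "digit_at j = sep P (%B. \<exists>m\<in>nats. ext B \<subseteq> ext (F (basic (opair j m))))"
lemma def_fun_digit_at[THEN def_funD, def_intros]: "def_fun digit_at"
  by (intro def_funI, unfold digit_at_def, intro def_intros)
lemma mem_digit_at: "B \<in> ext (digit_at j) \<longleftrightarrow> B \<in> ext P \<and> (\<exists>m\<in>nats. ext B \<subseteq> ext (F (basic (opair j m))))"
  unfolding digit_at_def by (subst ext_sep) (intro def_intros, simp)
definition digit_family :: 'a where "digit_family = img digit_at omega"

lemma dense_family_digit_family: "P.dense_family digit_family"
  unfolding digit_family_def
proof (rule P.dense_family_img[OF _ enumerable_omega])
  show "def_fun digit_at" by (intro def_intros)
  fix j assume j: "j \<in> nats"
  show "P.dense (digit_at j)"
    unfolding dense_set_def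
  proof (intro conjI ballI subsetI)
    show "B \<in> ext P" if "B \<in> ext (digit_at j)" for B using that mem_digit_at by blast
    fix B assume B: "B \<in> ext P"
    obtain s where s: "s \<in> ext B" "s \<in> ext Q" using P_nonempty[OF B] P_subset_Q[OF B] by blast
    obtain t m where t: "t \<in> ext Q" "m \<in> nats" "ext s \<subseteq> ext t" "t \<in> ext (F (basic (opair j m)))"
      by (rule F_basic_dense[OF s(2) j])
    obtain B' where B': "B' \<in> ext P" "ext B' \<subseteq> ext B" "ext B' \<subseteq> ext (F (basic (opair j m)))"
      by (rule P_meet[OF B X_basic[OF j t(2)] P_upward[OF B s(1) t(1,3)] t(4)])
    then have "B' \<in> ext (digit_at j)" unfolding mem_digit_at using t(2) by blast
    then show "\<exists>d\<in>ext (digit_at j). opair d B \<in> ext P_order" unfolding opair_P_order using B B' by blast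
  qed
qed

lemma generic_real_digit:
  assumes f: "P.generic digit_family f" and j: "j \<in> nats"
  shows "ends_in f (F (basic (opair j m))) \<longleftrightarrow> m = generic_real f $ j"
proof -
  have "def_fun digit_at" by (intro def_intros)
  then have "P.meets f (digit_at j)" by (intro P.generic_meets[OF f]) (simp add: digit_family_def ext_img j)
  then obtain B where "P.enters f B" "B \<in> ext (digit_at j)" unfolding seq_meets_iff by blast
  then obtain m0 where m0: "m0 \<in> nats" "ends_in f (F (basic (opair j m0)))"
    unfolding mem_digit_at using ends_in_if_enters by blast
  have "def_pred (%m. ends_in f (F (basic (opair j m))))" by (intro def_intros)
  from least_natI(2)[OF this m0] have digit: "ends_in f (F (basic (opair j (generic_real f $ j))))"
    unfolding ap_generic_real[OF j] .
  show ?thesis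
  proof
    assume m: "ends_in f (F (basic (opair j m)))"
    show "m = generic_real f $ j"
      by (rule ends_in_compatible[OF P.generic_descending[OF f] m digit]) (use F_basic_disjoint in blast)
  qed (use digit in simp)
qed

definition generic_in :: "'a => 'a" where "generic_in A = sep (funs omega P) (%f. generic_real f \<in> ext A)"
lemma def_fun_generic_in[THEN def_funD, def_intros]: "def_fun generic_in"
  by (intro def_funI, unfold generic_in_def, intro def_intros)
lemma mem_generic_in: "f \<in> ext (generic_in A) \<longleftrightarrow> func f omega P \<and> generic_real f \<in> ext A"
  unfolding generic_in_def by (subst ext_sep) (intro def_intros, simp)
abbreviation forced where "forced p A \<equiv> P.forces p (generic_in A)"
lemma invariant_generic_in: "P.invariant (generic_in A)"
  unfolding invariant_set_def mem_generic_in using generic_real_cong P.descending_func by metis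
definition truthful :: "'a => 'a" where
  "truthful A = sep (funs omega P) (%f. generic_real f \<in> ext A \<longleftrightarrow> ends_in f (F A))"
lemma def_fun_truthful[THEN def_funD, def_intros]: "def_fun truthful"
  by (intro def_funI, unfold truthful_def, intro def_intros)
lemma mem_truthful: "f \<in> ext (truthful A) \<longleftrightarrow> func f omega P \<and> (generic_real f \<in> ext A \<longleftrightarrow> ends_in f (F A))"
  unfolding truthful_def by (subst ext_sep) (intro def_intros, simp)
lemma invariant_truthful: "P.invariant (truthful A)"
  unfolding invariant_set_def mem_truthful using generic_real_cong ends_in_cong P.descending_func by metis

definition deciding :: "'a => 'a" where
  "deciding A = sep P (%B. ext B \<subseteq> ext (F A) \<or> ext B \<subseteq> ext (F (rcompl A)))"
lemma mem_deciding: "B \<in> ext (deciding A) \<longleftrightarrow> B \<in> ext P \<and> (ext B \<subseteq> ext (F A) \<or> ext B \<subseteq> ext (F (rcompl A)))"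
  unfolding deciding_def by (subst ext_sep) (intro def_intros, simp)
lemma dense_deciding:
  assumes A: "A \<in> ext X"
  shows "P.dense (deciding A)"
  unfolding dense_set_def
proof (intro conjI ballI subsetI)
  show "B \<in> ext P" if "B \<in> ext (deciding A)" for B using that mem_deciding by blast
  fix B assume B: "B \<in> ext P"
  obtain s where s: "s \<in> ext B" "s \<in> ext Q" using P_nonempty[OF B] P_subset_Q[OF B] by blast
  have "\<exists>B'\<in>ext P. ext B' \<subseteq> ext B \<and> (ext B' \<subseteq> ext (F A) \<or> ext B' \<subseteq> ext (F (rcompl A)))"
  proof (cases "s \<in> ext (F A)")
    case True
    show ?thesis by (rule P_meet[OF B A s(1) True]) blast
  next
    case False
    obtain t where t: "t \<in> ext (F (rcompl A))" "ext s \<subseteq> ext t" by (rule F_dense[OF s(2) False])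
    have "t \<in> ext B" using P_upward[OF B s(1) _ t(2)] t(1) F_subset_Q by blast
    then show ?thesis by (rule P_meet[OF B X_rcompl[OF A] _ t(1)]) blast
  qed
  then show "\<exists>B'\<in>ext (deciding A). opair B' B \<in> ext P_order"
    using B unfolding opair_P_order by (auto simp: mem_deciding)
qed

lemma generic_decides:
  assumes f: "P.generic (upair (deciding A) (deciding A)) f"
  shows "ends_in f (F (rcompl A)) \<longleftrightarrow> \<not> ends_in f (F A)"
proof -
  have "P.meets f (deciding A)" by (rule P.generic_meets[OF f]) simp
  then obtain B where "P.enters f B" "B \<in> ext (deciding A)" unfolding seq_meets_iff by blast
  then have "ends_in f (F A) \<or> ends_in f (F (rcompl A))"
    using ends_in_if_enters unfolding mem_deciding by blast
  then show ?thesis using not_ends_in_rcompl[OF P.generic_descending[OF f]] by blast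
qed

definition truthful_sets :: 'a where
  "truthful_sets = sep X (%A. ext A \<subseteq> ext reals \<and> (\<forall>p\<in>ext P. P.forces p (truthful A)))"
lemma mem_truthful_sets: "A \<in> ext truthful_sets \<longleftrightarrow>
    A \<in> ext X \<and> ext A \<subseteq> ext reals \<and> (\<forall>p\<in>ext P. P.forces p (truthful A))"
  unfolding truthful_sets_def by (subst ext_sep) (intro def_intros, simp)

context
  fixes Z A q
  assumes Z: "ext Z \<subseteq> ext truthful_sets" and A: "A \<in> ext X" "ext A = {x \<in> ext reals. \<forall>B\<in>ext Z. x \<in> ext B}"
    and q: "q \<in> ext P" and false: "P.forces q (seq_compl P (truthful A))"
begin

lemma false_inside:
  assumes "ext q \<subseteq> ext (F A)"
  shows False
proof -
  have rcA: "forced q (rcompl A)"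
  proof (rule P.forces_imp_generic[OF dense_family_digit_family false])
    fix f assume f: "P.generic digit_family f" "P.enters f q" "f \<in> ext (seq_compl P (truthful A))"
    then show "f \<in> ext (generic_in (rcompl A))" using ends_in_if_enters[OF f(2) assms] generic_real_in_reals
      unfolding mem_seq_compl mem_truthful mem_generic_in mem_rcompl by blast
  qed
  have "ext Z \<subseteq> ext X" using Z mem_truthful_sets by blast
  note wo_Z = well_orders_subset[OF wo this]
  have definable: "def_fun (%B. generic_in (rcompl B))" by (intro def_intros)
  have cover: "\<exists>B\<in>ext Z. f \<in> ext (generic_in (rcompl B))"
    if "P.descending f" "f \<in> ext (generic_in (rcompl A))" for f
    using that(2) unfolding mem_generic_in mem_rcompl A(2) by blast
  obtain p B where p: "p \<in> ext P" "B \<in> ext Z" "opair p q \<in> ext P_order" "forced p (rcompl B)"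
    by (rule P.well_ordered_additivity[OF determinacy wo_Z definable invariant_generic_in q rcA cover], assumption+)
  have truth: "P.forces p (truthful B)" using Z p(1,2) mem_truthful_sets by blast
  obtain f where f: "P.generic digit_family f" "f $ empty = p" "f \<in> ext (generic_in (rcompl B))"
    "f \<in> ext (truthful B)"
    by (rule P.forces_both[OF p(4) truth dense_family_digit_family p(1)])
  have "ext A \<subseteq> ext B" using A(2) p(2) by blast
  then have "ext p \<subseteq> ext (F B)" using p(3) assms F_mono unfolding opair_P_order by blast
  then have "ends_in f (F B)" unfolding ends_in_def using f(2) empty_in_omega by blast
  then show False using f(3,4) unfolding mem_generic_in mem_truthful mem_rcompl by blast
qed

lemma false_outside:
  assumes out: "ext q \<subseteq> ext (F (rcompl A))"
  shows False
proof -
  obtain s where s: "s \<in> ext q" "s \<in> ext Q" using P_nonempty[OF q] P_subset_Q[OF q] by blast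
  have Z_subset: "ext Z \<subseteq> ext X" using Z mem_truthful_sets by blast
  have "s \<notin> ext (F A)" using s(1) out F_rcompl_disjoint by blast
  then obtain B where B: "B \<in> ext Z" "s \<notin> ext (F B)" using F_Inter[OF wo Z_subset A(2) s(2)] by blast
  obtain t where t: "t \<in> ext (F (rcompl B))" "ext s \<subseteq> ext t" by (rule F_dense[OF s(2) B(2)])
  have B_in_X: "B \<in> ext X" using B(1) Z_subset by blast
  have t_in_q: "t \<in> ext q" using P_upward[OF q s(1) _ t(2)] t(1) F_subset_Q by blast
  obtain p where p: "p \<in> ext P" "ext p \<subseteq> ext q" "ext p \<subseteq> ext (F (rcompl B))"
    by (rule P_meet[OF q X_rcompl[OF B_in_X] t_in_q t(1)])
  have below: "opair p q \<in> ext P_order" unfolding opair_P_order using p q by blast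
  have truth: "P.forces p (truthful B)" using Z p(1) B(1) mem_truthful_sets by blast
  obtain f where f: "P.generic digit_family f" "f $ empty = p" "f \<in> ext (seq_compl P (truthful A))"
    "f \<in> ext (truthful B)"
    by (rule P.forces_generic[OF false truth dense_family_digit_family p(1) below P.refl[OF p(1)]])
  have "ends_in f (F (rcompl B))" "ends_in f (F (rcompl A))"
    unfolding ends_in_def using f(2) empty_in_omega p(2,3) out by blast+
  then have "\<not> ends_in f (F B)" "\<not> ends_in f (F A)"
    using not_ends_in_rcompl[OF P.generic_descending[OF f(1)]] by blast+
  then have "generic_real f \<notin> ext B" "f \<in> ext (truthful A)"
    using f(4) B(1) unfolding mem_truthful A(2) by blast+
  then show False using f(3) unfolding mem_seq_compl by blast
qed

end

lemma truthful_sets_Inter: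
  assumes Z: "ext Z \<subseteq> ext truthful_sets" and A: "A \<in> ext X" "ext A = {x \<in> ext reals. \<forall>B\<in>ext Z. x \<in> ext B}"
  shows "A \<in> ext truthful_sets"
proof -
  have "P.forces p (truthful A)" if p: "p \<in> ext P" for p
  proof (rule P.Baire_dichotomy[OF determinacy p P.invariant_compl[OF invariant_truthful[of A]]])
    fix q assume q: "q \<in> ext P" "P.forces q (seq_compl P (truthful A))"
    obtain q' where q': "q' \<in> ext (deciding A)" "opair q' q \<in> ext P_order" "q' \<in> ext P"
      using dense_deciding[OF A(1)] q(1) unfolding dense_set_def by blast
    have "P.forces q' (seq_compl P (truthful A))" by (rule P.forces_mono[OF q'(3) q(1) q'(2) q(2)])
    then show ?thesis
      using false_inside[OF Z A q'(3)] false_outside[OF Z A q'(3)] q'(1) unfolding mem_deciding by blast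
  next
    assume "P.forces p (seq_compl P (seq_compl P (truthful A)))"
    then show ?thesis by (rule P.forces_imp) (use P.descending_func in \<open>simp add: mem_seq_compl\<close>)
  qed
  then show ?thesis unfolding mem_truthful_sets using A by blast
qed

lemma truthful_sets_basic:
  assumes ij: "i \<in> nats" "j \<in> nats"
  shows "basic (opair i j) \<in> ext truthful_sets"
proof -
  have "P.forces p (truthful (basic (opair i j)))" for p
  proof (rule P.forcesI[OF dense_family_digit_family])
    fix f assume f: "P.generic digit_family f"
    have "func (generic_real f) omega omega" using generic_real_in_reals unfolding ext_reals .
    then show "f \<in> ext (truthful (basic (opair i j)))"
      using P.descending_func[OF P.generic_descending[OF f]] generic_real_in_reals ij(1)
      unfolding mem_truthful mem_basic generic_real_digit[OF f ij(1)] by (simp add: func_opair_iff)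
  qed
  then show ?thesis unfolding mem_truthful_sets using X_basic[OF ij] basic_reals by blast
qed

lemma truthful_sets_rcompl:
  assumes A: "A \<in> ext truthful_sets"
  shows "rcompl A \<in> ext truthful_sets"
proof -
  have A_in_X: "A \<in> ext X" using A mem_truthful_sets by blast
  have "P.forces p (truthful (rcompl A))" if "p \<in> ext P" for p
  proof (rule P.forces_imp_generic[OF P.dense_family_sing[OF dense_deciding[OF A_in_X]]])
    show "P.forces p (truthful A)" using A that mem_truthful_sets by blast
  qed (use generic_decides generic_real_in_reals in \<open>simp add: mem_truthful mem_rcompl\<close>)
  then show ?thesis unfolding mem_truthful_sets using X_rcompl[OF A_in_X] rcompl_reals by blast
qed

lemma truthful_sets_rinter:
  assumes "A \<in> ext truthful_sets" "B \<in> ext truthful_sets"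
  shows "rinter A B \<in> ext truthful_sets"
proof -
  have "P.forces p (truthful (rinter A B))" if "p \<in> ext P" for p
    by (rule P.forces_imp2[of p "truthful A" "truthful B"])
      (use assms that generic_real_in_reals ends_in_rinter mem_truthful_sets
      in \<open>auto simp: mem_truthful mem_rinter\<close>)
  then show ?thesis using assms X_rinter rinter_reals unfolding mem_truthful_sets by blast
qed

lemma Y_truthful: "Y \<in> ext truthful_sets"
proof (rule Y_L)
  have "ext truthful_sets \<subseteq> {A. ext A \<subseteq> ext reals}" using mem_truthful_sets by blast
  then show "borel_closed X truthful_sets" unfolding borel_closed_def
    using truthful_sets_basic truthful_sets_rcompl truthful_sets_rinter truthful_sets_Inter by simp
qed

lemma forced_Y:
  assumes p: "p \<in> ext P"
  shows "forced p Y"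
proof -
  have "P.forces p (truthful Y)" using Y_truthful p mem_truthful_sets by blast
  then show ?thesis
  proof (rule P.forces_imp)
    fix f assume f: "P.descending f" "f \<in> ext (truthful Y)"
    have "ends_in f (F Y)" unfolding ends_in_def F_Y
      using P_subset_Q[OF P.descending_in[OF f(1) empty_in_omega]] empty_in_omega by blast
    then show "f \<in> ext (generic_in Y)" using f(2) unfolding mem_truthful mem_generic_in by blast
  qed
qed

definition avoiding :: "'a => 'a" where
  "avoiding a = sep P (%B. \<exists>m\<in>nats. \<exists>n\<in>nats. n \<noteq> a $ m \<and>
      ext B \<subseteq> ext (F (basic (opair (nat_pair empty m) n))))"
lemma mem_avoiding:
  "B \<in> ext (avoiding a) \<longleftrightarrow> B \<in> ext P \<and>
    (\<exists>m\<in>nats. \<exists>n\<in>nats. n \<noteq> a $ m \<and> ext B \<subseteq> ext (F (basic (opair (nat_pair empty m) n))))"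
  unfolding avoiding_def by (subst ext_sep) (intro def_intros, simp)

lemma first_column_avoids:
  assumes B: "B \<in> ext P"
  obtains s where "s \<in> ext B" "s \<in> ext Q" "empty \<in> ext (dom s)" "s $ empty \<noteq> a"
proof -
  obtain A where A: "A \<in> ext X" "ext A \<subseteq> ext reals" "B = F A" "F A \<noteq> empty" using B unfolding mem_P by blast
  have zero: "empty \<in> ext (dom s)" if "s \<in> ext B" "dom s \<noteq> empty" for s
    using that P_subset_Q[OF B] ordinal_linear[OF ordinal_empty ordinal_if_in_omega[OF fin_seqs_func(1)[of s]]] by auto
  have "\<exists>s\<in>ext B. dom s \<noteq> empty \<and> s $ empty \<noteq> a"
  proof (cases "a \<in> ext C")
    case True
    then show ?thesis using undecided[OF A(1,2,4)] A(3) by simp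
  next
    case False
    obtain c where "c \<in> ext C" by (rule enumerable_nonempty[OF enumerable_C])
    then obtain s where s: "s \<in> ext B" "dom s \<noteq> empty" using undecided[OF A(1,2,4)] A(3) by blast
    have "s $ empty \<in> ext C"
      by (rule ap_in_codomain[OF fin_seqs_func(2) zero[OF s]]) (use s(1) P_subset_Q[OF B] in blast)
    then show ?thesis using s False by blast
  qed
  then show thesis using that zero P_subset_Q[OF B] by blast
qed

lemma dense_avoiding:
  assumes a: "a \<in> ext reals"
  shows "P.dense (avoiding a)"
  unfolding dense_set_def
proof (intro conjI ballI subsetI)
  show "B \<in> ext P" if "B \<in> ext (avoiding a)" for B using that mem_avoiding by blast
  fix B assume B: "B \<in> ext P"
  obtain s where s: "s \<in> ext B" "s \<in> ext Q" "empty \<in> ext (dom s)" "s $ empty \<noteq> a"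
    by (rule first_column_avoids[OF B])
  have funcs: "func (s $ empty) omega omega" "func a omega omega"
    using ap_in_codomain[OF fin_seqs_func(2)[OF s(2)] s(3)] C_reals a
    unfolding ext_reals[symmetric] by blast+
  obtain m where m: "m \<in> nats" "s $ empty $ m \<noteq> a $ m" using func_ext[OF funcs] s(4) by blast
  note pair = nat_pair_props[OF empty_in_omega m(1)]
  have s_in: "s \<in> ext (F (basic (opair (nat_pair empty m) (s $ empty $ m))))"
    using F_basicI[OF s(2) _ pair(1)] s(3) unfolding pair(2,3) by simp
  have digit: "s $ empty $ m \<in> nats" by (rule ap_in_codomain[OF funcs(1) m(1)])
  obtain B' where B': "B' \<in> ext P" "ext B' \<subseteq> ext B"
    "ext B' \<subseteq> ext (F (basic (opair (nat_pair empty m) (s $ empty $ m))))"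
    by (rule P_meet[OF B X_basic[OF pair(1) digit] s(1) s_in])
  then have "B' \<in> ext (avoiding a)" unfolding mem_avoiding using m digit by blast
  then show "\<exists>d\<in>ext (avoiding a). opair d B \<in> ext P_order" unfolding opair_P_order using B B' by blast
qed

lemma generic_avoids:
  assumes K: "enumerable K" "ext K \<subseteq> ext reals" and p: "p \<in> ext P" "forced p A"
    and A: "\<And>x. x \<in> ext A ==> x \<in> ext reals ==> column x empty \<in> ext K"
  shows False
proof -
  have definable: "def_fun avoiding" unfolding avoiding_def by (intro def_funI def_intros)
  have avoid: "P.dense_family (img avoiding K)"
    by (rule P.dense_family_img[OF definable K(1)]) (use dense_avoiding K(2) in blast)
  obtain f where f: "P.generic (cup digit_family (img avoiding K)) f" "f \<in> ext (generic_in A)"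
    by (rule P.forces_both[OF p(2,2) P.dense_family_cup[OF dense_family_digit_family avoid] p(1)])
  let ?a = "column (generic_real f) empty"
  have "?a \<in> ext K" using A f(2) generic_real_in_reals unfolding mem_generic_in by blast
  then have "P.meets f (avoiding ?a)" by (intro P.generic_meets[OF f(1)]) (simp add: ext_img[OF definable])
  then obtain B where "P.enters f B" "B \<in> ext (avoiding ?a)" unfolding seq_meets_iff by blast
  then obtain m n where m: "m \<in> nats" "n \<noteq> ?a $ m" "ends_in f (F (basic (opair (nat_pair empty m) n)))"
    unfolding mem_avoiding using ends_in_if_enters by blast
  have "P.generic digit_family f" using f(1) unfolding P.generic_cup by blast
  from generic_real_digit[OF this nat_pair_props(1)[OF empty_in_omega m(1)]] m(2,3) show False
    unfolding ap_column[OF m(1)] by blast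
qed

lemma swap_cond_in_P:
  assumes k: "k \<in> nats" and B: "B \<in> ext P"
  shows "swap_cond k B \<in> ext P" "swap_cond k (swap_cond k B) = B"
proof -
  obtain A where A: "A \<in> ext X" "B = F A" using B unfolding mem_P by blast
  have swapped: "swap_cond k B = F (swap_set k A)" unfolding A(2) F_swap_set[OF k] ..
  show involution: "swap_cond k (swap_cond k B) = B"
    unfolding swapped F_swap_set[OF k, symmetric] F_swap_swap[OF k] A(2) ..
  have "swap_cond k B \<noteq> empty"
  proof
    assume vanishes: "swap_cond k B = empty"
    obtain s where s: "s \<in> ext B" "s \<in> ext Q" using P_nonempty[OF B] P_subset_Q[OF B] by blast
    obtain t where t: "t \<in> ext Q" "ext s \<subseteq> ext t" "wide k t" by (rule wide_extension[OF k s(2)])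
    have "s \<in> ext (swap_cond k empty)" using s(1) involution unfolding vanishes by simp
    then have "swap_seq k t \<in> ext empty" unfolding mem_swap_cond using t by blast
    then show False by simp
  qed
  then show "swap_cond k B \<in> ext P"
    unfolding mem_P using swapped X_swap_set[OF k A(1)] swap_set_reals by blast
qed

lemma generic_real_swap:
  assumes k: "k \<in> nats" and f: "P.descending f" "P.descending h"
    and swap: "\<And>q. q \<in> ext P ==> P.enters h (swap_cond k q) \<longleftrightarrow> P.enters f q"
  shows "generic_real h = swap_real k (generic_real f)"
proof (rule func_ext)
  show "func (generic_real h) omega omega" "func (swap_real k (generic_real f)) omega omega"
    using generic_real_in_reals swap_real_in[OF k generic_real_in_reals] unfolding ext_reals .
  fix j assume j: "j \<in> nats"
  have "ends_in h (F A) \<longleftrightarrow> ends_in f (F (swap_set k A))" if A: "A \<in> ext X" "ext A \<subseteq> ext reals" for A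
    unfolding ends_in_iff_enters[OF f(2) A] ends_in_iff_enters[OF f(1) X_swap_set[OF k A(1)] swap_set_reals]
    using swap swap_cond_in_P[OF k] F_swap_set[OF k] F_swap_swap[OF k] by metis
  then have "m \<in> nats \<and> ends_in h (F (basic (opair j m))) \<longleftrightarrow>
      m \<in> nats \<and> ends_in f (F (swap_set k (basic (opair j m))))" for m
    using X_basic[OF j] basic_reals by blast
  then show "generic_real h $ j = swap_real k (generic_real f) $ j"
    unfolding ap_swap_real[OF j] ap_generic_real[OF j]
      ap_generic_real[OF nat_pair_swap_in_omega[OF k j]] swap_set_basic[OF k j] least_nat_def by simp
qed

lemma forced_swap:
  assumes k: "k \<in> nats" and B: "B \<in> ext P" "forced B A"
  shows "forced (swap_cond k B) (swap_set k A)"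
proof (rule P.forces_transfer[where \<pi>="swap_cond k" and big="%_. True" and W="generic_in A"
  and E=digit_family])
  show "def_fun (swap_cond k)" "def_pred (%_. True)" by (intro def_intros)+
  show "swap_cond k B \<in> ext P" "forced (swap_cond k (swap_cond k B)) A"
    using swap_cond_in_P[OF k B(1)] B(2) by simp_all
  show "P.dense_family digit_family" by (rule dense_family_digit_family)
  fix p assume p: "p \<in> ext P"
  show "\<exists>q\<in>ext P. True \<and> opair q p \<in> ext P_order" using P.refl[OF p] p by blast
  show "swap_cond k p \<in> ext P \<and> True" "swap_cond k (swap_cond k p) = p"
    using swap_cond_in_P[OF k p] by simp_all
  show "opair (swap_cond k q) (swap_cond k p) \<in> ext P_order" if "q \<in> ext P" "opair q p \<in> ext P_order" for q
    using that swap_cond_in_P(1)[OF k] swap_cond_mono[of q p k] unfolding opair_P_order by blast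
next
  fix f h assume f: "P.generic digit_family f" "P.generic digit_family h" "h \<in> ext (generic_in A)"
    and swap: "\<And>q. q \<in> ext P ==> True ==> P.enters h (swap_cond k q) \<longleftrightarrow> P.enters f q"
  note desc = f(1,2)[THEN P.generic_descending]
  have "generic_real h = swap_real k (generic_real f)"
    by (rule generic_real_swap[OF k desc]) (use swap in blast)
  then show "f \<in> ext (generic_in (swap_set k A))"
    using f(3) generic_real_in_reals P.descending_func[OF desc(1)]
    unfolding mem_generic_in mem_swap_set by simp
qed simp_all

end

section \<open>Choosing an element of each class\<close>

context zf_model
begin

lemma def_fun2_eq_class[THEN def_fun2D, def_intros]: "def_fun2 eq_class"
  by (intro def_fun2I, unfold eq_class_def, intro def_intros)
lemma equiv_rel_sub: "equiv_rel a r ==> opair x y \<in> ext r ==> x \<in> ext a \<and> y \<in> ext a"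
  unfolding equiv_rel_def opair_mem_cprod[symmetric] by blast
lemma ext_eq_class:
  assumes "equiv_rel a r"
  shows "ext (eq_class r x) = {y. opair x y \<in> ext r}"
proof -
  have "{y. opair x y \<in> ext r} \<subseteq> ext a" using equiv_rel_sub[OF assms] by blast
  then have "is_set {y. opair x y \<in> ext r}" by (rule is_set_subset) (simp, intro def_intros)
  then show ?thesis unfolding eq_class_def by (rule ext_coll)
qed

lemma eq_class_eq:
  assumes r: "equiv_rel a r" and "opair x y \<in> ext r"
  shows "eq_class r x = eq_class r y"
  by (rule ext_inject, unfold ext_eq_class[OF r]) (use assms in \<open>unfold equiv_rel_def, blast\<close>)
lemma quot_eq_img: "quot a r = img (eq_class r) a"
proof -
  have "eq_class r ` ext a = {y. \<exists>x\<in>ext a. y = eq_class r x}" by blast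
  then show ?thesis unfolding quot_def img_def by simp
qed

lemma ext_quot: "ext (quot a r) = eq_class r ` ext a"
  unfolding quot_eq_img by (rule ext_img) (intro def_intros)
lemma def_term_quot[def_intros]: assumes "def_term t" "def_term u" shows "def_term (%e. quot (t e) (u e))"
  unfolding quot_eq_img
  by (intro def_fun2D[where F="%a r. img (eq_class r) a", OF _ assms] def_fun2I def_intros)

lemma mem_eq_class: "equiv_rel a r ==> x \<in> ext a ==> x \<in> ext (eq_class r x)"
  by (simp add: ext_eq_class, simp add: equiv_rel_def)
lemma quot_nonempty:
  assumes "equiv_rel a r" "c \<in> ext (quot a r)"
  obtains x where "x \<in> ext c"
  using assms mem_eq_class unfolding ext_quot by blast
lemma quot_mem:
  assumes r: "equiv_rel a r" and c: "c \<in> ext (quot a r)" "x \<in> ext c"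
  shows "x \<in> ext a" "c = eq_class r x"
proof -
  obtain y where y: "c = eq_class r y" using c(1) unfolding ext_quot by blast
  then have "opair y x \<in> ext r" using c(2) ext_eq_class[OF r] by blast
  then show "x \<in> ext a" "c = eq_class r x" using equiv_rel_sub[OF r] eq_class_eq[OF r] y by blast+
qed

lemma quot_related:
  assumes r: "equiv_rel a r" and c: "c \<in> ext (quot a r)" "x \<in> ext c" "y \<in> ext c"
  shows "opair x y \<in> ext r"
  using c(3) quot_mem(2)[OF r c(1,2)] ext_eq_class[OF r, of x] by blast

definition related_columns :: "'a => 'a" where
  "related_columns r = sep reals (%x. \<forall>i\<in>nats. \<forall>j\<in>nats. opair (column x i) (column x j) \<in> ext r)"
lemma def_fun_related_columns[THEN def_funD, def_intros]: "def_fun related_columns"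
  by (intro def_funI, unfold related_columns_def, intro def_intros)
lemma mem_related_columns: "x \<in> ext (related_columns r) \<longleftrightarrow>
    x \<in> ext reals \<and> (\<forall>i\<in>nats. \<forall>j\<in>nats. opair (column x i) (column x j) \<in> ext r)"
  unfolding related_columns_def by (subst ext_sep) (intro def_intros, simp)

end

context F_forcing
begin

lemma amalgamation:
  assumes B: "B1 \<in> ext P" "B2 \<in> ext P"
  obtains k B3 where "k \<in> nats" "empty \<in> ext k" "B3 \<in> ext P" "ext B3 \<subseteq> ext B1"
    "ext B3 \<subseteq> ext (swap_cond k B2)"
proof -
  obtain A where A: "A \<in> ext X" "B2 = F A" using B(2) unfolding mem_P by blast
  obtain s1 s2 where s: "s1 \<in> ext B1" "s1 \<in> ext Q" "s2 \<in> ext B2" "s2 \<in> ext Q"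
    using P_nonempty[OF B(1)] P_nonempty[OF B(2)] P_subset_Q B by blast
  obtain k t where k: "k \<in> nats" "empty \<in> ext k" and t: "t \<in> ext Q" "wide k t"
    and above: "ext s1 \<subseteq> ext t" "ext s2 \<subseteq> ext (swap_seq k t)" by (rule common_swap_extension[OF s(2,4)])
  have t_in_B1: "t \<in> ext B1" by (rule P_upward[OF B(1) s(1) t(1) above(1)])
  have "swap_seq k t \<in> ext (F A)"
    using P_upward[OF B(2) s(3) swap_seq_in[OF k(1) t] above(2)] unfolding A(2) .
  then have "t \<in> ext (F (swap_set k A))" by (rule F_swap_set_if[OF k(1) t])
  then obtain B3 where "B3 \<in> ext P" "ext B3 \<subseteq> ext B1" "ext B3 \<subseteq> ext (F (swap_set k A))"
    by (rule P_meet[OF B(1) X_swap_set[OF k(1) A(1)] t_in_B1])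
  then show thesis using that[OF k] unfolding A(2) F_swap_set[OF k(1)] by blast
qed

lemma forced_cases:
  assumes p: "p \<in> ext P" and "\<And>q. q \<in> ext P ==> ext q \<subseteq> ext p ==> \<not> forced q (rcompl A)"
  shows "forced p A"
proof (rule P.Baire_dichotomy[OF determinacy p invariant_generic_in[of "rcompl A"]])
  show "forced p A" if "q \<in> ext P" "opair q p \<in> ext P_order" "forced q (rcompl A)" for q
    using that assms(2) opair_P_order by blast
  assume "P.forces p (seq_compl P (generic_in (rcompl A)))"
  then show "forced p A"
    by (rule P.forces_imp)
    (use P.descending_func generic_real_in_reals in \<open>simp add: mem_seq_compl mem_generic_in mem_rcompl\<close>)
qed

lemma forced_reals: "forced p reals"
  by (rule P.forcesI[OF dense_family_digit_family])
    (simp add: mem_generic_in generic_real_in_reals P.descending_func P.generic_descending)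
lemma forced_union:
  assumes p: "p \<in> ext P" "forced p U" and I: "well_orders v I" and A: "def_fun A"
    and cover: "\<And>x. x \<in> ext reals ==> x \<in> ext U ==> \<exists>i\<in>ext I. x \<in> ext (A i)"
  obtains q i where "q \<in> ext P" "i \<in> ext I" "ext q \<subseteq> ext p" "forced q (A i)"
proof -
  have definable: "def_fun (%i. generic_in (A i))" by (intro def_intros def_funD[OF A])
  have cover_gen: "\<exists>i\<in>ext I. f \<in> ext (generic_in (A i))" if "P.descending f" "f \<in> ext (generic_in U)" for f
    using that(2) cover[OF generic_real_in_reals] unfolding mem_generic_in by blast
  obtain q i where "q \<in> ext P" "i \<in> ext I" "opair q p \<in> ext P_order" "forced q (A i)"
    by (rule P.well_ordered_additivity[OF determinacy I definable invariant_generic_in p cover_gen],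
      assumption+)
  then show thesis using that unfolding opair_P_order by blast
qed

lemma forced_both:
  assumes "p \<in> ext P" "forced p A" "forced p B"
  obtains x where "x \<in> ext reals" "x \<in> ext A" "x \<in> ext B"
proof -
  obtain f where "f \<in> ext (generic_in A)" "f \<in> ext (generic_in B)"
    by (rule P.forces_both[OF assms(2,3) dense_family_digit_family assms(1)])
  then show thesis using that[OF generic_real_in_reals] unfolding mem_generic_in by blast
qed

lemma forced_mono: "q \<in> ext P ==> p \<in> ext P ==> ext q \<subseteq> ext p ==> forced p A ==> forced q A"
  using P.forces_mono[of q p] opair_P_order by blast

context
  fixes B R
  assumes B: "B \<in> ext P" and rel: "forced B (related_columns R)"
begin

text \<open>Two conditions below \<open>B\<close> that disagree about \<open>A\<close> would be amalgamated, up to a swap of columns, to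
  a condition forcing two related columns of one real to disagree about \<open>A\<close>.\<close>

lemma forced_or_forced_compl:
  assumes invariant: "\<And>x y. x \<in> ext A ==> y \<in> ext reals ==> opair (column x empty) (column y empty) \<in> ext R
      ==> y \<in> ext A"
  shows "forced B A \<or> forced B (rcompl A)"
proof (rule ccontr)
  assume undecided: "\<not> ?thesis"
  obtain B1 where B1: "B1 \<in> ext P" "ext B1 \<subseteq> ext B" "forced B1 (rcompl (rcompl A))"
    using undecided forced_cases[OF B, of "rcompl A"] by blast
  obtain B2 where B2: "B2 \<in> ext P" "forced B2 (rcompl A)" using undecided forced_cases[OF B, of A] by blast
  obtain k B3 where k: "k \<in> nats" "empty \<in> ext k" and B3: "B3 \<in> ext P" "ext B3 \<subseteq> ext B1"
    "ext B3 \<subseteq> ext (swap_cond k B2)"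
    by (rule amalgamation[OF B1(1) B2(1)])
  have "forced B3 (rcompl (rcompl A))" by (rule forced_mono[OF B3(1) B1(1) B3(2) B1(3)])
  moreover have "forced B3 (related_columns R)"
    by (rule forced_mono[OF B3(1) B _ rel]) (use B3(2) B1(2) in blast)
  ultimately have "forced B3 (rinter (rcompl (rcompl A)) (related_columns R))"
    by (rule P.forces_imp2) (simp add: mem_generic_in mem_rinter generic_real_in_reals)
  moreover have "forced B3 (swap_set k (rcompl A))"
    by (rule forced_mono[OF B3(1) swap_cond_in_P(1)[OF k(1) B2(1)] B3(3) forced_swap[OF k(1) B2]])
  ultimately obtain x where x: "x \<in> ext reals" "x \<in> ext (rinter (rcompl (rcompl A)) (related_columns R))"
    "x \<in> ext (swap_set k (rcompl A))"
    by (rule forced_both[OF B3(1)])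
  have "opair (column x empty) (column (swap_real k x) empty) \<in> ext R"
    using x(2) k(1) empty_in_omega
    unfolding mem_rinter mem_related_columns column_swap_real[OF k x(1)] by blast
  then have "swap_real k x \<in> ext A"
    using invariant[of x] x(2) swap_real_in[OF k(1) x(1)] unfolding mem_rinter mem_rcompl by blast
  then show False using x(3) unfolding mem_swap_set mem_rcompl by blast
qed

context
  fixes v
  assumes v: "def_fun v" and v_real: "\<And>x. x \<in> ext reals ==> v x \<in> ext reals"
    and v_eq: "\<And>x y. x \<in> ext reals ==> y \<in> ext reals ==> opair (column x empty) (column y empty) \<in> ext R ==>
        v x = v y"
begin

lemma mem_digit: "x \<in> ext (sep reals (%x. v x $ n = m)) \<longleftrightarrow> x \<in> ext reals \<and> v x $ n = m"
  by (subst ext_sep) (intro def_intros def_funD[OF v], simp)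

lemma forced_digit:
  assumes n: "n \<in> nats"
  obtains m where "m \<in> nats" "forced B (sep reals (%x. v x $ n = m))"
proof -
  let ?digit = "%m. sep reals (%x. v x $ n = m)"
  have definable: "def_fun ?digit" by (intro def_intros def_funD[OF v])
  have cover: "\<exists>m\<in>nats. x \<in> ext (?digit m)" if "x \<in> ext reals" "x \<in> ext reals" for x
    using ap_in_codomain[OF _ n] v_real[OF that(1)] that(1) unfolding mem_digit ext_reals by blast
  obtain q m where q: "q \<in> ext P" "m \<in> nats" "ext q \<subseteq> ext B" "forced q (?digit m)"
    by (rule forced_union[OF B forced_reals well_orders_ordinal[OF ordinal_omega] definable cover],
      assumption+)
  have "forced B (?digit m) \<or> forced B (rcompl (?digit m))"
    by (rule forced_or_forced_compl) (use v_eq in \<open>unfold mem_digit, metis\<close>)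
  moreover have False if "forced B (rcompl (?digit m))"
    by (rule forced_both[OF q(1,4) forced_mono[OF q(1) B q(3) that]]) (simp add: mem_rcompl)
  ultimately show thesis using that q(2) by blast
qed

lemma forced_constant:
  obtains z where "z \<in> ext reals" "forced B (sep reals (%x. v x = z))"
proof -
  let ?digit = "%n m. sep reals (%x. v x $ n = m)"
  define z where "z = lam omega (%n. least_nat (%m. forced B (?digit n m)))"
  have definable: "def_fun (%n. least_nat (%m. forced B (?digit n m)))"
    "def_pred (%m. forced B (?digit n m))" for n
    by (intro def_intros def_funD[OF v])+
  have z: "z $ n \<in> nats" "forced B (?digit n (z $ n))" if n: "n \<in> nats" for n
  proof -
    obtain m where m: "m \<in> nats" "forced B (?digit n m)" by (rule forced_digit[OF n])
    show "z $ n \<in> nats" "forced B (?digit n (z $ n))"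
      unfolding z_def ap_lam[OF definable(1) n] using least_natI(1,2)[OF definable(2) m] by blast+
  qed
  have z_func: "func z omega omega"
    using func_codomain[OF func_lam_img[OF definable(1)] z(1)[unfolded z_def]] unfolding z_def .
  have "forced B (sep reals (%x. v x = z))"
  proof (rule forced_cases[OF B], rule notI)
    fix q assume q: "q \<in> ext P" "ext q \<subseteq> ext B" "forced q (rcompl (sep reals (%x. v x = z)))"
    have definable_compl: "def_fun (%n. rcompl (?digit n (z $ n)))" by (intro def_intros def_funD[OF v])
    have fiber: "x \<in> ext (sep reals (%x. v x = z)) \<longleftrightarrow> x \<in> ext reals \<and> v x = z" for x
      by (subst ext_sep) (intro def_intros def_funD[OF v], simp)
    have cover: "\<exists>n\<in>nats. x \<in> ext (rcompl (?digit n (z $ n)))"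
      if x: "x \<in> ext reals" "x \<in> ext (rcompl (sep reals (%x. v x = z)))" for x
    proof -
      have "func (v x) omega omega" using v_real[OF x(1)] unfolding ext_reals .
      moreover have "v x \<noteq> z" using x unfolding mem_rcompl fiber by blast
      ultimately obtain n where "n \<in> nats" "v x $ n \<noteq> z $ n" using func_ext[OF _ z_func] by blast
      then show ?thesis using x(1) unfolding mem_rcompl mem_digit by blast
    qed
    obtain q' n where q': "q' \<in> ext P" "n \<in> nats" "ext q' \<subseteq> ext q" "forced q' (rcompl (?digit n (z $ n)))"
      by (rule forced_union[OF q(1,3) well_orders_ordinal[OF ordinal_omega] definable_compl cover],
        assumption+)
    have "forced q' (?digit n (z $ n))"
      by (rule forced_mono[OF q'(1) B _ z(2)[OF q'(2)]]) (use q(2) q'(3) in blast)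
    from forced_both[OF q'(1) this q'(4)] show False unfolding mem_rcompl by blast
  qed
  then show thesis using that z_func unfolding ext_reals by blast
qed

end

end

lemma undecided_contradiction:
  assumes \<kappa>: "ordinal \<kappa>" and eqv: "\<And>b. b \<in> ext \<kappa> ==> equiv_rel reals (E $ b)"
    and bij: "\<And>b. b \<in> ext \<kappa> ==> \<exists>h. bijection h (quot reals (E $ b)) reals"
    and classes: "\<And>b c. b \<in> ext \<kappa> ==> c \<in> ext (quot reals (E $ b)) ==> countable c"
    and Y: "\<And>x. x \<in> ext Y ==> \<exists>b\<in>ext \<kappa>. x \<in> ext (related_columns (E $ b))"
  shows False
proof -
  obtain p where p: "p \<in> ext P" by (rule P_inhabited)
  have definable: "def_fun (%b. related_columns (E $ b))" by (intro def_intros)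
  obtain B b where B: "B \<in> ext P" and b: "b \<in> ext \<kappa>" and rel: "forced B (related_columns (E $ b))"
    by (rule forced_union[OF p forced_Y[OF p] well_orders_ordinal[OF \<kappa>] definable]) (rule Y)
  define R where "R = E $ b"
  have R: "equiv_rel reals R" unfolding R_def by (rule eqv[OF b])
  obtain h where bijection: "bijection h (quot reals R) reals" using bij[OF b] unfolding R_def by blast
  then have h: "func h (quot reals R) reals" unfolding bijection_def by blast
  have h_bij: "bij_betw (($) h) (ext (quot reals R)) (ext reals)"
    using bijection by (simp add: bijection_def func_app[OF h] cong: bij_betw_cong)
  let ?v = "%x. h $ eq_class R (column x empty)"
  have v: "def_fun ?v" by (intro def_intros)
  have column: "eq_class R (column x empty) \<in> ext (quot reals R)" if "x \<in> ext reals" for x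
    using column_in_reals[OF that empty_in_omega] unfolding ext_quot by blast
  have v_eq: "?v x = ?v y"
    if "x \<in> ext reals" "y \<in> ext reals" "opair (column x empty) (column y empty) \<in> ext R" for x y
    unfolding eq_class_eq[OF R that(3)] ..
  obtain z where z: "z \<in> ext reals" "forced B (sep reals (%x. ?v x = z))"
    by (rule forced_constant[OF B rel[folded R_def] v ap_in_codomain[OF h column] v_eq], assumption+)
  have "z \<in> ($) h ` ext (quot reals R)" unfolding bij_betw_imp_surj_on[OF h_bij] by (rule z(1))
  then obtain K where K: "K \<in> ext (quot reals R)" "h $ K = z" by (elim imageE) metis
  obtain y where y: "y \<in> ext K" by (rule quot_nonempty[OF R K(1)])
  have "enumerable K" by (rule enumerable_if_countable[OF classes[OF b K(1)[unfolded R_def]] y])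
  moreover have "ext K \<subseteq> ext reals" using quot_mem(1)[OF R K(1)] by blast
  moreover have "column x empty \<in> ext K" if "x \<in> ext (sep reals (%x. ?v x = z))" "x \<in> ext reals" for x
  proof -
    have "?v x = h $ K" using that(1) K(2) by (subst (asm) ext_sep) (intro def_intros, simp)
    then have "eq_class R (column x empty) = K"
      by (rule inj_onD[OF bij_betw_imp_inj_on[OF h_bij] _ column[OF that(2)] K(1)])
    then show ?thesis using mem_eq_class[OF R column_in_reals[OF that(2) empty_in_omega]] by simp
  qed
  ultimately show False by (rule generic_avoids[OF _ _ B z(2)])
qed

end

context zf_model
begin

definition selects :: "'a => 'a => 'a => bool" where
  "selects C A a \<longleftrightarrow> a \<in> ext C \<and> (\<forall>s\<in>ext (forcing_set C A). dom s \<noteq> empty --> s $ empty = a)"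
definition selecting :: "'a => 'a => bool" where
  "selecting C A \<longleftrightarrow> ext A \<subseteq> ext reals \<and> forcing_set C A \<noteq> empty \<and> (\<exists>a. selects C A a)"
lemma def_pred2_selecting[THEN def_pred2D, def_intros]: "def_pred2 selecting"
  by (intro def_pred2I, unfold selecting_def selects_def, intro def_intros)

lemma F_nonempty_dom:
  assumes "column_forcing mem C" and A: "forcing_set C A \<noteq> empty"
  obtains s where "s \<in> ext (forcing_set C A)" "dom s \<noteq> empty"
proof -
  interpret column_forcing mem C by (rule assms(1))
  obtain s where s: "s \<in> ext (F A)" using A ext_eq_empty_iff by blast
  then have "s \<in> ext Q" using F_subset_Q by blast
  then obtain t where t: "t \<in> ext Q" "ext s \<subseteq> ext t" "ext (succ empty) \<subseteq> ext (dom t)"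
    by (rule long_extension[OF _ succ_in_omega[OF empty_in_omega]])
  have "dom t \<noteq> empty" using t(3) by auto
  with F_upward[OF s t(1,2)] show thesis by (rule that)
qed

lemma selects_unique:
  assumes "column_forcing mem C" "forcing_set C A \<noteq> empty" "selects C A a" "selects C A b"
  shows "a = b"
proof -
  obtain s where "s \<in> ext (forcing_set C A)" "dom s \<noteq> empty" by (rule F_nonempty_dom[OF assms(1,2)])
  then show ?thesis using assms(3,4) unfolding selects_def by metis
qed

lemma borel_closure_swap:
  assumes code: "infinity_Borel_code S \<phi> Y"
  obtains X w where "well_orders w X" "\<And>A. A \<in> ext X ==> rcompl A \<in> ext X"
    "\<And>A B. A \<in> ext X ==> B \<in> ext X ==> rinter A B \<in> ext X"
    "\<And>i j. i \<in> nats ==> j \<in> nats ==> basic (opair i j) \<in> ext X"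
    "\<And>k A. k \<in> nats ==> A \<in> ext X ==> swap_set k A \<in> ext X" "Y \<in> ext X" "\<And>L. borel_closed X L ==> Y \<in> ext L"
proof -
  let ?swap = "%d. swap_set (pfst d) (psnd d)"
  have "def_fun ?swap" by (intro def_intros)
  then have Gs: "def_fun G" if "G \<in> set [?swap]" for G using that by simp
  obtain X w where wo: "well_orders w X" and omega: "omega \<in> ext X"
    "\<And>c. c \<in> ext X ==> ordinal c ==> ext c \<subseteq> ext X"
    and pairs: "\<And>a b. a \<in> ext X ==> b \<in> ext X ==> opair a b \<in> ext X"
    and swap: "\<And>G a. G \<in> set [?swap] ==> a \<in> ext X ==> G a \<in> ext X"
    and mem_rcompl: "\<And>A. A \<in> ext X ==> rcompl A \<in> ext X"
      and mem_rinter: "\<And>A B. A \<in> ext X ==> B \<in> ext X ==> rinter A B \<in> ext X"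
    and mem_basic: "\<And>i j. i \<in> nats ==> j \<in> nats ==> basic (opair i j) \<in> ext X" and Y: "Y \<in> ext X"
    and Y_L: "\<And>L. borel_closed X L ==> Y \<in> ext L"
    by (rule borel_closure[OF code, where Gs="[?swap]", OF Gs]) (assumption, rule that)
  have mem_swap_set: "swap_set k A \<in> ext X" if "k \<in> nats" "A \<in> ext X" for k A
    using swap[of ?swap, OF _ pairs[of k A]] omega(2)[OF omega(1) ordinal_omega] that by auto
  show thesis by (rule that[OF wo mem_rcompl mem_rinter mem_basic mem_swap_set Y Y_L])
qed

lemma column_forcing_class:
  assumes "AD_plus" and r: "equiv_rel reals r" and C: "C \<in> ext (quot reals r)" "countable C"
  shows "column_forcing mem C"
proof -
  obtain y where y: "y \<in> ext C" by (rule quot_nonempty[OF r C(1)])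
  have "ext C \<subseteq> ext reals" using quot_mem(1)[OF r C(1)] by blast
  then show ?thesis by unfold_locales (rule AD_if_AD_plus[OF assms(1)] enumerable_if_countable[OF C(2) y])+
qed

lemma selecting_sets:
  assumes "AD_plus" and \<kappa>: "ordinal \<kappa>" and eqv: "\<And>a. a \<in> ext \<kappa> ==> equiv_rel reals (E $ a)"
    and bij: "\<And>a. a \<in> ext \<kappa> ==> \<exists>h. bijection h (quot reals (E $ a)) reals"
    and classes: "\<And>a c. a \<in> ext \<kappa> ==> c \<in> ext (quot reals (E $ a)) ==> countable c"
  obtains X w where "well_orders w X"
    "\<And>a C. a \<in> ext \<kappa> ==> C \<in> ext (quot reals (E $ a)) ==> \<exists>A\<in>ext X. selecting C A"
proof -
  define Y where "Y = sep reals (%x. \<exists>a\<in>ext \<kappa>. x \<in> ext (related_columns (E $ a)))"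
  have Y: "x \<in> ext Y \<longleftrightarrow> x \<in> ext reals \<and> (\<exists>a\<in>ext \<kappa>. x \<in> ext (related_columns (E $ a)))" for x
    unfolding Y_def by (subst ext_sep) (intro def_intros, simp)
  have Y_reals: "ext Y \<subseteq> ext reals" using Y by blast
  obtain S \<phi> where code: "infinity_Borel_code S \<phi> Y" using assms(1) Y_reals unfolding AD_plus_def by blast
  obtain X w where wo: "well_orders w X" and X: "\<And>A. A \<in> ext X ==> rcompl A \<in> ext X"
    "\<And>A B. A \<in> ext X ==> B \<in> ext X ==> rinter A B \<in> ext X"
    "\<And>i j. i \<in> nats ==> j \<in> nats ==> basic (opair i j) \<in> ext X"
    "\<And>k A. k \<in> nats ==> A \<in> ext X ==> swap_set k A \<in> ext X" "Y \<in> ext X" "\<And>L. borel_closed X L ==> Y \<in> ext L"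
    by (rule borel_closure_swap[OF code]) (rule that)
  have "\<exists>A\<in>ext X. selecting C A" if a: "a \<in> ext \<kappa>" and C: "C \<in> ext (quot reals (E $ a))" for a C
  proof (rule ccontr)
    assume none: "\<not> ?thesis"
    interpret column_forcing mem C by (rule column_forcing_class[OF assms(1) eqv[OF a] C classes[OF a C]])
    have F_Y: "ext (F Y) = ext Q"
    proof (rule F_eq_Q)
      fix g assume g: "func g omega C"
      have "opair (column (join_columns g) i) (column (join_columns g) j) \<in> ext (E $ a)"
        if "i \<in> nats" "j \<in> nats" for i j
        unfolding column_join_columns[OF g that(1)] column_join_columns[OF g that(2)]
        by (rule quot_related[OF eqv[OF a] C ap_in_codomain[OF g] ap_in_codomain[OF g]]) (rule that)+
      then show "join_columns g \<in> ext Y"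
        unfolding Y mem_related_columns using join_columns_real[OF g] a by blast
    qed
    have undecided: "\<exists>s\<in>ext (F A). dom s \<noteq> empty \<and> s $ empty \<noteq> c"
      if "A \<in> ext X" "ext A \<subseteq> ext reals" "F A \<noteq> empty" "c \<in> ext C" for A c
      using none that unfolding selecting_def selects_def by blast
    interpret F_forcing mem C X w Y
      by unfold_locales (rule wo Y_reals X(5) F_Y | erule X(6) | erule (3) undecided | erule (1)
        X(2-4) | erule X(1))+
    show False by (rule undecided_contradiction[OF \<kappa> eqv bij classes]) (use Y in blast)+
  qed
  then show thesis by (rule that[OF wo])
qed

lemma well_ordered_choice:
  assumes "AD_plus" "ordinal \<kappa>" "\<And>a. a \<in> ext \<kappa> ==> equiv_rel reals (E $ a)"
    and "\<And>a. a \<in> ext \<kappa> ==> \<exists>h. bijection h (quot reals (E $ a)) reals"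
    and "\<And>a c. a \<in> ext \<kappa> ==> c \<in> ext (quot reals (E $ a)) ==> countable c"
  obtains sel where "def_fun sel" "\<And>a c. a \<in> ext \<kappa> ==> c \<in> ext (quot reals (E $ a)) ==> sel c \<in> ext c"
proof -
  obtain X w where wo: "well_orders w X" and X: "\<And>a C. a \<in> ext \<kappa> ==> C \<in> ext (quot reals (E $ a)) ==>
      \<exists>A\<in>ext X. selecting C A"
    by (rule selecting_sets[OF assms]) (assumption+, rule that)
  define least where "least C = wo_least w (sep X (selecting C))" for C
  define sel where "sel C = descr (selects C (least C))" for C
  have def_fun_least: "def_fun least" unfolding least_def by (intro def_funI def_intros)
  have "def_fun sel" unfolding sel_def selects_def by (intro def_funI def_intros def_funD[OF def_fun_least])
  moreover have "sel C \<in> ext C" if a: "a \<in> ext \<kappa>" and C: "C \<in> ext (quot reals (E $ a))" for a C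
  proof -
    obtain A where A: "A \<in> ext X" "selecting C A" using X[OF a C] by blast
    have col: "column_forcing mem C"
      by (rule column_forcing_class[OF assms(1) assms(3)[OF a] C assms(5)[OF a C]])
    have definable: "def_pred (selecting C)" by (intro def_intros)
    have "least C \<in> ext (sep X (selecting C))"
      unfolding least_def
      by (rule wo_leastI(1)[OF wo, where x=A]) (use A in \<open>auto simp: ext_sep[OF definable]\<close>)
    then have least: "selecting C (least C)" unfolding ext_sep[OF definable] by blast
    then obtain c where c: "selects C (least C) c" unfolding selecting_def by blast
    have "sel C = c" unfolding sel_def
    proof (rule descr_equality)
      show "selects C (least C) c" by (rule c)
      show "d = c" if "selects C (least C) d" for d
        by (rule selects_unique[OF col _ that c]) (use least in \<open>simp add: selecting_def\<close>)
    qed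
    then show ?thesis using c unfolding selects_def by blast
  qed
  ultimately show thesis by (rule that)
qed

lemma ext_disjoint_union_quot:
  assumes E: "func E \<kappa> b" and eqv: "\<And>a. a \<in> ext \<kappa> ==> equiv_rel reals (E $ a)"
  shows "ext (disjoint_union_quot \<kappa> E) = {opair a c | a c. a \<in> ext \<kappa> \<and> c \<in> ext (quot reals (E $ a))}"
proof -
  let ?U = "sep (cprod \<kappa> (pow reals)) (%p. psnd p \<in> ext (quot reals (E $ pfst p)))"
  have "ext c \<subseteq> ext reals" if "a \<in> ext \<kappa>" "c \<in> ext (quot reals (E $ a))" for a c
    using quot_mem(1)[OF eqv[OF that(1)] that(2)] by blast
  then have U: "ext ?U = {opair a c | a c. a \<in> ext \<kappa> \<and> c \<in> ext (quot reals (E $ a))}"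
    by (subst ext_sep) (intro def_intros, auto)
  also have "\<dots> = {opair a c | a c. a \<in> ext \<kappa> \<and> c \<in> ext (quot reals (app E a))}" using func_app[OF E] by auto
  finally have "disjoint_union_quot \<kappa> E = ?U" unfolding disjoint_union_quot_def by (metis coll_ext)
  then show ?thesis using U by simp
qed

lemma disjoint_union_injection:
  assumes "AD_plus" "ordinal \<kappa>" and E: "func E \<kappa> b"
    and eqv: "\<And>a. a \<in> ext \<kappa> ==> equiv_rel reals (E $ a)"
    and "\<And>a. a \<in> ext \<kappa> ==> \<exists>h. bijection h (quot reals (E $ a)) reals"
    and "\<And>a c. a \<in> ext \<kappa> ==> c \<in> ext (quot reals (E $ a)) ==> countable c"
  shows "\<exists>f. injection f (disjoint_union_quot \<kappa> E) (cprod reals \<kappa>)"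
proof -
  obtain sel where sel: "def_fun sel" "\<And>a c. a \<in> ext \<kappa> ==> c \<in> ext (quot reals (E $ a)) ==> sel c \<in> ext c"
    by (rule well_ordered_choice[OF assms(1,2,4-6)]) (assumption+, rule that)
  let ?U = "disjoint_union_quot \<kappa> E" and ?g = "%p. opair (sel (psnd p)) (pfst p)"
  have U: "ext ?U = {opair a c | a c. a \<in> ext \<kappa> \<and> c \<in> ext (quot reals (E $ a))}"
    by (rule ext_disjoint_union_quot[OF E eqv])
  have definable: "def_fun ?g" by (intro def_intros def_funD[OF sel(1)])
  have f: "func (lam ?U ?g) ?U (cprod reals \<kappa>)"
  proof (rule func_lam[OF definable])
    fix p assume "p \<in> ext ?U"
    then obtain a c where p: "p = opair a c" "a \<in> ext \<kappa>" "c \<in> ext (quot reals (E $ a))" unfolding U by blast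
    have "sel c \<in> ext reals" by (rule quot_mem(1)[OF eqv[OF p(2)] p(3) sel(2)[OF p(2,3)]])
    then show "?g p \<in> ext (cprod reals \<kappa>)" unfolding p(1) opair_mem_cprod using p(2) by simp
  qed
  have "inj_on (app (lam ?U ?g)) (ext ?U)"
  proof (rule inj_onI)
    fix p q assume pq: "p \<in> ext ?U" "q \<in> ext ?U" "app (lam ?U ?g) p = app (lam ?U ?g) q"
    obtain a c where p: "p = opair a c" "a \<in> ext \<kappa>" "c \<in> ext (quot reals (E $ a))"
      using pq(1) unfolding U by blast
    obtain b d where q: "q = opair b d" "b \<in> ext \<kappa>" "d \<in> ext (quot reals (E $ b))"
      using pq(2) unfolding U by blast
    have "?g p = ?g q"
      using pq(3) func_app[OF f pq(1)] func_app[OF f pq(2)] ap_lam[OF definable pq(1)]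
        ap_lam[OF definable pq(2)] by simp
    then have same: "b = a" "sel d = sel c" unfolding p(1) q(1) by simp_all
    have d: "d \<in> ext (quot reals (E $ a))" "sel c \<in> ext d"
      using q(3) sel(2)[OF q(2,3)] unfolding same by blast+
    have "c = eq_class (E $ a) (sel c)" by (rule quot_mem(2)[OF eqv[OF p(2)] p(3) sel(2)[OF p(2,3)]])
    also have "\<dots> = d" by (rule quot_mem(2)[OF eqv[OF p(2)] d, symmetric])
    finally show "p = q" unfolding p(1) q(1) same(1) by simp
  qed
  then show ?thesis unfolding injection_def using f by blast
qed

end

theorem theorem5p4:
  fixes mem :: "'a \<Rightarrow> 'a \<Rightarrow> bool" and \<kappa> E :: 'a
  assumes "zf_model mem"
    and "set_structure.AD_plus mem"
    and "set_structure.V_eq_L_Pow_reals mem"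
    and "set_structure.ordinal mem \<kappa>"
    and "\<exists>b. set_structure.func mem E \<kappa> b"
    and "\<And>\<alpha>. mem \<alpha> \<kappa> \<Longrightarrow>
      set_structure.equiv_rel mem (set_structure.reals mem) (set_structure.app mem E \<alpha>)"
    and "\<And>\<alpha>. mem \<alpha> \<kappa> \<Longrightarrow>
      \<exists>f. set_structure.bijection mem f
        (set_structure.quot mem (set_structure.reals mem) (set_structure.app mem E \<alpha>))
        (set_structure.reals mem)"
    and "\<And>\<alpha> c. mem \<alpha> \<kappa> \<Longrightarrow>
      mem c (set_structure.quot mem (set_structure.reals mem) (set_structure.app mem E \<alpha>)) \<Longrightarrow>
      set_structure.countable mem c"
  shows "\<exists>f. set_structure.injection mem f
    (set_structure.disjoint_union_quot mem \<kappa> E)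
    (set_structure.cprod mem (set_structure.reals mem) \<kappa>)"
proof -
  interpret zf_model mem by (rule assms(1))
  obtain b where E: "func E \<kappa> b" using assms(5) by blast
  have app: "app E a = E $ a" if "mem a \<kappa>" for a by (rule func_app[OF E]) (simp add: ext_def that)
  show ?thesis
    by (rule disjoint_union_injection[OF assms(2,4) E]) (use assms(6-8) app in \<open>simp_all add: ext_def\<close>)
qed

end
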